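(* Let $\Bbbk$ be an algebraically closed field of characteristic $p>0$, $G$ a finite group, $\mathfrak{h}$ a faithful $n$-dimensional representation of $G$ over $\Bbbk$, and $c$ a conjugation-invariant $\Bbbk$-valued function on the set of reflections of $G$. Any irreducible $H_{1,c}(G,\mathfrak{h})$-representation has dimension (over $\Bbbk$) less than or equal to $p^n|G|$.
   Context: A reflection is an element $s\in GL(\mathfrak{h})$ such that $1-s$ has rank $1$ on $\mathfrak{h}$; $S$ is the set of reflections in $G\subseteq GL(\mathfrak{h})$. $\mathfrak{h}^*$ is the dual representation, $(g.y,x)=(y,g^{-1}.x)$, and $(\cdot,\cdot)$ is the canonical pairing. For $t\in\Bbbk$ and a conjugation-invariant function $c:S\to\Bbbk$, $s\mapsto c_s$, the rational Cherednik algebra $H_{t,c}(G,\mathfrak{h})$ is the quotient of $\Bbbk G\ltimes T(\mathfrak{h}\oplus\mathfrak{h}^* )$ by the relations $[x,x']=0$, $[y,y']=0$, $[y,x]=(y,x)t-\sum_{s\in S}c_s((1-s).x,y)s$ for $x,x'\in\mathfrak{h}^*$, $y,y'\in\mathfrak{h}$. $H_{1,c}(G,\mathfrak{h})$ is the case $t=1$. *)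

theory Defs
  imports
    "HOL-Computational_Algebra.Polynomial"
    "HOL-Library.Product_Plus"
    "HOL-Library.Function_Algebras"
    "HOL-Algebra.QuotRing"
    "HOL-Algebra.Module"
begin

section \<open>Algebras over a field\<close>

text \<open>
  An associative unital algebra over a field, given by a type \<open>'k\<close> of class \<open>field\<close>, is encoded
  by the record type \<open>('k, 'a) module\<close>: its ring part is the (not necessarily commutative)
  multiplication, and \<open>smult\<close> is the scalar multiplication. The locales \<open>module\<close> and \<open>algebra\<close> of
  HOL-Algebra are not used, since they require a scalar ring record and a commutative algebra.
  The word \<open>ideal\<close> refers to two-sided ideals, as in HOL-Algebra.
\<close>

definition quot_algebra :: "('k, 'a) module \<Rightarrow> 'a set \<Rightarrow> ('k, 'a set) module" where
  "quot_algebra A I =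
    \<lparr>carrier = carrier (A Quot I), mult = mult (A Quot I), one = one (A Quot I),
     zero = zero (A Quot I), add = add (A Quot I),
     smult = (\<lambda>a X. I <+>\<^bsub>A\<^esub> (smult A a ` X))\<rparr>"

text \<open>
  The free algebra on a set \<open>W\<close>: finitely supported functions on words over \<open>W\<close>, with the
  concatenation product. The sum over \<open>i\<close> runs over all factorisations of \<open>w\<close> into two words.
\<close>

definition free_algebra :: "'w set \<Rightarrow> ('k::field, 'w list \<Rightarrow> 'k) module" where
  "free_algebra W =
    \<lparr>carrier = {f. finite {w. f w \<noteq> 0} \<and> {w. f w \<noteq> 0} \<subseteq> lists W},
     mult = (\<lambda>f g w. \<Sum>i\<le>length w. f (take i w) * g (drop i w)),
     one = (\<lambda>w. if w = [] then 1 else 0),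
     zero = (\<lambda>w. 0),
     add = (\<lambda>f g w. f w + g w),
     smult = (\<lambda>a f w. a * f w)\<rparr>"

definition letter :: "'w \<Rightarrow> 'w list \<Rightarrow> 'k::field" where
  "letter u = (\<lambda>w. if w = [u] then 1 else 0)"

text \<open>
  The tensor algebra of the subspace \<open>W\<close> of the vector space with scalar multiplication
  \<open>scale\<close>: the free algebra on the set \<open>W\<close> modulo the relations making the inclusion of \<open>W\<close> linear.
\<close>

definition linearity_relations ::
    "('k::field \<Rightarrow> 'w::ab_group_add \<Rightarrow> 'w) \<Rightarrow> 'w set \<Rightarrow> ('w list \<Rightarrow> 'k) set" where
  "linearity_relations scale W =
    {letter (scale a u + scale b v)
        \<ominus>\<^bsub>free_algebra W\<^esub> (a \<odot>\<^bsub>free_algebra W\<^esub> letter u \<oplus>\<^bsub>free_algebra W\<^esub> b \<odot>\<^bsub>free_algebra W\<^esub> letter v)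
      | a b u v. u \<in> W \<and> v \<in> W}"

definition linearity_ideal ::
    "('k::field \<Rightarrow> 'w::ab_group_add \<Rightarrow> 'w) \<Rightarrow> 'w set \<Rightarrow> ('w list \<Rightarrow> 'k) set" where
  "linearity_ideal scale W = genideal (free_algebra W) (linearity_relations scale W)"

definition tensor_algebra ::
    "('k::field \<Rightarrow> 'w::ab_group_add \<Rightarrow> 'w) \<Rightarrow> 'w set \<Rightarrow> ('k, ('w list \<Rightarrow> 'k) set) module" where
  "tensor_algebra scale W = quot_algebra (free_algebra W) (linearity_ideal scale W)"

definition tensor_incl ::
    "('k::field \<Rightarrow> 'w::ab_group_add \<Rightarrow> 'w) \<Rightarrow> 'w set \<Rightarrow> 'w \<Rightarrow> ('w list \<Rightarrow> 'k) set" where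
  "tensor_incl scale W u = linearity_ideal scale W +>\<^bsub>free_algebra W\<^esub> letter u"

text \<open>
  The crossed product of the group algebra of the finite group \<open>G\<close> with an algebra \<open>T\<close> on which
  \<open>G\<close> acts by \<open>act\<close>. A function \<open>F\<close> stands for the sum of the products \<open>F g \<cdot> g\<close>, and
  \<open>(F g \<cdot> g) (F' h \<cdot> h) = (F g \<cdot> act g (F' h)) \<cdot> g h\<close>.
\<close>

definition crossed_product ::
    "('g, 'b) monoid_scheme \<Rightarrow> ('g \<Rightarrow> 'a \<Rightarrow> 'a) \<Rightarrow> ('k, 'a) module \<Rightarrow> ('k, 'g \<Rightarrow> 'a) module" where
  "crossed_product G act T =
    \<lparr>carrier = carrier G \<rightarrow>\<^sub>E carrier T,
     mult = (\<lambda>F F'. \<lambda>k\<in>carrier G.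
       \<Oplus>\<^bsub>T\<^esub>g\<in>carrier G. F g \<otimes>\<^bsub>T\<^esub> act g (F' (inv\<^bsub>G\<^esub> g \<otimes>\<^bsub>G\<^esub> k))),
     one = (\<lambda>k\<in>carrier G. if k = \<one>\<^bsub>G\<^esub> then \<one>\<^bsub>T\<^esub> else \<zero>\<^bsub>T\<^esub>),
     zero = (\<lambda>k\<in>carrier G. \<zero>\<^bsub>T\<^esub>),
     add = (\<lambda>F F'. \<lambda>k\<in>carrier G. F k \<oplus>\<^bsub>T\<^esub> F' k),
     smult = (\<lambda>a F. \<lambda>k\<in>carrier G. a \<odot>\<^bsub>T\<^esub> F k)\<rparr>"

definition crossed_single ::
    "('g, 'b) monoid_scheme \<Rightarrow> ('k, 'a) module \<Rightarrow> 'a \<Rightarrow> 'g \<Rightarrow> 'g \<Rightarrow> 'a" where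
  "crossed_single G T t g = (\<lambda>k\<in>carrier G. if k = g then t else \<zero>\<^bsub>T\<^esub>)"

section \<open>Representations\<close>

definition GL :: "('k::field \<Rightarrow> 'v::ab_group_add \<Rightarrow> 'v) \<Rightarrow> ('v \<Rightarrow> 'v) monoid" where
  "GL scale = \<lparr>carrier = {f. Vector_Spaces.linear scale scale f \<and> bij f}, mult = (\<circ>), one = id\<rparr>"

text \<open>Finite-dimensionality is a separate notion, as \<open>dim\<close> is \<open>0\<close> on infinite-dimensional spaces.\<close>

definition finite_dimensional :: "('k::field \<Rightarrow> 'v::ab_group_add \<Rightarrow> 'v) \<Rightarrow> bool" where
  "finite_dimensional scale \<longleftrightarrow> (\<exists>B. finite_dimensional_vector_space scale B)"

definition algebra_rep ::
    "('k::field, 'a) module \<Rightarrow> ('k \<Rightarrow> 'm::ab_group_add \<Rightarrow> 'm) \<Rightarrow> ('a \<Rightarrow> 'm \<Rightarrow> 'm) \<Rightarrow> bool" where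
  "algebra_rep A scale \<phi> \<longleftrightarrow>
    vector_space scale \<and>
    (\<forall>a\<in>carrier A. Vector_Spaces.linear scale scale (\<phi> a)) \<and>
    (\<forall>a\<in>carrier A. \<forall>b\<in>carrier A. \<phi> (a \<oplus>\<^bsub>A\<^esub> b) = (\<lambda>v. \<phi> a v + \<phi> b v)) \<and>
    (\<forall>a\<in>carrier A. \<forall>b\<in>carrier A. \<phi> (a \<otimes>\<^bsub>A\<^esub> b) = \<phi> a \<circ> \<phi> b) \<and>
    (\<forall>r. \<forall>a\<in>carrier A. \<phi> (r \<odot>\<^bsub>A\<^esub> a) = (\<lambda>v. scale r (\<phi> a v))) \<and>
    \<phi> \<one>\<^bsub>A\<^esub> = id"

definition irreducible_rep ::
    "('k::field, 'a) module \<Rightarrow> ('k \<Rightarrow> 'm::ab_group_add \<Rightarrow> 'm) \<Rightarrow> ('a \<Rightarrow> 'm \<Rightarrow> 'm) \<Rightarrow> bool" where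
  "irreducible_rep A scale \<phi> \<longleftrightarrow>
    algebra_rep A scale \<phi> \<and>
    (UNIV :: 'm set) \<noteq> {0} \<and>
    (\<forall>U. module.subspace scale U \<and> (\<forall>a\<in>carrier A. \<phi> a ` U \<subseteq> U) \<longrightarrow> U = {0} \<or> U = UNIV)"

section \<open>Rational Cherednik algebras\<close>

text \<open>
  Below, \<open>\<hh>\<close> is the vector space with scalar multiplication \<open>scale\<close> on the type \<open>'v\<close>, and
  \<open>\<rho>\<close> is the action of \<open>G\<close> on it. The space \<open>\<hh>\<^sup>*\<close> consists of linear functionals, so
  that the canonical pairing of \<open>y\<close> and \<open>x\<close> is \<open>x y\<close>; an element of \<open>\<hh> \<oplus> \<hh>\<^sup>*\<close> is a tuple \<open>(y, x)\<close>.
\<close>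

definition reflections ::
    "('g, 'b) monoid_scheme \<Rightarrow> ('k::field \<Rightarrow> 'v::ab_group_add \<Rightarrow> 'v) \<Rightarrow> ('g \<Rightarrow> 'v \<Rightarrow> 'v) \<Rightarrow> 'g set" where
  "reflections G scale \<rho> =
    {s \<in> carrier G. vector_space.dim scale (range (\<lambda>v. v - \<rho> s v)) = 1}"

definition dual_space :: "('k::field \<Rightarrow> 'v::ab_group_add \<Rightarrow> 'v) \<Rightarrow> ('v \<Rightarrow> 'k) set" where
  "dual_space scale = {x. Vector_Spaces.linear scale (*) x}"

definition dual_act ::
    "('g, 'b) monoid_scheme \<Rightarrow> ('g \<Rightarrow> 'v \<Rightarrow> 'v) \<Rightarrow> 'g \<Rightarrow> ('v \<Rightarrow> 'k) \<Rightarrow> 'v \<Rightarrow> 'k" where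
  "dual_act G \<rho> g x = (\<lambda>v. x (\<rho> (inv\<^bsub>G\<^esub> g) v))"

definition double_space :: "('k::field \<Rightarrow> 'v::ab_group_add \<Rightarrow> 'v) \<Rightarrow> ('v \<times> ('v \<Rightarrow> 'k)) set" where
  "double_space scale = UNIV \<times> dual_space scale"

definition double_scale ::
    "('k::field \<Rightarrow> 'v::ab_group_add \<Rightarrow> 'v) \<Rightarrow> 'k \<Rightarrow> 'v \<times> ('v \<Rightarrow> 'k) \<Rightarrow> 'v \<times> ('v \<Rightarrow> 'k)" where
  "double_scale scale a = map_prod (scale a) (\<lambda>x v. a * x v)"

definition double_act ::
    "('g, 'b) monoid_scheme \<Rightarrow> ('g \<Rightarrow> 'v \<Rightarrow> 'v) \<Rightarrow> 'g \<Rightarrow> 'v \<times> ('v \<Rightarrow> 'k) \<Rightarrow> 'v \<times> ('v \<Rightarrow> 'k)" where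
  "double_act G \<rho> g = map_prod (\<rho> g) (dual_act G \<rho> g)"

definition double_tensor ::
    "('k::field \<Rightarrow> 'v::ab_group_add \<Rightarrow> 'v) \<Rightarrow> ('k, (('v \<times> ('v \<Rightarrow> 'k)) list \<Rightarrow> 'k) set) module" where
  "double_tensor scale = tensor_algebra (double_scale scale) (double_space scale)"

text \<open>
  The induced action on the tensor algebra, on cosets: the word \<open>w\<close> is sent to \<open>map (double_act G \<rho> g) w\<close>,
  so the coefficient of \<open>w\<close> in the image of \<open>f\<close> is that of \<open>map (double_act G \<rho> (inv g)) w\<close> in \<open>f\<close>.
\<close>

definition tensor_act ::
    "('g, 'b) monoid_scheme \<Rightarrow> ('g \<Rightarrow> 'v \<Rightarrow> 'v) \<Rightarrow> 'g
      \<Rightarrow> (('v \<times> ('v \<Rightarrow> 'k)) list \<Rightarrow> 'k) set \<Rightarrow> (('v \<times> ('v \<Rightarrow> 'k)) list \<Rightarrow> 'k) set" where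
  "tensor_act G \<rho> g X = (\<lambda>f w. f (map (double_act G \<rho> (inv\<^bsub>G\<^esub> g)) w)) ` X"

definition cherednik_ambient ::
    "('g, 'b) monoid_scheme \<Rightarrow> ('k::field \<Rightarrow> 'v::ab_group_add \<Rightarrow> 'v) \<Rightarrow> ('g \<Rightarrow> 'v \<Rightarrow> 'v)
      \<Rightarrow> ('k, 'g \<Rightarrow> (('v \<times> ('v \<Rightarrow> 'k)) list \<Rightarrow> 'k) set) module" where
  "cherednik_ambient G scale \<rho> = crossed_product G (tensor_act G \<rho>) (double_tensor scale)"

definition vec_elt ::
    "('g, 'b) monoid_scheme \<Rightarrow> ('k::field \<Rightarrow> 'v::ab_group_add \<Rightarrow> 'v)
      \<Rightarrow> 'v \<Rightarrow> 'g \<Rightarrow> (('v \<times> ('v \<Rightarrow> 'k)) list \<Rightarrow> 'k) set" where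
  "vec_elt G scale y = crossed_single G (double_tensor scale)
     (tensor_incl (double_scale scale) (double_space scale) (y, 0)) \<one>\<^bsub>G\<^esub>"

definition covec_elt ::
    "('g, 'b) monoid_scheme \<Rightarrow> ('k::field \<Rightarrow> 'v::ab_group_add \<Rightarrow> 'v)
      \<Rightarrow> ('v \<Rightarrow> 'k) \<Rightarrow> 'g \<Rightarrow> (('v \<times> ('v \<Rightarrow> 'k)) list \<Rightarrow> 'k) set" where
  "covec_elt G scale x = crossed_single G (double_tensor scale)
     (tensor_incl (double_scale scale) (double_space scale) (0, x)) \<one>\<^bsub>G\<^esub>"

definition group_elt ::
    "('g, 'b) monoid_scheme \<Rightarrow> ('k::field \<Rightarrow> 'v::ab_group_add \<Rightarrow> 'v)
      \<Rightarrow> 'g \<Rightarrow> 'g \<Rightarrow> (('v \<times> ('v \<Rightarrow> 'k)) list \<Rightarrow> 'k) set" where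
  "group_elt G scale g = crossed_single G (double_tensor scale) \<one>\<^bsub>double_tensor scale\<^esub> g"

definition commutator :: "('a, 'b) ring_scheme \<Rightarrow> 'a \<Rightarrow> 'a \<Rightarrow> 'a" where
  "commutator A a b = (a \<otimes>\<^bsub>A\<^esub> b) \<ominus>\<^bsub>A\<^esub> (b \<otimes>\<^bsub>A\<^esub> a)"

definition cherednik_relations ::
    "('g, 'b) monoid_scheme \<Rightarrow> ('k::field \<Rightarrow> 'v::ab_group_add \<Rightarrow> 'v) \<Rightarrow> ('g \<Rightarrow> 'v \<Rightarrow> 'v)
      \<Rightarrow> 'k \<Rightarrow> ('g \<Rightarrow> 'k) \<Rightarrow> ('g \<Rightarrow> (('v \<times> ('v \<Rightarrow> 'k)) list \<Rightarrow> 'k) set) set" where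
  "cherednik_relations G scale \<rho> t c = (let A = cherednik_ambient G scale \<rho> in
    {commutator A (covec_elt G scale x) (covec_elt G scale x')
      | x x'. x \<in> dual_space scale \<and> x' \<in> dual_space scale}
    \<union> {commutator A (vec_elt G scale y) (vec_elt G scale y') | y y'. True}
    \<union> {commutator A (vec_elt G scale y) (covec_elt G scale x)
        \<ominus>\<^bsub>A\<^esub> ((x y * t) \<odot>\<^bsub>A\<^esub> \<one>\<^bsub>A\<^esub>
            \<ominus>\<^bsub>A\<^esub> (\<Oplus>\<^bsub>A\<^esub>s\<in>reflections G scale \<rho>.
                 (c s * (x - dual_act G \<rho> s x) y) \<odot>\<^bsub>A\<^esub> group_elt G scale s))
      | x y. x \<in> dual_space scale})"

definition rational_cherednik ::
    "('g, 'b) monoid_scheme \<Rightarrow> ('k::field \<Rightarrow> 'v::ab_group_add \<Rightarrow> 'v) \<Rightarrow> ('g \<Rightarrow> 'v \<Rightarrow> 'v)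
      \<Rightarrow> 'k \<Rightarrow> ('g \<Rightarrow> 'k) \<Rightarrow> ('k, ('g \<Rightarrow> (('v \<times> ('v \<Rightarrow> 'k)) list \<Rightarrow> 'k) set) set) module" where
  "rational_cherednik G scale \<rho> t c =
    quot_algebra (cherednik_ambient G scale \<rho>)
      (genideal (cherednik_ambient G scale \<rho>) (cherednik_relations G scale \<rho> t c))"

end

theory Submission
  imports Defs "HOL-Combinatorics.Permutations"
begin

text \<open>
  The proof is by polynomial identities. Write \<open>H\<close> for the algebra \<open>H\<^bsub>1,c\<^esub>(G, \<hh>)\<close> and \<open>N\<close> for
  \<open>p\<^sup>n |G|\<close>. The \<open>m\<close>-th Capelli polynomial is the alternating sum of the words
  \<open>b\<^sub>m a\<^bsub>\<sigma>(m-1)\<^esub> b\<^bsub>m-1\<^esub> \<dots> a\<^bsub>\<sigma>(0)\<^esub> b\<^sub>0\<close>. It vanishes as soon as the \<open>a\<^sub>i\<close> are linearly dependent over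
  central scalars, so it vanishes on all operators of a space of dimension \<open>d\<close> if \<open>m > d\<^sup>2\<close>, but not
  if \<open>m = d\<^sup>2\<close>.

  \<^item> The algebra \<open>H\<close> satisfies the Capelli identity of every degree \<open>m > N\<^sup>2\<close> (\<open>Capelli_cherednik\<close>). For a
    vector \<open>b\<close> with trivial stabiliser, Dunkl operators with poles on the reflection hyperplanes act
    on the dual of the functions on an infinitesimal neighbourhood of the orbit \<open>G b\<close>, the one cut
    out at each point by the \<open>p\<close>-th powers of coordinates centred there. This gives representations of \<open>H\<close> of dimension \<open>N\<close>
    (\<open>cherednik_system_dunkl\<close>), depending on \<open>b\<close> and on an additive shift of the
    derivatives. Each of them satisfies the identity. Jointly they are
    faithful: the monomials \<open>g x\<^sup>\<alpha> y\<^sup>\<beta>\<close> span \<open>H\<close> (\<open>alg_NF\<close>), and comparing leading terms in the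
    parameters shows that they act linearly independently on the whole family (\<open>family_independent\<close>).

  \<^item> Let \<open>M\<close> be irreducible, and let \<open>K\<close> be a maximal commutative subset of its commutant, which is a
    field by Schur's lemma. The operators from \<open>H\<close> and \<open>K\<close> act densely on the \<open>K\<close>-space \<open>M\<close>
    (\<open>density\<close>). With \<open>N + 1\<close> independent vectors they would contain enough matrix units to violate the
    Capelli identity of degree \<open>(N + 1)\<^sup>2\<close>, so \<open>M\<close> has dimension at most \<open>N\<close> over \<open>K\<close>.

  \<^item> As \<open>H\<close> is finitely generated, the matrix entries of finitely many generators generate a
    subalgebra \<open>R\<close> of \<open>K\<close>. The \<open>R\<close>-span of a \<open>K\<close>-basis is a submodule, hence all of \<open>M\<close>, which forces \<open>K = R\<close>.
    A field that is finitely generated as an algebra over the algebraically closed field \<open>\<Bbbk>\<close> is \<open>\<Bbbk>\<close>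
    (\<open>finitely_generated_field_trivial\<close>), so the bound over \<open>K\<close> is a bound over \<open>\<Bbbk>\<close>
    (\<open>Capelli_dimension_bound\<close>).

  Most of the argument concerns operators satisfying the defining relations, collected in the locale
  \<open>cherednik_system\<close>. The last sections read off such operators from a representation of the
  quotient of the crossed product by which \<open>H\<close> is defined.
\<close>

section \<open>Rings of additive endomorphisms and products of rings\<close>

text \<open>Additive operators form a type of class \<open>ring\<close>, so that identities between operators, words
  in them and matrix-free linear algebra can use type class arithmetic. Scalars act through
  a map \<open>S\<close> from the field to the operators.\<close>

typedef (overloaded) 'a endo = "{f :: 'a::ab_group_add \<Rightarrow> 'a. \<forall>x y. f (x + y) = f x + f y}"
  morphisms app Endo
  by (rule exI[of _ id]) simp

lemma app_Endo [simp]: "(\<And>x y. f (x + y) = f x + f y) \<Longrightarrow> app (Endo f) = f"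
  by (simp add: Endo_inverse)

lemma app_add_right [simp]: "app a (x + y) = app a x + app a y"
  using app[of a] by simp

lemma app_zero_right [simp]: "app a 0 = 0"
  using app_add_right[of a 0 0] by simp

lemma app_minus_right [simp]: "app a (- x) = - app a x"
  using app_add_right[of a x "- x"] by (metis add.right_inverse app_zero_right minus_unique)

lemma app_diff_right [simp]: "app a (x - y) = app a x - app a y"
  using app_add_right[of a x "- y"] by simp

lemma app_sum_right: "app a (\<Sum>i\<in>I. f i) = (\<Sum>i\<in>I. app a (f i))"
  by (induction I rule: infinite_finite_induct) auto

lemma endo_eqI: "(\<And>v. app a v = app b v) \<Longrightarrow> a = b"
  by (metis app_inject ext)

instantiation endo :: (ab_group_add) "{ring,monoid_mult}"
begin
definition zero_endo :: "'a endo" where "zero_endo = Endo (\<lambda>_. 0)"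
definition one_endo :: "'a endo" where "one_endo = Endo (\<lambda>v. v)"
definition plus_endo :: "'a endo \<Rightarrow> 'a endo \<Rightarrow> 'a endo" where
  "plus_endo a b = Endo (\<lambda>v. app a v + app b v)"
definition minus_endo :: "'a endo \<Rightarrow> 'a endo \<Rightarrow> 'a endo" where
  "minus_endo a b = Endo (\<lambda>v. app a v - app b v)"
definition uminus_endo :: "'a endo \<Rightarrow> 'a endo" where
  "uminus_endo a = Endo (\<lambda>v. - app a v)"
definition times_endo :: "'a endo \<Rightarrow> 'a endo \<Rightarrow> 'a endo" where
  "times_endo a b = Endo (\<lambda>v. app a (app b v))"
instance
  by standard
    (auto intro!: endo_eqI simp: zero_endo_def one_endo_def plus_endo_def minus_endo_def
      uminus_endo_def times_endo_def algebra_simps)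
end

lemma app_simps [simp]:
  "app 0 v = 0" "app 1 v = v" "app (a + b) v = app a v + app b v"
  "app (a - b) v = app a v - app b v" "app (- a) v = - app a v" "app (a * b) v = app a (app b v)"
  by (simp_all add: zero_endo_def one_endo_def plus_endo_def minus_endo_def
      uminus_endo_def times_endo_def algebra_simps)

lemma app_sum: "app (\<Sum>i\<in>I. f i) v = (\<Sum>i\<in>I. app (f i) v)"
  by (induction I rule: infinite_finite_induct) auto

lemma mult_shift: "x * y = y' * (x' :: 'e::ring) \<Longrightarrow> x * (y * z) = y' * (x' * z)"
  by (simp add: mult.assoc[symmetric])

instantiation prod :: (times, times) times
begin
definition "x * y = (fst x * fst y, snd x * snd y)"
instance ..
end

instantiation prod :: (one, one) one
begin
definition "1 = (1, 1)"
instance ..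
end

lemma fst_snd_times_one [simp]:
  "fst (x * y) = fst x * fst y" "snd (x * y) = snd x * snd y" "fst 1 = 1" "snd 1 = 1"
  by (simp_all add: times_prod_def one_prod_def)

instance prod :: (semigroup_mult, semigroup_mult) semigroup_mult
  by standard (simp_all add: prod_eq_iff algebra_simps)

instance prod :: (ring, ring) ring
  by standard (simp_all add: prod_eq_iff algebra_simps)

instance prod :: (monoid_mult, monoid_mult) monoid_mult
  by standard (simp_all add: prod_eq_iff algebra_simps)

lemma fst_sum': "fst (\<Sum>i\<in>I. f i) = (\<Sum>i\<in>I. fst (f i))"
  by (induction I rule: infinite_finite_induct) auto

lemma snd_sum': "snd (\<Sum>i\<in>I. f i) = (\<Sum>i\<in>I. snd (f i))"
  by (induction I rule: infinite_finite_induct) auto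

lemma snd_prod_list: "snd (prod_list xs) = prod_list (map snd xs)"
  by (induction xs) auto

section \<open>Linear systems over a commutative domain inside a ring\<close>

text \<open>The domains and fields below consist of operators, so they are subsets of a noncommutative ring.\<close>

locale domain_subset =
  fixes A :: "'e::{ring,monoid_mult} set"
  assumes zero_in [simp]: "0 \<in> A" and one_in [simp]: "1 \<in> A"
    and add_in [simp]: "a \<in> A \<Longrightarrow> b \<in> A \<Longrightarrow> a + b \<in> A"
    and neg_in [simp]: "a \<in> A \<Longrightarrow> - a \<in> A"
    and mult_in [simp]: "a \<in> A \<Longrightarrow> b \<in> A \<Longrightarrow> a * b \<in> A"
    and comm_in: "a \<in> A \<Longrightarrow> b \<in> A \<Longrightarrow> a * b = b * a"
    and one_neq_zero: "1 \<noteq> (0::'e)"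
    and no_zero_div: "a \<in> A \<Longrightarrow> b \<in> A \<Longrightarrow> a * b = 0 \<Longrightarrow> a = 0 \<or> b = 0"
begin

lemma diff_in [simp]: "a \<in> A \<Longrightarrow> b \<in> A \<Longrightarrow> a - b \<in> A"
  by (metis add_in neg_in diff_conv_add_uminus)

lemma sum_in [simp]: "(\<And>i. i \<in> I \<Longrightarrow> f i \<in> A) \<Longrightarrow> (\<Sum>i\<in>I. f i) \<in> A"
  by (induction I rule: infinite_finite_induct) auto

lemma power_in [simp]: "a \<in> A \<Longrightarrow> a ^ j \<in> A"
  by (induction j) auto

lemma power_nonzero: "a \<in> A \<Longrightarrow> a \<noteq> 0 \<Longrightarrow> a ^ j \<noteq> 0"
proof (induction j)
  case (Suc j)
  then show ?case using no_zero_div[of a "a ^ j"] by auto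
qed (simp add: one_neq_zero)

text \<open>Gaussian elimination without division: the other equations are multiplied by the pivot
  before the pivot variable is eliminated, so a domain of coefficients suffices.\<close>

lemma homogeneous_system:
  assumes "finite J" "finite S" "card J < card S" "\<And>s j. s \<in> S \<Longrightarrow> j \<in> J \<Longrightarrow> B s j \<in> A"
  shows "\<exists>l. (\<forall>s\<in>S. l s \<in> A) \<and> (\<exists>s\<in>S. l s \<noteq> 0) \<and> (\<forall>j\<in>J. (\<Sum>s\<in>S. l s * B s j) = 0)"
  using assms
proof (induction J arbitrary: S B rule: finite_induct)
  case empty
  then obtain s where "s \<in> S" by (metis card_gt_0_iff card.empty all_not_in_conv)
  then show ?case by (intro exI[of _ "\<lambda>_. 1"]) (auto simp: one_neq_zero)
next
  case (insert j0 J)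
  show ?case
  proof (cases "\<forall>s\<in>S. B s j0 = 0")
    case True
    have "\<exists>l. (\<forall>s\<in>S. l s \<in> A) \<and> (\<exists>s\<in>S. l s \<noteq> 0) \<and> (\<forall>j\<in>J. (\<Sum>s\<in>S. l s * B s j) = 0)"
      by (rule insert.IH) (use insert in auto)
    then show ?thesis using True by (auto intro!: sum.neutral)
  next
    case False
    then obtain s0 where s0: "s0 \<in> S" "B s0 j0 \<noteq> 0" by auto
    define S' where "S' = S - {s0}"
    define B' where "B' s j = B s0 j0 * B s j - B s j0 * B s0 j" for s j
    have fin: "finite S'" and S: "S = insert s0 S'" "s0 \<notin> S'"
      using insert.prems s0 by (auto simp: S'_def)
    have BA: "\<And>s j. s \<in> S \<Longrightarrow> j \<in> insert j0 J \<Longrightarrow> B s j \<in> A"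
      using insert.prems by auto
    have "\<exists>l. (\<forall>s\<in>S'. l s \<in> A) \<and> (\<exists>s\<in>S'. l s \<noteq> 0) \<and> (\<forall>j\<in>J. (\<Sum>s\<in>S'. l s * B' s j) = 0)"
      by (rule insert.IH) (use insert S fin s0 BA in \<open>auto simp: B'_def\<close>)
    then obtain l' where l': "\<And>s. s \<in> S' \<Longrightarrow> l' s \<in> A" "\<exists>s\<in>S'. l' s \<noteq> 0"
      "\<And>j. j \<in> J \<Longrightarrow> (\<Sum>s\<in>S'. l' s * B' s j) = 0" by auto
    define l where "l s = (if s = s0 then - (\<Sum>s\<in>S'. l' s * B s j0) else l' s * B s0 j0)" for s
    have sum: "(\<Sum>s\<in>S. l s * B s j) =
        (\<Sum>s\<in>S'. l' s * B s0 j0 * B s j) - (\<Sum>s\<in>S'. l' s * B s j0) * B s0 j" for j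
    proof -
      have "(\<Sum>s\<in>S'. l s * B s j) = (\<Sum>s\<in>S'. l' s * B s0 j0 * B s j)"
        by (rule sum.cong) (use S in \<open>auto simp: l_def\<close>)
      then show ?thesis using S fin by (simp add: l_def)
    qed
    have "(\<Sum>s\<in>S. l s * B s j) = 0" if "j \<in> J" for j
      using l'(3)[OF that] unfolding sum B'_def sum_distrib_right
      by (simp add: sum_subtractf[symmetric] algebra_simps)
    moreover have "(\<Sum>s\<in>S. l s * B s j0) = 0"
      unfolding sum sum_distrib_right sum_subtractf[symmetric]
    proof (rule sum.neutral, rule ballI)
      fix s assume "s \<in> S'"
      then have "B s0 j0 * B s j0 = B s j0 * B s0 j0"
        using BA s0 S by (intro comm_in) auto
      then show "l' s * B s0 j0 * B s j0 - l' s * B s j0 * B s0 j0 = 0"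
        by (simp add: mult.assoc)
    qed
    moreover have "\<exists>s\<in>S. l s \<noteq> 0"
    proof -
      obtain s where s: "s \<in> S'" "l' s \<noteq> 0" using l'(2) by auto
      then have "l' s * B s0 j0 \<noteq> 0" using no_zero_div[of "l' s" "B s0 j0"] l'(1) s0 BA by auto
      then have "l s \<noteq> 0" using s S by (auto simp: l_def)
      then show ?thesis using s S by auto
    qed
    moreover have "\<forall>s\<in>S. l s \<in> A"
      using l'(1) BA S s0 by (auto simp: l_def)
    ultimately show ?thesis by (intro exI[of _ l]) auto
  qed
qed

end

lemma domain_subset_UNIV: "domain_subset (UNIV :: 'k::field set)"
  by standard (auto simp: mult.commute)

section \<open>The Capelli polynomial\<close>

primrec cap_word :: "(nat \<Rightarrow> nat) \<Rightarrow> nat \<Rightarrow> nat list" where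
  "cap_word \<sigma> 0 = [0]"
| "cap_word \<sigma> (Suc j) = 2 * Suc j # Suc (2 * \<sigma> j) # cap_word \<sigma> j"

text \<open>The Capelli polynomial in the variables \<open>a i = c (2 i + 1)\<close> and \<open>b i = c (2 i)\<close>: the alternating
  sum over \<open>\<sigma>\<close> of the words \<open>b m, a (\<sigma> (m - 1)), b (m - 1), \<dots>, a (\<sigma> 0), b 0\<close>. One sequence \<open>c\<close> holds
  both kinds of variables, so that multilinearity has one statement for all slots.\<close>

definition cap :: "nat \<Rightarrow> (nat \<Rightarrow> 'e) \<Rightarrow> 'e::{ring,monoid_mult}" where
  "cap m c = (\<Sum>\<sigma> | \<sigma> permutes {..<m}.
     (if evenperm \<sigma> then prod_list (map c (cap_word \<sigma> m)) else - prod_list (map c (cap_word \<sigma> m))))"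

lemma cap_hom:
  assumes add: "\<And>x y. h (x + y) = h x + h y" and mult: "\<And>x y. h (x * y) = h x * h y" and one: "h 1 = 1"
  shows "h (cap m c) = cap m (\<lambda>i. h (c i))"
proof -
  have zero: "h 0 = 0" using add[of 0 0] by simp
  have neg: "h (- x) = - h x" for x using add[of x "- x"] zero by (metis add.right_inverse minus_unique)
  have sum: "h (sum f I) = (\<Sum>i\<in>I. h (f i))" for f :: "(nat \<Rightarrow> nat) \<Rightarrow> 'a" and I
    by (induction I rule: infinite_finite_induct) (auto simp: zero add)
  have prod: "h (prod_list xs) = prod_list (map h xs)" for xs
    by (induction xs) (auto simp: one mult)
  show ?thesis
    unfolding cap_def sum by (rule sum.cong) (auto simp: neg prod comp_def)
qed

lemma set_cap_word: "set (cap_word \<sigma> m) = (\<lambda>i. 2 * i) ` {..m} \<union> (\<lambda>i. Suc (2 * \<sigma> i)) ` {..<m}"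
  by (induction m) (auto simp: atMost_Suc lessThan_Suc)

lemma distinct_cap_word: "inj_on \<sigma> {..<m} \<Longrightarrow> distinct (cap_word \<sigma> m)"
proof (induction m)
  case (Suc m)
  then have "inj_on \<sigma> {..<m}" "\<sigma> m \<notin> \<sigma> ` {..<m}" by (auto simp: lessThan_Suc)
  moreover have "Suc (2 * a) \<noteq> 2 * b" "2 * b \<noteq> Suc (2 * a)" for a b :: nat by presburger+
  ultimately show ?case using Suc.IH by (auto simp: set_cap_word)
qed auto

lemma permutes_set_cap_word:
  assumes "\<sigma> permutes {..<m}" shows "set (cap_word \<sigma> m) = {..2 * m}"
proof -
  have "(\<lambda>i. Suc (2 * \<sigma> i)) ` {..<m} = (\<lambda>i. Suc (2 * i)) ` {..<m}"
    using permutes_image[OF assms] by (metis image_image)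
  moreover have "j \<in> (\<lambda>i. 2 * i) ` {..m} \<union> (\<lambda>i. Suc (2 * i)) ` {..<m} \<longleftrightarrow> j \<le> 2 * m" for j
    by (cases "even j") (auto elim!: evenE oddE)
  ultimately show ?thesis unfolding set_cap_word by (metis atMost_iff subsetI subset_antisym)
qed

lemma cap_cong:
  assumes "\<And>i. i \<le> 2 * m \<Longrightarrow> c i = c' i" shows "cap m c = cap m c'"
proof -
  have "prod_list (map c (cap_word \<sigma> m)) = prod_list (map c' (cap_word \<sigma> m))" if "\<sigma> permutes {..<m}" for \<sigma>
    using assms by (intro arg_cong[where f = prod_list] list.map_cong) (auto simp: permutes_set_cap_word[OF that])
  then show ?thesis unfolding cap_def by (intro sum.cong) (auto simp del: prod_list.Cons)
qed

text \<open>Each index up to \<open>2 m\<close> occurs exactly once in each word, so an identity for slot \<open>j\<close> of all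
  such words carries over to the sum.\<close>

lemma cap_slot:
  assumes "\<And>l. distinct l \<Longrightarrow> j \<in> set l \<Longrightarrow> set l = {..2*m} \<Longrightarrow>
     prod_list (map c1 l) = f (prod_list (map c2 l)) (prod_list (map c3 l))"
   and "j \<le> 2 * m" and f_add: "\<And>x y x' y'. f (x + x') (y + y') = f x y + f x' y'"
  shows "cap m c1 = f (cap m c2) (cap m c3)"
proof -
  have f0: "f 0 0 = 0" using f_add[of 0 0 0 0] by simp
  have fneg: "f (- x) (- y) = - f x y" for x y
    using f_add[of x "- x" y "- y"] f0 by (metis add.right_inverse minus_unique)
  have fsum: "f (sum g I) (sum h I) = (\<Sum>i\<in>I. f (g i) (h i))" for g h and I :: "(nat \<Rightarrow> nat) set"
    by (induction I rule: infinite_finite_induct) (auto simp: f0 f_add)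
  have "prod_list (map c1 (cap_word \<sigma> m)) =
      f (prod_list (map c2 (cap_word \<sigma> m))) (prod_list (map c3 (cap_word \<sigma> m)))"
    if "\<sigma> permutes {..<m}" for \<sigma>
    using that assms(2) by (intro assms(1) distinct_cap_word permutes_inj_on)
      (auto simp: permutes_set_cap_word)
  then show ?thesis
    unfolding cap_def fsum by (intro sum.cong) (auto simp: fneg)
qed

lemma cap_add:
  assumes "j \<le> 2 * m"
  shows "cap m (c(j := x + y)) = cap m (c(j := x)) + cap m (c(j := y))"
proof (rule cap_slot[where f = "(+)", OF _ assms])
  fix l :: "nat list" assume "distinct l" "j \<in> set l"
  then obtain l1 l2 where l: "l = l1 @ j # l2" "j \<notin> set l1" "j \<notin> set l2"
    by (metis distinct.simps(2) distinct_append split_list_first)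
  then show "prod_list (map (c(j := x + y)) l) = prod_list (map (c(j := x)) l) + prod_list (map (c(j := y)) l)"
    by (simp add: algebra_simps)
qed (simp add: algebra_simps)

lemma cap_mult_left:
  assumes "j \<le> 2 * m" and "\<And>i. i \<le> 2 * m \<Longrightarrow> i \<noteq> j \<Longrightarrow> z * c i = c i * z"
  shows "cap m (c(j := z * x)) = z * cap m (c(j := x))"
proof (rule cap_slot[where f = "\<lambda>x y. z * x" and ?c3.0 = c, OF _ assms(1)])
  fix l :: "nat list" assume "distinct l" "j \<in> set l" and set: "set l = {..2 * m}"
  then obtain l1 l2 where l: "l = l1 @ j # l2" "j \<notin> set l1" "j \<notin> set l2"
    by (metis distinct.simps(2) distinct_append split_list_first)
  have "prod_list (map c l') * z = z * prod_list (map c l')" if "set l' \<subseteq> {..2*m} - {j}" for l'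
    using that
  proof (induction l')
    case (Cons i l')
    have "c i * z = z * c i" using assms(2)[of i] Cons.prems by auto
    then show ?case using Cons by (auto simp: mult.assoc) (metis mult.assoc)
  qed simp
  from this[of l1] have "prod_list (map c l1) * z = z * prod_list (map c l1)" using l set by auto
  then show "prod_list (map (c(j := z * x)) l) = z * prod_list (map (c(j := x)) l)"
    using l by simp (metis mult.assoc)
qed (simp add: algebra_simps)

lemma cap_zero:
  assumes "j \<le> 2 * m" shows "cap m (c(j := 0)) = 0"
  using cap_add[OF assms, of c 0 0] by simp

lemma cap_sum:
  assumes "j \<le> 2 * m" shows "cap m (c(j := (\<Sum>i\<in>I. f i))) = (\<Sum>i\<in>I. cap m (c(j := f i)))"
  by (induction I rule: infinite_finite_induct)
    (simp_all only: sum.infinite sum.empty sum.insert cap_zero[OF assms] cap_add[OF assms] not_False_eq_True)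

text \<open>Composition with the transposition of \<open>a\<close> and \<open>b\<close> matches the even with the odd permutations
  without changing the word. Nothing is divided by two, so characteristic 2 is covered.\<close>

lemma cap_alternating:
  assumes "a < m" "b < m" "a \<noteq> b" and "c (Suc (2 * a)) = c (Suc (2 * b))"
  shows "cap m c = 0"
proof -
  let ?t = "Transposition.transpose a b"
  let ?w = "\<lambda>\<sigma>. prod_list (map c (cap_word \<sigma> m))"
  define E where "E = {\<sigma>. \<sigma> permutes {..<m} \<and> evenperm \<sigma>}"
  define O' where "O' = {\<sigma>. \<sigma> permutes {..<m} \<and> \<not> evenperm \<sigma>}"
  have fin: "finite E" "finite O'" unfolding E_def O'_def
    by (auto intro: finite_subset[OF _ finite_permutations[of "{..<m}"]])
  have t: "?t permutes {..<m}" using assms by (intro permutes_swap_id) auto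
  have perm: "permutation \<sigma>" if "\<sigma> permutes {..<m}" for \<sigma>
    using that permutation_permutes by blast
  have flip: "?t \<circ> \<sigma> permutes {..<m}" "evenperm (?t \<circ> \<sigma>) \<longleftrightarrow> \<not> evenperm \<sigma>"
    if "\<sigma> permutes {..<m}" for \<sigma>
    using that t assms(3) perm[OF that] perm[OF t]
    by (auto simp: permutes_compose evenperm_comp evenperm_swap)
  have w: "?w (?t \<circ> \<sigma>) = ?w \<sigma>" for \<sigma>
  proof -
    have "map c (cap_word (?t \<circ> \<sigma>) j) = map c (cap_word \<sigma> j)" for j
      by (induction j) (use assms(4) in \<open>auto simp: transpose_def\<close>)
    then show ?thesis by simp
  qed
  have inv: "?t \<circ> (?t \<circ> \<sigma>) = \<sigma>" for \<sigma> by (simp add: fun_eq_iff)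
  have "sum ?w O' = sum ?w E"
    by (rule sum.reindex_bij_witness[where i = "(\<circ>) ?t" and j = "(\<circ>) ?t"])
      (use flip w inv in \<open>auto simp: E_def O'_def\<close>)
  moreover have "cap m c = (\<Sum>\<sigma>\<in>E. ?w \<sigma>) + (\<Sum>\<sigma>\<in>O'. - ?w \<sigma>)"
  proof -
    have "{\<sigma>. \<sigma> permutes {..<m}} = E \<union> O'" "E \<inter> O' = {}" by (auto simp: E_def O'_def)
    then have "cap m c = (\<Sum>\<sigma>\<in>E. if evenperm \<sigma> then ?w \<sigma> else - ?w \<sigma>) + (\<Sum>\<sigma>\<in>O'. if evenperm \<sigma> then ?w \<sigma> else - ?w \<sigma>)"
      unfolding cap_def using fin by (simp add: sum.union_disjoint)
    also have "(\<Sum>\<sigma>\<in>E. if evenperm \<sigma> then ?w \<sigma> else - ?w \<sigma>) = (\<Sum>\<sigma>\<in>E. ?w \<sigma>)"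
      by (rule sum.cong) (auto simp: E_def)
    also have "(\<Sum>\<sigma>\<in>O'. if evenperm \<sigma> then ?w \<sigma> else - ?w \<sigma>) = (\<Sum>\<sigma>\<in>O'. - ?w \<sigma>)"
      by (rule sum.cong) (auto simp: O'_def)
    finally show ?thesis .
  qed
  ultimately show ?thesis by (simp add: sum_negf)
qed

text \<open>Moving \<open>l i0\<close> into its slot and replacing \<open>l i0 * a i0\<close> by the remaining terms of the relation
  leaves values of the polynomial in which some \<open>a i\<close> is repeated.\<close>

lemma cap_dependent:
  assumes dep: "(\<Sum>i<m. l i * c (Suc (2 * i))) = 0"
    and comm: "\<And>i j. i < m \<Longrightarrow> j \<le> 2 * m \<Longrightarrow> l i * c j = c j * l i"
    and i0: "i0 < m"
  shows "l i0 * cap m c = 0"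
proof -
  let ?j = "Suc (2 * i0)"
  have j: "?j \<le> 2 * m" using i0 by auto
  have "l i0 * c ?j = (\<Sum>i\<in>{..<m} - {i0}. - l i * c (Suc (2 * i)))"
    using dep i0 by (simp add: sum.remove[of "{..<m}" i0] sum_negf eq_neg_iff_add_eq_0)
  then have "l i0 * cap m c = cap m (c(?j := (\<Sum>i\<in>{..<m} - {i0}. - l i * c (Suc (2 * i)))))"
    using cap_mult_left[OF j, of "l i0" c "c ?j"] comm i0 by simp
  also have "\<dots> = (\<Sum>i\<in>{..<m} - {i0}. - l i * cap m (c(?j := c (Suc (2 * i)))))"
    unfolding cap_sum[OF j] by (intro sum.cong cap_mult_left j) (auto simp: comm)
  also have "\<dots> = 0"
  proof (rule sum.neutral, rule ballI)
    fix i assume i: "i \<in> {..<m} - {i0}"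
    then have "cap m (c(?j := c (Suc (2 * i)))) = 0"
      by (intro cap_alternating[of i m i0]) (use i0 in auto)
    then show "- l i * cap m (c(?j := c (Suc (2 * i)))) = 0" by simp
  qed
  finally show ?thesis .
qed

inductive_set scalar_extension :: "'e::{ring,monoid_mult} set \<Rightarrow> 'e set \<Rightarrow> 'e set" for K A where
  base: "a \<in> A \<Longrightarrow> a \<in> scalar_extension K A"
| add: "a \<in> scalar_extension K A \<Longrightarrow> b \<in> scalar_extension K A \<Longrightarrow> a + b \<in> scalar_extension K A"
| scale: "d \<in> K \<Longrightarrow> a \<in> scalar_extension K A \<Longrightarrow> d * a \<in> scalar_extension K A"

lemma scalar_extension_commute:
  assumes "a \<in> scalar_extension K A" and "\<And>a. a \<in> A \<Longrightarrow> x * a = a * x" and "\<And>d. d \<in> K \<Longrightarrow> x * d = d * x"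
  shows "x * a = a * x"
  using assms(1)
proof induction
  case (scale d a)
  then show ?case using assms(3)[of d] by (metis mult.assoc)
qed (use assms in \<open>auto simp: algebra_simps\<close>)

text \<open>A multilinear identity survives extension by commuting scalars; the slots are replaced
  one after the other.\<close>

lemma cap_scalar_extension:
  assumes van: "\<And>c. (\<And>i. i \<le> 2 * m \<Longrightarrow> c i \<in> A) \<Longrightarrow> cap m c = 0"
    and KA: "\<And>d a. d \<in> K \<Longrightarrow> a \<in> A \<Longrightarrow> d * a = a * d"
    and KK: "\<And>d d'. d \<in> K \<Longrightarrow> d' \<in> K \<Longrightarrow> d * d' = d' * d"
    and c: "\<And>i. i \<le> 2 * m \<Longrightarrow> c i \<in> scalar_extension K A"
  shows "cap m c = 0"
proof -
  have "cap m c = 0" if "j \<le> Suc (2 * m)" "\<And>i. i < j \<Longrightarrow> c i \<in> scalar_extension K A"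
    "\<And>i. j \<le> i \<Longrightarrow> i \<le> 2 * m \<Longrightarrow> c i \<in> A" for j c
    using that
  proof (induction j arbitrary: c)
    case 0
    then show ?case by (intro van) auto
  next
    case (Suc j)
    have j: "j \<le> 2 * m" using Suc.prems by simp
    have "cap m (c(j := x)) = 0" if "x \<in> scalar_extension K A" for x
      using that
    proof induction
      case (base a)
      show ?case by (rule Suc.IH) (use Suc.prems base in auto)
    next
      case (add a b)
      then show ?case by (simp only: cap_add[OF j] add_0_right)
    next
      case (scale d a)
      have "d * c i = c i * d" if "i \<le> 2 * m" "i \<noteq> j" for i
      proof -
        have "c i \<in> scalar_extension K A"
          using Suc.prems(2,3) that by (cases "i < j") (auto intro: scalar_extension.base)
        then show ?thesis by (rule scalar_extension_commute) (use KA KK scale in auto)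
      qed
      then have "cap m (c(j := d * a)) = d * cap m (c(j := a))" by (intro cap_mult_left j) auto
      then show ?case using scale by (simp only: mult_zero_right)
    qed
    from this[of "c j"] show ?case using Suc.prems by simp
  qed
  from this[of "Suc (2 * m)" c] show ?thesis using c by simp
qed

text \<open>The witness that operators on a space of dimension \<open>d\<close> violate the identity of degree \<open>d\<^sup>2\<close>. On
  the vectors \<open>v k\<close>, the \<open>a i\<close> run through all matrix units, with the row and column of \<open>a i\<close> given by the digits of \<open>i\<close> in
  base \<open>d\<close>, and \<open>b i\<close> connects \<open>a (i - 1)\<close> to \<open>a i\<close>. Then only the word of the identity
  permutation is nonzero on \<open>v 0\<close>. By truncated subtraction, \<open>b 0\<close> maps \<open>v 0\<close> to itself.\<close>

lemma cap_matrix_units: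
  fixes v :: "nat \<Rightarrow> 'm::ab_group_add"
  assumes d: "d > 0" and v0: "v 0 \<noteq> 0"
    and odd: "\<And>i k. i < d * d \<Longrightarrow> k < d \<Longrightarrow>
      app (c (Suc (2 * i))) (v k) = (if k = i mod d then v (i div d) else 0)"
    and even: "\<And>i k. i \<le> d * d \<Longrightarrow> k < d \<Longrightarrow>
      app (c (2 * i)) (v k) = (if k = (i - 1) div d then v (i mod d) else 0)"
  shows "cap (d * d) c \<noteq> 0"
proof -
  let ?m = "d * d"
  have word: "app (prod_list (map c (cap_word \<sigma> j))) (v 0) = (if \<forall>i<j. \<sigma> i = i then v (j mod d) else 0)"
    if \<sigma>: "\<sigma> permutes {..<?m}" and "j \<le> ?m" for \<sigma> j
    using \<open>j \<le> ?m\<close>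
  proof (induction j)
    case 0
    then show ?case using d even[of 0 0] by simp
  next
    case (Suc j)
    have s: "\<sigma> j < ?m" using \<sigma> Suc.prems permutes_in_image[OF \<sigma>, of j] by auto
    have div: "\<sigma> j div d < d" using s by (simp add: less_mult_imp_div_less)
    have eq: "\<sigma> j = j \<longleftrightarrow> j mod d = \<sigma> j mod d \<and> \<sigma> j div d = j div d"
      by (metis div_mult_mod_eq)
    have all: "(\<forall>i<Suc j. \<sigma> i = i) \<longleftrightarrow> (\<forall>i<j. \<sigma> i = i) \<and> \<sigma> j = j"
      by (auto simp: less_Suc_eq)
    have step: "app (c (2 * Suc j)) (app (c (Suc (2 * \<sigma> j))) (v (j mod d))) =
      (if \<sigma> j = j then v (Suc j mod d) else 0)"
      using odd[OF s, of "j mod d"] even[of "Suc j" "\<sigma> j div d"] div d Suc.prems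
      unfolding eq by (cases "\<sigma> j div d = j div d"; cases "j mod d = \<sigma> j mod d") auto
    have IH: "app (prod_list (map c (cap_word \<sigma> j))) (v 0) = (if \<forall>i<j. \<sigma> i = i then v (j mod d) else 0)"
      by (rule Suc.IH) (use Suc.prems in simp)
    show ?case
    proof (cases "\<forall>i<j. \<sigma> i = i")
      case True
      show ?thesis
        unfolding cap_word.simps list.map prod_list.Cons app_simps IH[unfolded if_P[OF True]] step all
        using True by simp
    next
      case False
      show ?thesis
        unfolding cap_word.simps list.map prod_list.Cons app_simps IH[unfolded if_not_P[OF False]] all
        using False by auto
    qed
  qed
  have id: "\<sigma> = id" if "\<sigma> permutes {..<?m}" "\<forall>i<?m. \<sigma> i = i" for \<sigma>
    using that unfolding fun_eq_iff permutes_def by (metis id_apply lessThan_iff)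
  have "app (cap ?m c) (v 0) = (\<Sum>\<sigma> | \<sigma> permutes {..<?m}. if \<sigma> = id then v 0 else 0)"
    unfolding cap_def app_sum
  proof (rule sum.cong)
    fix \<sigma> assume "\<sigma> \<in> {\<sigma>. \<sigma> permutes {..<?m}}"
    then show "app (if evenperm \<sigma> then prod_list (map c (cap_word \<sigma> ?m)) else - prod_list (map c (cap_word \<sigma> ?m))) (v 0)
      = (if \<sigma> = id then v 0 else 0)"
      using word[of \<sigma> ?m] id[of \<sigma>] by (auto simp: evenperm_id)
  qed simp
  also have "\<dots> = v 0" by (simp add: sum.delta finite_permutations permutes_id)
  finally show ?thesis using v0 by auto
qed

section \<open>Characters of finitely generated subalgebras of a field\<close>

text \<open>Elements of \<open>A[u]\<close> are handled as values of Horner's scheme on lists of coefficients, since the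
  coefficients range over a subset of a ring.\<close>

inductive_set adjoin :: "'e::{ring,monoid_mult} set \<Rightarrow> 'e \<Rightarrow> 'e set" for A u where
  zero: "0 \<in> adjoin A u"
| step: "a \<in> A \<Longrightarrow> w \<in> adjoin A u \<Longrightarrow> a + u * w \<in> adjoin A u"

primrec horner :: "'e \<Rightarrow> 'e list \<Rightarrow> 'e::{ring,monoid_mult}" where
  "horner u [] = 0"
| "horner u (a # as) = a + u * horner u as"

lemma adjoin_horner: "adjoin A u = horner u ` lists A"
proof (intro equalityI subsetI)
  fix w assume "w \<in> adjoin A u"
  then show "w \<in> horner u ` lists A"
  proof induction
    case zero
    show ?case by (rule image_eqI[of _ _ "[]"]) auto
  next
    case (step a w)
    then obtain as where "as \<in> lists A" "w = horner u as" by auto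
    then show ?case using step by (intro image_eqI[of _ _ "a # as"]) auto
  qed
next
  fix w assume "w \<in> horner u ` lists A"
  then obtain as where "as \<in> lists A" "w = horner u as" by auto
  then show "w \<in> adjoin A u"
    by (induction as arbitrary: w) (auto intro: adjoin.intros)
qed

lemma horner_append: "horner u (as @ bs) = horner u as + u ^ length as * horner u bs"
  by (induction as) (auto simp: algebra_simps)

lemma horner_sum: "horner u as = (\<Sum>i<length as. u ^ i * as ! i)"
  by (induction as)
    (auto simp: sum.lessThan_Suc_shift sum_distrib_left mult.assoc simp del: sum.lessThan_Suc)

lemma horner_zeros: "(\<forall>a\<in>set as. a = 0) \<Longrightarrow> horner u as = 0"
  by (induction as) auto

lemma horner_map_mult:
  assumes "b * u = u * b" shows "horner u (map ((*) b) as) = b * horner u as"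
proof (induction as)
  case (Cons a as)
  have "u * (b * horner u as) = b * (u * horner u as)"
    using assms by (simp add: mult.assoc[symmetric])
  then show ?case using Cons by (simp add: distrib_left)
qed simp

lemma horner_map2_diff:
  "length as = length bs \<Longrightarrow> horner u (map2 (-) as bs) = horner u as - horner u bs"
  by (induction as bs rule: list_induct2) (auto simp: right_diff_distrib add_diff_add)

lemma horner_poly: "horner t as = poly (Poly as) (t :: 'k::field)"
  by (induction as) auto

locale commuting_subring =
  fixes A :: "'e::{ring,monoid_mult} set" and u :: 'e
  assumes zeroA: "0 \<in> A" and oneA: "1 \<in> A"
    and addA: "\<And>a b. a \<in> A \<Longrightarrow> b \<in> A \<Longrightarrow> a + b \<in> A"
    and negA: "\<And>a. a \<in> A \<Longrightarrow> - a \<in> A"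
    and multA: "\<And>a b. a \<in> A \<Longrightarrow> b \<in> A \<Longrightarrow> a * b \<in> A"
    and commA: "\<And>a b. a \<in> A \<Longrightarrow> b \<in> A \<Longrightarrow> a * b = b * a"
    and commu: "\<And>a. a \<in> A \<Longrightarrow> a * u = u * a"
begin

lemma adjoin_base: "a \<in> A \<Longrightarrow> a \<in> adjoin A u"
  using adjoin.step[OF _ adjoin.zero, of a A u] by simp

lemma adjoin_gen_mult: "w \<in> adjoin A u \<Longrightarrow> u * w \<in> adjoin A u"
  using adjoin.step[OF zeroA, of w u] by simp

lemma adjoin_gen: "u \<in> adjoin A u"
  using adjoin_gen_mult[OF adjoin_base[OF oneA]] by simp

lemma adjoin_add: "w \<in> adjoin A u \<Longrightarrow> w' \<in> adjoin A u \<Longrightarrow> w + w' \<in> adjoin A u"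
proof (induction arbitrary: w' rule: adjoin.induct)
  case (step a w)
  from \<open>w' \<in> adjoin A u\<close> show ?case
  proof cases
    case (step b w'')
    have "(a + b) + u * (w + w'') \<in> adjoin A u"
      using addA \<open>a \<in> A\<close> step \<open>\<And>w'. w' \<in> adjoin A u \<Longrightarrow> w + w' \<in> adjoin A u\<close> by (intro adjoin.step) auto
    then show ?thesis using step by (simp add: algebra_simps)
  qed (use step in \<open>auto intro: adjoin.step\<close>)
qed auto

lemma adjoin_scale: "w \<in> adjoin A u \<Longrightarrow> b \<in> A \<Longrightarrow> b * w \<in> adjoin A u"
proof (induction rule: adjoin.induct)
  case (step a w)
  then have "b * a + u * (b * w) \<in> adjoin A u" by (intro adjoin.step multA) auto
  moreover have "b * (u * w) = u * (b * w)" using commu[OF \<open>b \<in> A\<close>] by (metis mult.assoc)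
  ultimately show ?case by (simp add: algebra_simps)
qed (auto intro: adjoin.zero)

lemma adjoin_mult: "w \<in> adjoin A u \<Longrightarrow> w' \<in> adjoin A u \<Longrightarrow> w * w' \<in> adjoin A u"
proof (induction rule: adjoin.induct)
  case (step a w)
  then have "a * w' + u * (w * w') \<in> adjoin A u"
    by (intro adjoin_add adjoin_gen_mult adjoin_scale[OF _ \<open>a \<in> A\<close>]) auto
  then show ?case by (simp add: algebra_simps)
qed (auto intro: adjoin.zero)

lemma adjoin_neg: "w \<in> adjoin A u \<Longrightarrow> - w \<in> adjoin A u"
  using adjoin_scale[of w "- 1"] negA[OF oneA] by simp

lemma adjoin_power: "w \<in> adjoin A u \<Longrightarrow> w ^ j \<in> adjoin A u"
  by (induction j) (auto intro: adjoin_mult adjoin_base oneA)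

text \<open>One step of division by a relation \<open>f\<close> of \<open>u\<close>. The leading coefficient of \<open>f\<close> may not be
  invertible, so the dividend is multiplied by it.\<close>

lemma pseudo_division_step:
  assumes f: "f \<in> lists A" "f \<noteq> []" "horner u f = 0" and ds: "ds \<in> lists A" "length f \<le> length ds"
  shows "\<exists>ds'\<in>lists A. Suc (length ds') = length ds \<and> horner u ds' = last f * horner u ds"
proof -
  define b where "b = last ds"
  define q where "q = replicate (length ds - length f) 0 @ map ((*) b) f"
  have ds_ne: "ds \<noteq> []" using f ds by auto
  have A: "b \<in> A" "last f \<in> A" using f ds ds_ne by (auto simp: b_def in_lists_conv_set)
  have len: "length q = length ds" using ds by (simp add: q_def)
  have hq: "horner u q = 0"
    using horner_map_mult[of b u f] commu[OF A(1)] f(3)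
    by (simp add: q_def horner_append horner_zeros)
  define r where "r = map2 (-) (map ((*) (last f)) ds) q"
  have lr: "length r = length ds" using len by (simp add: r_def)
  have qA: "q \<in> lists A" using f A zeroA multA by (auto simp: q_def in_lists_conv_set)
  have diff: "x - y \<in> A" if "x \<in> A" "y \<in> A" for x y
    using addA[OF that(1) negA[OF that(2)]] by simp
  have rA: "r \<in> lists A"
    unfolding in_lists_conv_set
  proof
    fix x assume "x \<in> set r"
    then obtain i where i: "i < length ds" "x = r ! i" using lr by (metis in_set_conv_nth)
    then have "ds ! i \<in> A" "q ! i \<in> A" using qA ds(1) len by (auto simp: in_lists_conv_set)
    then show "x \<in> A" using i len A unfolding r_def by (auto intro!: diff multA)
  qed
  have r_ne: "r \<noteq> []" using lr ds_ne by auto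
  have "last r = last (map ((*) (last f)) ds) - last q"
    using ds_ne len lr r_ne unfolding r_def
    by (simp add: last_conv_nth)
  also have "last q = b * last f" using f(2) by (simp add: q_def last_append last_map)
  also have "last (map ((*) (last f)) ds) = last f * b" using ds_ne by (simp add: last_map b_def)
  finally have "last r = 0" using commA A by simp
  then have "r = butlast r @ [0]" using r_ne by (metis append_butlast_last_id)
  then have "horner u (butlast r) = horner u r"
    by (metis horner.simps add.right_neutral horner_append mult_zero_right)
  also have "\<dots> = last f * horner u ds"
    using len hq horner_map_mult[of "last f" u ds] commu[OF A(2)]
    by (simp add: r_def horner_map2_diff)
  finally show ?thesis
    using rA lr ds_ne by (intro bexI[of _ "butlast r"]) (auto simp: in_lists_conv_set dest: in_set_butlastD)
qed

text \<open>With a relation of minimal length as \<open>f\<close>, this decides relations of \<open>u\<close>: the remainder is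
  too short to be a nontrivial one.\<close>

lemma pseudo_division:
  assumes f: "f \<in> lists A" "f \<noteq> []" "horner u f = 0" and ds: "ds \<in> lists A"
  shows "\<exists>s. \<exists>ds'\<in>lists A. length ds' < length f \<and> horner u ds' = last f ^ s * horner u ds"
  using ds
proof (induction "length ds" arbitrary: ds rule: less_induct)
  case less
  show ?case
  proof (cases "length ds < length f")
    case True
    then show ?thesis using less.prems by (intro exI[of _ 0]) auto
  next
    case False
    then obtain ds' where ds': "ds' \<in> lists A" "Suc (length ds') = length ds" "horner u ds' = last f * horner u ds"
      using pseudo_division_step[OF f less.prems] by auto
    from less.hyps[of ds'] ds' obtain s ds'' where
      "ds'' \<in> lists A" "length ds'' < length f" "horner u ds'' = last f ^ s * horner u ds'" by auto
    then show ?thesis using ds' by (intro exI[of _ "Suc s"] bexI[of _ ds''])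
        (auto simp: mult.assoc[symmetric] power_commutes)
  qed
qed

end

lemma infinite_alg_closed_field: "infinite (UNIV :: 'k::alg_closed_field set)"
proof
  assume fin: "finite (UNIV :: 'k set)"
  define p :: "'k poly" where "p = (\<Prod>a\<in>UNIV. [:- a, 1:])"
  have deg: "degree p = card (UNIV :: 'k set)"
    unfolding p_def by (subst degree_prod_eq_sum_degree) auto
  moreover have "card (UNIV :: 'k set) > 0" using fin by (simp add: finite_UNIV_card_ge_0)
  ultimately have "degree (p + 1) > 0" by (metis add.commute degree_1 degree_add_eq_right)
  then obtain x where "poly (p + 1) x = 0" using alg_closed_imp_poly_has_root by blast
  moreover have "poly p x = 0" unfolding p_def poly_prod using fin by (simp add: prod_zero_iff)
  ultimately show False by simp
qed

definition algebra_character :: "('k::field \<Rightarrow> 'e::{ring,monoid_mult}) \<Rightarrow> 'e set \<Rightarrow> ('e \<Rightarrow> 'k) \<Rightarrow> bool" where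
  "algebra_character S A \<psi> \<longleftrightarrow> (\<forall>r. \<psi> (S r) = r) \<and>
    (\<forall>a\<in>A. \<forall>b\<in>A. \<psi> (a + b) = \<psi> a + \<psi> b \<and> \<psi> (a * b) = \<psi> a * \<psi> b)"

text \<open>The conclusion of the Nullstellensatz for \<open>A\<close>. Unlike the mere existence of a character, it is
  strong enough to pass from \<open>A\<close> to \<open>A[u]\<close>.\<close>

definition enough_characters :: "('k::field \<Rightarrow> 'e::{ring,monoid_mult}) \<Rightarrow> 'e set \<Rightarrow> bool" where
  "enough_characters S A \<longleftrightarrow> (\<forall>a\<in>A. a \<noteq> 0 \<longrightarrow> (\<exists>\<psi>. algebra_character S A \<psi> \<and> \<psi> a \<noteq> 0))"

locale algebra_extension = K: domain_subset K + A: domain_subset A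
  for K A :: "'e::{ring,monoid_mult} set" +
  fixes S :: "'k::alg_closed_field \<Rightarrow> 'e" and u :: 'e
  assumes AK: "A \<subseteq> K" and uK: "u \<in> K" and SA: "S r \<in> A"
    and S_add: "S (r + s) = S r + S s" and S_mult: "S (r * s) = S r * S s" and S_one: "S 1 = 1"
begin

sublocale commuting_subring A u
proof
  fix a assume "a \<in> A" then show "a * u = u * a" using K.comm_in AK uK by auto
qed (auto intro: A.comm_in)

lemma S_zero: "S 0 = 0"
  using S_add[of 0 0] by simp

lemma adjoin_subset: "adjoin A u \<subseteq> K"
proof
  fix w assume "w \<in> adjoin A u" then show "w \<in> K" by induction (use AK uK in auto)
qed

lemma domain_subset_adjoin: "domain_subset (adjoin A u)"
proof
  fix a b assume "a \<in> adjoin A u" "b \<in> adjoin A u"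
  then show "a * b = b * a" "a * b = 0 \<Longrightarrow> a = 0 \<or> b = 0"
    using adjoin_subset K.comm_in[of a b] K.no_zero_div[of a b] by (metis subsetD)+
qed (auto intro: adjoin_add adjoin_mult adjoin_neg adjoin_base oneA adjoin.zero simp: A.one_neq_zero)

lemma
  assumes "algebra_character S A \<psi>"
  shows char_S: "\<psi> (S r) = r" and char_add: "a \<in> A \<Longrightarrow> b \<in> A \<Longrightarrow> \<psi> (a + b) = \<psi> a + \<psi> b"
    and char_mult: "a \<in> A \<Longrightarrow> b \<in> A \<Longrightarrow> \<psi> (a * b) = \<psi> a * \<psi> b"
    and char_zero: "\<psi> 0 = 0" and char_one: "\<psi> 1 = 1"
  using assms S_zero S_one by (auto simp: algebra_character_def) metis+

text \<open>A character \<open>\<psi>\<close> of \<open>A\<close> is extended to \<open>A[u]\<close> with value \<open>t\<close> at \<open>u\<close> by adjoining \<open>(u, t)\<close> to its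
  graph, which is a subring of a product. The extension exists if and only if the result is the
  graph of a function, and additivity and multiplicativity are then automatic.\<close>

definition graph :: "('e \<Rightarrow> 'k) \<Rightarrow> ('e \<times> 'k) set" where
  "graph \<psi> = (\<lambda>a. (a, \<psi> a)) ` A"

lemma commuting_subring_graph:
  assumes "algebra_character S A \<psi>"
  shows "commuting_subring (graph \<psi>) (u, t)"
proof -
  note c = char_S[OF assms] char_add[OF assms] char_mult[OF assms] char_zero[OF assms] char_one[OF assms]
  have graph: "x \<in> graph \<psi> \<longleftrightarrow> fst x \<in> A \<and> snd x = \<psi> (fst x)" for x
    by (cases x) (auto simp: graph_def)
  have neg: "\<psi> (- a) = - \<psi> a" if "a \<in> A" for a
    using c(2)[of a "- a"] c(4) that by (metis A.neg_in add.right_inverse minus_unique)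
  show ?thesis
    by standard (auto simp: graph c neg prod_eq_iff A.comm_in commu mult.commute)
qed

lemma extend_character:
  assumes \<psi>: "algebra_character S A \<psi>"
    and wd: "\<And>r. (0, r) \<in> adjoin (graph \<psi>) (u, t) \<Longrightarrow> r = 0"
  obtains \<psi>' where "algebra_character S (adjoin A u) \<psi>'"
    "\<And>w r. (w, r) \<in> adjoin (graph \<psi>) (u, t) \<Longrightarrow> \<psi>' w = r" "\<And>a. a \<in> A \<Longrightarrow> \<psi>' a = \<psi> a"
proof -
  interpret G: commuting_subring "graph \<psi>" "(u, t)" by (rule commuting_subring_graph[OF \<psi>])
  let ?G = "adjoin (graph \<psi>) (u, t)"
  have ex: "\<exists>r. (w, r) \<in> ?G" if "w \<in> adjoin A u" for w
    using that
  proof induction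
    case zero
    show ?case using adjoin.zero[of "graph \<psi>" "(u, t)"] by (auto simp: zero_prod_def)
  next
    case (step a w)
    then obtain r where "(w, r) \<in> ?G" by auto
    then have "(a, \<psi> a) + (u, t) * (w, r) \<in> ?G" using step by (intro adjoin.step) (auto simp: graph_def)
    then show ?case by (auto simp: times_prod_def)
  qed
  have uniq: "r = r'" if "(w, r) \<in> ?G" "(w, r') \<in> ?G" for w r r'
  proof -
    have "(w, r) + - (w, r') \<in> ?G" using that by (intro G.adjoin_add G.adjoin_neg)
    then have "(0, r - r') \<in> ?G" by simp
    then show ?thesis using wd by fastforce
  qed
  define \<psi>' where "\<psi>' w = (THE r. (w, r) \<in> ?G)" for w
  have val: "\<psi>' w = r" if "(w, r) \<in> ?G" for w r
    unfolding \<psi>'_def using that uniq by blast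
  have inG: "(w, \<psi>' w) \<in> ?G" if "w \<in> adjoin A u" for w
    using ex[OF that] val by auto
  have base: "(a, \<psi> a) \<in> ?G" if "a \<in> A" for a using that by (intro G.adjoin_base) (auto simp: graph_def)
  have "algebra_character S (adjoin A u) \<psi>'"
    unfolding algebra_character_def
  proof (intro conjI allI ballI)
    show "\<psi>' (S r) = r" for r using base[OF SA] val char_S[OF \<psi>] by metis
    fix a b assume ab: "a \<in> adjoin A u" "b \<in> adjoin A u"
    show "\<psi>' (a + b) = \<psi>' a + \<psi>' b"
      using G.adjoin_add[OF inG[OF ab(1)] inG[OF ab(2)]] by (intro val) simp
    show "\<psi>' (a * b) = \<psi>' a * \<psi>' b"
      using G.adjoin_mult[OF inG[OF ab(1)] inG[OF ab(2)]] by (intro val) (simp add: times_prod_def)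
  qed
  then show thesis using that val base by blast
qed

lemma horner_graph: "horner (u, t) (map (\<lambda>a. (a, \<psi> a)) cs) = (horner u cs, horner t (map \<psi> cs))"
  by (induction cs) (auto simp: times_prod_def zero_prod_def)

lemma adjoin_graph: "x \<in> adjoin (graph \<psi>) (u, t) \<longleftrightarrow> (\<exists>cs\<in>lists A. x = (horner u cs, horner t (map \<psi> cs)))"
proof -
  have "lists (graph \<psi>) = map (\<lambda>a. (a, \<psi> a)) ` lists A" by (simp add: graph_def lists_image)
  then show ?thesis unfolding adjoin_horner by (auto simp: image_image horner_graph)
qed

text \<open>Without relations for \<open>u\<close>, every \<open>t\<close> is admissible as the value at \<open>u\<close>. If \<open>\<psi>\<close> does not kill all
  coefficients of \<open>b\<close>, only finitely many \<open>t\<close> send \<open>b\<close> to zero.\<close>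

lemma enough_characters_transcendental:
  assumes "enough_characters S A" and "\<And>cs. cs \<in> lists A \<Longrightarrow> horner u cs = 0 \<Longrightarrow> \<forall>a\<in>set cs. a = 0"
  shows "enough_characters S (adjoin A u)"
  unfolding enough_characters_def
proof (intro ballI impI)
  fix b assume "b \<in> adjoin A u" "b \<noteq> 0"
  then obtain bs where bs: "bs \<in> lists A" "b = horner u bs" by (auto simp: adjoin_horner)
  then obtain a where a: "a \<in> set bs" "a \<noteq> 0" using horner_zeros[of bs u] \<open>b \<noteq> 0\<close> by auto
  then obtain \<psi> where \<psi>: "algebra_character S A \<psi>" "\<psi> a \<noteq> 0"
    using assms(1) bs by (auto simp: enough_characters_def in_lists_conv_set)
  have "Poly (map \<psi> bs) \<noteq> 0"
    using a \<psi> by (auto simp: Poly_eq_0 dest!: arg_cong[where f = set])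
  then have "finite {t. poly (Poly (map \<psi> bs)) t = 0}" by (rule poly_roots_finite)
  then obtain t where t: "horner t (map \<psi> bs) \<noteq> 0"
    using infinite_alg_closed_field ex_new_if_finite[of "{t. poly (Poly (map \<psi> bs)) t = 0}"]
    by (auto simp: horner_poly)
  have "r = 0" if in_adj: "(0, r) \<in> adjoin (graph \<psi>) (u, t)" for r
  proof -
    obtain cs where cs: "cs \<in> lists A" "horner u cs = 0" "r = horner t (map \<psi> cs)"
      using in_adj by (auto simp: adjoin_graph)
    have "\<forall>a\<in>set (map \<psi> cs). a = 0" using assms(2)[OF cs(1,2)] char_zero[OF \<psi>(1)] by auto
    then show ?thesis using cs(3) horner_zeros by blast
  qed
  then show "\<exists>\<psi>. algebra_character S (adjoin A u) \<psi> \<and> \<psi> b \<noteq> 0"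
  proof (rule extend_character[OF \<psi>(1)])
    fix \<psi>' assume \<psi>': "algebra_character S (adjoin A u) \<psi>'"
      "\<And>w r. (w, r) \<in> adjoin (graph \<psi>) (u, t) \<Longrightarrow> \<psi>' w = r"
    have "(b, horner t (map \<psi> bs)) \<in> adjoin (graph \<psi>) (u, t)" unfolding adjoin_graph using bs by blast
    from \<psi>'(2)[OF this] show "\<exists>\<psi>. algebra_character S (adjoin A u) \<psi> \<and> \<psi> b \<noteq> 0"
      using \<psi>'(1) t by (intro exI[of _ \<psi>']) simp
  qed
qed

text \<open>Division by \<open>f\<close> writes the powers of \<open>b\<close>, up to powers of the leading coefficient, in
  terms of \<open>r = length f - 1\<close> powers of \<open>u\<close>. So \<open>r + 1\<close> powers are dependent, and \<open>b\<close> satisfies a relation over \<open>A\<close>. Cancelling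
  factors \<open>b\<close> gives a relation with constant term \<open>a \<noteq> 0\<close>, in which \<open>- a\<close> is a multiple of \<open>b\<close>.\<close>

lemma multiple_in_base:
  assumes f: "f \<in> lists A" "f \<noteq> []" "last f \<noteq> 0" "horner u f = 0" and b: "b \<in> adjoin A u" "b \<noteq> 0"
  obtains b' where "b' \<in> adjoin A u" "b * b' \<in> A" "b * b' \<noteq> 0"
proof -
  define r where "r = length f - 1"
  have lfA: "last f \<in> A" using f by (auto simp: in_lists_conv_set)
  have "\<exists>s. \<exists>ds\<in>lists A. length ds \<le> r \<and> horner u ds = last f ^ s * b ^ i" for i
  proof -
    obtain bs where "bs \<in> lists A" "b ^ i = horner u bs"
      using adjoin_power[OF b(1), of i] by (auto simp: adjoin_horner)
    moreover obtain s ds where "ds \<in> lists A" "length ds < length f" "horner u ds = last f ^ s * horner u bs"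
      using pseudo_division[OF f(1,2,4) calculation(1)] by blast
    ultimately show ?thesis by (intro exI[of _ s] bexI[of _ ds]) (auto simp: r_def)
  qed
  then obtain s ds where ds: "\<And>i. ds i \<in> lists A" "\<And>i. length (ds i) \<le> r"
    "\<And>i. horner u (ds i) = last f ^ s i * b ^ i" by metis
  define B where "B i j = (if j < length (ds i) then ds i ! j else 0)" for i j
  have BA: "B i j \<in> A" for i j using ds(1)[of i] by (auto simp: B_def in_lists_conv_set)
  have hB: "last f ^ s i * b ^ i = (\<Sum>j<r. u ^ j * B i j)" for i
  proof -
    have "(\<Sum>j<length (ds i). u ^ j * ds i ! j) = (\<Sum>j<r. u ^ j * B i j)"
      using ds(2)[of i] by (intro sum.mono_neutral_cong_left) (auto simp: B_def)
    then show ?thesis using ds(3)[of i] by (simp add: horner_sum)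
  qed
  have "\<exists>l. (\<forall>i\<in>{..r}. l i \<in> A) \<and> (\<exists>i\<in>{..r}. l i \<noteq> 0) \<and> (\<forall>j\<in>{..<r}. (\<Sum>i\<le>r. l i * B i j) = 0)"
    by (rule A.homogeneous_system) (use BA in auto)
  then obtain l where l': "\<forall>i\<in>{..r}. l i \<in> A" "\<exists>i\<in>{..r}. l i \<noteq> 0"
    "\<forall>j\<in>{..<r}. (\<Sum>i\<le>r. l i * B i j) = 0" by blast
  have l: "\<And>i. i \<le> r \<Longrightarrow> l i \<in> A" "\<exists>i\<le>r. l i \<noteq> 0" "\<And>j. j < r \<Longrightarrow> (\<Sum>i\<le>r. l i * B i j) = 0"
    using l' by auto
  have "(\<Sum>i\<le>r. l i * (last f ^ s i * b ^ i)) = (\<Sum>i\<le>r. \<Sum>j<r. u ^ j * (l i * B i j))"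
    unfolding hB sum_distrib_left
  proof (intro sum.cong refl)
    fix i j assume "i \<in> {..r}"
    then have "l i * u ^ j = u ^ j * l i" using K.comm_in[of "l i" "u ^ j"] l(1) AK uK by auto
    then show "l i * (u ^ j * B i j) = u ^ j * (l i * B i j)" by (metis mult.assoc)
  qed
  also have "\<dots> = (\<Sum>j<r. u ^ j * (\<Sum>i\<le>r. l i * B i j))"
    by (subst sum.swap) (simp add: sum_distrib_left)
  also have "\<dots> = 0" using l(3) by simp
  finally have rel: "(\<Sum>i\<le>r. l i * last f ^ s i * b ^ i) = 0" by (simp add: mult.assoc)
  define g where "g = map (\<lambda>i. l i * last f ^ s i) [0..<Suc r]"
  have bK: "b \<in> K" using b adjoin_subset by auto
  have gA: "g \<in> lists A" using l(1) lfA by (auto simp: g_def in_lists_conv_set)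
  have "horner b g = (\<Sum>i\<le>r. b ^ i * (l i * last f ^ s i))"
    unfolding horner_sum g_def length_map length_upt lessThan_Suc_atMost diff_zero
    by (intro sum.cong) (auto simp del: upt_Suc)
  also have "\<dots> = (\<Sum>i\<le>r. l i * last f ^ s i * b ^ i)"
    using l(1) lfA AK bK by (intro sum.cong K.comm_in) auto
  finally have hg: "horner b g = 0" using rel by simp
  have gnz: "\<exists>a\<in>set g. a \<noteq> 0"
  proof -
    obtain i where i: "i \<le> r" "l i \<noteq> 0" using l(2) by auto
    then have "l i * last f ^ s i \<noteq> 0"
      using A.no_zero_div[OF l(1)[OF i(1)], of "last f ^ s i"] A.power_nonzero[OF lfA f(3)] lfA by auto
    then show ?thesis using i by (auto simp: g_def simp del: upt_Suc)
  qed
  interpret AB: commuting_subring A b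
  proof
    fix a assume "a \<in> A" then show "a * b = b * a" using K.comm_in AK bK by auto
  qed (auto intro: A.comm_in)
  have hA: "horner b g \<in> adjoin A u" if "g \<in> lists A" for g
    using that
  proof (induction g rule: list.induct)
    case (Cons a g)
    then show ?case using adjoin_add[OF adjoin_base adjoin_mult[OF b(1)]] by auto
  qed (auto intro: adjoin.zero)
  have "\<exists>b'\<in>adjoin A u. b * b' \<in> A \<and> b * b' \<noteq> 0"
    if "g \<in> lists A" "horner b g = 0" "\<exists>a\<in>set g. a \<noteq> 0" for g
    using that
  proof (induction g rule: list.induct)
    case (Cons a g)
    have h: "horner b g \<in> adjoin A u" by (intro hA) (use Cons.prems in auto)
    show ?case
    proof (cases "a = 0")
      case True
      then have "horner b g = 0" using Cons.prems(2) K.no_zero_div[of b "horner b g"] bK h adjoin_subset b by auto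
      then show ?thesis using Cons True by auto
    next
      case False
      have "b * horner b g = - a" using Cons.prems(2) by (simp add: minus_unique)
      then show ?thesis using h False Cons.prems(1) by (intro bexI[of _ "horner b g"]) auto
    qed
  qed auto
  from this[OF gA hg gnz] that show thesis by auto
qed

text \<open>Take \<open>\<psi>\<close> nonzero at a multiple of \<open>b\<close> in \<open>A\<close> and at the leading coefficient of a
  shortest relation \<open>f\<close> of \<open>u\<close>, and \<open>t\<close> a root of the image of \<open>f\<close>. Every other relation is, up to the leading
  coefficient, a multiple of \<open>f\<close>, so \<open>u\<close> may be sent to \<open>t\<close>.\<close>

lemma enough_characters_algebraic:
  assumes many: "enough_characters S A" and "cs \<in> lists A" "horner u cs = 0" "\<exists>a\<in>set cs. a \<noteq> 0"
  shows "enough_characters S (adjoin A u)"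
proof -
  define R where "R cs \<longleftrightarrow> cs \<in> lists A \<and> horner u cs = 0 \<and> (\<exists>a\<in>set cs. a \<noteq> 0)" for cs
  obtain f where f: "R f" "\<And>g. R g \<Longrightarrow> length f \<le> length g"
    using assms ex_has_least_nat[of R cs length] by (auto simp: R_def)
  have f_ne: "f \<noteq> []" and fA: "f \<in> lists A" "horner u f = 0" using f by (auto simp: R_def)
  have lastf: "last f \<noteq> 0"
  proof
    assume "last f = 0"
    then have e: "f = butlast f @ [0]" using f_ne by (metis append_butlast_last_id)
    then have "horner u (butlast f) = horner u f"
      by (metis horner.simps add.right_neutral horner_append mult_zero_right)
    moreover have "set f = insert 0 (set (butlast f))" by (subst e) simp
    ultimately have "R (butlast f)" using f(1) by (auto simp: R_def in_lists_conv_set)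
    then show False using f(2)[of "butlast f"] f_ne by (cases f) (auto split: if_splits)
  qed
  have lfA: "last f \<in> A" using fA f_ne by (auto simp: in_lists_conv_set)
  have len2: "length f \<ge> 2"
  proof (rule ccontr)
    assume "\<not> length f \<ge> 2"
    then have "f = [last f]" using f_ne by (cases f; cases "tl f") auto
    then show False using fA(2) lastf by (metis add.right_neutral horner.simps mult_zero_right)
  qed
  show ?thesis
    unfolding enough_characters_def
  proof (intro ballI impI)
    fix b assume b: "b \<in> adjoin A u" "b \<noteq> 0"
    obtain b' where b': "b' \<in> adjoin A u" "b * b' \<in> A" "b * b' \<noteq> 0"
      using multiple_in_base[OF fA(1) f_ne lastf fA(2) b] by auto
    have "last f * (b * b') \<noteq> 0" using A.no_zero_div[OF lfA b'(2)] lastf b'(3) by auto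
    then obtain \<psi> where \<psi>: "algebra_character S A \<psi>" "\<psi> (last f * (b * b')) \<noteq> 0"
      using many lfA b' by (auto simp: enough_characters_def)
    then have nz: "\<psi> (last f) \<noteq> 0" "\<psi> (b * b') \<noteq> 0" using char_mult[OF \<psi>(1) lfA b'(2)] by auto
    define F where "F = Poly (map \<psi> f)"
    have "coeff F (length f - 1) \<noteq> 0"
      using nz f_ne len2 by (simp add: F_def coeff_Poly_eq nth_default_def last_conv_nth)
    then have "degree F > 0" using len2 le_degree[of F "length f - 1"] by simp
    then obtain t where "poly F t = 0" using alg_closed_imp_poly_has_root by blast
    then have t: "horner t (map \<psi> f) = 0" by (simp add: horner_poly F_def)
    interpret G: commuting_subring "graph \<psi>" "(u, t)" by (rule commuting_subring_graph[OF \<psi>(1)])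
    let ?g = "\<lambda>cs. map (\<lambda>a. (a, \<psi> a)) cs"
    have "r = 0" if in_adj: "(0, r) \<in> adjoin (graph \<psi>) (u, t)" for r
    proof -
      obtain cs where cs: "cs \<in> lists A" "horner u cs = 0" "r = horner t (map \<psi> cs)"
        using in_adj by (auto simp: adjoin_graph)
      have lists: "?g cs \<in> lists (graph \<psi>)" if "cs \<in> lists A" for cs
        using that by (auto simp: graph_def in_lists_conv_set)
      have "\<exists>s. \<exists>ds'\<in>lists (graph \<psi>). length ds' < length (?g f) \<and>
          horner (u, t) ds' = last (?g f) ^ s * horner (u, t) (?g cs)"
        by (rule G.pseudo_division) (use fA f_ne t cs lists in \<open>auto simp: horner_graph zero_prod_def\<close>)
      then obtain s ds' where ds': "ds' \<in> lists (graph \<psi>)" "length ds' < length f"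
        "horner (u, t) ds' = last (?g f) ^ s * (0, r)" using cs by (auto simp: horner_graph)
      from ds'(1) obtain es where es: "es \<in> lists A" "ds' = ?g es" by (auto simp: graph_def lists_image)
      have pow: "(x, y) ^ s = (x ^ s, y ^ s)" for x :: 'e and y :: 'k
        by (induction s) (auto simp: times_prod_def one_prod_def)
      have "last (?g f) = (last f, \<psi> (last f))" using f_ne by (simp add: last_map)
      then have h: "horner u es = 0" "horner t (map \<psi> es) = \<psi> (last f) ^ s * r"
        using ds'(3) es by (auto simp: horner_graph pow times_prod_def)
      then have "\<forall>a\<in>set es. a = 0" using f(2)[of es] es ds'(2) by (auto simp: R_def)
      then have "horner t (map \<psi> es) = 0" using char_zero[OF \<psi>(1)] by (intro horner_zeros) auto
      then show ?thesis using h nz by simp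
    qed
    then show "\<exists>\<psi>. algebra_character S (adjoin A u) \<psi> \<and> \<psi> b \<noteq> 0"
    proof (rule extend_character[OF \<psi>(1)])
      fix \<psi>' assume \<psi>': "algebra_character S (adjoin A u) \<psi>'" "\<And>a. a \<in> A \<Longrightarrow> \<psi>' a = \<psi> a"
      have "\<psi>' b * \<psi>' b' = \<psi>' (b * b')"
        using \<psi>'(1) b(1) b'(1) unfolding algebra_character_def by metis
      then show "\<exists>\<psi>. algebra_character S (adjoin A u) \<psi> \<and> \<psi> b \<noteq> 0"
        using \<psi>'(1) \<psi>'(2)[OF b'(2)] nz by (intro exI[of _ \<psi>']) auto
    qed
  qed
qed

lemma enough_characters_adjoin: "enough_characters S A \<Longrightarrow> enough_characters S (adjoin A u)"
  using enough_characters_transcendental enough_characters_algebraic by blast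

end

lemma iterated_adjoin:
  fixes S :: "'k::alg_closed_field \<Rightarrow> 'e::{ring,monoid_mult}"
  assumes K: "domain_subset K"
    and S: "\<And>r. S r \<in> K" "\<And>r s. S (r + s) = S r + S s" "\<And>r s. S (r * s) = S r * S s" "S 1 = 1"
    and us: "set us \<subseteq> K"
  defines "R \<equiv> foldr (\<lambda>u A. adjoin A u) us (range S)"
  shows "R \<subseteq> K" "domain_subset R" "range S \<subseteq> R" "set us \<subseteq> R" "enough_characters S R"
proof -
  interpret K: domain_subset K by (rule K)
  have S0: "S 0 = 0" using S(2)[of 0 0] by simp
  have Sneg: "S (- r) = - S r" for r using S(2)[of r "- r"] S0 by (metis add.right_inverse minus_unique)
  have S_nz: "S r \<noteq> 0" if "r \<noteq> 0" for r
  proof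
    assume "S r = 0"
    then have "S (r * inverse r) = 0" by (simp only: S(3) mult_zero_left)
    then show False using that S(4) K.one_neq_zero by simp
  qed
  have inj: "S r = S s \<Longrightarrow> r = s" for r s
    using S_nz[of "r - s"] S(2)[of r "- s"] Sneg[of s] by auto
  have "R \<subseteq> K \<and> domain_subset R \<and> range S \<subseteq> R \<and> set us \<subseteq> R \<and> enough_characters S R"
    unfolding R_def using us
  proof (induction us)
    case Nil
    have "domain_subset (range S)"
    proof
      show "0 \<in> range S" "1 \<in> range S" using S0 S(4) by (metis rangeI)+
      fix a b assume "a \<in> range S" "b \<in> range S"
      then obtain r s where rs: "a = S r" "b = S s" by auto
      then show "a + b \<in> range S" "- a \<in> range S" "a * b \<in> range S" "a * b = b * a"
        using S(2,3) Sneg by (metis rangeI mult.commute)+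
      show "a * b = 0 \<Longrightarrow> a = 0 \<or> b = 0"
        using K.no_zero_div[of a b] rs S(1) by auto
    qed (rule K.one_neq_zero)
    moreover have "algebra_character S (range S) (inv_into UNIV S)"
      unfolding algebra_character_def
    proof (intro conjI allI ballI)
      have i: "inv_into UNIV S (S r) = r" for r by (rule inv_f_f) (use inj in \<open>auto intro: injI\<close>)
      then show "inv_into UNIV S (S r) = r" for r .
      fix a b assume "a \<in> range S" "b \<in> range S"
      then obtain r s where "a = S r" "b = S s" by auto
      then show "inv_into UNIV S (a + b) = inv_into UNIV S a + inv_into UNIV S b" "inv_into UNIV S (a * b) = inv_into UNIV S a * inv_into UNIV S b"
        using i by (simp_all add: S(2,3)[symmetric])
    qed
    moreover have "inv_into UNIV S a \<noteq> 0" if "a \<in> range S" "a \<noteq> 0" for a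
      using that S0 by (metis f_inv_into_f)
    ultimately show ?case using S(1) unfolding enough_characters_def by auto
  next
    case (Cons u us)
    let ?A = "foldr (\<lambda>u A. adjoin A u) us (range S)"
    have IH: "?A \<subseteq> K" "domain_subset ?A" "range S \<subseteq> ?A" "enough_characters S ?A"
      "set us \<subseteq> ?A" and u: "u \<in> K"
      using Cons by auto
    interpret A: domain_subset ?A by (rule IH)
    interpret algebra_extension K ?A S u
      by standard (use IH u S in auto)
    show ?case
      using adjoin_subset domain_subset_adjoin enough_characters_adjoin[OF IH(4)] adjoin_base IH(3,5) adjoin_gen by auto
  qed
  then show "R \<subseteq> K" "domain_subset R" "range S \<subseteq> R" "set us \<subseteq> R" "enough_characters S R" by auto
qed

text \<open>Zariski's lemma over an algebraically closed field: a field \<open>K\<close> that is finitely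
  generated as an algebra over \<open>S\<close> has a character, which is injective.\<close>

theorem finitely_generated_field_trivial:
  fixes S :: "'k::alg_closed_field \<Rightarrow> 'e::{ring,monoid_mult}"
  assumes K: "domain_subset K" and inv: "\<And>d. d \<in> K \<Longrightarrow> d \<noteq> 0 \<Longrightarrow> \<exists>e\<in>K. d * e = 1"
    and S: "\<And>r. S r \<in> K" "\<And>r s. S (r + s) = S r + S s" "\<And>r s. S (r * s) = S r * S s" "S 1 = 1"
    and us: "set us \<subseteq> K" and fg: "K = foldr (\<lambda>u A. adjoin A u) us (range S)"
  shows "K = range S"
proof -
  interpret K: domain_subset K by (rule K)
  have S0: "S 0 = 0" using S(2)[of 0 0] by simp
  have Sneg: "S (- r) = - S r" for r using S(2)[of r "- r"] S0 by (metis add.right_inverse minus_unique)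
  have "enough_characters S K" using iterated_adjoin(5)[OF K S us] fg by simp
  then obtain \<psi> where \<psi>: "algebra_character S K \<psi>"
    using K.one_neq_zero K.one_in unfolding enough_characters_def by blast
  have "\<psi> (S 0) = 0" "\<psi> (S 1) = 1" using \<psi> by (auto simp: algebra_character_def)
  then have zero: "\<psi> 0 = 0" "\<psi> 1 = 1" by (simp_all only: S0 S(4))
  have "d \<in> range S" if d: "d \<in> K" for d
  proof -
    let ?x = "d + S (- \<psi> d)"
    have xK: "?x \<in> K" using d S(1) by auto
    have x0: "\<psi> ?x = 0" using \<psi> d S(1) by (simp add: algebra_character_def)
    have x: "?x = 0"
    proof (rule ccontr)
      assume "?x \<noteq> 0"
      then obtain e where e: "e \<in> K" "?x * e = 1" using inv[OF xK] by blast
      have "\<psi> ?x * \<psi> e = \<psi> (?x * e)" using \<psi> xK e(1) unfolding algebra_character_def by metis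
      then show False using x0 zero e(2) by (simp only: mult_zero_left) simp
    qed
    have "d = S (\<psi> d)" using x unfolding Sneg by (metis eq_iff_diff_eq_0 diff_conv_add_uminus)
    then show ?thesis by auto
  qed
  then show ?thesis using S(1) by auto
qed

section \<open>Irreducible modules over algebras satisfying a Capelli identity\<close>

locale irreducible_operators =
  fixes S :: "'k::alg_closed_field \<Rightarrow> 'm::ab_group_add endo" and A :: "'m endo set"
  assumes S_add: "S (r + s) = S r + S s" and S_mult: "S (r * s) = S r * S s" and S_one: "S 1 = 1"
    and SA: "S r \<in> A" and addA: "a \<in> A \<Longrightarrow> b \<in> A \<Longrightarrow> a + b \<in> A" and multA: "a \<in> A \<Longrightarrow> b \<in> A \<Longrightarrow> a * b \<in> A"
    and S_comm: "a \<in> A \<Longrightarrow> S r * a = a * S r"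
    and irreducible: "0 \<in> U \<Longrightarrow> (\<And>x y. x \<in> U \<Longrightarrow> y \<in> U \<Longrightarrow> x + y \<in> U) \<Longrightarrow>
      (\<And>a x. a \<in> A \<Longrightarrow> x \<in> U \<Longrightarrow> app a x \<in> U) \<Longrightarrow> U = {0} \<or> U = UNIV"
    and nontrivial: "\<exists>v::'m. v \<noteq> 0"
begin

lemma S_zero: "S 0 = 0" using S_add[of 0 0] by simp
lemma S_neg: "S (- r) = - S r" using S_add[of r "- r"] S_zero by (metis add.right_inverse minus_unique)

lemma zeroA: "0 \<in> A" using SA[of 0] S_zero by simp
lemma oneA: "1 \<in> A" using SA[of 1] S_one by simp
lemma negA: "a \<in> A \<Longrightarrow> - a \<in> A" using multA[OF SA[of "- 1"]] by (simp add: S_neg S_one)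

text \<open>The commutant of \<open>A\<close>.\<close>

definition D :: "'m endo set" where "D = {d. \<forall>a\<in>A. d * a = a * d}"

lemma D_app: "d \<in> D \<Longrightarrow> a \<in> A \<Longrightarrow> app d (app a v) = app a (app d v)"
  by (metis (mono_tags, lifting) D_def app_simps(6) mem_Collect_eq)

text \<open>Kernel and image of an element of the commutant are submodules.\<close>

lemma Schur:
  assumes d: "d \<in> D" "d \<noteq> 0"
  obtains e where "e \<in> D" "d * e = 1" "e * d = 1"
proof -
  have "{v. app d v = 0} = {0} \<or> {v. app d v = 0} = UNIV"
    by (rule irreducible) (auto simp: D_app[OF d(1)])
  moreover have "{v. app d v = 0} \<noteq> UNIV" using d(2) by (auto intro!: endo_eqI)
  ultimately have ker: "{v. app d v = 0} = {0}" by simp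
  have "range (app d) = {0} \<or> range (app d) = UNIV"
  proof (rule irreducible)
    show "0 \<in> range (app d)" using app_zero_right by (metis rangeI)
    show "x + y \<in> range (app d)" if xy: "x \<in> range (app d)" "y \<in> range (app d)" for x y
    proof -
      obtain u w where "x = app d u" "y = app d w" using xy by auto
      then have "x + y = app d (u + w)" by simp
      then show ?thesis by blast
    qed
    show "app a x \<in> range (app d)" if ax: "a \<in> A" "x \<in> range (app d)" for a x
    proof -
      obtain u where "x = app d u" using ax by auto
      then have "app a x = app d (app a u)" using D_app[OF d(1) ax(1)] by simp
      then show ?thesis by blast
    qed
  qed
  moreover have "range (app d) \<noteq> {0}"
  proof
    assume "range (app d) = {0}"
    then have "app d v = 0" for v by auto
    then have "d = 0" by (intro endo_eqI) simp
    then show False using d(2) by simp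
  qed
  ultimately have surj: "range (app d) = UNIV" by simp
  define g where "g w = (SOME v. app d v = w)" for w
  have g: "app d (g w) = w" for w
    unfolding g_def using surj by (metis (mono_tags) someI_ex surj_def)
  have inj: "v = w" if "app d v = app d w" for v w
  proof -
    have "v - w \<in> {v. app d v = 0}" using that by simp
    then show ?thesis unfolding ker by simp
  qed
  have gadd: "g (x + y) = g x + g y" for x y by (rule inj) (simp add: g)
  define e where "e = Endo g"
  have app_e: "app e = g" unfolding e_def by (rule app_Endo) (rule gadd)
  have "e \<in> D"
    unfolding D_def
  proof (intro CollectI ballI endo_eqI)
    fix a v assume a: "a \<in> A"
    have "app d (g (app a v)) = app d (app a (g v))" using D_app[OF d(1) a, of "g v"] by (simp only: g)
    then show "app (e * a) v = app (a * e) v" unfolding app_simps app_e by (rule inj)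
  qed
  moreover have "d * e = 1" by (rule endo_eqI) (simp add: app_e g)
  moreover have "e * d = 1" by (rule endo_eqI, rule inj) (simp add: app_e g)
  ultimately show thesis by (rule that)
qed

text \<open>Zorn's lemma. Maximality says that the subset is its own centraliser in the commutant; this
  makes it a field and is what the density argument needs.\<close>

lemma maximal_commuting_subset:
  "\<exists>K\<subseteq>D. (\<forall>x\<in>K. \<forall>y\<in>K. x * y = y * x) \<and> (\<forall>d\<in>D. (\<forall>e\<in>K. d * e = e * d) \<longrightarrow> d \<in> K)"
proof -
  define F where "F = {K. K \<subseteq> D \<and> (\<forall>x\<in>K. \<forall>y\<in>K. x * y = y * x)}"
  have "\<exists>M\<in>F. \<forall>X\<in>F. M \<subseteq> X \<longrightarrow> X = M"
  proof (rule subset_Zorn')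
    fix C assume C: "subset.chain F C"
    have "x * y = y * x" if "x \<in> X" "X \<in> C" "y \<in> Y" "Y \<in> C" for x y X Y
    proof -
      have XY: "X \<subseteq> Y \<or> Y \<subseteq> X" using C that by (auto simp: subset.chain_def)
      have "X \<in> F" "Y \<in> F" using C that unfolding subset.chain_def by auto
      then have "\<forall>x\<in>X. \<forall>y\<in>X. x * y = y * x" "\<forall>x\<in>Y. \<forall>y\<in>Y. x * y = y * x" by (simp_all add: F_def)
      then show ?thesis using XY that by (meson subsetD)
    qed
    moreover have "\<Union>C \<subseteq> D" using C unfolding subset.chain_def F_def by blast
    ultimately show "\<Union>C \<in> F" unfolding F_def by auto
  qed
  then obtain K where K: "K \<in> F" "\<And>X. X \<in> F \<Longrightarrow> K \<subseteq> X \<Longrightarrow> X = K" by blast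
  have KF: "K \<subseteq> D" "\<forall>x\<in>K. \<forall>y\<in>K. x * y = y * x" using K(1) by (simp_all add: F_def)
  have "d \<in> K" if d: "d \<in> D" "\<forall>e\<in>K. d * e = e * d" for d
  proof -
    have "insert d K \<in> F"
      unfolding F_def
    proof (intro CollectI conjI ballI)
      fix x y assume "x \<in> insert d K" "y \<in> insert d K"
      then show "x * y = y * x" using KF(2) d(2) by (metis insertE)
    qed (use KF(1) d(1) in auto)
    then have "insert d K = K" using K(2) by (meson subset_insertI)
    then show ?thesis by blast
  qed
  then have "\<forall>d\<in>D. (\<forall>e\<in>K. d * e = e * d) \<longrightarrow> d \<in> K" by (intro ballI impI)
  with KF show ?thesis by (intro exI[of _ K] conjI)
qed

end

locale maximal_subfield = irreducible_operators S A
  for S :: "'k::alg_closed_field \<Rightarrow> 'm::ab_group_add endo" and A +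
  fixes K :: "'m endo set"
  assumes KD: "K \<subseteq> D" and K_comm: "x \<in> K \<Longrightarrow> y \<in> K \<Longrightarrow> x * y = y * x"
    and K_max: "d \<in> D \<Longrightarrow> (\<And>e. e \<in> K \<Longrightarrow> d * e = e * d) \<Longrightarrow> d \<in> K"
begin

lemma K_A: "d \<in> K \<Longrightarrow> a \<in> A \<Longrightarrow> d * a = a * d"
  using KD by (auto simp: D_def)

lemma in_K:
  assumes "\<And>a. a \<in> A \<Longrightarrow> d * a = a * d" "\<And>e. e \<in> K \<Longrightarrow> d * e = e * d" shows "d \<in> K"
  by (rule K_max) (use assms in \<open>auto simp: D_def\<close>)

lemma SK: "S r \<in> K"
  by (rule in_K) (use S_comm K_A[OF _ SA] in auto)

lemma K_inverse:
  assumes "d \<in> K" "d \<noteq> 0" obtains e where "e \<in> K" "d * e = 1"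
proof -
  obtain e where e: "e \<in> D" "d * e = 1" "e * d = 1" using Schur assms KD by blast
  have "e \<in> K"
  proof (rule in_K)
    show "e * a = a * e" if "a \<in> A" for a using e that by (auto simp: D_def)
    fix f assume "f \<in> K"
    then have "f * d = d * f" using K_comm assms by auto
    then have "e * (f * d) * e = e * (d * f) * e" by simp
    then show "e * f = f * e" using e(2,3) by (simp add: mult.assoc) (simp add: mult.assoc[symmetric])
  qed
  then show thesis using that e by blast
qed

lemma one_neq_zero_endo: "1 \<noteq> (0 :: 'm endo)"
  using nontrivial by (metis app_simps(1,2))

lemma domain_subset_K: "domain_subset K"
proof
  show "0 \<in> K" "1 \<in> K" using SK S_zero S_one by metis+
  fix a b assume ab: "a \<in> K" "b \<in> K"
  show "a + b \<in> K" using ab by (intro in_K) (auto simp: algebra_simps K_A K_comm)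
  show "- a \<in> K" using ab by (intro in_K) (auto simp: K_A K_comm)
  show "a * b \<in> K"
  proof (rule in_K)
    show "a * b * x = x * (a * b)" if "x \<in> A" for x
      using K_A[OF ab(1) that] K_A[OF ab(2) that] by (metis mult.assoc)
    show "a * b * x = x * (a * b)" if "x \<in> K" for x
      using K_comm[OF ab(1) that] K_comm[OF ab(2) that] by (metis mult.assoc)
  qed
  show "a * b = b * a" using ab K_comm by auto
  show "a * b = 0 \<Longrightarrow> a = 0 \<or> b = 0"
  proof (rule ccontr)
    assume "a * b = 0" "\<not> (a = 0 \<or> b = 0)"
    then obtain e where "e \<in> K" "a * e = 1" using K_inverse ab by blast
    then have "b = e * (a * b)" using K_comm[OF ab(1), of e] by (simp add: mult.assoc[symmetric])
    then show False using \<open>a * b = 0\<close> \<open>\<not> (a = 0 \<or> b = 0)\<close> by simp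
  qed
qed (rule one_neq_zero_endo)

sublocale K: domain_subset K by (rule domain_subset_K)

abbreviation "AK \<equiv> scalar_extension K A"

lemma K_AK: "a \<in> AK \<Longrightarrow> d \<in> K \<Longrightarrow> d * a = a * d"
  by (rule scalar_extension_commute) (auto simp: K_A K_comm)

lemma K_AK_app: "a \<in> AK \<Longrightarrow> d \<in> K \<Longrightarrow> app a (app d v) = app d (app a v)"
  using K_AK by (metis app_simps(6))

lemma A_AK: "a \<in> A \<Longrightarrow> b \<in> AK \<Longrightarrow> a * b \<in> AK"
  by (rotate_tac, induction rule: scalar_extension.induct)
    (auto simp: distrib_left mult.assoc[symmetric] K_A[symmetric] intro: scalar_extension.intros multA,
     auto simp: mult.assoc intro: scalar_extension.intros)

lemma AK_mult: "a \<in> AK \<Longrightarrow> b \<in> AK \<Longrightarrow> a * b \<in> AK"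
  by (induction rule: scalar_extension.induct)
    (auto simp: distrib_right mult.assoc intro: scalar_extension.intros A_AK)

lemma AK_neg: "a \<in> AK \<Longrightarrow> - a \<in> AK"
  using A_AK[OF negA[OF oneA], of a] by simp

lemma AK_diff: "a \<in> AK \<Longrightarrow> b \<in> AK \<Longrightarrow> a - b \<in> AK"
  using scalar_extension.add[OF _ AK_neg, of a b] by simp

lemma K_in_AK: "d \<in> K \<Longrightarrow> d \<in> AK"
  using scalar_extension.scale[OF _ scalar_extension.base[OF oneA]] by fastforce

definition spanK :: "('i \<Rightarrow> 'm) \<Rightarrow> 'i set \<Rightarrow> 'm set" where
  "spanK v I = {\<Sum>i\<in>I. app (d i) (v i) | d. \<forall>i. d i \<in> K}"

lemma spanK_insert:
  assumes "finite I" "i \<notin> I" "d \<in> K" "w - app d (v i) \<in> spanK v I" shows "w \<in> spanK v (insert i I)"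
proof -
  obtain f where f: "\<forall>j. f j \<in> K" "w - app d (v i) = (\<Sum>j\<in>I. app (f j) (v j))"
    using assms(4) by (auto simp: spanK_def)
  have "(\<Sum>j\<in>insert i I. app ((f(i := d)) j) (v j)) = app d (v i) + (\<Sum>j\<in>I. app (f j) (v j))"
    using assms(1,2) by (simp cong: sum.cong) (auto intro!: sum.cong)
  then have "w = (\<Sum>j\<in>insert i I. app ((f(i := d)) j) (v j))" using f(2) by (simp add: algebra_simps)
  moreover have "\<forall>j. (f(i := d)) j \<in> K" using f(1) assms(3) by simp
  ultimately show ?thesis unfolding spanK_def by blast
qed

lemma spanK_mono_insert: "finite I \<Longrightarrow> i \<notin> I \<Longrightarrow> w \<in> spanK v I \<Longrightarrow> w \<in> spanK v (insert i I)"
  by (rule spanK_insert[of I i 0]) auto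

lemma orbit_UNIV:
  assumes J: "0 \<in> J" "\<And>a b. a \<in> J \<Longrightarrow> b \<in> J \<Longrightarrow> a + b \<in> J" "\<And>a b. a \<in> A \<Longrightarrow> b \<in> J \<Longrightarrow> a * b \<in> J"
    and "a \<in> J" "app a x \<noteq> 0"
  shows "\<exists>a\<in>J. app a x = y"
proof -
  have "(\<lambda>a. app a x) ` J = {0} \<or> (\<lambda>a. app a x) ` J = UNIV"
  proof (rule irreducible)
    show "0 \<in> (\<lambda>a. app a x) ` J" using J(1) by (metis app_simps(1) image_eqI)
    show "u + w \<in> (\<lambda>a. app a x) ` J" if "u \<in> (\<lambda>a. app a x) ` J" "w \<in> (\<lambda>a. app a x) ` J" for u w
      using that J(2) by (auto simp: image_iff) (metis app_simps(3))
    show "app b w \<in> (\<lambda>a. app a x) ` J" if "b \<in> A" "w \<in> (\<lambda>a. app a x) ` J" for b w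
      using that J(3) by (auto simp: image_iff) (metis app_simps(6))
  qed
  moreover have "(\<lambda>a. app a x) ` J \<noteq> {0}" using assms(4,5) by blast
  ultimately show ?thesis by (metis UNIV_I imageE)
qed

text \<open>Jacobson density over \<open>K\<close>, by induction on the family. If every operator that kills all \<open>v j\<close> with \<open>j\<close> in
  \<open>insert i I\<close> killed \<open>w\<close>, then on the left ideal \<open>J\<close> of operators that kill the \<open>v j\<close> with \<open>j\<close> in \<open>I\<close>, the value at \<open>v i\<close> would
  determine the value at \<open>w\<close>. The map \<open>\<theta>\<close> between the values commutes with the operators and with
  \<open>K\<close>, so it lies in \<open>K\<close> by maximality and expresses \<open>w\<close> in terms of the family.\<close>

lemma density:
  assumes "finite I" "w \<notin> spanK v I"
  shows "\<exists>a\<in>AK. (\<forall>i\<in>I. app a (v i) = 0) \<and> app a w \<noteq> 0"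
  using assms
proof (induction I arbitrary: w rule: finite_induct)
  case empty
  have "\<exists>d :: 'a \<Rightarrow> 'm endo. \<forall>i. d i \<in> K" by (intro exI[of _ "\<lambda>_. 0"]) simp
  then have "w \<noteq> 0" using empty by (auto simp: spanK_def)
  then show ?case by (intro bexI[of _ 1]) (auto intro: scalar_extension.base oneA)
next
  case (insert i I)
  show ?case
  proof (rule ccontr)
    assume contra: "\<not> ?case"
    have H: "app a w = 0" if "a \<in> AK" "\<forall>j\<in>I. app a (v j) = 0" "app a (v i) = 0" for a
      using contra that by auto
    show False
    proof (cases "v i \<in> spanK v I")
      case True
      then obtain d where d: "\<forall>j. d j \<in> K" "v i = (\<Sum>j\<in>I. app (d j) (v j))" by (auto simp: spanK_def)
      have "w \<notin> spanK v I" using insert.prems spanK_mono_insert[OF insert.hyps(1,2)] by blast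
      then obtain a where a: "a \<in> AK" "\<forall>j\<in>I. app a (v j) = 0" "app a w \<noteq> 0" using insert.IH by blast
      have "app a (app (d j) (v j)) = 0" if "j \<in> I" for j
        using K_AK_app[OF a(1), of "d j" "v j"] a(2) d(1) that by simp
      then have "app a (v i) = 0" unfolding d(2) app_sum_right by (intro sum.neutral) auto
      then show False using H a by auto
    next
      case False
      define J where "J = {a \<in> AK. \<forall>j\<in>I. app a (v j) = 0}"
      have J0: "0 \<in> J" by (auto simp: J_def intro: scalar_extension.base zeroA)
      have Jadd: "a + b \<in> J" if "a \<in> J" "b \<in> J" for a b
        using that by (auto simp: J_def intro: scalar_extension.add)
      have Jmult: "a * b \<in> J" if "a \<in> AK" "b \<in> J" for a b
        using that by (auto simp: J_def intro: AK_mult)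
      obtain a0 where "a0 \<in> J" "app a0 (v i) \<noteq> 0"
        using insert.IH[OF False] by (auto simp: J_def)
      then have ex: "\<exists>a\<in>J. app a (v i) = m" for m
        using J0 Jadd Jmult[OF scalar_extension.base] by (intro orbit_UNIV)
      define g where "g m = (SOME a. a \<in> J \<and> app a (v i) = m)" for m
      have g: "g m \<in> J" "app (g m) (v i) = m" for m
        using ex[of m] someI_ex[of "\<lambda>a. a \<in> J \<and> app a (v i) = m"] by (auto simp: g_def)
      have val: "app a w = app (g (app a (v i))) w" if "a \<in> J" for a
      proof -
        have "app (a - g (app a (v i))) w = 0"
          by (rule H) (use that g in \<open>auto simp: J_def intro: AK_diff\<close>)
        then show ?thesis by simp
      qed
      define \<theta> where "\<theta> = Endo (\<lambda>m. app (g m) w)"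
      have app_\<theta>: "app \<theta> = (\<lambda>m. app (g m) w)"
        unfolding \<theta>_def
      proof (rule app_Endo)
        fix x y show "app (g (x + y)) w = app (g x) w + app (g y) w"
          using val[OF Jadd[OF g(1)[of x] g(1)[of y]]] g(2) by simp
      qed
      have \<theta>: "app \<theta> (app a (v i)) = app a w" if "a \<in> J" for a
        using val[OF that] by (simp add: app_\<theta>)
      have comm: "\<theta> * b = b * \<theta>" if "b \<in> AK" for b
      proof (rule endo_eqI)
        fix m
        have "app \<theta> (app b m) = app \<theta> (app (b * g m) (v i))" by (simp add: g)
        also have "\<dots> = app (b * g m) w" by (rule \<theta>) (rule Jmult[OF that g(1)])
        finally show "app (\<theta> * b) m = app (b * \<theta>) m" by (simp add: app_\<theta>)
      qed
      have \<theta>K: "\<theta> \<in> K"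
        by (rule in_K) (auto intro!: comm intro: scalar_extension.base K_in_AK)
      have "w - app \<theta> (v i) \<in> spanK v I"
      proof (rule ccontr)
        assume "w - app \<theta> (v i) \<notin> spanK v I"
        then obtain a where a: "a \<in> AK" "\<forall>j\<in>I. app a (v j) = 0" "app a (w - app \<theta> (v i)) \<noteq> 0"
          using insert.IH by blast
        moreover have "app a (app \<theta> (v i)) = app a w"
          using \<theta>[of a] a K_AK_app[OF a(1) \<theta>K] by (auto simp: J_def)
        ultimately show False by simp
      qed
      then show False using insert.prems spanK_insert[OF insert.hyps(1,2) \<theta>K] by blast
    qed
  qed
qed

definition indep :: "(nat \<Rightarrow> 'm) \<Rightarrow> nat \<Rightarrow> bool" where
  "indep v d \<longleftrightarrow> (\<forall>c. (\<forall>i<d. c i \<in> K) \<longrightarrow> (\<Sum>i<d. app (c i) (v i)) = 0 \<longrightarrow> (\<forall>i<d. c i = 0))"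

lemma indepD: "indep v d \<Longrightarrow> (\<And>i. i < d \<Longrightarrow> c i \<in> K) \<Longrightarrow> (\<Sum>i<d. app (c i) (v i)) = 0 \<Longrightarrow> i < d \<Longrightarrow> c i = 0"
  by (auto simp: indep_def)

lemma indep_le:
  assumes "indep v d" "d' \<le> d" shows "indep v d'"
  unfolding indep_def
proof (intro allI impI)
  fix c i assume c: "\<forall>i<d'. c i \<in> K" "(\<Sum>i<d'. app (c i) (v i)) = 0" "i < d'"
  define c' where "c' i = (if i < d' then c i else 0)" for i
  have "(\<Sum>i<d. app (c' i) (v i)) = (\<Sum>i<d'. app (c i) (v i))"
    using assms(2) by (intro sum.mono_neutral_cong_right) (auto simp: c'_def)
  then have "c' i = 0" using c assms(2) by (intro indepD[OF assms(1), of c']) (auto simp: c'_def)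
  then show "c i = 0" using c by (simp add: c'_def)
qed

lemma matrix_unit:
  assumes ind: "indep v d" and j: "j < d"
  shows "\<exists>a\<in>AK. \<forall>i<d. app a (v i) = (if i = j then x else 0)"
proof -
  let ?I = "{..<d} - {j}"
  have "v j \<notin> spanK v ?I"
  proof
    assume "v j \<in> spanK v ?I"
    then obtain f where f: "\<forall>i. f i \<in> K" "v j = (\<Sum>i\<in>?I. app (f i) (v i))" by (auto simp: spanK_def)
    define c where "c i = (if i = j then - 1 else f i)" for i
    have "(\<Sum>i<d. app (c i) (v i)) = app (c j) (v j) + (\<Sum>i\<in>?I. app (c i) (v i))"
      using j by (simp add: sum.remove[of "{..<d}" j])
    also have "(\<Sum>i\<in>?I. app (c i) (v i)) = (\<Sum>i\<in>?I. app (f i) (v i))"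
      by (rule sum.cong) (auto simp: c_def)
    finally have "(\<Sum>i<d. app (c i) (v i)) = 0" using f(2) by (simp add: c_def)
    then have "c j = 0" using f(1) j by (intro indepD[OF ind, of c]) (auto simp: c_def)
    then show False using one_neq_zero_endo by (simp add: c_def)
  qed
  then obtain a0 where a0: "a0 \<in> AK" "\<forall>i\<in>?I. app a0 (v i) = 0" "app a0 (v j) \<noteq> 0"
    using density[of ?I "v j" v] by auto
  define J where "J = {a \<in> AK. \<forall>i\<in>?I. app a (v i) = 0}"
  have "\<exists>a\<in>J. app a (v j) = x"
    by (rule orbit_UNIV[of _ a0])
      (use a0 in \<open>auto simp: J_def intro: scalar_extension.intros zeroA A_AK\<close>)
  then show ?thesis using j by (auto simp: J_def)
qed

text \<open>\<open>N + 1\<close> independent vectors would give matrix units, which violate the Capelli identity that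
  is inherited from \<open>A\<close>.\<close>

lemma indep_bound:
  assumes van: "\<And>c. (\<And>i. c i \<in> A) \<Longrightarrow> cap (Suc N * Suc N) c = 0" and ind: "indep v d"
  shows "d \<le> N"
proof (rule ccontr)
  assume "\<not> d \<le> N"
  let ?d = "Suc N"
  have ind: "indep v ?d" using ind \<open>\<not> d \<le> N\<close> by (intro indep_le[OF ind]) simp
  have v0: "v 0 \<noteq> 0"
  proof
    assume "v 0 = 0"
    then have "(\<Sum>i<?d. app (if i = 0 then 1 else 0) (v i)) = 0" by (intro sum.neutral) auto
    then have "(if 0 = (0::nat) then 1 else 0 :: 'm endo) = 0"
      by (intro indepD[OF ind, of "\<lambda>i. if i = 0 then 1 else 0"]) auto
    then show False using one_neq_zero_endo by simp
  qed
  obtain E where E: "\<And>j x. j < ?d \<Longrightarrow> E j x \<in> AK"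
    "\<And>j x i. j < ?d \<Longrightarrow> i < ?d \<Longrightarrow> app (E j x) (v i) = (if i = j then x else 0)"
    using matrix_unit[OF ind] by metis
  \<comment> \<open>The matrix units of \<open>cap_matrix_units\<close>; beyond the used indices, the column index is reset to
    \<open>0\<close> to keep it in range.\<close>
  define c where "c l = (if odd l then E (l div 2 mod ?d) (v (l div 2 div ?d))
     else E (if l \<le> 2 * (?d * ?d) then (l div 2 - 1) div ?d else 0) (v (l div 2 mod ?d)))" for l
  have lt: "(i - 1) div ?d < ?d" if "i \<le> ?d * ?d" for i
  proof -
    have "i - 1 < ?d * ?d" using that by (cases i) auto
    then show ?thesis by (simp add: less_mult_imp_div_less del: mult_Suc mult_Suc_right)
  qed
  have "cap (?d * ?d) c \<noteq> 0"
  proof (rule cap_matrix_units[of ?d v, OF _ v0])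
    show "app (c (Suc (2 * i))) (v k) = (if k = i mod ?d then v (i div ?d) else 0)"
      if "k < ?d" for i k
      using that E(2)[of "i mod ?d" k] by (simp add: c_def)
    show "app (c (2 * i)) (v k) = (if k = (i - 1) div ?d then v (i mod ?d) else 0)"
      if "i \<le> ?d * ?d" "k < ?d" for i k
      using that E(2)[OF lt[OF that(1)] that(2)] by (simp add: c_def del: mult_Suc mult_Suc_right)
  qed simp
  moreover have "cap (?d * ?d) c = 0"
  proof (rule cap_scalar_extension[where A = A and K = K])
    show "cap (?d * ?d) c = 0" if "\<And>i. i \<le> 2 * (?d * ?d) \<Longrightarrow> c i \<in> A" for c
    proof -
      define c' where "c' i = (if i \<le> 2 * (?d * ?d) then c i else 0)" for i
      have "cap (?d * ?d) c' = 0" by (rule van) (use that zeroA in \<open>auto simp: c'_def\<close>)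
      moreover have "cap (?d * ?d) c' = cap (?d * ?d) c"
        by (rule cap_cong) (simp add: c'_def)
      ultimately show ?thesis by simp
    qed
    show "c i \<in> AK" if "i \<le> 2 * (?d * ?d)" for i
    proof (cases "odd i")
      case True
      then show ?thesis using E(1)[of "i div 2 mod ?d"] by (simp add: c_def)
    next
      case False
      have "(i div 2 - 1) div ?d < ?d" using that by (intro lt) linarith
      then show ?thesis using E(1) False that by (simp add: c_def del: mult_Suc mult_Suc_right)
    qed
  qed (auto intro: K_A K_comm)
  ultimately show False by simp
qed

end

text \<open>The identity bounds the dimension over a maximal subfield \<open>K\<close> of the commutant. The matrix
  entries of the generators over a \<open>K\<close>-basis generate a subalgebra \<open>R\<close> of \<open>K\<close> whose span of the
  basis is stable, so irreducibility gives \<open>K = R\<close>, and Zariski's lemma makes \<open>K\<close> the base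
  field. The hypothesis \<open>gen\<close> expresses that \<open>E\<close> generates \<open>A\<close> over the scalars.\<close>

theorem (in irreducible_operators) Capelli_dimension_bound:
  assumes van: "\<And>c. (\<And>i. c i \<in> A) \<Longrightarrow> cap (Suc N * Suc N) c = 0"
    and E: "finite E" "E \<subseteq> A"
    and gen: "\<And>U a x. 0 \<in> U \<Longrightarrow> (\<And>x y. x \<in> U \<Longrightarrow> y \<in> U \<Longrightarrow> x + y \<in> U) \<Longrightarrow>
      (\<And>r x. x \<in> U \<Longrightarrow> app (S r) x \<in> U) \<Longrightarrow> (\<And>e x. e \<in> E \<Longrightarrow> x \<in> U \<Longrightarrow> app e x \<in> U) \<Longrightarrow>
      a \<in> A \<Longrightarrow> x \<in> U \<Longrightarrow> app a x \<in> U"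
  shows "\<exists>d\<le>N. \<exists>v :: nat \<Rightarrow> 'm. \<forall>w. \<exists>r. w = (\<Sum>j<d. app (S (r j)) (v j))"
proof -
  obtain K where K: "K \<subseteq> D" "\<forall>x\<in>K. \<forall>y\<in>K. x * y = y * x"
    "\<forall>d\<in>D. (\<forall>e\<in>K. d * e = e * d) \<longrightarrow> d \<in> K"
    using maximal_commuting_subset by (elim exE conjE)
  interpret maximal_subfield S A K
  proof
    show "K \<subseteq> D" by (rule K)
    show "x * y = y * x" if "x \<in> K" "y \<in> K" for x y using K(2) that by metis
    show "d \<in> K" if "d \<in> D" "\<And>e. e \<in> K \<Longrightarrow> d * e = e * d" for d using K(3) that by metis
  qed
  have "\<exists>v. indep v 0" by (simp add: indep_def)
  moreover have "\<forall>d. (\<exists>v. indep v d) \<longrightarrow> d \<le> N" using indep_bound[OF van] by blast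
  ultimately obtain d where d: "\<exists>v. indep v d" "\<And>d'. \<exists>v. indep v d' \<Longrightarrow> d' \<le> d"
    using Nat.ex_has_greatest_nat[of "\<lambda>d. \<exists>v. indep v d" 0 N] by blast
  then obtain v where v: "indep v d" by blast
  have dN: "d \<le> N" using indep_bound[OF van v] by simp
  \<comment> \<open>An independent family of maximal length spans.\<close>
  have span: "w \<in> spanK v {..<d}" for w
  proof (rule ccontr)
    assume w: "w \<notin> spanK v {..<d}"
    have "indep (v(d := w)) (Suc d)"
      unfolding indep_def
    proof (intro allI impI)
      fix c i assume c: "\<forall>i<Suc d. c i \<in> K" "(\<Sum>i<Suc d. app (c i) ((v(d := w)) i)) = 0" "i < Suc d"
      have sum: "(\<Sum>i<d. app (c i) (v i)) + app (c d) w = 0" using c(2) by simp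
      have "c d = 0"
      proof (rule ccontr)
        assume "c d \<noteq> 0"
        then obtain e where e: "e \<in> K" "c d * e = 1" using K_inverse c(1) by blast
        have "w = app (c d * e) w" using e by simp
        also have "\<dots> = app e (app (c d) w)" using K_comm[of "c d" e] c(1) e(1) by (metis app_simps(6) lessI)
        also have "app (c d) w = - (\<Sum>i<d. app (c i) (v i))" using sum by (metis add.commute minus_unique)
        finally have "w = (\<Sum>i<d. app (- (e * c i)) (v i))" by (simp add: app_sum_right sum_negf)
        also have "\<dots> = (\<Sum>i<d. app (if i < d then - (e * c i) else 0) (v i))" by (rule sum.cong) auto
        finally have "w = (\<Sum>i<d. app (if i < d then - (e * c i) else 0) (v i))" .
        moreover have "\<forall>i. (if i < d then - (e * c i) else 0) \<in> K" using c(1) e(1) by simp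
        ultimately have "w \<in> spanK v {..<d}"
          unfolding spanK_def by (intro CollectI exI[of _ "\<lambda>i. if i < d then - (e * c i) else 0"] conjI)
        then show False using w by simp
      qed
      then show "c i = 0" using c sum indepD[OF v, of c i] by (cases "i = d") auto
    qed
    then show False using d(2)[of "Suc d"] by auto
  qed
  have d0: "0 < d"
  proof (rule ccontr)
    assume "\<not> 0 < d"
    then show False using span nontrivial by (auto simp: spanK_def)
  qed
  have "\<exists>f. (\<forall>j. f j \<in> K) \<and> app e (v i) = (\<Sum>j<d. app (f j) (v j))" for e i
    using span[of "app e (v i)"] by (auto simp: spanK_def)
  then obtain M where M: "\<And>e i j. M e i j \<in> K" "\<And>e i. app e (v i) = (\<Sum>j<d. app (M e i j) (v j))"
    by metis
  obtain us where us: "set us = (\<lambda>(e, i, j). M e i j) ` (E \<times> {..<d} \<times> {..<d})"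
    using finite_list[of "(\<lambda>(e, i, j). M e i j) ` (E \<times> {..<d} \<times> {..<d})"] E(1) by auto
  define R where "R = foldr (\<lambda>u A. adjoin A u) us (range S)"
  have usK: "set us \<subseteq> K" using us M(1) by auto
  note R = iterated_adjoin[OF domain_subset_K SK S_add S_mult S_one usK, folded R_def]
  interpret R: domain_subset R by (rule R)
  \<comment> \<open>The \<open>R\<close>-span of the basis.\<close>
  define W where "W = {\<Sum>j<d. app (r j) (v j) | r. \<forall>j. r j \<in> R}"
  have W_add: "x + y \<in> W" if xy: "x \<in> W" "y \<in> W" for x y
  proof -
    obtain r where r: "\<forall>j. r j \<in> R" "x = (\<Sum>j<d. app (r j) (v j))" using xy by (auto simp: W_def)
    obtain s where s: "\<forall>j. s j \<in> R" "y = (\<Sum>j<d. app (s j) (v j))" using xy by (auto simp: W_def)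
    from r s show ?thesis unfolding W_def
      by (intro CollectI exI[of _ "\<lambda>j. r j + s j"]) (auto simp: sum.distrib)
  qed
  have W0: "0 \<in> W" unfolding W_def by (intro CollectI exI[of _ "\<lambda>j. 0"]) auto
  have W_sum: "(\<Sum>i\<in>I. f i) \<in> W" if "\<And>i. i \<in> I \<Longrightarrow> f i \<in> W" for f and I :: "nat set"
    using that by (induction I rule: infinite_finite_induct) (auto intro: W0 W_add)
  have W_R: "app s x \<in> W" if sx: "s \<in> R" "x \<in> W" for s x
  proof -
    obtain r where "\<forall>j. r j \<in> R" "x = (\<Sum>j<d. app (r j) (v j))" using sx by (auto simp: W_def)
    then show ?thesis using sx unfolding W_def
      by (intro CollectI exI[of _ "\<lambda>j. s * r j"]) (auto simp: app_sum_right)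
  qed
  have W_v: "v i \<in> W" if "i < d" for i
  proof -
    have "(\<Sum>j<d. app (if j = i then 1 else 0) (v j)) = (\<Sum>j<d. if j = i then v j else 0)"
      by (rule sum.cong) auto
    then have "v i = (\<Sum>j<d. app (if j = i then 1 else 0) (v j))" using that by simp
    then show ?thesis unfolding W_def by (intro CollectI exI[of _ "\<lambda>j. if j = i then 1 else 0"]) auto
  qed
  have W_E: "app e x \<in> W" if e: "e \<in> E" "x \<in> W" for e x
  proof -
    obtain r where r: "\<forall>j. r j \<in> R" "x = (\<Sum>j<d. app (r j) (v j))" using e by (auto simp: W_def)
    have "app e x = (\<Sum>j<d. app (r j) (app e (v j)))"
      unfolding r(2) app_sum_right
      by (intro sum.cong refl K_AK_app) (use e E r R in \<open>auto intro: scalar_extension.base\<close>)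
    also have "\<dots> \<in> W"
    proof (rule W_sum)
      fix j assume j: "j \<in> {..<d}"
      have "M e j l \<in> R" if "l < d" for l using us R(4) e j that by force
      then have "app e (v j) \<in> W" unfolding M(2)[of e j] by (intro W_sum W_R W_v) auto
      then show "app (r j) (app e (v j)) \<in> W" using W_R[of "r j" "app e (v j)"] r by auto
    qed
    finally show ?thesis .
  qed
  have W_A: "app a x \<in> W" if "a \<in> A" "x \<in> W" for a x
  proof (rule gen[of W, OF W0 _ _ _ that])
    show "app (S r) x \<in> W" if "x \<in> W" for r x using that R(3) by (intro W_R) auto
  qed (use W_add W_E in auto)
  have "W = {0} \<or> W = UNIV" using W0 W_add W_A by (intro irreducible) auto
  moreover have "v 0 \<noteq> 0"
  proof
    assume "v 0 = 0"
    then have "(\<Sum>i<d. app (if i = 0 then 1 else 0) (v i)) = 0" by (intro sum.neutral) auto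
    then have "(if 0 = (0::nat) then 1 else 0 :: 'm endo) = 0"
      by (intro indepD[OF v, of "\<lambda>i. if i = 0 then 1 else 0"]) (use d0 in auto)
    then show False using one_neq_zero_endo by simp
  qed
  ultimately have WU: "W = UNIV" using W_v[OF d0] by auto
  have "K \<subseteq> R"
  proof
    fix \<delta> assume \<delta>: "\<delta> \<in> K"
    have "app \<delta> (v 0) \<in> W" using WU by simp
    then obtain r where r: "\<forall>j. r j \<in> R" "app \<delta> (v 0) = (\<Sum>j<d. app (r j) (v j))" by (auto simp: W_def)
    have "(\<Sum>j<d. app (r j - (if j = 0 then \<delta> else 0)) (v j)) =
        (\<Sum>j<d. app (r j) (v j)) - (\<Sum>j<d. if j = 0 then app \<delta> (v j) else 0)"
      unfolding sum_subtractf[symmetric] by (rule sum.cong) auto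
    also have "\<dots> = 0" using r(2) d0 by simp
    finally have sum0: "(\<Sum>j<d. app (r j - (if j = 0 then \<delta> else 0)) (v j)) = 0" .
    have rK: "r j \<in> K" for j using r(1) R(1) by auto
    have "r 0 - (if 0 = (0::nat) then \<delta> else 0) = 0"
      using sum0 rK \<delta> d0 by (intro indepD[OF v, of "\<lambda>j. r j - (if j = 0 then \<delta> else 0)"]) auto
    then show "\<delta> \<in> R" using r(1) by (metis eq_iff_diff_eq_0)
  qed
  then have KR: "K = R" using R(1) by auto
  have KS: "K = range S"
  proof (rule finitely_generated_field_trivial[OF domain_subset_K _ SK S_add S_mult S_one usK])
    show "\<exists>e\<in>K. d * e = 1" if "d \<in> K" "d \<noteq> 0" for d using K_inverse[OF that] by blast
    show "K = foldr (\<lambda>u A. adjoin A u) us (range S)" using KR by (simp add: R_def)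
  qed
  have "\<exists>r. w = (\<Sum>j<d. app (S (r j)) (v j))" for w
  proof -
    obtain f where f: "\<forall>j. f j \<in> K" "w = (\<Sum>j<d. app (f j) (v j))" using span[of w] by (auto simp: spanK_def)
    have "\<exists>r. \<forall>j. f j = S (r j)" using f(1) KS by (intro choice) auto
    then show ?thesis using f(2) by auto
  qed
  then show ?thesis using dN by blast
qed

section \<open>Normal forms modulo the Cherednik relations\<close>

text \<open>A faithful linear action together with a pair of dual bases \<open>e\<close> and \<open>\<epsilon>\<close>, in which the normal
  forms are written.\<close>

locale reflection_data =
  fixes G :: "'g monoid" (structure)
    and scale :: "'k::field \<Rightarrow> 'v::ab_group_add \<Rightarrow> 'v"
    and \<rho> :: "'g \<Rightarrow> 'v \<Rightarrow> 'v" and c :: "'g \<Rightarrow> 'k"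
    and n :: nat and e :: "nat \<Rightarrow> 'v" and \<epsilon> :: "nat \<Rightarrow> 'v \<Rightarrow> 'k"
  assumes G: "group G" and finG: "finite (carrier G)"
    and vs: "vector_space scale"
    and \<epsilon>_dual: "i < n \<Longrightarrow> \<epsilon> i \<in> dual_space scale"
    and \<epsilon>_e: "i < n \<Longrightarrow> j < n \<Longrightarrow> \<epsilon> i (e j) = (if i = j then 1 else 0)"
    and expand: "y = (\<Sum>i<n. scale (\<epsilon> i y) (e i))"
    and \<rho>_add: "g \<in> carrier G \<Longrightarrow> \<rho> g (u + v) = \<rho> g u + \<rho> g v"
    and \<rho>_scale: "g \<in> carrier G \<Longrightarrow> \<rho> g (scale r v) = scale r (\<rho> g v)"
    and \<rho>_one: "\<rho> \<one> v = v"
    and \<rho>_mult: "g \<in> carrier G \<Longrightarrow> h \<in> carrier G \<Longrightarrow> \<rho> (g \<otimes> h) v = \<rho> g (\<rho> h v)"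
    and faithful: "g \<in> carrier G \<Longrightarrow> (\<And>v. \<rho> g v = v) \<Longrightarrow> g = \<one>"
begin

sublocale G: group G by (rule G)
sublocale V: vector_space scale by (rule vs)

abbreviation "dual \<equiv> dual_space scale"
abbreviation "refls \<equiv> reflections G scale \<rho>"
abbreviation "dact \<equiv> dual_act G \<rho>"

lemma dual_iff: "x \<in> dual \<longleftrightarrow> (\<forall>u v. x (u + v) = x u + x v) \<and> (\<forall>r v. x (scale r v) = r * x v)"
proof -
  have "vector_space ((*) :: 'k \<Rightarrow> 'k \<Rightarrow> 'k)" by unfold_locales (auto simp: algebra_simps)
  then show ?thesis unfolding dual_space_def
    using vs by (auto simp: Vector_Spaces.linear_iff)
qed

lemma dual_add: "x \<in> dual \<Longrightarrow> x (u + v) = x u + x v" and dual_scale: "x \<in> dual \<Longrightarrow> x (scale r v) = r * x v"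
  by (simp_all add: dual_iff)

lemma dual_zero: "x \<in> dual \<Longrightarrow> x 0 = 0" using dual_add[of x 0 0] by (metis add_0 add_cancel_right_right)

lemma dual_diff: "x \<in> dual \<Longrightarrow> x (u - v) = x u - x v"
  using dual_add[of x "u - v" v] by simp

lemma dual_sum: "x \<in> dual \<Longrightarrow> x (\<Sum>i\<in>I. f i) = (\<Sum>i\<in>I. x (f i))"
  by (induction I rule: infinite_finite_induct) (auto simp: dual_zero dual_add)

lemma dual_plus: "x \<in> dual \<Longrightarrow> x' \<in> dual \<Longrightarrow> x + x' \<in> dual"
  and dual_smult: "x \<in> dual \<Longrightarrow> (\<lambda>v. r * x v) \<in> dual"
  and zero_dual: "0 \<in> dual" "(\<lambda>v. 0) \<in> dual"
  by (auto simp: dual_iff algebra_simps)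

lemma \<rho>_zero: "g \<in> carrier G \<Longrightarrow> \<rho> g 0 = 0"
  using \<rho>_add[of g 0 0] by simp

lemma \<rho>_diff: "g \<in> carrier G \<Longrightarrow> \<rho> g (u - v) = \<rho> g u - \<rho> g v"
  using \<rho>_add[of g "u - v" v] by simp

lemma \<rho>_inv: "g \<in> carrier G \<Longrightarrow> \<rho> g (\<rho> (inv g) v) = v" "g \<in> carrier G \<Longrightarrow> \<rho> (inv g) (\<rho> g v) = v"
  by (simp_all add: \<rho>_mult[symmetric] \<rho>_one)

lemma dual_comp: "x \<in> dual \<Longrightarrow> g \<in> carrier G \<Longrightarrow> (\<lambda>v. x (\<rho> g v)) \<in> dual"
  by (auto simp: dual_iff \<rho>_add \<rho>_scale)

lemma dact_dual: "x \<in> dual \<Longrightarrow> g \<in> carrier G \<Longrightarrow> dact g x \<in> dual"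
  unfolding dual_act_def by (intro dual_comp) auto

lemma dact_inv: "g \<in> carrier G \<Longrightarrow> dact g (dact (inv g) x) = x"
  by (auto simp: dual_act_def \<rho>_inv)

lemma refl_carrier: "s \<in> refls \<Longrightarrow> s \<in> carrier G" by (simp add: reflections_def)

lemma finite_refl: "finite refls"
  by (rule finite_subset[OF _ finG]) (auto simp: refl_carrier)

lemma dual_expand: "x \<in> dual \<Longrightarrow> x v = (\<Sum>i<n. x (e i) * \<epsilon> i v)"
proof -
  assume x: "x \<in> dual"
  have "x v = x (\<Sum>i<n. scale (\<epsilon> i v) (e i))" by (simp only: expand[of v, symmetric])
  also have "\<dots> = (\<Sum>i<n. x (e i) * \<epsilon> i v)" using x by (simp add: dual_sum dual_scale mult.commute)
  finally show ?thesis .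
qed

end

inductive_set generated_algebra ::
    "('k \<Rightarrow> 'e::{ring,monoid_mult}) \<Rightarrow> ('x \<Rightarrow> 'e) \<Rightarrow> ('y \<Rightarrow> 'e) \<Rightarrow> ('g \<Rightarrow> 'e) \<Rightarrow> 'x set \<Rightarrow> 'g set \<Rightarrow> 'e set"
  for S X Y T dual G where
  S: "S r \<in> generated_algebra S X Y T dual G"
| X: "x \<in> dual \<Longrightarrow> X x \<in> generated_algebra S X Y T dual G"
| Y: "Y y \<in> generated_algebra S X Y T dual G"
| T: "g \<in> G \<Longrightarrow> T g \<in> generated_algebra S X Y T dual G"
| add: "a \<in> generated_algebra S X Y T dual G \<Longrightarrow> b \<in> generated_algebra S X Y T dual G \<Longrightarrow>
    a + b \<in> generated_algebra S X Y T dual G"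
| mult: "a \<in> generated_algebra S X Y T dual G \<Longrightarrow> b \<in> generated_algebra S X Y T dual G \<Longrightarrow>
    a * b \<in> generated_algebra S X Y T dual G"

text \<open>Operators satisfying the defining relations for \<open>t = 1\<close>. The unit \<open>S 1\<close> of the scalars
  only has to act as a unit on the other operators: in the Dunkl representations it is a
  projection of the ambient function space.\<close>

locale cherednik_system = reflection_data G scale \<rho> c n e \<epsilon>
  for G :: "'g monoid" (structure)
    and scale :: "'k::field \<Rightarrow> 'v::ab_group_add \<Rightarrow> 'v" and \<rho> c n e \<epsilon> +
  fixes S :: "'k \<Rightarrow> 'e::{ring,monoid_mult}" and X :: "('v \<Rightarrow> 'k) \<Rightarrow> 'e" and Y :: "'v \<Rightarrow> 'e" and T :: "'g \<Rightarrow> 'e"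
  assumes S_add: "S (r + s) = S r + S s" and S_mult: "S (r * s) = S r * S s"
    and S1_X: "x \<in> dual \<Longrightarrow> S 1 * X x = X x" and S1_Y: "S 1 * Y y = Y y" and S1_T: "g \<in> carrier G \<Longrightarrow> S 1 * T g = T g"
    and S_X: "x \<in> dual \<Longrightarrow> X x * S r = S r * X x" and S_Y: "Y y * S r = S r * Y y"
    and S_T: "g \<in> carrier G \<Longrightarrow> T g * S r = S r * T g"
    and X_add: "x \<in> dual \<Longrightarrow> x' \<in> dual \<Longrightarrow> X (x + x') = X x + X x'"
    and X_scale: "x \<in> dual \<Longrightarrow> X (\<lambda>v. r * x v) = S r * X x"
    and Y_add: "Y (y + y') = Y y + Y y'" and Y_scale: "Y (scale r y) = S r * Y y"
    and T_mult: "g \<in> carrier G \<Longrightarrow> h \<in> carrier G \<Longrightarrow> T g * T h = T (g \<otimes> h)" and T_one: "T \<one> = S 1"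
    and T_X: "g \<in> carrier G \<Longrightarrow> x \<in> dual \<Longrightarrow> T g * X x = X (dact g x) * T g"
    and T_Y: "g \<in> carrier G \<Longrightarrow> T g * Y y = Y (\<rho> g y) * T g"
    and X_comm: "x \<in> dual \<Longrightarrow> x' \<in> dual \<Longrightarrow> X x * X x' = X x' * X x"
    and Y_comm: "Y y * Y y' = Y y' * Y y"
    and Y_X: "x \<in> dual \<Longrightarrow> Y y * X x = X x * Y y + S (x y) - (\<Sum>s\<in>refls. S (c s * (x - dact s x) y) * T s)"
begin

abbreviation "alg \<equiv> generated_algebra S X Y T dual (carrier G)"

definition xmon :: "nat list \<Rightarrow> 'e" where "xmon xs = prod_list (map (\<lambda>i. X (\<epsilon> i)) xs)"
definition ymon :: "nat list \<Rightarrow> 'e" where "ymon ys = prod_list (map (\<lambda>i. Y (e i)) ys)"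

text \<open>Exponent vectors are encoded as sorted lists of indices.\<close>

definition Idx :: "('g \<times> nat list \<times> nat list) set" where
  "Idx = {(g, xs, ys). g \<in> carrier G \<and> sorted xs \<and> set xs \<subseteq> {..<n} \<and> sorted ys \<and> set ys \<subseteq> {..<n}}"

definition mon :: "'g \<times> nat list \<times> nat list \<Rightarrow> 'e" where
  "mon = (\<lambda>(g, xs, ys). T g * (xmon xs * ymon ys))"

inductive_set NF :: "'e set" where
  zero: "0 \<in> NF"
| step: "t \<in> Idx \<Longrightarrow> z \<in> NF \<Longrightarrow> S r * mon t + z \<in> NF"

lemma S_zero: "S 0 = 0" using S_add[of 0 0] by simp
lemma S_neg: "S (- r) = - S r" using S_add[of r "- r"] S_zero by (metis add.right_inverse minus_unique)

lemma NF_add: "z \<in> NF \<Longrightarrow> w \<in> NF \<Longrightarrow> z + w \<in> NF"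
  by (induction rule: NF.induct) (auto simp: add.assoc intro: NF.intros)

lemma NF_sum: "(\<And>i. i \<in> I \<Longrightarrow> f i \<in> NF) \<Longrightarrow> (\<Sum>i\<in>I. f i) \<in> NF"
  by (induction I rule: infinite_finite_induct) (auto intro: NF_add NF.zero)

lemma NF_S: "z \<in> NF \<Longrightarrow> S r * z \<in> NF"
proof (induction rule: NF.induct)
  case (step t z r')
  then show ?case using NF.step[OF step(1) step(3), of "r * r'"] by (simp add: distrib_left S_mult mult.assoc)
qed (auto intro: NF.zero)

lemma NF_neg: "z \<in> NF \<Longrightarrow> - z \<in> NF"
proof (induction rule: NF.induct)
  case (step t z r)
  then show ?case using NF.step[OF step(1) step(3), of "- r"] by (simp add: S_neg algebra_simps)
qed (auto intro: NF.zero)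

lemma NF_mon: "t \<in> Idx \<Longrightarrow> S r * mon t \<in> NF"
  using NF.step[OF _ NF.zero] by simp

lemma prod_list_insort:
  fixes f :: "nat \<Rightarrow> 'e"
  assumes "\<And>j. j \<in> set xs \<Longrightarrow> f i * f j = f j * f i"
  shows "f i * prod_list (map f xs) = prod_list (map f (insort i xs))"
  using assms
proof (induction xs)
  case (Cons j xs)
  have "f i * (f j * prod_list (map f xs)) = f j * (f i * prod_list (map f xs))"
    using Cons.prems[of j] by (simp add: mult.assoc[symmetric])
  then show ?case using Cons by auto
qed simp

lemma X_expand: "x \<in> dual \<Longrightarrow> X x = (\<Sum>i<n. S (x (e i)) * X (\<epsilon> i))"
proof -
  assume x: "x \<in> dual"
  have "(\<lambda>v. \<Sum>i<m. x (e i) * \<epsilon> i v) \<in> dual \<and>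
    X (\<lambda>v. \<Sum>i<m. x (e i) * \<epsilon> i v) = (\<Sum>i<m. S (x (e i)) * X (\<epsilon> i))" if "m \<le> n" for m
    using that
  proof (induction m)
    case 0
    have "X (\<lambda>v. 0 * 0) = S 0 * X (\<lambda>v. 0)" by (rule X_scale) (rule zero_dual)
    then show ?case using zero_dual by (simp add: S_zero)
  next
    case (Suc m)
    have d: "(\<lambda>v. x (e m) * \<epsilon> m v) \<in> dual" using Suc.prems by (intro dual_smult \<epsilon>_dual) auto
    have eq: "(\<lambda>v. \<Sum>i<Suc m. x (e i) * \<epsilon> i v) = (\<lambda>v. \<Sum>i<m. x (e i) * \<epsilon> i v) + (\<lambda>v. x (e m) * \<epsilon> m v)"
      by (auto simp: fun_eq_iff)
    show ?case unfolding eq using Suc d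
      by (auto simp: X_add X_scale \<epsilon>_dual intro!: dual_plus)
  qed
  note conjunct2[OF this[OF order_refl]]
  moreover have "(\<lambda>v. \<Sum>i<n. x (e i) * \<epsilon> i v) = x" by (rule ext) (rule dual_expand[OF x, symmetric])
  ultimately show ?thesis by simp
qed

lemma Y_expand: "Y y = (\<Sum>i<n. S (\<epsilon> i y) * Y (e i))"
proof -
  have "Y 0 = 0" using Y_add[of 0 0] by simp
  then have "Y (\<Sum>i\<in>I. f i) = (\<Sum>i\<in>I. Y (f i))" for f and I :: "nat set"
    by (induction I rule: infinite_finite_induct) (auto simp: Y_add)
  then have "Y (\<Sum>i<n. scale (\<epsilon> i y) (e i)) = (\<Sum>i<n. S (\<epsilon> i y) * Y (e i))" by (simp add: Y_scale)
  then show ?thesis by (simp only: expand[of y, symmetric])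
qed

lemma X_T: "g \<in> carrier G \<Longrightarrow> x \<in> dual \<Longrightarrow> X x * T g = T g * X (dact (inv g) x)"
  using T_X[of g "dact (inv g) x"] by (simp add: dact_dual dact_inv)

lemma Y_T: "g \<in> carrier G \<Longrightarrow> Y y * T g = T g * Y (\<rho> (inv g) y)"
  using T_Y[of g "\<rho> (inv g) y"] by (simp add: \<rho>_inv)

lemma T_NF:
  assumes z: "z \<in> NF" and h: "h \<in> carrier G" shows "T h * z \<in> NF"
  using z
proof induction
  case (step t z r)
  obtain g xs ys where t: "t = (g, xs, ys)" by (cases t)
  then have g: "g \<in> carrier G" and t': "(h \<otimes> g, xs, ys) \<in> Idx" using step(1) h by (auto simp: Idx_def)
  have "T h * (S r * mon t) = S r * mon (h \<otimes> g, xs, ys)"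
    unfolding t mon_def prod.case mult_shift[OF S_T[OF h]] mult.assoc[of "T h" "T g", symmetric] T_mult[OF h g]
    by (rule refl)
  then show ?case using NF.step[OF t' step(3), of r] by (simp add: distrib_left)
qed (auto intro: NF.zero)

lemma X_NF:
  assumes z: "z \<in> NF" and x: "x \<in> dual" shows "X x * z \<in> NF"
  using z
proof induction
  case (step t z r)
  obtain g xs ys where t: "t = (g, xs, ys)" by (cases t)
  then have g: "g \<in> carrier G" and xs: "set xs \<subseteq> {..<n}" using step(1) by (auto simp: Idx_def)
  let ?x = "dact (inv g) x"
  have dx: "?x \<in> dual" using x g by (intro dact_dual) auto
  have "X x * (S r * mon t) = S r * (T g * (X ?x * (xmon xs * ymon ys)))"
    unfolding t mon_def prod.case mult_shift[OF S_X[OF x]] mult_shift[OF X_T[OF g x]] by (rule refl)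
  also have "\<dots> = S r * (\<Sum>i<n. T g * (S (?x (e i)) * X (\<epsilon> i) * (xmon xs * ymon ys)))"
    by (simp add: X_expand[OF dx] sum_distrib_right sum_distrib_left)
  also have "(\<Sum>i<n. T g * (S (?x (e i)) * X (\<epsilon> i) * (xmon xs * ymon ys))) =
      (\<Sum>i<n. S (?x (e i)) * mon (g, insort i xs, ys))"
  proof (rule sum.cong[OF refl])
    fix i assume i: "i \<in> {..<n}"
    have "X (\<epsilon> i) * xmon xs = xmon (insort i xs)"
      unfolding xmon_def by (rule prod_list_insort[where f = "\<lambda>i. X (\<epsilon> i)"]) (use i xs in \<open>auto intro!: X_comm \<epsilon>_dual\<close>)
    then show "T g * (S (?x (e i)) * X (\<epsilon> i) * (xmon xs * ymon ys)) = S (?x (e i)) * mon (g, insort i xs, ys)"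
      unfolding mon_def prod.case mult.assoc mult_shift[OF S_T[OF g]] by (metis mult.assoc)
  qed
  also have "S r * \<dots> \<in> NF"
    using step(1) by (intro NF_S NF_sum NF_mon) (auto simp: t Idx_def sorted_insort set_insort_key)
  finally show ?case using step NF_add by (simp add: distrib_left)
qed (auto intro: NF.zero)

text \<open>Moving \<open>Y y\<close> past one \<open>X\<close> produces a scalar and a combination of group elements, each
  followed by a shorter monomial.\<close>

lemma Y_mon_NF: "(\<one>, xs, ys) \<in> Idx \<Longrightarrow> Y y * (xmon xs * ymon ys) \<in> NF"
proof (induction xs arbitrary: y)
  case Nil
  then have ys: "sorted ys" "set ys \<subseteq> {..<n}" by (auto simp: Idx_def)
  have "Y y * (xmon [] * ymon ys) = (\<Sum>i<n. S (\<epsilon> i y) * (Y (e i) * ymon ys))"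
    by (subst Y_expand) (simp add: xmon_def sum_distrib_right mult.assoc)
  also have "\<dots> = (\<Sum>i<n. S (\<epsilon> i y) * mon (\<one>, [], insort i ys))"
  proof (rule sum.cong[OF refl])
    fix i
    have "Y (e i) * ymon ys = ymon (insort i ys)"
      unfolding ymon_def by (rule prod_list_insort[where f = "\<lambda>i. Y (e i)"]) (rule Y_comm)
    moreover have "S r = S r * S 1" for r by (simp add: S_mult[symmetric])
    ultimately show "S (\<epsilon> i y) * (Y (e i) * ymon ys) = S (\<epsilon> i y) * mon (\<one>, [], insort i ys)"
      by (simp add: mon_def xmon_def T_one mult.assoc[symmetric])
  qed
  also have "\<dots> \<in> NF"
    using ys by (intro NF_sum NF_mon) (auto simp: Idx_def sorted_insort set_insort_key)
  finally show ?case .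
next
  case (Cons i xs)
  then have xs: "(\<one>, xs, ys) \<in> Idx" and i: "i < n" by (auto simp: Idx_def)
  let ?p = "xmon xs * ymon ys"
  have "Y y * (xmon (i # xs) * ymon ys) = Y y * X (\<epsilon> i) * ?p" by (simp add: xmon_def mult.assoc)
  also have "\<dots> = X (\<epsilon> i) * (Y y * ?p) + S (\<epsilon> i y) * ?p
      + - (\<Sum>s\<in>refls. S (c s * (\<epsilon> i - dact s (\<epsilon> i)) y) * (T s * ?p))"
    by (simp add: Y_X[OF \<epsilon>_dual[OF i]] algebra_simps sum_distrib_right mult.assoc)
  also have "\<dots> \<in> NF"
  proof (intro NF_add NF_neg NF_sum)
    show "X (\<epsilon> i) * (Y y * ?p) \<in> NF" using Cons.IH[OF xs] by (rule X_NF) (rule \<epsilon>_dual[OF i])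
    have "S (\<epsilon> i y) * ?p = S (\<epsilon> i y) * mon (\<one>, xs, ys)"
      by (simp add: mon_def T_one mult.assoc[symmetric] S_mult[symmetric])
    then show "S (\<epsilon> i y) * ?p \<in> NF" using NF_mon[OF xs] by simp
    fix s assume "s \<in> refls"
    then have "(s, xs, ys) \<in> Idx" using xs by (auto simp: Idx_def refl_carrier)
    then show "S (c s * (\<epsilon> i - dact s (\<epsilon> i)) y) * (T s * ?p) \<in> NF"
      using NF_mon[of "(s, xs, ys)" "c s * (\<epsilon> i - dact s (\<epsilon> i)) y"] by (simp add: mon_def)
  qed
  finally show ?case .
qed

lemma Y_NF:
  assumes z: "z \<in> NF" shows "Y y * z \<in> NF"
  using z
proof induction
  case (step t z r)
  obtain g xs ys where t: "t = (g, xs, ys)" by (cases t)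
  then have g: "g \<in> carrier G" and xs: "(\<one>, xs, ys) \<in> Idx" using step(1) by (auto simp: Idx_def)
  have "Y y * (S r * mon t) = S r * (T g * (Y (\<rho> (inv g) y) * (xmon xs * ymon ys)))"
    unfolding t mon_def prod.case mult_shift[OF S_Y] mult_shift[OF Y_T[OF g]] by (rule refl)
  also have "\<dots> \<in> NF" by (intro NF_S T_NF g Y_mon_NF xs)
  finally show ?case using step NF_add by (simp add: distrib_left)
qed (auto intro: NF.zero)

text \<open>The spanning half of the Poincare--Birkhoff--Witt theorem: the normal forms contain \<open>S 1\<close> and
  are stable under left multiplication by the generators.\<close>

theorem alg_NF: "a \<in> alg \<Longrightarrow> a \<in> NF"
proof -
  assume a: "a \<in> alg"
  have "S 1 * a = a \<and> a * S 1 = a \<and> (\<forall>z\<in>NF. a * z \<in> NF)"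
    using a
  proof induction
    case (add a b)
    then show ?case by (auto simp: distrib_left distrib_right intro: NF_add)
  next
    case (mult a b)
    then show ?case by (metis mult.assoc)
  qed (auto simp: S_mult[symmetric] S1_X S1_Y S1_T S_X S_Y S_T intro: NF_S X_NF Y_NF T_NF)
  moreover have "S 1 \<in> NF"
    using NF_mon[of "(\<one>, [], [])" 1]
    by (simp add: Idx_def mon_def xmon_def ymon_def T_one S_mult[symmetric])
  ultimately show ?thesis by metis
qed

lemma NF_finite_sum:
  assumes "z \<in> NF"
  shows "\<exists>F C. finite F \<and> F \<subseteq> Idx \<and> z = (\<Sum>t\<in>F. S (C t) * mon t)"
  using assms
proof induction
  case zero
  show ?case by (intro exI[of _ "{}"]) auto
next
  case (step t z r)
  then obtain F C where F: "finite F" "F \<subseteq> Idx" "z = (\<Sum>t\<in>F. S (C t) * mon t)" by auto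
  define C' where "C' u = (if u = t then r + (if t \<in> F then C t else 0) else C u)" for u
  have "S r * mon t + z = (\<Sum>t\<in>insert t F. S (C' t) * mon t)"
  proof (cases "t \<in> F")
    case True
    have "(\<Sum>u\<in>F. S (C' u) * mon u) = S (C' t) * mon t + (\<Sum>u\<in>F - {t}. S (C' u) * mon u)"
      using True F(1) by (simp add: sum.remove)
    also have "(\<Sum>u\<in>F - {t}. S (C' u) * mon u) = (\<Sum>u\<in>F - {t}. S (C u) * mon u)"
      by (rule sum.cong) (auto simp: C'_def)
    finally show ?thesis using True F by (simp add: sum.remove[of F t] insert_absorb C'_def S_add algebra_simps)
  next
    case False
    have "(\<Sum>u\<in>F. S (C' u) * mon u) = z" unfolding F(3) using False by (intro sum.cong) (auto simp: C'_def)
    then show ?thesis using False F(1) by (simp add: C'_def)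
  qed
  then show ?case using F step(1) by (intro exI[of _ "insert t F"] exI[of _ C']) auto
qed

end

lemma cherednik_system_pair:
  assumes 1: "cherednik_system G scale \<rho> c n e \<epsilon> S X Y T" and 2: "cherednik_system G scale \<rho> c n e \<epsilon> S' X' Y' T'"
  shows "cherednik_system G scale \<rho> c n e \<epsilon> (\<lambda>r. (S r, S' r)) (\<lambda>x. (X x, X' x)) (\<lambda>y. (Y y, Y' y)) (\<lambda>g. (T g, T' g))"
proof -
  interpret A: cherednik_system G scale \<rho> c n e \<epsilon> S X Y T by (rule 1)
  interpret B: cherednik_system G scale \<rho> c n e \<epsilon> S' X' Y' T' by (rule 2)
  show ?thesis
  proof
    show "(Y y, Y' y) * (X x, X' x) = (X x, X' x) * (Y y, Y' y) + (S (x y), S' (x y)) -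
      (\<Sum>s\<in>A.refls. (S (c s * (x - A.dact s x) y), S' (c s * (x - A.dact s x) y)) * (T s, T' s))"
      if "x \<in> A.dual" for x y
      unfolding prod_eq_iff fst_snd_times_one fst_add snd_add fst_diff snd_diff fst_sum' snd_sum' fst_conv snd_conv
      by (intro conjI A.Y_X[OF that] B.Y_X[OF that])
  qed (auto simp: prod_eq_iff intro: A.S_add A.S_mult A.S1_X A.S1_Y A.S1_T A.S_X A.S_Y A.S_T A.X_add A.X_scale
        A.Y_add A.Y_scale A.T_mult A.T_one A.T_X A.T_Y A.X_comm A.Y_comm
        B.S_add B.S_mult B.S1_X B.S1_Y B.S1_T B.S_X B.S_Y B.S_T B.X_add B.X_scale
        B.Y_add B.Y_scale B.T_mult B.T_one B.T_X B.T_Y B.X_comm B.Y_comm)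
qed

section \<open>Truncated polynomial model of the Weyl algebra in positive characteristic\<close>

locale dunkl_data = reflection_data G scale \<rho> c n e \<epsilon>
  for G :: "'g monoid" (structure)
    and scale :: "'k::field \<Rightarrow> 'v::ab_group_add \<Rightarrow> 'v" and \<rho> c n e \<epsilon> +
  fixes p :: nat and b :: 'v and lam :: "nat \<Rightarrow> 'k"
  assumes char_p: "CHAR('k) = p" "p > 0"
    and b_free: "g \<in> carrier G \<Longrightarrow> \<rho> g b = b \<Longrightarrow> g = \<one>"
    and c_conj: "g \<in> carrier G \<Longrightarrow> s \<in> refls \<Longrightarrow> c (g \<otimes> s \<otimes> inv g) = c s"
begin

text \<open>
  A function \<open>f\<close> on exponents stands for the functional on polynomials in \<open>t\<^sub>0, \<dots>, t\<^bsub>n-1\<^esub>\<close> modulo the \<open>p\<close>-th powers of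
  the \<open>t\<^sub>i\<close> whose value at the monomial \<open>t\<^sup>a\<close> is \<open>f a\<close>. The operators \<open>ft i\<close> and \<open>fD i\<close> are the transposes of
  the multiplication by \<open>t\<^sub>i\<close> and of minus the derivative \<open>\<partial>\<^sub>i\<close>, which is defined modulo \<open>p\<close>-th powers
  in characteristic \<open>p\<close>. Passing to functionals makes the
  evaluation at the origin a common eigenvector of all \<open>ft i\<close>, from which leading terms are read
  off. The projection to functions supported in the box is \<open>fS 1\<close>.
\<close>

definition Box :: "(nat \<Rightarrow> nat) set" where
  "Box = {a. (\<forall>i<n. a i < p) \<and> (\<forall>i\<ge>n. a i = 0)}"

lemma Box_upd: "a \<in> Box \<Longrightarrow> i < n \<Longrightarrow> a(i := m) \<in> Box \<longleftrightarrow> m < p"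
  by (auto simp: Box_def)

lemma Box_upd_pred: "a \<in> Box \<Longrightarrow> i < n \<Longrightarrow> a(i := a i - 1) \<in> Box"
  by (subst Box_upd) (auto simp: Box_def dest: less_imp_diff_less)

definition fS :: "'k \<Rightarrow> ((nat \<Rightarrow> nat) \<Rightarrow> 'k) endo" where
  "fS r = Endo (\<lambda>f a. if a \<in> Box then r * f a else 0)"

definition ft :: "nat \<Rightarrow> ((nat \<Rightarrow> nat) \<Rightarrow> 'k) endo" where
  "ft i = Endo (\<lambda>f a. if a \<in> Box \<and> a(i := Suc (a i)) \<in> Box then f (a(i := Suc (a i))) else 0)"

definition fD :: "nat \<Rightarrow> ((nat \<Rightarrow> nat) \<Rightarrow> 'k) endo" where
  "fD i = Endo (\<lambda>f a. if a \<in> Box then - (of_nat (a i) * f (a(i := a i - 1))) else 0)"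

lemma app_fS: "app (fS r) f = (\<lambda>a. if a \<in> Box then r * f a else 0)"
  unfolding fS_def by (subst app_Endo) (auto simp: fun_eq_iff algebra_simps)

lemma app_ft: "app (ft i) f = (\<lambda>a. if a \<in> Box \<and> a(i := Suc (a i)) \<in> Box then f (a(i := Suc (a i))) else 0)"
  unfolding ft_def by (subst app_Endo) (auto simp: fun_eq_iff algebra_simps)

lemma app_fD: "app (fD i) f = (\<lambda>a. if a \<in> Box then - (of_nat (a i) * f (a(i := a i - 1))) else 0)"
  unfolding fD_def by (subst app_Endo) (auto simp: fun_eq_iff algebra_simps)

lemma fS_add: "fS (r + s) = fS r + fS s" and fS_mult: "fS (r * s) = fS r * fS s"
  by (auto intro!: endo_eqI ext simp: app_fS algebra_simps)

lemma fS_zero: "fS 0 = 0" using fS_add[of 0 0] by simp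
lemma fS_neg: "fS (- r) = - fS r" using fS_add[of r "- r"] fS_zero by (metis add.right_inverse minus_unique)

lemma fS_ft: "fS r * ft i = ft i * fS r" and fS1_ft: "fS 1 * ft i = ft i"
  by (auto intro!: endo_eqI ext simp: app_fS app_ft)

lemma fS_fD: "i < n \<Longrightarrow> fS r * fD i = fD i * fS r" and fS1_fD: "fS 1 * fD i = fD i"
  using Box_upd_pred by (auto intro!: endo_eqI ext simp: app_fS app_fD)

lemma ft_comm:
  assumes "i < n" "j < n" shows "ft i * ft j = ft j * ft i"
proof (cases "i = j")
  case False
  show ?thesis
  proof (intro endo_eqI ext)
    fix f a
    show "app (ft i * ft j) f a = app (ft j * ft i) f a"
    proof (cases "a \<in> Box")
      case True
      have "app (ft i) g a = (if Suc (a i) < p then g (a(i := Suc (a i))) else 0)"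
        "app (ft j) g a = (if Suc (a j) < p then g (a(j := Suc (a j))) else 0)" for g
        using True by (simp_all add: app_ft Box_upd assms)
      moreover have "app (ft j) f (a(i := Suc (a i))) = (if Suc (a j) < p then f (a(i := Suc (a i), j := Suc (a j))) else 0)"
        if "Suc (a i) < p"
      proof -
        have "a(i := Suc (a i)) \<in> Box" using True that Box_upd assms by blast
        then show ?thesis using False by (simp add: app_ft Box_upd assms)
      qed
      moreover have "app (ft i) f (a(j := Suc (a j))) = (if Suc (a i) < p then f (a(i := Suc (a i), j := Suc (a j))) else 0)"
        if "Suc (a j) < p"
      proof -
        have B: "a(j := Suc (a j)) \<in> Box" using True that Box_upd assms by blast
        moreover have "a(j := Suc (a j), i := Suc (a i)) = a(i := Suc (a i), j := Suc (a j))"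
          using False by (simp add: fun_upd_twist)
        ultimately show ?thesis using False Box_upd[OF B assms(1), of "Suc (a i)"]
          by (simp add: app_ft)
      qed
      ultimately show ?thesis by simp
    qed (simp add: app_ft)
  qed
qed simp

lemma fD_comm:
  assumes "i < n" "j < n" shows "fD i * fD j = fD j * fD i"
proof (cases "i = j")
  case False
  show ?thesis
  proof (intro endo_eqI ext)
    fix f a
    show "app (fD i * fD j) f a = app (fD j * fD i) f a"
      using False Box_upd_pred[of a i] Box_upd_pred[of a j] assms by (simp add: app_fD fun_upd_twist)
  qed
qed simp

text \<open>For \<open>a i = p - 1\<close> the relation survives the truncation because \<open>p = 0\<close> in the field.\<close>

lemma fD_ft:
  assumes "i < n" "j < n" shows "fD i * ft j = ft j * fD i + (if i = j then fS 1 else 0)"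
proof (intro endo_eqI ext)
  fix f a
  show "app (fD i * ft j) f a = app (ft j * fD i + (if i = j then fS 1 else 0)) f a"
  proof (cases "a \<in> Box")
    case True
    have D: "app (fD i) g a = - (of_nat (a i) * g (a(i := a i - 1)))" for g using True by (simp add: app_fD)
    have t: "app (ft j) g a = (if Suc (a j) < p then g (a(j := Suc (a j))) else 0)" for g
      using True by (simp add: app_ft Box_upd assms)
    have B: "a(i := a i - 1) \<in> Box" by (rule Box_upd_pred[OF True assms(1)])
    have aj: "a j < p" using True assms by (auto simp: Box_def)
    show ?thesis
    proof (cases "i = j")
      case False
      have "app (ft j) f (a(i := a i - 1)) = (if Suc (a j) < p then f (a(i := a i - 1, j := Suc (a j))) else 0)"
        using B False by (simp add: app_ft Box_upd assms)
      moreover have "app (fD i) f (a(j := Suc (a j))) = - (of_nat (a i) * f (a(i := a i - 1, j := Suc (a j))))" if "Suc (a j) < p"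
      proof -
        have "a(j := Suc (a j)) \<in> Box" using True that Box_upd assms by blast
        then show ?thesis using False by (simp add: app_fD fun_upd_twist)
      qed
      ultimately show ?thesis using False by (simp add: D t)
    next
      case True
      have 1: "of_nat (a i) * app (ft i) f (a(i := a i - 1)) = of_nat (a i) * f a"
      proof (cases "a i")
        case (Suc m)
        then have "app (ft i) f (a(i := a i - 1)) = f a"
          using B aj \<open>a \<in> Box\<close> True assms by (simp add: app_ft Box_upd) (metis fun_upd_triv)
        then show ?thesis by simp
      qed simp
      have 2: "app (fD i) f (a(i := Suc (a i))) = - (of_nat (Suc (a i)) * f a)" if "Suc (a i) < p"
      proof -
        have "a(i := Suc (a i)) \<in> Box" using \<open>a \<in> Box\<close> that Box_upd assms by blast
        then show ?thesis by (simp add: app_fD)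
      qed
      have 3: "of_nat (Suc (a i)) = (0 :: 'k)" if "\<not> Suc (a i) < p"
      proof -
        have "Suc (a i) = p" using that aj True by simp
        then show ?thesis using char_p(1) by (metis of_nat_CHAR)
      qed
      have "app (fD i * ft j) f a = - (of_nat (a i) * f a)"
        unfolding True[symmetric] app_simps D 1 by (rule refl)
      moreover have "app (ft j * fD i) f a = - (of_nat (Suc (a i)) * f a)"
        unfolding app_simps t unfolding True[symmetric]
        using 2 3 by (cases "Suc (a i) < p") (simp_all del: of_nat_Suc)
      moreover have "app (fS 1) f a = f a" using \<open>a \<in> Box\<close> by (simp add: app_fS)
      ultimately have "app (fD i * ft j) f a = app (ft j * fD i) f a + app (fS 1) f a"
        by (simp only:) (simp add: algebra_simps)
      then show ?thesis using True by simp
    qed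
  qed (simp add: app_fD app_ft app_fS)
qed

text \<open>The linear function \<open>x\<close>, expanded at \<open>b\<close>, and the derivative along \<open>y\<close>, shifted by a
  constant that is linear in \<open>y\<close>.\<close>

definition fz :: "('v \<Rightarrow> 'k) \<Rightarrow> ((nat \<Rightarrow> nat) \<Rightarrow> 'k) endo" where
  "fz x = fS (x b) + (\<Sum>i<n. fS (x (e i)) * ft i)"

definition fd :: "'v \<Rightarrow> ((nat \<Rightarrow> nat) \<Rightarrow> 'k) endo" where
  "fd y = (\<Sum>i<n. fS (\<epsilon> i y) * (fD i + fS (lam i)))"

lemma fS_comm: "fS r * fS s = fS s * fS r" by (simp add: fS_mult[symmetric] mult.commute)

lemma central_sum: "(\<And>i. i < n \<Longrightarrow> u * f i = f i * u) \<Longrightarrow> u * (\<Sum>i<n. f i) = (\<Sum>i<n. f i) * (u :: 'e::ring)"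
  by (simp add: sum_distrib_left sum_distrib_right)

lemma central_mult: "u * a = a * u \<Longrightarrow> u * b' = b' * u \<Longrightarrow> u * (a * b') = (a * b') * (u :: 'e::ring)"
  by (simp add: mult_shift[of u a a u] mult.assoc)

lemma central_add: "u * a = a * u \<Longrightarrow> u * b' = b' * u \<Longrightarrow> u * (a + b') = (a + b') * (u :: 'e::ring)"
  by (simp add: algebra_simps)

lemma fS_fz: "fS r * fz x = fz x * fS r"
  unfolding fz_def by (intro central_add central_sum central_mult fS_comm fS_ft)

lemma fS_fd: "fS r * fd y = fd y * fS r"
  unfolding fd_def by (intro central_sum central_mult central_add fS_comm fS_fD)

lemma fS1_fS: "fS 1 * fS r = fS r" by (simp add: fS_mult[symmetric])

lemma fS1_fz: "fS 1 * fz x = fz x"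
  by (simp add: fz_def distrib_left sum_distrib_left mult.assoc[symmetric] fS1_fS)

lemma fS1_fd: "fS 1 * fd x = fd x"
  by (simp add: fd_def sum_distrib_left mult.assoc[symmetric] fS1_fS)

lemma fz_add: "fz (\<lambda>v. x v + x' v) = fz x + fz x'"
  by (simp add: fz_def fS_add sum.distrib algebra_simps)

lemma fz_scale: "fz (\<lambda>v. r * x v) = fS r * fz x"
  by (simp add: fz_def fS_mult sum_distrib_left distrib_left mult.assoc)

lemma fd_add: "fd (y + y') = fd y + fd y'"
  by (simp add: fd_def fS_add dual_add[OF \<epsilon>_dual] distrib_right sum.distrib)

lemma fd_scale: "fd (scale r y) = fS r * fd y"
  by (simp add: fd_def fS_mult dual_scale[OF \<epsilon>_dual] sum_distrib_left mult.assoc)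

lemma fz_comm: "fz x * fz x' = fz x' * fz x"
proof -
  have t: "ft i * fz x' = fz x' * ft i" if "i < n" for i x'
    unfolding fz_def by (intro central_add central_sum central_mult fS_ft[symmetric] ft_comm that)
  have "fz x' * fz x = fz x * fz x'"
    unfolding fz_def[of x] by (intro central_add central_sum central_mult fS_fz[symmetric] t[symmetric])
  then show ?thesis by simp
qed

lemma fd_comm: "fd y * fd y' = fd y' * fd y"
proof -
  have D: "fD i * fd y' = fd y' * fD i" if "i < n" for i y'
    unfolding fd_def by (intro central_sum central_mult central_add fS_fD[symmetric] fD_comm that)
  have "fd y' * fd y = fd y * fd y'"
    unfolding fd_def[of y] by (intro central_sum central_mult central_add fS_fd[symmetric] D[symmetric])
  then show ?thesis by simp
qed

lemma fd_fz: "x \<in> dual \<Longrightarrow> fd y * fz x = fz x * fd y + fS (x y)"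
proof -
  assume x: "x \<in> dual"
  have D: "fD i * fz x = fz x * fD i + fS (x (e i))" if i: "i < n" for i
  proof -
    have "fD i * (\<Sum>j<n. fS (x (e j)) * ft j) =
        (\<Sum>j<n. fS (x (e j)) * ft j * fD i + (if j = i then fS (x (e i)) else 0))"
      unfolding sum_distrib_left
    proof (rule sum.cong[OF refl])
      fix j assume j: "j \<in> {..<n}"
      have "fD i * (fS (x (e j)) * ft j) = fS (x (e j)) * (fD i * ft j)"
        by (rule mult_shift) (rule fS_fD[OF i, symmetric])
      then show "fD i * (fS (x (e j)) * ft j) = fS (x (e j)) * ft j * fD i + (if j = i then fS (x (e i)) else 0)"
        using j i by (auto simp: fD_ft distrib_left mult.assoc fS_mult[symmetric])
    qed
    also have "\<dots> = (\<Sum>j<n. fS (x (e j)) * ft j) * fD i + fS (x (e i))"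
      using i by (simp add: sum.distrib sum_distrib_right)
    finally show ?thesis using fS_fD[OF i, of "x b"] by (simp add: fz_def algebra_simps)
  qed
  have "fd y * fz x = (\<Sum>i<n. fS (\<epsilon> i y) * ((fD i + fS (lam i)) * fz x))"
    by (simp add: fd_def sum_distrib_right mult.assoc)
  also have "\<dots> = (\<Sum>i<n. fz x * (fS (\<epsilon> i y) * (fD i + fS (lam i))) + fS (x (e i) * \<epsilon> i y))"
  proof (rule sum.cong[OF refl])
    fix i assume "i \<in> {..<n}"
    then have "(fD i + fS (lam i)) * fz x = fz x * (fD i + fS (lam i)) + fS (x (e i))"
      using D[of i] fS_fz[of "lam i" x] by (simp add: distrib_left distrib_right)
    then have "fS (\<epsilon> i y) * ((fD i + fS (lam i)) * fz x) =
      fS (\<epsilon> i y) * fz x * (fD i + fS (lam i)) + fS (\<epsilon> i y * x (e i))"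
      by (simp add: distrib_left mult.assoc fS_mult)
    then show "fS (\<epsilon> i y) * ((fD i + fS (lam i)) * fz x) =
      fz x * (fS (\<epsilon> i y) * (fD i + fS (lam i))) + fS (x (e i) * \<epsilon> i y)"
      by (simp add: fS_fz mult.assoc mult.commute)
  qed
  also have "\<dots> = fz x * fd y + (\<Sum>i<n. fS (x (e i) * \<epsilon> i y))"
    by (simp add: sum.distrib fd_def sum_distrib_left)
  also have "(\<Sum>i<n. fS (x (e i) * \<epsilon> i y)) = fS (x y)"
  proof -
    have "(\<Sum>i<m. fS (x (e i) * \<epsilon> i y)) = fS (\<Sum>i<m. x (e i) * \<epsilon> i y)" for m
      by (induction m) (auto simp: fS_zero fS_add)
    then show ?thesis by (simp only: dual_expand[OF x, symmetric])
  qed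
  finally show ?thesis .
qed

text \<open>Every factor raises the total exponent at which \<open>f\<close> is evaluated, and this is at most \<open>n p\<close> in the box.\<close>

lemma nilpotent_shift:
  fixes \<kappa> :: "nat \<Rightarrow> 'k" defines "u \<equiv> \<Sum>i<n. fS (\<kappa> i) * ft i"
  shows "u ^ Suc (n * p) = 0"
proof -
  have level: "app (u ^ k) (app (fS 1) f) a \<noteq> 0 \<Longrightarrow> a \<in> Box \<and> (\<Sum>i<n. a i) + k \<le> n * p" for k f a
  proof (induction k arbitrary: a)
    case 0
    then have "a \<in> Box" by (auto simp: app_fS split: if_splits)
    moreover have "(\<Sum>i<n. a i) \<le> (\<Sum>i<n. p)" using \<open>a \<in> Box\<close> by (intro sum_mono) (auto simp: Box_def less_imp_le)
    ultimately show ?case by simp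
  next
    case (Suc k)
    let ?g = "app (u ^ k) (app (fS 1) f)"
    have "app u ?g a = (\<Sum>i<n. app (fS (\<kappa> i) * ft i) ?g a)"
    proof -
      have "(\<Sum>i\<in>I. h i) a = (\<Sum>i\<in>I. h i a)" for h :: "nat \<Rightarrow> (nat \<Rightarrow> nat) \<Rightarrow> 'k" and I
        by (induction I rule: infinite_finite_induct) auto
      then show ?thesis unfolding u_def app_sum by simp
    qed
    moreover have "app u ?g a \<noteq> 0" using Suc.prems by simp
    ultimately have ne: "(\<Sum>i<n. app (fS (\<kappa> i) * ft i) ?g a) \<noteq> 0" by simp
    have "\<exists>i\<in>{..<n}. app (fS (\<kappa> i) * ft i) ?g a \<noteq> 0"
    proof (rule ccontr)
      assume "\<not> ?thesis"
      then have "(\<Sum>i<n. app (fS (\<kappa> i) * ft i) ?g a) = 0" by (intro sum.neutral) blast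
      then show False using ne by contradiction
    qed
    then obtain i where i: "i < n" "app (fS (\<kappa> i) * ft i) ?g a \<noteq> 0" by auto
    then have a: "a \<in> Box" and g: "?g (a(i := Suc (a i))) \<noteq> 0"
      by (auto simp: app_fS app_ft split: if_splits)
    have "(\<Sum>j<n. (a(i := Suc (a i))) j) = Suc (\<Sum>j<n. a j)"
    proof -
      have "(\<Sum>j<n. (a(i := Suc (a i))) j) = Suc (a i) + (\<Sum>j\<in>{..<n} - {i}. a j)"
        using i by (subst sum.remove[of _ i]) auto
      then show ?thesis using i by (simp add: sum.remove[of "{..<n}" i a])
    qed
    then show ?case using Suc.IH[OF g] a by simp
  qed
  have "ft i * fS 1 = ft i" for i using fS_ft[of 1 i] fS1_ft[of i] by simp
  then have uS: "u * fS 1 = u"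
    unfolding u_def by (simp add: sum_distrib_right mult.assoc)
  have "u ^ Suc (n * p) * fS 1 = 0"
  proof (intro endo_eqI ext)
    fix f a
    show "app (u ^ Suc (n * p) * fS 1) f a = app 0 f a"
      using level[of "Suc (n * p)" f a] by (auto simp del: power_Suc)
  qed
  moreover have "u ^ Suc k * fS 1 = u ^ Suc k" for k
    using uS by (simp add: power_Suc2 mult.assoc del: power_Suc)
  ultimately show ?thesis by metis
qed

text \<open>The operator is \<open>x b (1 - u)\<close> with \<open>u\<close> nilpotent, so its inverse is a geometric sum.\<close>

lemma fz_invertible:
  assumes "x b \<noteq> 0"
  shows "\<exists>w. fz x * w = fS 1 \<and> w * fz x = fS 1 \<and> fS 1 * w = w \<and> w * fS 1 = w"
proof -
  define r where "r = x b"
  have r: "r \<noteq> 0" using assms by (simp add: r_def)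
  define u where "u = (\<Sum>i<n. fS (- x (e i) / r) * ft i)"
  define N where "N = Suc (n * p)"
  have uN: "u ^ N = 0" unfolding u_def N_def by (rule nilpotent_shift)
  define g where "g = (\<Sum>k<N. u ^ k)"
  have geo: "(1 - u) * (\<Sum>k<m. u ^ k) = 1 - u ^ m \<and> (\<Sum>k<m. u ^ k) * (1 - u) = 1 - u ^ m" for m
  proof (induction m)
    case (Suc m)
    have "(1 - u) * u ^ m = u ^ m - u ^ Suc m" "u ^ m * (1 - u) = u ^ m - u ^ Suc m"
      by (simp_all add: left_diff_distrib right_diff_distrib power_commutes)
    then show ?case using Suc unfolding sum.lessThan_Suc distrib_left distrib_right by simp
  qed simp
  have g1: "(1 - u) * g = 1" "g * (1 - u) = 1" using geo[of N] uN by (simp_all add: g_def)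
  have Su: "fS s * u = u * fS s" for s
    unfolding u_def by (intro central_sum central_mult fS_comm fS_ft)
  have Sk: "fS s * u ^ k = u ^ k * fS s" for s k
    by (induction k) (auto intro!: central_mult Su)
  have Sg: "fS s * g = g * fS s" for s
    unfolding g_def by (simp add: sum_distrib_left sum_distrib_right Sk)
  have "fS r * u = - (\<Sum>i<n. fS (x (e i)) * ft i)"
    unfolding u_def sum_distrib_left sum_negf[symmetric]
    by (rule sum.cong) (auto simp: mult.assoc[symmetric] fS_mult[symmetric] fS_neg r)
  then have z: "fz x = fS r * (1 - u)" by (simp add: fz_def r_def[symmetric] algebra_simps)
  have S1: "fS 1 = fS r * fS (1 / r)" using r by (simp add: fS_mult[symmetric])
  define w where "w = fS (1 / r) * g"
  have "fz x * w = fS r * ((1 - u) * fS (1 / r)) * g" by (simp add: z w_def mult.assoc)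
  also have "(1 - u) * fS (1 / r) = fS (1 / r) * (1 - u)" by (simp add: algebra_simps Su)
  finally have "fz x * w = fS 1" using g1 by (simp add: S1 mult.assoc)
  moreover have "w * fz x = fS 1"
  proof -
    have "w * fz x = fS (1 / r) * (g * fS r) * (1 - u)" by (simp add: z w_def mult.assoc)
    also have "\<dots> = fS (1 / r) * fS r * (g * (1 - u))" by (simp add: Sg[symmetric] mult.assoc)
    finally show ?thesis using g1 by (simp add: S1 fS_comm)
  qed
  moreover have "fS 1 * w = w" by (simp add: w_def mult.assoc[symmetric] fS1_fS)
  moreover have "w * fS 1 = w"
    by (simp add: w_def mult.assoc Sg[symmetric]) (simp add: mult.assoc[symmetric] fS_mult[symmetric])
  ultimately show ?thesis by blast
qed

definition fw :: "('v \<Rightarrow> 'k) \<Rightarrow> ((nat \<Rightarrow> nat) \<Rightarrow> 'k) endo" where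
  "fw x = (SOME w. fz x * w = fS 1 \<and> w * fz x = fS 1 \<and> fS 1 * w = w \<and> w * fS 1 = w)"

lemma
  assumes "x b \<noteq> 0"
  shows fz_fw: "fz x * fw x = fS 1" and fw_fz: "fw x * fz x = fS 1" and fS1_fw: "fS 1 * fw x = fw x"
    and fw_fS1: "fw x * fS 1 = fw x"
  using someI_ex[OF fz_invertible[of x, OF assms]] unfolding fw_def by auto

lemma fw_central:
  assumes x: "x b \<noteq> 0" and a: "fS 1 * a = a * fS 1" "fz x * a = a * fz x" shows "fw x * a = a * fw x"
proof -
  have "fw x * a = fw x * fS 1 * a" by (simp add: fw_fS1[of x, OF x])
  also have "\<dots> = fw x * a * (fz x * fw x)" by (simp add: mult.assoc a(1) fz_fw[of x, OF x])
  also have "\<dots> = fw x * (fz x * a) * fw x" by (simp add: mult.assoc a(2))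
  also have "\<dots> = fS 1 * a * fw x" by (simp add: mult.assoc[symmetric] fw_fz[of x, OF x])
  also have "\<dots> = a * fw x" by (simp add: a(1) mult.assoc fS1_fw[of x, OF x])
  finally show ?thesis .
qed

lemma fw_fz': "x b \<noteq> 0 \<Longrightarrow> fw x * fz x' = fz x' * fw x"
  by (rule fw_central) (auto simp: fS_fz fz_comm)

lemma fw_fS: "x b \<noteq> 0 \<Longrightarrow> fS r * fw x = fw x * fS r"
  by (rule fw_central[symmetric]) (auto simp: fS_fz fS_comm)

lemma fw_scale:
  assumes x: "x b \<noteq> 0" and r: "r \<noteq> 0" shows "fS r * fw (\<lambda>v. r * x v) = fw x"
proof -
  have rx: "r * x b \<noteq> 0" using assms by simp
  have "fw x = fw x * (fz (\<lambda>v. r * x v) * fw (\<lambda>v. r * x v))"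
    using fz_fw[of "\<lambda>v. r * x v", OF rx] fw_fS1[of x, OF x] by simp
  also have "\<dots> = fS r * (fw x * fz x) * fw (\<lambda>v. r * x v)"
    by (simp add: fz_scale mult_shift[OF fw_fS[of x, OF x, of r, symmetric]] mult.assoc)
  also have "\<dots> = fS r * fw (\<lambda>v. r * x v)"
    using fw_fz[of x, OF x] fS1_fw[of "\<lambda>v. r * x v", OF rx] by (simp add: mult.assoc)
  finally show ?thesis by simp
qed

text \<open>The quotient rule, from the commutator of \<open>fd y\<close> with the inverse operator.\<close>

lemma fd_fw:
  assumes x: "x b \<noteq> 0" "x \<in> dual"
  shows "fd y * fw x - fw x * fd y = - (fS (x y) * (fw x * fw x))"
proof -
  have "fw x * (fd y * fz x) * fw x = fw x * (fz x * fd y + fS (x y)) * fw x"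
    using fd_fz[OF x(2)] by simp
  moreover have "fw x * (fd y * fz x) * fw x = fw x * fd y"
    by (simp add: mult.assoc fz_fw[of x, OF x(1)] fS_fd[of 1 y, symmetric] fS1_fd)
  moreover have "fw x * (fz x * fd y + fS (x y)) * fw x = fd y * fw x + fS (x y) * (fw x * fw x)"
  proof -
    have "fw x * (fz x * fd y) * fw x = (fw x * fz x) * fd y * fw x" by (simp add: mult.assoc)
    then show ?thesis
      by (simp add: distrib_left distrib_right fw_fz[of x, OF x(1)] fS1_fd fw_fS[of x, OF x(1), symmetric] mult.assoc)
  qed
  ultimately show ?thesis by (simp add: algebra_simps)
qed

end

section \<open>Roots of the reflections\<close>

context reflection_data
begin

lemma refl_of_root:
  assumes s: "s \<in> carrier G" and r: "\<And>y. y - \<rho> s y = scale (\<beta> y) w" and w: "w \<noteq> 0"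
    and \<beta>: "\<beta> y0 \<noteq> 0"
  shows "s \<in> refls"
proof -
  have "range (\<lambda>v. v - \<rho> s v) = V.span {w}"
  proof (intro equalityI subsetI)
    fix u assume "u \<in> range (\<lambda>v. v - \<rho> s v)"
    then show "u \<in> V.span {w}" using r by (auto simp: V.span_singleton)
  next
    fix u assume "u \<in> V.span {w}"
    then obtain k where k: "u = scale k w" by (auto simp: V.span_singleton)
    let ?y = "scale (k / \<beta> y0) y0"
    have "?y - \<rho> s ?y = scale (k / \<beta> y0) (y0 - \<rho> s y0)"
      by (simp add: \<rho>_scale[OF s] V.scale_right_diff_distrib)
    also have "\<dots> = u" using \<beta> by (simp add: r k)
    finally show "u \<in> range (\<lambda>v. v - \<rho> s v)" by (metis rangeI)
  qed
  moreover have "V.dim (V.span {w}) = 1"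
    using w by (subst V.dim_span_eq_card_independent) (auto simp: V.dependent_single)
  ultimately show ?thesis using s by (simp add: reflections_def)
qed

text \<open>As \<open>1 - s\<close> has rank one, it is the product of a functional and a vector.\<close>

lemma root_exists:
  assumes s: "s \<in> refls"
  shows "\<exists>\<alpha> w. \<alpha> \<in> dual \<and> w \<noteq> 0 \<and> (\<forall>y. y - \<rho> s y = scale (\<alpha> y) w) \<and> (\<exists>y. \<alpha> y \<noteq> 0)"
proof -
  have sG: "s \<in> carrier G" using s by (rule refl_carrier)
  let ?R = "range (\<lambda>v. v - \<rho> s v)"
  obtain B where B: "B \<subseteq> ?R" "V.independent B" "?R \<subseteq> V.span B" "card B = V.dim ?R"
    using V.basis_exists by blast
  then have "card B = 1" using s by (simp add: reflections_def)
  then obtain w where Bw: "B = {w}" by (auto simp: card_1_singleton_iff)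
  have w: "w \<noteq> 0" using B(2) Bw by (auto simp: V.dependent_single)
  have "\<exists>k. y - \<rho> s y = scale k w" for y
    using B(3) Bw by (auto simp: V.span_singleton)
  then obtain \<alpha> where \<alpha>: "\<And>y. y - \<rho> s y = scale (\<alpha> y) w" by metis
  have "\<alpha> (u + v) = \<alpha> u + \<alpha> v" for u v
  proof -
    have "scale (\<alpha> (u + v)) w = scale (\<alpha> u + \<alpha> v) w"
      unfolding V.scale_left_distrib \<alpha>[symmetric] by (simp add: \<rho>_add[OF sG])
    then show ?thesis using w by (simp only: V.scale_cancel_right) simp
  qed
  moreover have "\<alpha> (scale r v) = r * \<alpha> v" for r v
  proof -
    have "scale (\<alpha> (scale r v)) w = scale (r * \<alpha> v) w"
      unfolding V.scale_scale[symmetric] \<alpha>[symmetric] by (simp add: \<rho>_scale[OF sG] V.scale_right_diff_distrib)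
    then show ?thesis using w by (simp only: V.scale_cancel_right) simp
  qed
  ultimately have "\<alpha> \<in> dual" by (simp add: dual_iff)
  moreover have "\<exists>y. \<alpha> y \<noteq> 0"
  proof -
    obtain y where "w = y - \<rho> s y" using B(1) Bw by auto
    then have "scale (\<alpha> y) w \<noteq> 0" using w \<alpha> by simp
    then show ?thesis by (auto intro: exI[of _ y])
  qed
  ultimately show ?thesis using w \<alpha> by blast
qed

definition root :: "'g \<Rightarrow> 'v \<Rightarrow> 'k" where
  "root s = (SOME \<alpha>. \<exists>w. \<alpha> \<in> dual \<and> w \<noteq> 0 \<and> (\<forall>y. y - \<rho> s y = scale (\<alpha> y) w) \<and> (\<exists>y. \<alpha> y \<noteq> 0))"

definition coroot :: "'g \<Rightarrow> 'v" where
  "coroot s = (SOME w. w \<noteq> 0 \<and> (\<forall>y. y - \<rho> s y = scale (root s y) w))"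

lemma
  assumes s: "s \<in> refls"
  shows root_dual: "root s \<in> dual" and coroot_nz: "coroot s \<noteq> 0"
    and root_eq: "y - \<rho> s y = scale (root s y) (coroot s)" and root_nz: "\<exists>y. root s y \<noteq> 0"
proof -
  have *: "\<exists>w. root s \<in> dual \<and> w \<noteq> 0 \<and> (\<forall>y. y - \<rho> s y = scale (root s y) w) \<and> (\<exists>y. root s y \<noteq> 0)"
    unfolding root_def using root_exists[OF s] by (rule someI_ex)
  then show "root s \<in> dual" "\<exists>y. root s y \<noteq> 0" by auto
  have "\<exists>w. w \<noteq> 0 \<and> (\<forall>y. y - \<rho> s y = scale (root s y) w)" using * by auto
  then have "coroot s \<noteq> 0 \<and> (\<forall>y. y - \<rho> s y = scale (root s y) (coroot s))"
    unfolding coroot_def by (rule someI_ex)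
  then show "coroot s \<noteq> 0" "y - \<rho> s y = scale (root s y) (coroot s)" by auto
qed

lemma root_unique:
  assumes s: "s \<in> refls" and r: "\<And>y. y - \<rho> s y = scale (\<beta> y) w" and w: "w \<noteq> 0"
  shows "\<exists>\<kappa>. \<kappa> \<noteq> 0 \<and> root s = (\<lambda>y. \<kappa> * \<beta> y)"
proof -
  obtain y0 where y0: "root s y0 \<noteq> 0" using root_nz[OF s] by blast
  define k where "k = \<beta> y0 / root s y0"
  have eq: "scale (root s y) (coroot s) = scale (\<beta> y) w" for y
    using root_eq[OF s, of y] r[of y] by simp
  have "coroot s = scale (1 / root s y0) (scale (root s y0) (coroot s))" using y0 by simp
  then have cor: "coroot s = scale k w" unfolding eq by (simp add: k_def)
  then have k0: "k \<noteq> 0" using coroot_nz[OF s] by auto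
  have "root s y * k = \<beta> y" for y
  proof -
    have "scale (root s y * k) w = scale (\<beta> y) w" using eq[of y] by (simp add: cor)
    then show ?thesis using w by (simp only: V.scale_cancel_right) simp
  qed
  then have "root s = (\<lambda>y. (1 / k) * \<beta> y)" using k0 by (auto simp: fun_eq_iff field_simps)
  then show ?thesis using k0 by (intro exI[of _ "1 / k"]) auto
qed

lemma refl_conj:
  assumes s: "s \<in> refls" and h: "h \<in> carrier G"
  shows "h \<otimes> s \<otimes> inv h \<in> refls" "\<exists>\<kappa>. \<kappa> \<noteq> 0 \<and> root (h \<otimes> s \<otimes> inv h) = (\<lambda>y. \<kappa> * dact h (root s) y)"
proof -
  have sG: "s \<in> carrier G" using s by (rule refl_carrier)
  have eq: "y - \<rho> (h \<otimes> s \<otimes> inv h) y = scale (dact h (root s) y) (\<rho> h (coroot s))" for y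
  proof -
    have "y - \<rho> (h \<otimes> s \<otimes> inv h) y = \<rho> h (\<rho> (inv h) y - \<rho> s (\<rho> (inv h) y))"
      using h sG by (simp add: \<rho>_mult \<rho>_diff \<rho>_inv)
    also have "\<dots> = scale (root s (\<rho> (inv h) y)) (\<rho> h (coroot s))"
      unfolding root_eq[OF s] by (rule \<rho>_scale[OF h])
    finally show ?thesis by (simp add: dual_act_def)
  qed
  have nz: "\<rho> h (coroot s) \<noteq> 0"
  proof
    assume "\<rho> h (coroot s) = 0"
    then have "\<rho> (inv h) (\<rho> h (coroot s)) = 0" using h by (simp add: \<rho>_zero)
    then show False using coroot_nz[OF s] h by (simp add: \<rho>_inv)
  qed
  obtain y0 where "root s y0 \<noteq> 0" using root_nz[OF s] by blast
  then have "dact h (root s) (\<rho> h y0) \<noteq> 0" using h by (simp add: dual_act_def \<rho>_inv)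
  then show *: "h \<otimes> s \<otimes> inv h \<in> refls"
    using h sG by (intro refl_of_root[OF _ eq nz]) auto
  show "\<exists>\<kappa>. \<kappa> \<noteq> 0 \<and> root (h \<otimes> s \<otimes> inv h) = (\<lambda>y. \<kappa> * dact h (root s) y)"
    by (rule root_unique[OF * eq nz])
qed

lemma minus_inv_refl:
  assumes s: "s \<in> refls"
  shows "y - \<rho> (inv s) y = scale (root s y) (- \<rho> (inv s) (coroot s))"
proof -
  have sG: "s \<in> carrier G" using s by (rule refl_carrier)
  have "\<rho> (inv s) (y - \<rho> s y) = scale (root s y) (\<rho> (inv s) (coroot s))"
    unfolding root_eq[OF s] using sG by (intro \<rho>_scale) auto
  then have "\<rho> (inv s) y - y = scale (root s y) (\<rho> (inv s) (coroot s))"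
    using sG by (simp add: \<rho>_diff \<rho>_inv)
  then show ?thesis by (simp add: V.scale_minus_right) (metis minus_diff_eq)
qed

lemma refl_inv:
  assumes s: "s \<in> refls"
  shows "inv s \<in> refls" "\<exists>\<kappa>. \<kappa> \<noteq> 0 \<and> root (inv s) = (\<lambda>y. \<kappa> * root s y)"
proof -
  have sG: "s \<in> carrier G" using s by (rule refl_carrier)
  have nz: "- \<rho> (inv s) (coroot s) \<noteq> 0"
  proof
    assume "- \<rho> (inv s) (coroot s) = 0"
    then have "\<rho> s (\<rho> (inv s) (coroot s)) = 0" using sG by (simp add: \<rho>_zero)
    then show False using coroot_nz[OF s] sG by (simp add: \<rho>_inv)
  qed
  obtain y0 where "root s y0 \<noteq> 0" using root_nz[OF s] by blast
  then show *: "inv s \<in> refls"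
    using sG by (intro refl_of_root[OF _ minus_inv_refl[OF s] nz]) auto
  show "\<exists>\<kappa>. \<kappa> \<noteq> 0 \<and> root (inv s) = (\<lambda>y. \<kappa> * root s y)"
    by (rule root_unique[OF * minus_inv_refl[OF s] nz])
qed

text \<open>The coefficient in the commutation relation of \<open>x\<close> and \<open>y\<close> has \<open>root s\<close> as its only
  dependence on \<open>y\<close>, which is what a Dunkl operator with pole along \<open>root s\<close> produces.\<close>

lemma refl_dual: 
  assumes s: "s \<in> refls" and x: "x \<in> dual"
  shows "x - dact s x = (\<lambda>y. - x (\<rho> (inv s) (coroot s)) * root s y)"
proof
  fix y
  have "(x - dact s x) y = x (y - \<rho> (inv s) y)" by (simp add: dual_act_def dual_diff[OF x])
  also have "\<dots> = root s y * x (- \<rho> (inv s) (coroot s))"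
    unfolding minus_inv_refl[OF s] by (rule dual_scale[OF x])
  also have "x (- \<rho> (inv s) (coroot s)) = - x (\<rho> (inv s) (coroot s))"
    using dual_diff[OF x, of 0 "\<rho> (inv s) (coroot s)"] dual_zero[OF x] by simp
  finally show "(x - dact s x) y = - x (\<rho> (inv s) (coroot s)) * root s y" by (simp add: mult.commute)
qed

lemma refl_neq_one: "s \<in> refls \<Longrightarrow> s \<noteq> \<one>"
proof
  assume s: "s \<in> refls" "s = \<one>"
  obtain y0 where "root s y0 \<noteq> 0" using root_nz[OF s(1)] by blast
  moreover have "scale (root s y0) (coroot s) = 0" using root_eq[OF s(1), of y0] s(2) by (simp add: \<rho>_one)
  ultimately show False using coroot_nz[OF s(1)] by simp
qed

end

section \<open>Dunkl operators\<close>

context dunkl_data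
begin

lemma root_regular: "s \<in> refls \<Longrightarrow> g \<in> carrier G \<Longrightarrow> root s (\<rho> g b) \<noteq> 0"
proof
  assume s: "s \<in> refls" and g: "g \<in> carrier G" and "root s (\<rho> g b) = 0"
  have sG: "s \<in> carrier G" using s by (rule refl_carrier)
  have "\<rho> s (\<rho> g b) = \<rho> g b" using root_eq[OF s, of "\<rho> g b"] \<open>root s (\<rho> g b) = 0\<close> by simp
  then have "\<rho> (inv g \<otimes> s \<otimes> g) b = b" using g sG by (simp add: \<rho>_mult \<rho>_inv)
  then have "inv g \<otimes> s \<otimes> g = \<one>" using g sG by (intro b_free) auto
  then have "s = \<one>" using g sG
    by (metis G.inv_closed G.inv_solve_left' G.m_assoc G.m_closed G.r_inv G.r_one)
  then show False using refl_neq_one[OF s] by simp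
qed

text \<open>The space is the sum of copies of the truncated model indexed by \<open>G\<close>, the copy of \<open>g\<close> belonging to the
  neighbourhood of the point \<open>g b\<close>. Functions and derivatives act by \<open>vd\<close> on each copy
  separately, in coordinates transported to \<open>b\<close>, while \<open>vT\<close> permutes the copies.\<close>

definition vd :: "('g \<Rightarrow> ((nat \<Rightarrow> nat) \<Rightarrow> 'k) endo) \<Rightarrow> ('g \<Rightarrow> (nat \<Rightarrow> nat) \<Rightarrow> 'k) endo" where
  "vd q = Endo (\<lambda>f g. if g \<in> carrier G then app (q g) (f g) else 0)"

definition vT :: "'g \<Rightarrow> ('g \<Rightarrow> (nat \<Rightarrow> nat) \<Rightarrow> 'k) endo" where
  "vT h = Endo (\<lambda>f g. if g \<in> carrier G then app (fS 1) (f (inv h \<otimes> g)) else 0)"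

definition vS :: "'k \<Rightarrow> ('g \<Rightarrow> (nat \<Rightarrow> nat) \<Rightarrow> 'k) endo" where "vS r = vd (\<lambda>_. fS r)"

lemma app_vd: "app (vd q) f = (\<lambda>g. if g \<in> carrier G then app (q g) (f g) else 0)"
  unfolding vd_def by (subst app_Endo) (auto simp: fun_eq_iff)

lemma app_vT: "app (vT h) f = (\<lambda>g. if g \<in> carrier G then app (fS 1) (f (inv h \<otimes> g)) else 0)"
  unfolding vT_def by (subst app_Endo) (auto simp: fun_eq_iff)

lemma vd_cong: "(\<And>g. g \<in> carrier G \<Longrightarrow> q g = q' g) \<Longrightarrow> vd q = vd q'"
  by (auto intro!: endo_eqI simp: app_vd fun_eq_iff)

lemma vd_mult: "vd q * vd q' = vd (\<lambda>g. q g * q' g)" and vd_add: "vd q + vd q' = vd (\<lambda>g. q g + q' g)"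
  and vd_diff: "vd q - vd q' = vd (\<lambda>g. q g - q' g)" and vd_neg: "- vd q = vd (\<lambda>g. - q g)"
  and vd_zero: "vd (\<lambda>g. 0) = 0"
  by (auto intro!: endo_eqI simp: app_vd fun_eq_iff)

lemma vd_sum: "(\<Sum>i\<in>I. vd (q i)) = vd (\<lambda>g. \<Sum>i\<in>I. q i g)"
  by (induction I rule: infinite_finite_induct) (auto simp: vd_zero vd_add)

lemma vT_vd:
  assumes h: "h \<in> carrier G" and "\<And>g. g \<in> carrier G \<Longrightarrow> fS 1 * q g = q g * fS 1"
  shows "vT h * vd q = vd (\<lambda>g. q (inv h \<otimes> g)) * vT h"
proof (intro endo_eqI ext)
  fix f g a
  show "app (vT h * vd q) f g a = app (vd (\<lambda>g. q (inv h \<otimes> g)) * vT h) f g a"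
  proof (cases "g \<in> carrier G")
    case True
    then have hg: "inv h \<otimes> g \<in> carrier G" using h by simp
    have "app (fS 1) (app (q (inv h \<otimes> g)) u) = app (q (inv h \<otimes> g)) (app (fS 1) u)" for u
      using assms(2)[OF hg] by (metis app_simps(6))
    then show ?thesis using True hg by (simp add: app_vd app_vT)
  qed (simp add: app_vd app_vT)
qed

lemma vT_mult:
  assumes "g \<in> carrier G" "h \<in> carrier G" shows "vT g * vT h = vT (g \<otimes> h)"
proof (intro endo_eqI ext)
  fix f k a
  have "app (fS 1) (app (fS 1) u) = app (fS 1) u" for u
    using fS1_fS[of 1] by (metis app_simps(6))
  then show "app (vT g * vT h) f k a = app (vT (g \<otimes> h)) f k a"
    using assms by (simp add: app_vT G.inv_mult_group G.m_assoc)
qed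

lemma vT_one: "vT \<one> = vS 1"
  by (intro endo_eqI ext) (auto simp: app_vT vS_def app_vd)

lemma vS_add: "vS (r + s) = vS r + vS s" and vS_mult: "vS (r * s) = vS r * vS s"
  by (simp_all add: vS_def vd_add vd_mult fS_add fS_mult)

lemma vS_neg: "vS (- r) = - vS r" by (simp add: vS_def fS_neg vd_neg)
lemma vS_comm: "vS r * vS s = vS s * vS r" by (simp add: vS_mult[symmetric] mult.commute)

lemma vT_vS: "h \<in> carrier G \<Longrightarrow> vT h * vS r = vS r * vT h"
  unfolding vS_def by (subst vT_vd) (auto simp: fS_comm)

lemma vS1_vT: "h \<in> carrier G \<Longrightarrow> vS 1 * vT h = vT h"
  using vT_mult[of \<one> h] by (simp add: vT_one)

definition vX :: "('v \<Rightarrow> 'k) \<Rightarrow> ('g \<Rightarrow> (nat \<Rightarrow> nat) \<Rightarrow> 'k) endo" where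
  "vX x = vd (\<lambda>g. fz (\<lambda>v. x (\<rho> g v)))"

definition vP :: "'v \<Rightarrow> ('g \<Rightarrow> (nat \<Rightarrow> nat) \<Rightarrow> 'k) endo" where
  "vP y = vd (\<lambda>g. fd (\<rho> (inv g) y))"

definition vW :: "('v \<Rightarrow> 'k) \<Rightarrow> ('g \<Rightarrow> (nat \<Rightarrow> nat) \<Rightarrow> 'k) endo" where
  "vW \<alpha> = vd (\<lambda>g. fw (\<lambda>v. \<alpha> (\<rho> g v)))"

text \<open>The reflection part of the Dunkl operator. It is a multiple of \<open>s\<close> where the classical operator
  has a multiple of \<open>1 - s\<close>: the missing summand is a function, which does not change commutators
  with functions.\<close>

definition vR :: "'v \<Rightarrow> ('g \<Rightarrow> (nat \<Rightarrow> nat) \<Rightarrow> 'k) endo" where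
  "vR y = (\<Sum>s\<in>refls. vS (c s * root s y) * (vW (root s) * vT s))"

definition vY :: "'v \<Rightarrow> ('g \<Rightarrow> (nat \<Rightarrow> nat) \<Rightarrow> 'k) endo" where "vY y = vP y + vR y"

text \<open>The linear functions that are invertible near all points of the orbit of \<open>b\<close>.\<close>

definition good :: "('v \<Rightarrow> 'k) \<Rightarrow> bool" where
  "good \<alpha> \<longleftrightarrow> \<alpha> \<in> dual \<and> (\<forall>g\<in>carrier G. \<alpha> (\<rho> g b) \<noteq> 0)"

lemma good_root: "s \<in> refls \<Longrightarrow> good (root s)"
  by (auto simp: good_def root_dual root_regular)

lemma vX_vS: "vX x * vS r = vS r * vX x" and vP_vS: "vP y * vS r = vS r * vP y"
  and vW_vS: "good \<alpha> \<Longrightarrow> vW \<alpha> * vS r = vS r * vW \<alpha>"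
  unfolding vX_def vP_def vW_def vS_def good_def
  by (auto simp: vd_mult fS_fz fS_fd intro!: vd_cong fw_fS[symmetric])

lemma vS1_vX: "vS 1 * vX x = vX x" and vS1_vP: "vS 1 * vP y = vP y" and vS1_vW: "good \<alpha> \<Longrightarrow> vS 1 * vW \<alpha> = vW \<alpha>"
  unfolding vX_def vP_def vW_def vS_def good_def
  by (auto simp: vd_mult fS1_fz fS1_fd intro!: vd_cong fS1_fw)

lemma vX_add: "vX (x + x') = vX x + vX x'" and vX_scale: "vX (\<lambda>v. r * x v) = vS r * vX x"
  by (simp_all add: vX_def vS_def vd_add vd_mult fz_add fz_scale)

lemma vP_add: "vP (y + y') = vP y + vP y'" and vP_scale: "vP (scale r y) = vS r * vP y"
  unfolding vP_def vS_def vd_add vd_mult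
  by (auto intro!: vd_cong simp: \<rho>_add \<rho>_scale fd_add fd_scale)

lemma vX_comm: "vX x * vX x' = vX x' * vX x" and vP_comm: "vP y * vP y' = vP y' * vP y"
  by (auto simp: vX_def vP_def vd_mult fz_comm fd_comm intro!: vd_cong)

lemma vW_vX: "good \<alpha> \<Longrightarrow> vW \<alpha> * vX x = vX x * vW \<alpha>"
  unfolding vX_def vW_def vd_mult good_def by (auto intro!: vd_cong fw_fz')

lemma vW_inverse: "good \<alpha> \<Longrightarrow> vW \<alpha> * vX \<alpha> = vS 1"
  unfolding vX_def vW_def vd_mult good_def vS_def by (auto intro!: vd_cong fw_fz)

lemma vP_vX: "x \<in> dual \<Longrightarrow> vP y * vX x = vX x * vP y + vS (x y)"
  unfolding vP_def vX_def vS_def vd_mult vd_add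
  by (rule vd_cong) (simp add: fd_fz dual_comp \<rho>_inv)

lemma vP_vW: "good \<alpha> \<Longrightarrow> vP y * vW \<alpha> = vW \<alpha> * vP y - vS (\<alpha> y) * (vW \<alpha> * vW \<alpha>)"
proof -
  assume a: "good \<alpha>"
  show ?thesis
    unfolding vP_def vW_def vS_def vd_mult vd_diff
  proof (rule vd_cong)
    fix g assume g: "g \<in> carrier G"
    have "fd (\<rho> (inv g) y) * fw (\<lambda>v. \<alpha> (\<rho> g v)) - fw (\<lambda>v. \<alpha> (\<rho> g v)) * fd (\<rho> (inv g) y) =
      - (fS (\<alpha> (\<rho> g (\<rho> (inv g) y))) * (fw (\<lambda>v. \<alpha> (\<rho> g v)) * fw (\<lambda>v. \<alpha> (\<rho> g v))))"
      by (rule fd_fw) (use a g in \<open>auto simp: good_def dual_comp\<close>)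
    then show "fd (\<rho> (inv g) y) * fw (\<lambda>v. \<alpha> (\<rho> g v)) = fw (\<lambda>v. \<alpha> (\<rho> g v)) * fd (\<rho> (inv g) y) -
       fS (\<alpha> y) * (fw (\<lambda>v. \<alpha> (\<rho> g v)) * fw (\<lambda>v. \<alpha> (\<rho> g v)))"
      using g by (simp add: \<rho>_inv algebra_simps)
  qed
qed

lemma vT_vX: "h \<in> carrier G \<Longrightarrow> vT h * vX x = vX (dact h x) * vT h"
proof -
  assume h: "h \<in> carrier G"
  have "vd (\<lambda>g. fz (\<lambda>v. x (\<rho> (inv h \<otimes> g) v))) = vX (dact h x)"
    unfolding vX_def by (rule vd_cong) (use h in \<open>simp add: dual_act_def \<rho>_mult\<close>)
  then show ?thesis using vT_vd[OF h, of "\<lambda>g. fz (\<lambda>v. x (\<rho> g v))"] by (simp add: vX_def fS_fz)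
qed

lemma vT_vP: "h \<in> carrier G \<Longrightarrow> vT h * vP y = vP (\<rho> h y) * vT h"
proof -
  assume h: "h \<in> carrier G"
  have "vd (\<lambda>g. fd (\<rho> (inv (inv h \<otimes> g)) y)) = vP (\<rho> h y)"
    unfolding vP_def by (rule vd_cong) (use h in \<open>simp add: G.inv_mult_group \<rho>_mult\<close>)
  then show ?thesis using vT_vd[OF h, of "\<lambda>g. fd (\<rho> (inv g) y)"] by (simp add: vP_def fS_fd)
qed

lemma vT_vW: "h \<in> carrier G \<Longrightarrow> good \<alpha> \<Longrightarrow> vT h * vW \<alpha> = vW (dact h \<alpha>) * vT h"
proof -
  assume h: "h \<in> carrier G" and a: "good \<alpha>"
  have "vd (\<lambda>g. fw (\<lambda>v. \<alpha> (\<rho> (inv h \<otimes> g) v))) = vW (dact h \<alpha>)"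
    unfolding vW_def by (rule vd_cong) (use h in \<open>simp add: dual_act_def \<rho>_mult\<close>)
  moreover have "vT h * vd (\<lambda>g. fw (\<lambda>v. \<alpha> (\<rho> g v))) = vd (\<lambda>g. fw (\<lambda>v. \<alpha> (\<rho> (inv h \<otimes> g) v))) * vT h"
    by (rule vT_vd[OF h]) (rule fw_fS, use a in \<open>auto simp: good_def\<close>)
  ultimately show ?thesis by (simp add: vW_def)
qed

lemma good_dact: "h \<in> carrier G \<Longrightarrow> good \<alpha> \<Longrightarrow> good (dact h \<alpha>)"
  unfolding good_def by (auto intro: dact_dual) (auto simp: dual_act_def \<rho>_mult[symmetric])

lemma vW_scale: "good \<alpha> \<Longrightarrow> \<kappa> \<noteq> 0 \<Longrightarrow> vS \<kappa> * vW (\<lambda>v. \<kappa> * \<alpha> v) = vW \<alpha>"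
  unfolding vW_def vS_def vd_mult good_def by (auto intro!: vd_cong fw_scale)

lemma vR_add: "vR (y + y') = vR y + vR y'"
proof -
  have "vS (c s * root s (y + y')) * (vW (root s) * vT s) =
    vS (c s * root s y) * (vW (root s) * vT s) + vS (c s * root s y') * (vW (root s) * vT s)" if "s \<in> refls" for s
    by (simp add: dual_add[OF root_dual[OF that]] distrib_left vS_add distrib_right)
  then show ?thesis unfolding vR_def sum.distrib[symmetric] by (intro sum.cong) auto
qed

lemma vR_scale: "vR (scale r y) = vS r * vR y"
proof -
  have "vS (c s * root s (scale r y)) * (vW (root s) * vT s) =
    vS r * (vS (c s * root s y) * (vW (root s) * vT s))" if "s \<in> refls" for s
    unfolding dual_scale[OF root_dual[OF that]] mult.assoc[symmetric] vS_mult[symmetric]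
    by (simp add: mult.commute mult.left_commute)
  then show ?thesis unfolding vR_def sum_distrib_left by (intro sum.cong) auto
qed

lemma vU_vS: "s \<in> refls \<Longrightarrow> (vW (root s) * vT s) * vS r = vS r * (vW (root s) * vT s)"
  by (simp add: mult.assoc vT_vS refl_carrier mult_shift[OF vW_vS[OF good_root]])

lemma vR_vS: "vR y * vS r = vS r * vR y"
  unfolding vR_def sum_distrib_left sum_distrib_right
  by (rule sum.cong[OF refl]) (simp add: mult.assoc vU_vS[unfolded mult.assoc] mult_shift[OF vS_comm])

lemma vS1_vR: "vS 1 * vR y = vR y"
  unfolding vR_def sum_distrib_left by (simp add: mult.assoc[symmetric] vS_mult[symmetric])

text \<open>Conjugation by \<open>h\<close> permutes the reflections, and the scalar by which it changes the root
  cancels against the inverse of the root.\<close>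

lemma vT_vR:
  assumes h: "h \<in> carrier G" shows "vT h * vR y = vR (\<rho> h y) * vT h"
proof -
  let ?f = "\<lambda>s. vS (c s * root s (\<rho> h y)) * (vW (root s) * vT s) * vT h"
  have "vT h * vR y = (\<Sum>s\<in>refls. ?f (h \<otimes> s \<otimes> inv h))"
    unfolding vR_def sum_distrib_left
  proof (rule sum.cong[OF refl])
    fix s assume s: "s \<in> refls"
    have sG: "s \<in> carrier G" using s by (rule refl_carrier)
    let ?s = "h \<otimes> s \<otimes> inv h"
    obtain \<kappa> where \<kappa>: "\<kappa> \<noteq> 0" "root ?s = (\<lambda>y. \<kappa> * dact h (root s) y)" using refl_conj[OF s h] by auto
    have "vT h * (vS (c s * root s y) * (vW (root s) * vT s)) =
        vS (c s * root s y) * (vW (dact h (root s)) * vT (h \<otimes> s))"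
      using h sG by (simp add: mult_shift[OF vT_vS[OF h]] mult_shift[OF vT_vW[OF h good_root[OF s]]] vT_mult)
    also have "vW (dact h (root s)) = vS \<kappa> * vW (root ?s)"
      unfolding \<kappa>(2) by (rule vW_scale[symmetric]) (use \<kappa> h good_dact good_root[OF s] in auto)
    also have "vS (c s * root s y) * (vS \<kappa> * vW (root ?s) * vT (h \<otimes> s)) =
        vS (c s * root s y * \<kappa>) * (vW (root ?s) * vT (h \<otimes> s))"
      by (simp add: vS_mult mult.assoc)
    also have "c s * root s y * \<kappa> = c ?s * root ?s (\<rho> h y)"
      using h by (simp add: \<kappa>(2) dual_act_def \<rho>_inv c_conj[OF h s])
    also have "vT (h \<otimes> s) = vT ?s * vT h"
      using h sG by (simp add: vT_mult G.m_assoc)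
    finally show "vT h * (vS (c s * root s y) * (vW (root s) * vT s)) = ?f ?s" by (simp add: mult.assoc)
  qed
  also have "\<dots> = (\<Sum>s\<in>refls. ?f s)"
  proof (rule sum.reindex_bij_witness[where i = "\<lambda>s. inv h \<otimes> s \<otimes> h" and j = "\<lambda>s. h \<otimes> s \<otimes> inv h"])
    fix s assume s: "s \<in> refls"
    have sG: "s \<in> carrier G" using s by (rule refl_carrier)
    show "h \<otimes> s \<otimes> inv h \<in> refls" by (rule refl_conj[OF s h])
    show "inv h \<otimes> s \<otimes> h \<in> refls" using refl_conj(1)[OF s, of "inv h"] h by simp
    show "inv h \<otimes> (h \<otimes> s \<otimes> inv h) \<otimes> h = s" "h \<otimes> (inv h \<otimes> s \<otimes> h) \<otimes> inv h = s"
      using h sG by (simp_all add: G.m_assoc[symmetric]) (simp_all add: G.m_assoc)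
  qed simp
  finally show ?thesis by (simp add: vR_def sum_distrib_right)
qed

text \<open>Since \<open>x\<close> and \<open>s x\<close> differ by a multiple of the root, moving \<open>vX x\<close> past \<open>s\<close> cancels the pole.\<close>

lemma vR_vX:
  assumes x: "x \<in> dual"
  shows "vR y * vX x = vX x * vR y - (\<Sum>s\<in>refls. vS (c s * (x - dact s x) y) * vT s)"
proof -
  have "vS (c s * root s y) * (vW (root s) * vT s) * vX x =
      vX x * (vS (c s * root s y) * (vW (root s) * vT s)) - vS (c s * (x - dact s x) y) * vT s" if s: "s \<in> refls" for s
  proof -
    have sG: "s \<in> carrier G" using s by (rule refl_carrier)
    define \<beta> where "\<beta> = - x (\<rho> (inv s) (coroot s))"
    have d: "x - dact s x = (\<lambda>y. \<beta> * root s y)" unfolding \<beta>_def by (rule refl_dual[OF s x])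
    have "x = dact s x + (\<lambda>y. \<beta> * root s y)" using d by (metis add.commute diff_add_cancel)
    then have "vX x = vX (dact s x) + vS \<beta> * vX (root s)" by (metis vX_add vX_scale)
    then have "vX (dact s x) = vX x - vS \<beta> * vX (root s)" by simp
    then have "vW (root s) * vX (dact s x) = vX x * vW (root s) - vS \<beta>"
      using vW_vX[OF good_root[OF s], of x] mult_shift[OF vW_vS[OF good_root[OF s], of \<beta>], of "vX (root s)"]
      by (simp add: right_diff_distrib vW_inverse[OF good_root[OF s]] vS_mult[symmetric])
    moreover have "vW (root s) * vT s * vX x = vW (root s) * vX (dact s x) * vT s"
      by (simp add: mult.assoc vT_vX[OF sG])
    ultimately have "vW (root s) * vT s * vX x = vX x * (vW (root s) * vT s) - vS \<beta> * vT s"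
      by (simp add: left_diff_distrib mult.assoc)
    then have "vS (c s * root s y) * (vW (root s) * vT s) * vX x =
      vS (c s * root s y) * (vX x * (vW (root s) * vT s)) - vS (c s * root s y * \<beta>) * vT s"
      by (simp add: mult.assoc right_diff_distrib vS_mult)
    then show ?thesis by (simp add: d mult_shift[OF vX_vS] mult.assoc mult.commute mult.left_commute)
  qed
  then show ?thesis
    unfolding vR_def sum_distrib_right sum_distrib_left sum_subtractf[symmetric] by (intro sum.cong) auto
qed

lemma vY_vX: "x \<in> dual \<Longrightarrow>
  vY y * vX x = vX x * vY y + vS (x y) - (\<Sum>s\<in>refls. vS (c s * (x - dact s x) y) * vT s)"
  by (simp add: vY_def distrib_left distrib_right vP_vX vR_vX algebra_simps)

lemma vT_vY: "h \<in> carrier G \<Longrightarrow> vT h * vY y = vY (\<rho> h y) * vT h"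
  by (simp add: vY_def distrib_left distrib_right vT_vP vT_vR)

lemma vY_add: "vY (y + y') = vY y + vY y'" and vY_scale: "vY (scale r y) = vS r * vY y"
  and vY_vS: "vY y * vS r = vS r * vY y" and vS1_vY: "vS 1 * vY y = vY y"
  by (simp_all add: vY_def vP_add vR_add vP_scale vR_scale vP_vS vR_vS distrib_left distrib_right vS1_vP vS1_vR)

end

context dunkl_data
begin

text \<open>The commutator of a derivative along \<open>y\<close> with the summand of \<open>s\<close> is \<open>root s y\<close> times this
  operator, which does not depend on \<open>y\<close>.\<close>

definition vE :: "'g \<Rightarrow> ('g \<Rightarrow> (nat \<Rightarrow> nat) \<Rightarrow> 'k) endo" where
  "vE s = vW (root s) * vP (coroot s) * vT s - vW (root s) * vW (root s) * vT s"

lemma coroot_expand: "s \<in> refls \<Longrightarrow> y = \<rho> s y + scale (root s y) (coroot s)"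
  using root_eq[of s y] by (metis add.commute diff_add_cancel)

lemma vP_vU:
  assumes s: "s \<in> refls"
  shows "vP y * (vW (root s) * vT s) - (vW (root s) * vT s) * vP y = vS (root s y) * vE s"
proof -
  have sG: "s \<in> carrier G" using s by (rule refl_carrier)
  note gr = good_root[OF s]
  have y: "vP y = vP (\<rho> s y) + vS (root s y) * vP (coroot s)"
    using coroot_expand[OF s, of y] vP_add vP_scale by metis
  have "(vW (root s) * vT s) * vP y = vW (root s) * vP (\<rho> s y) * vT s"
    by (simp add: mult.assoc vT_vP[OF sG])
  moreover have "vP y * (vW (root s) * vT s) =
      vW (root s) * vP y * vT s - vS (root s y) * (vW (root s) * vW (root s)) * vT s"
    by (simp add: mult.assoc[symmetric] vP_vW[OF gr] left_diff_distrib)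
  moreover have "vW (root s) * vP y = vW (root s) * vP (\<rho> s y) + vS (root s y) * (vW (root s) * vP (coroot s))"
    by (subst y) (simp add: distrib_left mult_shift[OF vW_vS[OF gr]])
  ultimately show ?thesis
    by (simp add: vE_def right_diff_distrib distrib_right mult.assoc)
qed

lemma vP_vR: "vP y * vR y' - vR y' * vP y = (\<Sum>s\<in>refls. vS (c s * root s y * root s y') * vE s)"
proof -
  have "vP y * (vS (c s * root s y') * (vW (root s) * vT s)) - vS (c s * root s y') * (vW (root s) * vT s) * vP y
     = vS (c s * root s y * root s y') * vE s" if s: "s \<in> refls" for s
  proof -
    have "vP y * (vS (c s * root s y') * (vW (root s) * vT s)) - vS (c s * root s y') * (vW (root s) * vT s) * vP y
      = vS (c s * root s y') * (vP y * (vW (root s) * vT s) - (vW (root s) * vT s) * vP y)"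
      by (simp add: mult_shift[OF vP_vS] right_diff_distrib mult.assoc)
    also have "\<dots> = vS (c s * root s y' * root s y) * vE s"
      unfolding vP_vU[OF s] by (simp add: vS_mult mult.assoc)
    finally show ?thesis by (simp add: mult.commute mult.left_commute)
  qed
  then show ?thesis
    unfolding vR_def sum_distrib_left sum_distrib_right sum_subtractf[symmetric] by (intro sum.cong) auto
qed

text \<open>The mixed terms are symmetric in \<open>y\<close> and \<open>y'\<close> by \<open>vP_vR\<close>, hence cancel.\<close>

lemma vY_commutator: "vY y * vY y' - vY y' * vY y = vR y * vR y' - vR y' * vR y"
proof -
  have "vP y * vR y' - vR y' * vP y = vP y' * vR y - vR y * vP y'"
    unfolding vP_vR by (simp add: mult.commute mult.left_commute)
  then show ?thesis using vP_comm[of y y'] by (simp add: vY_def algebra_simps)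
qed

lemma vY_vT:
  assumes s: "s \<in> refls"
  shows "vY y * vT s - vT s * vY y = vS (root s y) * (vY (coroot s) * vT s)"
proof -
  have sG: "s \<in> carrier G" using s by (rule refl_carrier)
  have "vY y = vY (\<rho> s y) + vS (root s y) * vY (coroot s)"
    using coroot_expand[OF s, of y] vY_add vY_scale by metis
  then have "vY y * vT s = vY (\<rho> s y) * vT s + vS (root s y) * (vY (coroot s) * vT s)"
    by (simp add: distrib_right mult.assoc)
  then show ?thesis by (simp add: vT_vY[OF sG])
qed

text \<open>By the Jacobi identity it suffices that the commutator of \<open>vY y'\<close> with \<open>[vY y, vX x]\<close> is symmetric in \<open>y\<close>
  and \<open>y'\<close>.\<close>

lemma vY_commutator_vX:
  assumes x: "x \<in> dual"
  shows "(vY y * vY y' - vY y' * vY y) * vX x = vX x * (vY y * vY y' - vY y' * vY y)"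
proof -
  define K where "K y = (\<Sum>s\<in>refls. vS (c s * (x - dact s x) y) * vT s)" for y
  have YX: "vY y * vX x = vX x * vY y + vS (x y) - K y" for y
    unfolding K_def by (rule vY_vX[OF x])
  have YK: "vY y' * K y - K y * vY y' = vY y * K y' - K y' * vY y" for y y'
  proof -
    define B where "B s = - x (\<rho> (inv s) (coroot s))" for s
    have "vY y' * K y - K y * vY y' = (\<Sum>s\<in>refls. vS (c s * B s * root s y * root s y') * (vY (coroot s) * vT s))" for y y'
      unfolding K_def sum_distrib_left sum_distrib_right sum_subtractf[symmetric]
    proof (rule sum.cong[OF refl])
      fix s assume s: "s \<in> refls"
      have "(x - dact s x) y = B s * root s y" unfolding refl_dual[OF s x] B_def ..
      then have "vY y' * (vS (c s * (x - dact s x) y) * vT s) - vS (c s * (x - dact s x) y) * vT s * vY y' =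
          vS (c s * B s * root s y) * (vY y' * vT s - vT s * vY y')"
        by (simp add: mult_shift[OF vY_vS] right_diff_distrib mult.assoc)
      then show "vY y' * (vS (c s * (x - dact s x) y) * vT s) - vS (c s * (x - dact s x) y) * vT s * vY y' =
          vS (c s * B s * root s y * root s y') * (vY (coroot s) * vT s)"
        by (simp add: vY_vT[OF s] vS_mult mult.assoc)
    qed
    then show ?thesis by (simp add: mult.commute mult.left_commute)
  qed
  have 1: "vY y * vY y' * vX x = vX x * (vY y * vY y') + vS (x y) * vY y' - K y * vY y' + vS (x y') * vY y - vY y * K y'" for y y'
  proof -
    have "vY y * vY y' * vX x = vY y * (vX x * vY y' + vS (x y') - K y')" by (simp add: mult.assoc YX)
    also have "\<dots> = vY y * vX x * vY y' + vY y * vS (x y') - vY y * K y'"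
      by (simp add: distrib_left right_diff_distrib mult.assoc)
    also have "vY y * vX x * vY y' = vX x * (vY y * vY y') + vS (x y) * vY y' - K y * vY y'"
      by (simp add: YX distrib_right left_diff_distrib mult.assoc)
    finally show ?thesis by (simp add: vY_vS)
  qed
  show ?thesis
    unfolding left_diff_distrib right_diff_distrib 1 using YK[of y' y] by (simp add: algebra_simps)
qed

lemma fz_diff: "fz (\<lambda>v. x v - x' v) = fz x - fz x'"
  using fz_add[of "\<lambda>v. x v - x' v" x'] by simp

lemma vd_vT_independent:
  assumes sum: "(\<Sum>k\<in>carrier G. vd (r k) * vT k) = 0" and k: "k \<in> carrier G" and g: "g \<in> carrier G"
  shows "r k g * fS 1 = 0"
proof (rule endo_eqI)
  fix u :: "(nat \<Rightarrow> nat) \<Rightarrow> 'k"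
  define f where "f = (\<lambda>g'. if g' = inv k \<otimes> g then u else 0)"
  have "(\<Sum>j\<in>carrier G. app (r j g) (app (fS 1) (f (inv j \<otimes> g)))) = 0"
  proof -
    have "app (\<Sum>k\<in>carrier G. vd (r k) * vT k) f g = (\<Sum>j\<in>carrier G. app (vd (r j) * vT j) f g)"
    proof -
      have "(\<Sum>i\<in>I. h i) g = (\<Sum>i\<in>I. h i g)" for h :: "'g \<Rightarrow> 'g \<Rightarrow> (nat \<Rightarrow> nat) \<Rightarrow> 'k" and I
        by (induction I rule: infinite_finite_induct) auto
      then show ?thesis unfolding app_sum by simp
    qed
    also have "\<dots> = (\<Sum>j\<in>carrier G. app (r j g) (app (fS 1) (f (inv j \<otimes> g))))"
      using g by (simp add: app_vd app_vT)
    finally show ?thesis by (simp add: sum)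
  qed
  moreover have "f (inv j \<otimes> g) = (if j = k then u else 0)" if "j \<in> carrier G" for j
    using that k g by (auto simp: f_def)
  then have "(\<Sum>j\<in>carrier G. app (r j g) (app (fS 1) (f (inv j \<otimes> g)))) =
      (\<Sum>j\<in>carrier G. if j = k then app (r k g) (app (fS 1) u) else 0)"
    by (intro sum.cong) auto
  ultimately show "app (r k g * fS 1) u = app 0 u" using k finG by simp
qed

text \<open>The commutator of two Dunkl operators has no derivative terms, hence is a sum of functions
  times group elements; as it commutes with all functions and the orbit of \<open>b\<close> is free, only the
  unit element can contribute, and there the contributions of \<open>s\<close> and its inverse are symmetric.\<close>

lemma vY_comm: "vY y * vY y' = vY y' * vY y"
proof -
  define C where "C = vY y * vY y' - vY y' * vY y"
  define m where "m = (\<lambda>(s, s'). c s * c s' * (root s y * root s' y' - root s y' * root s' y))"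
  define q where "q = (\<lambda>(s, s') g. fw (\<lambda>v. root s (\<rho> g v)) * fw (\<lambda>v. dact s (root s') (\<rho> g v)))"
  let ?P = "refls \<times> refls"
  define pairs where "pairs k = {t \<in> ?P. (case t of (s, s') \<Rightarrow> s \<otimes> s') = k}" for k
  \<comment> \<open>The function that multiplies the group element \<open>k\<close> in the commutator, on the copy of \<open>g\<close>.\<close>
  define Q where "Q k g = (\<Sum>t\<in>pairs k. fS (m t) * q t g)" for k g
  have UU: "(vW (root s) * vT s) * (vW (root s') * vT s') = vd (q (s, s')) * vT (s \<otimes> s')"
    if "s \<in> refls" "s' \<in> refls" for s s'
  proof -
    have "(vW (root s) * vT s) * (vW (root s') * vT s') = vW (root s) * vW (dact s (root s')) * (vT s * vT s')"
      unfolding mult.assoc mult_shift[OF vT_vW[OF refl_carrier[OF that(1)] good_root[OF that(2)]]] ..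
    also have "vT s * vT s' = vT (s \<otimes> s')" using that by (intro vT_mult refl_carrier)
    finally show ?thesis by (simp add: vW_def vd_mult q_def)
  qed
  have RR: "vR y * vR y' = (\<Sum>(s, s')\<in>?P. vS (c s * root s y * (c s' * root s' y')) * ((vW (root s) * vT s) * (vW (root s') * vT s')))" for y y'
    unfolding vR_def sum_product sum.cartesian_product
  proof (rule sum.cong[OF refl], clarify)
    fix s s' assume s: "s \<in> refls" "s' \<in> refls"
    show "vS (c s * root s y) * (vW (root s) * vT s) * (vS (c s' * root s' y') * (vW (root s') * vT s')) =
      vS (c s * root s y * (c s' * root s' y')) * (vW (root s) * vT s * (vW (root s') * vT s'))"
      unfolding vS_mult[of "c s * root s y"] mult.assoc[of _ "vW (root s) * vT s"]
        mult_shift[OF vU_vS[OF s(1)]] by (simp add: mult.assoc)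
  qed
  have swap: "(\<Sum>(s, s')\<in>?P. vS (c s * root s y' * (c s' * root s' y)) * ((vW (root s) * vT s) * (vW (root s') * vT s')))
     = vR y' * vR y" by (rule RR[symmetric])
  have "C = (\<Sum>t\<in>?P. vd (\<lambda>g. fS (m t) * q t g) * vT (case t of (s, s') \<Rightarrow> s \<otimes> s'))"
    unfolding C_def vY_commutator RR sum_subtractf[symmetric]
  proof (rule sum.cong[OF refl], clarify)
    fix s s' assume s: "s \<in> refls" "s' \<in> refls"
    have "m (s, s') = c s * root s y * (c s' * root s' y') - c s * root s y' * (c s' * root s' y)"
      by (simp add: m_def algebra_simps)
    then have "vS (m (s, s')) = vS (c s * root s y * (c s' * root s' y')) - vS (c s * root s y' * (c s' * root s' y))"
      by (metis vS_add vS_neg diff_conv_add_uminus)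
    moreover have "vS (m (s, s')) * (vW (root s) * vT s * (vW (root s') * vT s')) =
        vd (\<lambda>g. fS (m (s, s')) * q (s, s') g) * vT (s \<otimes> s')"
      unfolding UU[OF s] unfolding mult.assoc[symmetric] by (simp add: vS_def vd_mult)
    ultimately show "vS (c s * root s y * (c s' * root s' y')) * (vW (root s) * vT s * (vW (root s') * vT s')) -
        vS (c s * root s y' * (c s' * root s' y)) * (vW (root s) * vT s * (vW (root s') * vT s')) =
        vd (\<lambda>g. fS (m (s, s')) * q (s, s') g) * vT (s \<otimes> s')"
      by (simp only: left_diff_distrib)
  qed
  also have "\<dots> = (\<Sum>k\<in>carrier G. \<Sum>t\<in>pairs k. vd (\<lambda>g. fS (m t) * q t g) * vT (case t of (s, s') \<Rightarrow> s \<otimes> s'))"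
    unfolding pairs_def by (rule sum.group[symmetric]) (use finite_refl finG refl_carrier in auto)
  also have "\<dots> = (\<Sum>k\<in>carrier G. vd (Q k) * vT k)"
  proof (rule sum.cong[OF refl])
    fix k
    have "(\<Sum>t\<in>pairs k. vd (\<lambda>g. fS (m t) * q t g) * vT (case t of (s, s') \<Rightarrow> s \<otimes> s')) =
        (\<Sum>t\<in>pairs k. vd (\<lambda>g. fS (m t) * q t g) * vT k)"
      by (rule sum.cong) (auto simp: pairs_def)
    also have "\<dots> = vd (Q k) * vT k" unfolding Q_def sum_distrib_right[symmetric] vd_sum ..
    finally show "(\<Sum>t\<in>pairs k. vd (\<lambda>g. fS (m t) * q t g) * vT (case t of (s, s') \<Rightarrow> s \<otimes> s')) = vd (Q k) * vT k" .
  qed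
  finally have C: "C = (\<Sum>k\<in>carrier G. vd (Q k) * vT k)" .
  have qfz: "q t g * fz x = fz x * q t g" and qS: "q t g * fS 1 = q t g"
    if t: "t \<in> ?P" and g: "g \<in> carrier G" for t g x
  proof -
    obtain s s' where tt: "t = (s, s')" "s \<in> refls" "s' \<in> refls" using t by auto
    have nz: "root s (\<rho> g b) \<noteq> 0" "dact s (root s') (\<rho> g b) \<noteq> 0"
      using g tt good_dact[OF refl_carrier good_root] good_root by (auto simp: good_def)
    show "q t g * fz x = fz x * q t g"
      unfolding tt q_def prod.case by (rule central_mult[symmetric]) (rule fw_fz'[symmetric], rule nz)+
    show "q t g * fS 1 = q t g"
      unfolding tt q_def prod.case by (simp add: mult.assoc fw_fS1[of "\<lambda>v. dact s (root s') (\<rho> g v)", OF nz(2)])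
  qed
  have pairsP: "t \<in> ?P" if "t \<in> pairs k" for t k using that by (auto simp: pairs_def)
  have Qfz: "Q k g * fz x = fz x * Q k g" if "g \<in> carrier G" for k g x
    unfolding Q_def sum_distrib_left sum_distrib_right
    by (rule sum.cong[OF refl]) (simp add: mult.assoc qfz[OF pairsP that] mult_shift[OF fS_fz])
  have QS: "Q k g * fS 1 = Q k g" if "g \<in> carrier G" for k g
    unfolding Q_def sum_distrib_right
    by (rule sum.cong[OF refl]) (simp add: mult.assoc qS[OF pairsP that])
  have Q0: "Q k g = 0" if k: "k \<in> carrier G" and g: "g \<in> carrier G" for k g
  proof (cases "k = \<one>")
    case True
    have "m t = 0" if t: "t \<in> pairs k" for t
    proof -
      obtain s s' where tt: "t = (s, s')" "s \<in> refls" "s' \<in> refls" "s \<otimes> s' = \<one>"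
        using t True by (auto simp: pairs_def)
      then have "s' = inv s" using G.inv_equality[of s' s] G.inv_comm refl_carrier by metis
      then obtain \<kappa> where "root s' = (\<lambda>y. \<kappa> * root s y)" using refl_inv[OF tt(2)] by auto
      then show ?thesis by (simp add: tt m_def)
    qed
    then show ?thesis by (simp add: Q_def fS_zero)
  next
    case False
    have "\<rho> (inv k) (\<rho> g b) \<noteq> \<rho> g b"
    proof
      assume "\<rho> (inv k) (\<rho> g b) = \<rho> g b"
      then have "\<rho> (inv g \<otimes> inv k \<otimes> g) b = b" using k g by (simp add: \<rho>_mult \<rho>_inv)
      then have "inv g \<otimes> inv k \<otimes> g = \<one>" using k g by (intro b_free) auto
      then have "g \<otimes> (inv g \<otimes> inv k \<otimes> g) \<otimes> inv g = g \<otimes> inv g" using g by simp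
      moreover have "g \<otimes> (inv g \<otimes> inv k \<otimes> g) \<otimes> inv g = inv k"
        using k g by (simp add: G.m_assoc) (simp add: G.m_assoc[symmetric])
      ultimately have "inv k = \<one>" using g by simp
      then show False using False k by (metis G.inv_inv G.inv_one)
    qed
    moreover have "\<exists>i<n. \<epsilon> i u \<noteq> 0" if "u \<noteq> 0" for u
    proof (rule ccontr)
      assume "\<not> ?thesis"
      then have "(\<Sum>i<n. scale (\<epsilon> i u) (e i)) = 0" by (intro sum.neutral) auto
      then show False using expand[of u] that by simp
    qed
    ultimately obtain i where i: "i < n" "\<epsilon> i (\<rho> (inv k) (\<rho> g b) - \<rho> g b) \<noteq> 0" by force
    define x where "x = \<epsilon> i"
    have x: "x \<in> dual" unfolding x_def by (rule \<epsilon>_dual[OF i(1)])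
    define z where "z k g = (\<lambda>v. dact k x (\<rho> g v) - x (\<rho> g v))" for k g
    \<comment> \<open>As \<open>x\<close> separates the two orbit points, \<open>fz (z k g)\<close> is invertible.\<close>
    have "(\<Sum>k\<in>carrier G. vd (\<lambda>g. Q k g * fz (z k g)) * vT k) = C * vX x - vX x * C"
      unfolding C sum_distrib_left sum_distrib_right sum_subtractf[symmetric]
    proof (rule sum.cong[OF refl])
      fix k assume k: "k \<in> carrier G"
      have "vd (Q k) * vT k * vX x - vX x * (vd (Q k) * vT k) = (vd (Q k) * vX (dact k x) - vX x * vd (Q k)) * vT k"
        by (simp add: mult.assoc vT_vX[OF k] left_diff_distrib)
      also have "vd (Q k) * vX (dact k x) - vX x * vd (Q k) = vd (\<lambda>g. Q k g * fz (z k g))"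
        unfolding vX_def vd_mult vd_diff by (rule vd_cong) (simp add: z_def fz_diff right_diff_distrib Qfz)
      finally show "vd (\<lambda>g. Q k g * fz (z k g)) * vT k = vd (Q k) * vT k * vX x - vX x * (vd (Q k) * vT k)" ..
    qed
    also have "\<dots> = 0" unfolding C_def using vY_commutator_vX[OF x] by simp
    finally have "Q k g * fz (z k g) * fS 1 = 0" by (rule vd_vT_independent[OF _ k g])
    then have "Q k g * fz (z k g) = 0" by (simp add: mult.assoc fS_fz[symmetric] fS1_fz)
    moreover have nz: "z k g b \<noteq> 0" using i(2) dual_diff[OF x] by (simp add: z_def dual_act_def x_def)
    ultimately have "Q k g * (fz (z k g) * fw (z k g)) = 0" by (simp add: mult.assoc[symmetric])
    then show ?thesis using fz_fw[of "z k g", OF nz] QS[OF g] by simp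
  qed
  have "C = 0"
    unfolding C using Q0 vd_cong[of "Q _" "\<lambda>_. 0"] by (intro sum.neutral) (simp add: vd_zero)
  then show ?thesis by (simp add: C_def)
qed

lemma cherednik_system_dunkl: "cherednik_system G scale \<rho> c n e \<epsilon> vS vX vY vT"
proof
  show "vY y * vX x = vX x * vY y + vS (x y) - (\<Sum>s\<in>refls. vS (c s * (x - dact s x) y) * vT s)"
    if "x \<in> dual" for x y by (rule vY_vX[OF that])
qed (auto intro: vS_add vS_mult vS1_vX vS1_vY vS1_vT vX_vS vY_vS vT_vS vX_add vX_scale vY_add vY_scale
    vT_mult vT_one vT_vX vT_vY vX_comm vY_comm)

end

section \<open>The Dunkl representations have dimension \<open>p\<^sup>n |G|\<close>\<close>

lemma sum_fun_apply: "(\<Sum>i\<in>I. f i) x = (\<Sum>i\<in>I. f i x)"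
  by (induction I rule: infinite_finite_induct) auto

context dunkl_data
begin

definition point :: "'g \<Rightarrow> (nat \<Rightarrow> nat) \<Rightarrow> 'g \<Rightarrow> (nat \<Rightarrow> nat) \<Rightarrow> 'k" where
  "point g a = (\<lambda>g' a'. if g' = g \<and> a' = a then 1 else 0)"

lemma app_vS: "app (vS r) f = (\<lambda>g a. if g \<in> carrier G \<and> a \<in> Box then r * f g a else 0)"
  by (auto simp: vS_def app_vd app_fS fun_eq_iff)

lemma card_Box: "finite Box \<and> card Box = p ^ n"
proof -
  let ?f = "\<lambda>a i. if i < n then a i else (0::nat)" and ?P = "PiE {..<n} (\<lambda>_. {..<p})"
  have "Box = ?f ` ?P"
  proof (intro equalityI subsetI)
    fix a assume a: "a \<in> Box"
    then have "restrict a {..<n} \<in> ?P" by (auto simp: Box_def)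
    moreover have "a = ?f (restrict a {..<n})" using a by (auto simp: Box_def fun_eq_iff)
    ultimately show "a \<in> ?f ` ?P" by (intro image_eqI[of a ?f "restrict a {..<n}" ?P])
  next
    fix a assume "a \<in> ?f ` ?P"
    then obtain a' where a': "a' \<in> ?P" "a = ?f a'" by (rule imageE)
    have "a' i < p" if "i < n" for i using PiE_mem[OF a'(1), of i] that by simp
    then show "a \<in> Box" unfolding Box_def a'(2) by simp
  qed
  moreover have "inj_on ?f ?P"
  proof (rule inj_onI)
    fix a a' assume a: "a \<in> ?P" "a' \<in> ?P" and eq: "?f a = ?f a'"
    have "a i = a' i" if "i \<in> {..<n}" for i using fun_cong[OF eq, of i] that by simp
    then show "a = a'" using a by (intro PiE_ext) auto
  qed
  ultimately show ?thesis by (simp add: card_image card_PiE finite_PiE)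
qed

lemma vS1_expand: "app (vS 1) f = (\<Sum>j\<in>carrier G \<times> Box. app (vS (f (fst j) (snd j))) (point (fst j) (snd j)))"
proof (intro ext)
  fix g a
  let ?J = "carrier G \<times> Box"
  have fin: "finite ?J" using finG card_Box by auto
  have "(\<Sum>j\<in>?J. app (vS (f (fst j) (snd j))) (point (fst j) (snd j))) g a =
      (\<Sum>j\<in>?J. if j = (g, a) then f g a else 0)"
    unfolding sum_fun_apply by (intro sum.cong) (auto simp: app_vS point_def)
  then show "app (vS 1) f g a = (\<Sum>j\<in>?J. app (vS (f (fst j) (snd j))) (point (fst j) (snd j))) g a"
    using fin by (simp add: app_vS sum.delta)
qed

text \<open>More than \<open>N\<^sup>2\<close> operators that are linear over the scalars are dependent, where \<open>N = p\<^sup>n |G|\<close> is the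
  number of points of \<open>G \<times> Box\<close>.\<close>

lemma Capelli_dunkl:
  assumes m: "(p ^ n * card (carrier G)) * (p ^ n * card (carrier G)) < m"
    and c: "\<And>i r. a i * vS r = vS r * a i" "\<And>i. a i * vS 1 = a i"
  shows "cap m a = 0"
proof -
  let ?J = "carrier G \<times> Box"
  have fin: "finite ?J" and cardJ: "card ?J = p ^ n * card (carrier G)"
    using finG card_Box by (auto simp: card_cartesian_product)
  interpret U: domain_subset "UNIV :: 'k set" by (rule domain_subset_UNIV)
  define B where "B i = (\<lambda>(j, j'). app (a (Suc (2 * i))) (point (fst j) (snd j)) (fst j') (snd j'))" for i
  have "\<exists>l. (\<forall>i\<in>{..<m}. l i \<in> UNIV) \<and> (\<exists>i\<in>{..<m}. l i \<noteq> 0) \<and> (\<forall>j\<in>?J \<times> ?J. (\<Sum>i<m. l i * B i j) = 0)"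
    by (rule U.homogeneous_system) (use fin m in \<open>auto simp: card_cartesian_product[of ?J ?J] cardJ\<close>)
  then obtain l i0 where i0: "i0 < m" "l i0 \<noteq> 0" and l: "\<forall>j\<in>?J \<times> ?J. (\<Sum>i<m. l i * B i j) = 0"
    by auto
  have point0: "(\<Sum>i<m. app (vS (l i)) (app (a (Suc (2 * i))) (point (fst j) (snd j)))) = 0" if j: "j \<in> ?J" for j
  proof (intro ext)
    fix g b
    show "(\<Sum>i<m. app (vS (l i)) (app (a (Suc (2 * i))) (point (fst j) (snd j)))) g b = 0 g b"
    proof (cases "(g, b) \<in> ?J")
      case True
      then have "(\<Sum>i<m. l i * B i (j, (g, b))) = 0" using j l by blast
      then show ?thesis using True by (simp add: sum_fun_apply app_vS B_def)
    next
      case False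
      then show ?thesis by (auto simp: sum_fun_apply app_vS intro!: sum.neutral)
    qed
  qed
  have "(\<Sum>i<m. vS (l i) * a (Suc (2 * i))) = 0"
  proof (rule endo_eqI)
    fix f
    have "app (\<Sum>i<m. vS (l i) * a (Suc (2 * i))) f = (\<Sum>i<m. app (vS (l i)) (app (a (Suc (2 * i))) (app (vS 1) f)))"
      unfolding app_sum using c(2) by (metis (no_types, lifting) app_simps(6))
    also have "\<dots> = (\<Sum>i<m. \<Sum>j\<in>?J. app (vS (l i) * a (Suc (2 * i)) * vS (f (fst j) (snd j))) (point (fst j) (snd j)))"
      unfolding vS1_expand by (simp add: app_sum_right)
    also have "\<dots> = (\<Sum>i<m. \<Sum>j\<in>?J. app (vS (f (fst j) (snd j))) (app (vS (l i)) (app (a (Suc (2 * i))) (point (fst j) (snd j)))))"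
    proof (intro sum.cong refl)
      fix i j
      have "vS (l i) * a (Suc (2 * i)) * vS (f (fst j) (snd j)) = vS (f (fst j) (snd j)) * (vS (l i) * a (Suc (2 * i)))"
        by (simp add: mult.assoc c(1) mult_shift[OF vS_comm])
      then show "app (vS (l i) * a (Suc (2 * i)) * vS (f (fst j) (snd j))) (point (fst j) (snd j)) =
        app (vS (f (fst j) (snd j))) (app (vS (l i)) (app (a (Suc (2 * i))) (point (fst j) (snd j))))"
        by (simp only: app_simps)
    qed
    also have "\<dots> = (\<Sum>j\<in>?J. app (vS (f (fst j) (snd j))) (\<Sum>i<m. app (vS (l i)) (app (a (Suc (2 * i))) (point (fst j) (snd j)))))"
      by (subst sum.swap) (simp add: app_sum_right)
    also have "\<dots> = 0" using point0 by (intro sum.neutral) auto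
    finally show "app (\<Sum>i<m. vS (l i) * a (Suc (2 * i))) f = app 0 f" by simp
  qed
  from cap_dependent[OF this _ i0(1)] c(1) have "vS (l i0) * cap m a = 0" by auto
  then have "vS (1 / l i0) * (vS (l i0) * cap m a) = 0" by simp
  then have "vS 1 * cap m a = 0" using i0 by (simp add: mult.assoc[symmetric] vS_mult[symmetric])
  moreover have "vS 1 * cap m a = cap m a"
    using cap_mult_left[of 0 m "vS 1" a "a 0"] c(1)[of _ 1] c(2)[of 0] by simp
  ultimately show ?thesis by simp
qed

section \<open>Leading terms of the Dunkl representations\<close>

text \<open>The part of \<open>vY y\<close> that depends on the shift of the derivatives.\<close>

definition vL :: "(nat \<Rightarrow> 'k) \<Rightarrow> 'v \<Rightarrow> ('g \<Rightarrow> (nat \<Rightarrow> nat) \<Rightarrow> 'k) endo" where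
  "vL \<mu> y = vd (\<lambda>g. fS (\<Sum>i<n. \<epsilon> i (\<rho> (inv g) y) * \<mu> i))"

lemma fS_sum: "fS (\<Sum>i\<in>I. f i) = (\<Sum>i\<in>I. fS (f i))"
  by (induction I rule: infinite_finite_induct) (auto simp: fS_zero fS_add)

abbreviation "vY_at \<equiv> dunkl_data.vY G scale \<rho> c n e \<epsilon> p b"

lemma vY_at_shift: "vY_at l y = vY_at (\<lambda>_. 0) y + vL l y"
proof -
  interpret D: dunkl_data G scale \<rho> c n e \<epsilon> p b l by unfold_locales
  interpret D0: dunkl_data G scale \<rho> c n e \<epsilon> p b "\<lambda>_. 0" by unfold_locales
  have "D.fd y = D0.fd y + fS (\<Sum>i<n. \<epsilon> i y * l i)" for y
    by (simp add: D.fd_def D0.fd_def distrib_left sum.distrib fS_zero fS_sum fS_mult)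
  then have "D.vP y = D0.vP y + vL l y" by (simp add: D.vP_def D0.vP_def vL_def vd_add)
  then show ?thesis by (simp add: D.vY_def D0.vY_def algebra_simps)
qed

lemma vL_scale: "vL (\<lambda>i. r * \<mu> i) y = vS r * vL \<mu> y"
  unfolding vL_def vS_def vd_mult fS_mult[symmetric] by (simp add: sum_distrib_left mult.left_commute)

lemma vL_vS: "vL \<mu> y * vS r = vS r * vL \<mu> y"
  unfolding vL_def vS_def vd_mult by (simp add: fS_comm)

abbreviation "origin \<equiv> point \<one> (\<lambda>_. 0)"

lemma vL_origin: "i < n \<Longrightarrow> app (vL \<mu> (e i)) origin = app (vS (\<mu> i)) origin"
proof -
  assume i: "i < n"
  have "(\<Sum>j<n. \<epsilon> j (e i) * \<mu> j) = (\<Sum>j<n. if j = i then \<mu> i else 0)"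
    using i by (intro sum.cong) (auto simp: \<epsilon>_e)
  then have "(\<Sum>j<n. \<epsilon> j (\<rho> (inv \<one>) (e i)) * \<mu> j) = \<mu> i" using i by (simp add: \<rho>_one)
  then show ?thesis by (auto simp: vL_def vS_def app_vd app_fS point_def fun_eq_iff)
qed

lemma vX_origin: "app (vX x) origin = app (vS (x b)) origin"
proof (intro ext)
  fix g a
  have t: "app (fS r * ft i) (origin \<one>) a = 0" for r i
    by (auto simp: app_fS app_ft point_def fun_eq_iff dest: spec[of _ i])
  have "app (fz (\<lambda>v. x (\<rho> \<one> v))) (origin \<one>) a = app (fS (x b)) (origin \<one>) a"
    using t by (simp add: fz_def \<rho>_one app_sum sum_fun_apply)
  moreover have "origin g = 0" if "g \<noteq> \<one>" using that by (auto simp: point_def fun_eq_iff)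
  ultimately show "app (vX x) origin g a = app (vS (x b)) origin g a"
    by (cases "g = \<one>") (auto simp: vX_def vS_def app_vd)
qed

lemma xmon_origin:
  assumes "set xs \<subseteq> {..<n}"
  shows "app (prod_list (map (\<lambda>i. vX (\<epsilon> i)) xs)) (app (vS r) origin) = app (vS (r * (\<Prod>i\<leftarrow>xs. \<epsilon> i b))) origin"
  using assms
proof (induction xs)
  case (Cons i xs)
  have "app (vX (\<epsilon> i)) (app (vS s) origin) = app (vS (s * \<epsilon> i b)) origin" for s
  proof -
    have "app (vX (\<epsilon> i)) (app (vS s) origin) = app (vS s) (app (vX (\<epsilon> i)) origin)"
      using vX_vS by (metis app_simps(6))
    then show ?thesis unfolding vX_origin vS_mult by simp
  qed
  then show ?case using Cons by (simp add: mult.assoc) (simp add: mult.commute)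
qed simp

text \<open>For the shift \<open>\<sigma> \<mu>\<close>, a monomial in the \<open>y\<^sub>i\<close> applied to the point mass is a polynomial in \<open>\<sigma>\<close>, whose leading
  coefficient \<open>w (length ys)\<close> sees only the shifts and not the derivatives and reflections.\<close>

lemma ymon_origin:
  assumes "set ys \<subseteq> {..<n}"
  shows "\<exists>w. w (length ys) = app (vS (\<Prod>i\<leftarrow>ys. \<mu> i)) origin \<and>
    (\<forall>\<sigma>. app (prod_list (map (\<lambda>i. vY_at (\<lambda>i. \<sigma> * \<mu> i) (e i)) ys)) (app (vS 1) origin) =
      (\<Sum>j\<le>length ys. app (vS (\<sigma> ^ j)) (w j)))"
  using assms
proof (induction ys)
  case Nil
  show ?case by (intro exI[of _ "\<lambda>_. app (vS 1) origin"]) (auto simp: app_vS fun_eq_iff)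
next
  case (Cons i ys)
  then obtain w where w: "w (length ys) = app (vS (\<Prod>i\<leftarrow>ys. \<mu> i)) origin"
    "\<And>\<sigma>. app (prod_list (map (\<lambda>i. vY_at (\<lambda>i. \<sigma> * \<mu> i) (e i)) ys)) (app (vS 1) origin) =
      (\<Sum>j\<le>length ys. app (vS (\<sigma> ^ j)) (w j))" by auto
  interpret D0: dunkl_data G scale \<rho> c n e \<epsilon> p b "\<lambda>_. 0" by unfold_locales
  define w' where "w' j = (if j \<le> length ys then app (D0.vY (e i)) (w j) else 0) +
     (if j = 0 then 0 else app (vL \<mu> (e i)) (w (j - 1)))" for j
  have "w' (Suc (length ys)) = app (vL \<mu> (e i)) (app (vS (\<Prod>i\<leftarrow>ys. \<mu> i)) origin)"
    by (simp add: w'_def w(1))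
  also have "\<dots> = app (vS (\<Prod>i\<leftarrow>ys. \<mu> i)) (app (vL \<mu> (e i)) origin)"
    using vL_vS by (metis app_simps(6))
  also have "\<dots> = app (vS (\<Prod>i\<leftarrow>i # ys. \<mu> i)) origin"
    using Cons.prems by (simp add: vL_origin) (simp add: app_simps(6)[symmetric] vS_mult[symmetric] mult.commute del: app_simps)
  finally have top: "w' (length (i # ys)) = app (vS (\<Prod>i\<leftarrow>i # ys. \<mu> i)) origin" by simp
  have "app (prod_list (map (\<lambda>i. vY_at (\<lambda>i. \<sigma> * \<mu> i) (e i)) (i # ys))) (app (vS 1) origin) =
      (\<Sum>j\<le>length (i # ys). app (vS (\<sigma> ^ j)) (w' j))" for \<sigma>
  proof -
    let ?L = "length ys"
    have "app (prod_list (map (\<lambda>i. vY_at (\<lambda>i. \<sigma> * \<mu> i) (e i)) (i # ys))) (app (vS 1) origin) =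
        app (vY_at (\<lambda>i. \<sigma> * \<mu> i) (e i)) (\<Sum>j\<le>?L. app (vS (\<sigma> ^ j)) (w j))"
      using w(2)[of \<sigma>] by simp
    also have "\<dots> = (\<Sum>j\<le>?L. app (D0.vY (e i)) (app (vS (\<sigma> ^ j)) (w j)))
        + (\<Sum>j\<le>?L. app (vS \<sigma> * vL \<mu> (e i)) (app (vS (\<sigma> ^ j)) (w j)))"
      by (subst vY_at_shift) (simp add: vL_scale app_sum_right sum.distrib)
    also have "(\<Sum>j\<le>?L. app (D0.vY (e i)) (app (vS (\<sigma> ^ j)) (w j))) =
        (\<Sum>j\<le>?L. app (vS (\<sigma> ^ j)) (app (D0.vY (e i)) (w j)))"
      using D0.vY_vS by (metis (no_types) app_simps(6))
    also have "\<dots> = (\<Sum>j\<le>Suc ?L. app (vS (\<sigma> ^ j)) (if j \<le> ?L then app (D0.vY (e i)) (w j) else 0))"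
      by simp
    also have "(\<Sum>j\<le>?L. app (vS \<sigma> * vL \<mu> (e i)) (app (vS (\<sigma> ^ j)) (w j))) =
        (\<Sum>j\<le>?L. app (vS (\<sigma> ^ Suc j)) (app (vL \<mu> (e i)) (w j)))"
    proof (rule sum.cong[OF refl])
      fix j
      have "vS \<sigma> * vL \<mu> (e i) * vS (\<sigma> ^ j) = vS (\<sigma> ^ Suc j) * vL \<mu> (e i)"
        by (simp add: mult.assoc vL_vS vS_mult)
      then show "app (vS \<sigma> * vL \<mu> (e i)) (app (vS (\<sigma> ^ j)) (w j)) = app (vS (\<sigma> ^ Suc j)) (app (vL \<mu> (e i)) (w j))"
        by (metis app_simps(6))
    qed
    also have "\<dots> = (\<Sum>j\<le>Suc ?L. app (vS (\<sigma> ^ j)) (if j = 0 then 0 else app (vL \<mu> (e i)) (w (j - 1))))"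
      by (simp add: sum.atMost_Suc_shift del: power_Suc sum.atMost_Suc)
    finally show ?thesis unfolding w'_def app_add_right sum.distrib list.size add_Suc_right add_0_right .
  qed
  then show ?case using top by blast
qed

lemma zero_Box: "(\<lambda>_. 0) \<in> Box" using char_p by (simp add: Box_def)

end

section \<open>Linear independence of the normal forms\<close>

lemma base_digits_unique:
  fixes a a' :: "nat \<Rightarrow> nat"
  assumes "\<And>i. a i < B" "\<And>i. a' i < B" "(\<Sum>i<M. a i * B ^ i) = (\<Sum>i<M. a' i * B ^ i)" "i < M"
  shows "a i = a' i"
  using assms(3,4)
proof (induction M arbitrary: i)
  case (Suc M)
  have lt: "(\<Sum>i<m. f i * B ^ i) < B ^ m" if "\<And>i. f i < B" for f :: "nat \<Rightarrow> nat" and m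
  proof (induction m)
    case (Suc m)
    have "Suc (f m) * B ^ m \<le> B * B ^ m" using that[of m] by (intro mult_right_mono) auto
    then show ?case using Suc by simp
  qed simp
  have div_eq: "(u * w + v) div w = u" if "v < w" for u v w :: nat using that by simp
  have d: "(a M * B ^ M + (\<Sum>i<M. a i * B ^ i)) div B ^ M = a M"
    "(a' M * B ^ M + (\<Sum>i<M. a' i * B ^ i)) div B ^ M = a' M"
    by (rule div_eq, rule lt, rule assms(1), rule div_eq, rule lt, rule assms(2))
  have eq: "a M * B ^ M + (\<Sum>i<M. a i * B ^ i) = a' M * B ^ M + (\<Sum>i<M. a' i * B ^ i)"
    using Suc.prems(1) by (simp add: add.commute)
  have top: "a M = a' M" by (rule d(1)[unfolded eq d(2), symmetric])
  then have rest: "(\<Sum>i<M. a i * B ^ i) = (\<Sum>i<M. a' i * B ^ i)"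
    using Suc.prems(1) by (simp only: sum.lessThan_Suc add_right_cancel)
  show ?case
  proof (cases "i = M")
    case False
    then show ?thesis using Suc.prems(2) by (intro Suc.IH[OF rest]) simp
  qed (simp add: top)
qed simp

lemma sum_list_powers_unique:
  fixes l l' :: "nat list"
  assumes "length l < B" "length l' < B" "(\<Sum>i\<leftarrow>l. B ^ i) = (\<Sum>i\<leftarrow>l'. B ^ i)"
  shows "mset l = mset l'"
proof (rule multiset_eqI)
  fix i
  define M where "M = Suc (Max (insert i (set l \<union> set l')))"
  have M: "set l \<subseteq> {..<M}" "set l' \<subseteq> {..<M}" "i < M"
    using Max_ge[of "insert i (set l \<union> set l')"] by (auto simp: M_def less_Suc_eq_le)
  have s: "(\<Sum>i\<leftarrow>l. B ^ i) = (\<Sum>i<M. count_list l i * B ^ i)" if "set l \<subseteq> {..<M}" for l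
    unfolding sum_list_map_eq_sum_count using that
    by (intro sum.mono_neutral_left) (auto simp: count_list_0_iff)
  have "count_list l i = count_list l' i"
  proof (rule base_digits_unique[of "count_list l" B "count_list l'" M])
    show "count_list l j < B" "count_list l' j < B" for j
      by (rule le_less_trans[OF count_le_length assms(1)], rule le_less_trans[OF count_le_length assms(2)])
    show "(\<Sum>i<M. count_list l i * B ^ i) = (\<Sum>i<M. count_list l' i * B ^ i)"
      using assms(3) s M by simp
  qed (rule M)
  then show "count (mset l) i = count (mset l') i" by (simp add: count_mset)
qed

text \<open>The Dunkl representations are considered for all base points \<open>b\<close> and shifts at once: in
  the ring of functions of these parameters, their operators again satisfy the relations.\<close>

locale cherednik_family = reflection_data G scale \<rho> c n e \<epsilon>
  for G :: "'g monoid" (structure)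
    and scale :: "'k::alg_closed_field \<Rightarrow> 'v::ab_group_add \<Rightarrow> 'v" and \<rho> c n e \<epsilon> +
  fixes p :: nat
  assumes char_p: "CHAR('k) = p" "p > 0"
    and c_conj: "g \<in> carrier G \<Longrightarrow> s \<in> refls \<Longrightarrow> c (g \<otimes> s \<otimes> inv g) = c s"
begin

definition regular :: "'v \<Rightarrow> bool" where "regular b \<longleftrightarrow> (\<forall>g\<in>carrier G. \<rho> g b = b \<longrightarrow> g = \<one>)"

definition vec :: "(nat \<Rightarrow> 'k) \<Rightarrow> 'v" where "vec \<beta> = (\<Sum>i<n. scale (\<beta> i) (e i))"

lemma \<epsilon>_vec: "i < n \<Longrightarrow> \<epsilon> i (vec \<beta>) = \<beta> i"
proof -
  assume i: "i < n"
  have "\<epsilon> i (vec \<beta>) = (\<Sum>j<n. \<beta> j * \<epsilon> i (e j))"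
    by (simp add: vec_def dual_sum[OF \<epsilon>_dual[OF i]] dual_scale[OF \<epsilon>_dual[OF i]])
  also have "\<dots> = (\<Sum>j<n. if j = i then \<beta> i else 0)" using i by (intro sum.cong) (auto simp: \<epsilon>_e)
  finally show ?thesis using i by simp
qed

lemma \<rho>_sum: "g \<in> carrier G \<Longrightarrow> \<rho> g (\<Sum>i\<in>I. f i) = (\<Sum>i\<in>I. \<rho> g (f i))"
  by (induction I rule: infinite_finite_induct) (auto simp: \<rho>_add \<rho>_zero)

text \<open>The exponents \<open>D\<^sup>i\<close> are distinct, so the curve \<open>\<tau> \<mapsto> (\<tau>\<^bsup>D^i\<^esup>)\<^sub>i\<close> lies in no hyperplane. The vectors on
  it that are fixed by \<open>k \<noteq> 1\<close> occur only at roots of a nonzero polynomial in \<open>\<tau>\<close>.\<close>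

lemma finite_irregular:
  assumes D: "2 \<le> D" shows "finite {\<tau>. \<not> regular (vec (\<lambda>i. \<tau> ^ (D ^ i)))}"
proof -
  let ?b = "\<lambda>\<tau>. vec (\<lambda>i. \<tau> ^ (D ^ i))"
  have fin: "finite {\<tau>. \<rho> k (?b \<tau>) = ?b \<tau>}" if k: "k \<in> carrier G" "k \<noteq> \<one>" for k
  proof -
    have "\<exists>i0<n. \<rho> k (e i0) \<noteq> e i0"
    proof (rule ccontr)
      assume "\<not> ?thesis"
      then have fixd: "\<rho> k (\<Sum>i<n. scale (\<epsilon> i v) (e i)) = (\<Sum>i<n. scale (\<epsilon> i v) (e i))" for v
        by (simp add: \<rho>_sum[OF k(1)] \<rho>_scale[OF k(1)])
      have "\<rho> k v = v" for v using fixd[of v] by (simp only: expand[of v, symmetric])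
      then show False using faithful k by blast
    qed
    then obtain i0 where i0: "i0 < n" "\<rho> k (e i0) - e i0 \<noteq> 0" by auto
    have "\<exists>j<n. \<epsilon> j (\<rho> k (e i0) - e i0) \<noteq> 0"
    proof (rule ccontr)
      assume "\<not> ?thesis"
      then have "(\<Sum>j<n. scale (\<epsilon> j (\<rho> k (e i0) - e i0)) (e j)) = 0" by (intro sum.neutral) auto
      then show False using i0(2) by (simp only: expand[of "\<rho> k (e i0) - e i0", symmetric])
    qed
    then obtain j where j: "j < n" "\<epsilon> j (\<rho> k (e i0) - e i0) \<noteq> 0" by auto
    note jd = \<epsilon>_dual[OF j(1)]
    define P where "P = (\<Sum>i<n. monom (\<epsilon> j (\<rho> k (e i) - e i)) (D ^ i))"
    have "coeff P (D ^ i0) = (\<Sum>i<n. if i = i0 then \<epsilon> j (\<rho> k (e i0) - e i0) else 0)"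
      unfolding P_def coeff_sum using D by (intro sum.cong) (auto simp: power_inject_exp)
    then have "P \<noteq> 0" using i0(1) j(2) by auto
    then have "finite {\<tau>. poly P \<tau> = 0}" by (rule poly_roots_finite)
    moreover have "poly P \<tau> = \<epsilon> j (\<rho> k (?b \<tau>) - ?b \<tau>)" for \<tau>
    proof -
      have "\<rho> k (?b \<tau>) - ?b \<tau> = (\<Sum>i<n. scale (\<tau> ^ (D ^ i)) (\<rho> k (e i) - e i))"
        by (simp add: vec_def \<rho>_sum[OF k(1)] \<rho>_scale[OF k(1)] sum_subtractf V.scale_right_diff_distrib)
      then show ?thesis
        by (simp add: P_def poly_sum poly_monom dual_sum[OF jd] dual_scale[OF jd] mult.commute)
    qed
    ultimately have "finite {\<tau>. \<epsilon> j (\<rho> k (?b \<tau>) - ?b \<tau>) = 0}" by simp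
    then show ?thesis by (rule rev_finite_subset) (auto simp: dual_zero[OF jd])
  qed
  have "{\<tau>. \<not> regular (?b \<tau>)} \<subseteq> (\<Union>k\<in>carrier G - {\<one>}. {\<tau>. \<rho> k (?b \<tau>) = ?b \<tau>})"
    by (auto simp: regular_def)
  moreover have "finite (\<Union>k\<in>carrier G - {\<one>}. {\<tau>. \<rho> k (?b \<tau>) = ?b \<tau>})" using finG fin by auto
  ultimately show ?thesis by (rule finite_subset)
qed

lemma infinite_regular: "2 \<le> D \<Longrightarrow> infinite {\<tau>. regular (vec (\<lambda>i. \<tau> ^ (D ^ i)))}"
proof
  assume D: "2 \<le> D" and "finite {\<tau>. regular (vec (\<lambda>i. \<tau> ^ (D ^ i)))}"
  then have "finite ({\<tau>. regular (vec (\<lambda>i. \<tau> ^ (D ^ i)))} \<union> {\<tau>. \<not> regular (vec (\<lambda>i. \<tau> ^ (D ^ i)))})"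
    by (intro finite_UnI finite_irregular[OF D])
  also have "\<dots> = UNIV" by auto
  finally show False using infinite_alg_closed_field by auto
qed

lemma regular_exists: "\<exists>b. regular b"
  using infinite_regular[of 2] by (metis (mono_tags, lifting) empty_Collect_eq finite.emptyI order_refl)

text \<open>The base point of a family member; irregular parameters get some fixed regular point.\<close>

definition base_point :: "(nat \<Rightarrow> 'k) \<Rightarrow> 'v" where
  "base_point \<beta> = (if regular (vec \<beta>) then vec \<beta> else (SOME b. regular b))"

lemma regular_base_point: "regular (base_point \<beta>)"
  unfolding base_point_def using someI_ex[OF regular_exists] by auto

lemma dunkl_data_base_point: "dunkl_data G scale \<rho> c n e \<epsilon> p (base_point \<beta>)"
  by unfold_locales (use char_p c_conj regular_base_point in \<open>auto simp: regular_def\<close>)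

definition famS :: "'k \<Rightarrow> (nat \<Rightarrow> 'k) \<times> (nat \<Rightarrow> 'k) \<Rightarrow> ('g \<Rightarrow> (nat \<Rightarrow> nat) \<Rightarrow> 'k) endo" where
  "famS r = (\<lambda>_. dunkl_data.vS G n p r)"
definition famX :: "('v \<Rightarrow> 'k) \<Rightarrow> (nat \<Rightarrow> 'k) \<times> (nat \<Rightarrow> 'k) \<Rightarrow> ('g \<Rightarrow> (nat \<Rightarrow> nat) \<Rightarrow> 'k) endo" where
  "famX x = (\<lambda>(\<beta>, l). dunkl_data.vX G \<rho> n e p (base_point \<beta>) x)"
definition famY :: "'v \<Rightarrow> (nat \<Rightarrow> 'k) \<times> (nat \<Rightarrow> 'k) \<Rightarrow> ('g \<Rightarrow> (nat \<Rightarrow> nat) \<Rightarrow> 'k) endo" where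
  "famY y = (\<lambda>(\<beta>, l). dunkl_data.vY G scale \<rho> c n e \<epsilon> p (base_point \<beta>) l y)"
definition famT :: "'g \<Rightarrow> (nat \<Rightarrow> 'k) \<times> (nat \<Rightarrow> 'k) \<Rightarrow> ('g \<Rightarrow> (nat \<Rightarrow> nat) \<Rightarrow> 'k) endo" where
  "famT g = (\<lambda>_. dunkl_data.vT G n p g)"

lemma cherednik_system_member:
  "cherednik_system G scale \<rho> c n e \<epsilon> (\<lambda>r. famS r \<iota>) (\<lambda>x. famX x \<iota>) (\<lambda>y. famY y \<iota>) (\<lambda>g. famT g \<iota>)"
proof -
  obtain \<beta> l where \<iota>: "\<iota> = (\<beta>, l)" by (cases \<iota>)
  interpret D: dunkl_data G scale \<rho> c n e \<epsilon> p "base_point \<beta>" l by (rule dunkl_data_base_point)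
  show ?thesis unfolding \<iota> famS_def famX_def famY_def famT_def prod.case by (rule D.cherednik_system_dunkl)
qed

lemma cherednik_system_family: "cherednik_system G scale \<rho> c n e \<epsilon> famS famX famY famT"
proof -
  interpret M: cherednik_system G scale \<rho> c n e \<epsilon> "\<lambda>r. famS r \<iota>" "\<lambda>x. famX x \<iota>" "\<lambda>y. famY y \<iota>" "\<lambda>g. famT g \<iota>" for \<iota>
    by (rule cherednik_system_member)
  show ?thesis
  proof
    show "famY y * famX x = famX x * famY y + famS (x y) - (\<Sum>s\<in>refls. famS (c s * (x - dact s x) y) * famT s)"
      if "x \<in> dual" for x y
      by (rule ext) (simp only: sum_fun_apply plus_fun_apply minus_apply times_fun_apply M.Y_X[OF that])
    show "famT \<one> = famS 1" by (rule ext) (rule M.T_one)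
  qed (rule ext; simp only: plus_fun_apply times_fun_apply;
      fast intro: M.S_add M.S_mult M.S1_X M.S1_Y M.S1_T M.S_X M.S_Y M.S_T M.X_add M.X_scale M.Y_add M.Y_scale
        M.T_mult M.T_one M.T_X M.T_Y M.X_comm M.Y_comm)+
qed

sublocale fam: cherednik_system G scale \<rho> c n e \<epsilon> famS famX famY famT
  by (rule cherednik_system_family)

lemma prod_list_apply: "prod_list xs \<iota> = prod_list (map (\<lambda>f. f \<iota>) xs)"
  by (induction xs) auto

text \<open>The exponent of \<open>\<tau>\<close> to which the monomial in the \<open>\<beta> i\<close> and \<open>\<mu> i\<close> specialises for \<open>\<beta> i = \<tau>\<^bsup>D^i\<^esup>\<close> and
  \<open>\<mu> i = \<tau>\<^bsup>D^(n+i)\<^esup>\<close>. Its digits in base \<open>D\<close> are the exponents of the monomial.\<close>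

definition wt :: "nat \<Rightarrow> 'g \<times> nat list \<times> nat list \<Rightarrow> nat" where
  "wt D = (\<lambda>(g, xs, ys). (\<Sum>i\<leftarrow>xs @ map ((+) n) ys. D ^ i))"

lemma wt_inj:
  assumes t: "(g, xs, ys) \<in> fam.Idx" "(g, xs', ys') \<in> fam.Idx" and wt: "wt D (g, xs, ys) = wt D (g, xs', ys')"
    and D: "length xs + length ys < D" "length xs' + length ys' < D"
  shows "xs = xs' \<and> ys = ys'"
proof -
  have ms: "mset (xs @ map ((+) n) ys) = mset (xs' @ map ((+) n) ys')"
    by (rule sum_list_powers_unique[of _ D]) (use D wt in \<open>auto simp: wt_def\<close>)
  have x: "filter (\<lambda>i. i < n) (xs @ map ((+) n) ys) = xs" if "(g, xs, ys) \<in> fam.Idx" for xs ys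
    using that by (auto simp: fam.Idx_def filter_id_conv filter_empty_conv)
  have y: "filter (\<lambda>i. \<not> i < n) (xs @ map ((+) n) ys) = map ((+) n) ys" if "(g, xs, ys) \<in> fam.Idx" for xs ys
    using that by (auto simp: fam.Idx_def filter_id_conv filter_empty_conv)
  have "mset xs = mset xs'" using arg_cong[OF ms, of "filter_mset (\<lambda>i. i < n)"] x t by (metis mset_filter)
  moreover have "mset (map ((+) n) ys) = mset (map ((+) n) ys')"
    using arg_cong[OF ms, of "filter_mset (\<lambda>i. \<not> i < n)"] y t by (metis mset_filter)
  then have "image_mset (\<lambda>j. j - n) (mset (map ((+) n) ys)) = image_mset (\<lambda>j. j - n) (mset (map ((+) n) ys'))" by simp
  then have "mset ys = mset ys'" by (simp add: multiset.map_comp comp_def)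
  ultimately show ?thesis using t
    by (auto simp: fam.Idx_def) (metis properties_for_sort sorted_sort_id)+
qed

lemma prod_list_power: "(\<Prod>i\<leftarrow>xs. \<tau> ^ f i) = \<tau> ^ (\<Sum>i\<leftarrow>xs. f i)" for \<tau> :: 'k
  by (induction xs) (auto simp: power_add)

text \<open>A normal form monomial applied to the point mass and evaluated at \<open>(g0, 0)\<close> is a polynomial in \<open>\<sigma>\<close>.
  Its leading coefficient singles out \<open>g = g0\<close> and is then a monomial in the parameters.\<close>

lemma mon_origin:
  assumes t: "(g, xs, ys) \<in> fam.Idx" and g0: "g0 \<in> carrier G" and reg: "regular (vec \<beta>)"
  shows "\<exists>K. K (length ys) = (if g = g0 then (\<Prod>i\<leftarrow>ys. \<mu> i) * (\<Prod>i\<leftarrow>xs. \<beta> i) else 0) \<and>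
    (\<forall>\<sigma>. app (fam.mon (g, xs, ys) (\<beta>, \<lambda>i. \<sigma> * \<mu> i)) (app (famS 1 (\<beta>, \<lambda>i. \<sigma> * \<mu> i)) (dunkl_data.point \<one> (\<lambda>_. 0))) g0 (\<lambda>_. 0)
      = (\<Sum>j\<le>length ys. \<sigma> ^ j * K j))"
proof -
  interpret D: dunkl_data G scale \<rho> c n e \<epsilon> p "base_point \<beta>" \<mu> by (rule dunkl_data_base_point)
  have bp: "base_point \<beta> = vec \<beta>" using reg by (simp add: base_point_def)
  have t': "g \<in> carrier G" "set xs \<subseteq> {..<n}" "set ys \<subseteq> {..<n}" using t by (auto simp: fam.Idx_def)
  obtain w where w: "w (length ys) = app (D.vS (\<Prod>i\<leftarrow>ys. \<mu> i)) D.origin"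
    "\<And>\<sigma>. app (prod_list (map (\<lambda>i. D.vY_at (\<lambda>i. \<sigma> * \<mu> i) (e i)) ys)) (app (D.vS 1) D.origin) =
      (\<Sum>j\<le>length ys. app (D.vS (\<sigma> ^ j)) (w j))" using D.ymon_origin[OF t'(3), of \<mu>] by blast
  let ?x = "prod_list (map (\<lambda>i. D.vX (\<epsilon> i)) xs)"
  let ?h = "inv g \<otimes> g0"
  have h: "?h \<in> carrier G" using t' g0 by simp
  define K where "K j = app ?x (w j) ?h (\<lambda>_. 0)" for j
  have xS: "?x * D.vS r = D.vS r * ?x" for r
    by (induction xs) (auto simp: mult.assoc mult_shift[OF D.vX_vS])
  have "app ?x (w (length ys)) = app (D.vS ((\<Prod>i\<leftarrow>ys. \<mu> i) * (\<Prod>i\<leftarrow>xs. \<epsilon> i (vec \<beta>)))) D.origin"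
    unfolding w(1) using D.xmon_origin[OF t'(2)] bp by simp
  also have "(\<Prod>i\<leftarrow>xs. \<epsilon> i (vec \<beta>)) = (\<Prod>i\<leftarrow>xs. \<beta> i)"
    using t'(2) by (intro arg_cong[where f = prod_list] map_cong) (auto simp: \<epsilon>_vec)
  finally have "K (length ys) = (if ?h = \<one> then (\<Prod>i\<leftarrow>ys. \<mu> i) * (\<Prod>i\<leftarrow>xs. \<beta> i) else 0)"
    using h D.zero_Box by (simp add: K_def D.app_vS D.point_def)
  moreover have "?h = \<one> \<longleftrightarrow> g = g0" using t' g0
    by (metis G.inv_closed G.inv_equality G.inv_inv G.l_inv)
  ultimately have top: "K (length ys) = (if g = g0 then (\<Prod>i\<leftarrow>ys. \<mu> i) * (\<Prod>i\<leftarrow>xs. \<beta> i) else 0)" by simp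
  have "app (fam.mon (g, xs, ys) (\<beta>, \<lambda>i. \<sigma> * \<mu> i)) (app (famS 1 (\<beta>, \<lambda>i. \<sigma> * \<mu> i)) D.origin) g0 (\<lambda>_. 0)
      = (\<Sum>j\<le>length ys. \<sigma> ^ j * K j)" for \<sigma>
  proof -
    have "fam.mon (g, xs, ys) (\<beta>, \<lambda>i. \<sigma> * \<mu> i) =
        D.vT g * (?x * prod_list (map (\<lambda>i. D.vY_at (\<lambda>i. \<sigma> * \<mu> i) (e i)) ys))"
      by (simp add: fam.mon_def fam.xmon_def fam.ymon_def prod_list_apply comp_def famT_def famX_def famY_def)
    then have 1: "app (fam.mon (g, xs, ys) (\<beta>, \<lambda>i. \<sigma> * \<mu> i)) (app (famS 1 (\<beta>, \<lambda>i. \<sigma> * \<mu> i)) D.origin) =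
        app (D.vT g) (app ?x (\<Sum>j\<le>length ys. app (D.vS (\<sigma> ^ j)) (w j)))"
      using w(2)[of \<sigma>] by (simp add: famS_def)
    have 2: "app ?x (\<Sum>j\<le>length ys. app (D.vS (\<sigma> ^ j)) (w j)) = (\<Sum>j\<le>length ys. app (D.vS (\<sigma> ^ j)) (app ?x (w j)))"
      unfolding app_sum_right
    proof (rule sum.cong[OF refl])
      fix j
      have "app (?x * D.vS (\<sigma> ^ j)) (w j) = app (D.vS (\<sigma> ^ j) * ?x) (w j)" by (simp only: xS)
      then show "app ?x (app (D.vS (\<sigma> ^ j)) (w j)) = app (D.vS (\<sigma> ^ j)) (app ?x (w j))" by (simp only: app_simps)
    qed
    have 3: "app (D.vT g) (\<Sum>j\<le>length ys. app (D.vS (\<sigma> ^ j)) (app ?x (w j))) g0 (\<lambda>_. 0) = (\<Sum>j\<le>length ys. \<sigma> ^ j * K j)"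
      using g0 h D.zero_Box by (simp add: D.app_vT D.app_fS sum_fun_apply D.app_vS K_def)
    show ?thesis unfolding 1 2 3 ..
  qed
  then show ?thesis using top by blast
qed

end

context cherednik_family
begin

text \<open>Among the terms with nonzero coefficient, those with the most factors \<open>y\<close> have the
  highest degree in \<open>\<sigma>\<close>. Evaluation at \<open>g0\<close> keeps those with group element \<open>g0\<close>. These have distinct
  weights, so their coefficients are those of a polynomial in \<open>\<tau>\<close> with infinitely many roots.\<close>

lemma family_independent:
  assumes F: "finite F" "F \<subseteq> fam.Idx" and zero: "(\<Sum>t\<in>F. famS (C t) * fam.mon t) = 0"
  shows "\<forall>t\<in>F. C t = 0"
proof (rule ccontr)
  assume contra: "\<not> (\<forall>t\<in>F. C t = 0)"
  define len where "len = (\<lambda>t :: 'g \<times> nat list \<times> nat list. length (snd (snd t)))"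
  define N where "N = {t \<in> F. C t \<noteq> 0}"
  have N: "finite N" "N \<noteq> {}" using F contra by (auto simp: N_def)
  define m where "m = Max (len ` N)"
  have "m \<in> len ` N" unfolding m_def using N by (intro Max_in) auto
  then obtain t0 where t0: "t0 \<in> F" "C t0 \<noteq> 0" "len t0 = m" by (auto simp: N_def)
  have len_le: "len t \<le> m" if "t \<in> F" "C t \<noteq> 0" for t
    unfolding m_def using N that by (intro Max_ge) (auto simp: N_def)
  obtain g0 xs0 ys0 where t0': "t0 = (g0, xs0, ys0)" by (cases t0)
  have g0: "g0 \<in> carrier G" using t0 F t0' by (auto simp: fam.Idx_def)
  define sz where "sz = (\<lambda>t :: 'g \<times> nat list \<times> nat list. length (fst (snd t)) + length (snd (snd t)))"
  \<comment> \<open>Larger than all degrees, so that base \<open>D\<close> digits do not carry, and at least \<open>2\<close>.\<close>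
  define D where "D = 2 + (\<Sum>t\<in>F. sz t)"
  have szD: "sz t < D" if "t \<in> F" for t
    using member_le_sum[of t F sz] F(1) that by (simp add: D_def)
  define F' where "F' = {t \<in> F. len t = m \<and> fst t = g0}"
  \<comment> \<open>The leading coefficient in \<open>\<sigma>\<close> of the relation, as a polynomial in \<open>\<tau>\<close>.\<close>
  define Q where "Q = (\<Sum>t\<in>F'. monom (C t) (wt D t))"
  have "poly Q \<tau> = 0" if reg: "regular (vec (\<lambda>i. \<tau> ^ (D ^ i)))" for \<tau>
  proof -
    define \<beta> where "\<beta> = (\<lambda>i. \<tau> ^ (D ^ i))"
    define \<mu> where "\<mu> = (\<lambda>i. \<tau> ^ (D ^ (n + i)))"
    let ?o = "dunkl_data.point \<one> (\<lambda>_. 0)" and ?z = "\<lambda>_::nat. 0::nat"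
    interpret D: dunkl_data G scale \<rho> c n e \<epsilon> p "base_point \<beta>" \<mu> by (rule dunkl_data_base_point)
    have "\<exists>K. K (len t) = (if fst t = g0 then \<tau> ^ wt D t else 0) \<and>
      (\<forall>\<sigma>. app (fam.mon t (\<beta>, \<lambda>i. \<sigma> * \<mu> i)) (app (famS 1 (\<beta>, \<lambda>i. \<sigma> * \<mu> i)) ?o) g0 ?z
      = (\<Sum>j\<le>len t. \<sigma> ^ j * K j))" if "t \<in> F" for t
    proof -
      obtain g xs ys where t: "t = (g, xs, ys)" by (cases t)
      have "(\<Prod>i\<leftarrow>ys. \<mu> i) * (\<Prod>i\<leftarrow>xs. \<beta> i) = \<tau> ^ wt D t"
        unfolding \<mu>_def \<beta>_def prod_list_power power_add[symmetric]
        by (simp add: t wt_def comp_def add.commute)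
      moreover have "regular (vec \<beta>)" using reg by (simp add: \<beta>_def)
      ultimately show ?thesis
        using mon_origin[of g xs ys g0 \<beta> \<mu>] that F(2) g0 t by (auto simp: len_def)
    qed
    then have "\<forall>t\<in>F. \<exists>K. K (len t) = (if fst t = g0 then \<tau> ^ wt D t else 0) \<and>
      (\<forall>\<sigma>. app (fam.mon t (\<beta>, \<lambda>i. \<sigma> * \<mu> i)) (app (famS 1 (\<beta>, \<lambda>i. \<sigma> * \<mu> i)) ?o) g0 ?z
      = (\<Sum>j\<le>len t. \<sigma> ^ j * K j))" by (rule ballI)
    from bchoice[OF this] obtain K where K': "\<forall>t\<in>F. K t (len t) = (if fst t = g0 then \<tau> ^ wt D t else 0) \<and>
      (\<forall>\<sigma>. app (fam.mon t (\<beta>, \<lambda>i. \<sigma> * \<mu> i)) (app (famS 1 (\<beta>, \<lambda>i. \<sigma> * \<mu> i)) ?o) g0 ?z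
      = (\<Sum>j\<le>len t. \<sigma> ^ j * K t j))" by (rule exE)
    have K: "\<And>t. t \<in> F \<Longrightarrow> K t (len t) = (if fst t = g0 then \<tau> ^ wt D t else 0)"
      "\<And>t \<sigma>. t \<in> F \<Longrightarrow> app (fam.mon t (\<beta>, \<lambda>i. \<sigma> * \<mu> i)) (app (famS 1 (\<beta>, \<lambda>i. \<sigma> * \<mu> i)) ?o) g0 ?z
      = (\<Sum>j\<le>len t. \<sigma> ^ j * K t j)" by (rule bspec[OF K', THEN conjunct1], assumption)
        (rule bspec[OF K', THEN conjunct2, THEN spec])
    \<comment> \<open>The relation applied to the point mass, as a polynomial in \<open>\<sigma>\<close>.\<close>
    define P where "P = (\<Sum>t\<in>F. Polynomial.smult (C t) (\<Sum>j\<le>len t. monom (K t j) j))"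
    have "poly P \<sigma> = 0" for \<sigma>
    proof -
      let ?\<iota> = "(\<beta>, \<lambda>i. \<sigma> * \<mu> i)"
      have "app ((\<Sum>t\<in>F. famS (C t) * fam.mon t) ?\<iota>) (app (famS 1 ?\<iota>) ?o) g0 ?z =
          (\<Sum>t\<in>F. C t * app (fam.mon t ?\<iota>) (app (famS 1 ?\<iota>) ?o) g0 ?z)"
        using g0 D.zero_Box by (simp add: sum_fun_apply app_sum famS_def D.app_vS)
      then have "0 = (\<Sum>t\<in>F. C t * (\<Sum>j\<le>len t. \<sigma> ^ j * K t j))"
        unfolding zero using K(2) by simp
      then show ?thesis
        by (simp add: P_def poly_sum poly_monom mult.commute)
    qed
    then have "{\<sigma>. poly P \<sigma> = 0} = UNIV" by auto
    then have "P = 0" using poly_roots_finite[of P] infinite_alg_closed_field by auto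
    then have "coeff P m = 0" by simp
    moreover have "coeff P m = (\<Sum>t\<in>F. if t \<in> F' then C t * \<tau> ^ wt D t else 0)"
      unfolding P_def coeff_sum
    proof (rule sum.cong[OF refl])
      fix t assume t: "t \<in> F"
      have c: "coeff (\<Sum>j\<le>len t. monom (K t j) j) m = (if m \<le> len t then K t m else 0)"
        by (simp add: coeff_sum sum.delta)
      show "coeff (Polynomial.smult (C t) (\<Sum>j\<le>len t. monom (K t j) j)) m = (if t \<in> F' then C t * \<tau> ^ wt D t else 0)"
      proof (cases "C t = 0")
        case False
        then have "len t \<le> m" using len_le t by auto
        then show ?thesis using K(1)[OF t] t unfolding coeff_smult c
          by (cases "len t = m") (auto simp: F'_def)
      qed auto
    qed
    moreover have "(\<Sum>t\<in>F. if t \<in> F' then C t * \<tau> ^ wt D t else 0) = poly Q \<tau>"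
      unfolding Q_def poly_sum poly_monom using F(1)
      by (intro sum.mono_neutral_cong_right) (auto simp: F'_def)
    ultimately show ?thesis by simp
  qed
  then have "{\<tau>. regular (vec (\<lambda>i. \<tau> ^ (D ^ i)))} \<subseteq> {\<tau>. poly Q \<tau> = 0}" by auto
  moreover have "infinite {\<tau>. regular (vec (\<lambda>i. \<tau> ^ (D ^ i)))}" by (rule infinite_regular) (simp add: D_def)
  ultimately have "Q = 0" using poly_roots_finite[of Q] finite_subset by blast
  then have "coeff Q (wt D t0) = 0" by simp
  moreover have "coeff Q (wt D t0) = (\<Sum>t\<in>F'. if t = t0 then C t0 else 0)"
    unfolding Q_def coeff_sum
  proof (rule sum.cong[OF refl])
    fix t assume t: "t \<in> F'"
    obtain xs ys where tt: "t = (g0, xs, ys)" using t by (cases t) (auto simp: F'_def)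
    have "t = t0" if "wt D t = wt D t0"
    proof -
      have tF: "t \<in> F" using t by (simp add: F'_def)
      have "xs = xs0 \<and> ys = ys0"
        by (rule wt_inj[of g0 xs ys xs0 ys0 D])
          (use tt t0' t0 tF F(2) that szD[OF tF] szD[OF t0(1)] in \<open>auto simp: sz_def\<close>)
      then show ?thesis using tt t0' by simp
    qed
    then show "coeff (monom (C t) (wt D t)) (wt D t0) = (if t = t0 then C t0 else 0)" by auto
  qed
  moreover have "t0 \<in> F'" "finite F'" using t0 t0' F by (auto simp: F'_def)
  ultimately show False using t0(2) by simp
qed

section \<open>The Capelli identity for the Cherednik relations\<close>

text \<open>The given operators are paired with those of the family. The value of the Capelli polynomial in
  the product has a normal form; its second component vanishes because every member of the family satisfies
  the identity, and by independence all coefficients vanish.\<close>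

theorem Capelli_cherednik:
  assumes sys: "cherednik_system G scale \<rho> c n e \<epsilon> S X Y T"
    and a: "\<And>i. a i \<in> generated_algebra S X Y T dual (carrier G)"
    and m: "(p ^ n * card (carrier G)) * (p ^ n * card (carrier G)) < m"
  shows "cap m a = 0"
proof -
  let ?S = "\<lambda>r. (S r, famS r)" and ?X = "\<lambda>x. (X x, famX x)" and ?Y = "\<lambda>y. (Y y, famY y)" and ?T = "\<lambda>g. (T g, famT g)"
  interpret A: cherednik_system G scale \<rho> c n e \<epsilon> S X Y T by (rule sys)
  interpret P: cherednik_system G scale \<rho> c n e \<epsilon> ?S ?X ?Y ?T
    by (rule cherednik_system_pair[OF sys cherednik_system_family])
  \<comment> \<open>Arguments are lifted to the product, where the value has a normal form.\<close>
  have "\<exists>z\<in>P.alg. fst z = x" if "x \<in> A.alg" for x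
    using that
  proof induction
    case (add x y)
    then obtain u v where "u \<in> P.alg" "v \<in> P.alg" "fst u = x" "fst v = y" by auto
    then show ?case by (intro bexI[of _ "u + v"]) (auto intro: generated_algebra.add)
  next
    case (mult x y)
    then obtain u v where "u \<in> P.alg" "v \<in> P.alg" "fst u = x" "fst v = y" by auto
    then show ?case by (intro bexI[of _ "u * v"]) (auto intro: generated_algebra.mult)
  next
    case (S r)
    show ?case by (intro bexI[of _ "?S r"] generated_algebra.S) auto
  next
    case (X x)
    then show ?case by (intro bexI[of _ "?X x"] generated_algebra.X) auto
  next
    case (Y y)
    show ?case by (intro bexI[of _ "?Y y"] generated_algebra.Y) auto
  next
    case (T g)
    then show ?case by (intro bexI[of _ "?T g"] generated_algebra.T) auto
  qed
  then have "\<forall>i. \<exists>z. z \<in> P.alg \<and> fst z = a i" using a by blast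
  then obtain z where z': "\<forall>i. z i \<in> P.alg \<and> fst (z i) = a i" by (rule choice[THEN exE])
  have z: "z i \<in> P.alg" "fst (z i) = a i" for i using z' by auto
  have zero: "0 \<in> P.alg" using generated_algebra.S[of ?S 0] P.S_zero by metis
  have neg: "- x \<in> P.alg" if "x \<in> P.alg" for x
  proof -
    have "?S 1 * x = x"
      using that by induction (auto simp: distrib_left mult.assoc[symmetric] P.S_mult[symmetric] P.S1_X P.S1_Y P.S1_T)
    moreover have e: "?S (- 1) = - ?S 1" by (rule P.S_neg)
    have "?S (- 1) * x = - (?S 1 * x)" unfolding e by (rule mult_minus_left)
    ultimately have "?S (- 1) * x = - x" by (simp only:)
    then show ?thesis using generated_algebra.mult[OF generated_algebra.S[of ?S "- 1"] that] by simp
  qed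
  have prodl: "prod_list (map z l) \<in> P.alg" if "l \<noteq> []" for l
    using that
  proof (induction l)
    case (Cons i l)
    then show ?case using z(1) by (cases l) (auto intro: generated_algebra.mult)
  qed simp
  have suml: "(\<Sum>i\<in>I. f i) \<in> P.alg" if "\<And>i. f i \<in> P.alg" for f and I :: "(nat \<Rightarrow> nat) set"
    using that zero by (induction I rule: infinite_finite_induct) (auto intro: generated_algebra.add)
  have "cap_word \<sigma> m \<noteq> []" for \<sigma> by (cases m) auto
  then have "cap m z \<in> P.alg" unfolding cap_def by (intro suml) (auto intro: prodl neg)
  then have NF: "cap m z \<in> P.NF" by (rule P.alg_NF)
  have fst_cap: "fst (cap m z) = cap m a" using cap_hom[of fst m z] z(2) by simp
  have snd_alg: "snd x \<in> fam.alg" if "x \<in> P.alg" for x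
    using that
  proof induction
    case (add x y)
    from add(3,4) show ?case unfolding snd_add by (rule generated_algebra.add)
  next
    case (mult x y)
    from mult(3,4) show ?case unfolding fst_snd_times_one by (rule generated_algebra.mult)
  qed (auto intro: generated_algebra.intros)
  have "cap m (\<lambda>i. snd (z i) \<iota>) = 0" for \<iota>
  proof -
    obtain \<beta> l where \<iota>: "\<iota> = (\<beta>, l)" by (cases \<iota>)
    interpret D: dunkl_data G scale \<rho> c n e \<epsilon> p "base_point \<beta>" l by (rule dunkl_data_base_point)
    interpret M: cherednik_system G scale \<rho> c n e \<epsilon> "\<lambda>r. famS r \<iota>" "\<lambda>x. famX x \<iota>" "\<lambda>y. famY y \<iota>" "\<lambda>g. famT g \<iota>"
      by (rule cherednik_system_member)
    have fS: "D.vS r = famS r \<iota>" for r by (simp add: famS_def)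
    have comm: "x \<iota> * famS r \<iota> = famS r \<iota> * x \<iota> \<and> famS 1 \<iota> * x \<iota> = x \<iota>" if "x \<in> fam.alg" for x r
      using that
    proof induction
      case (add x y)
      then show ?case by (simp add: distrib_left distrib_right)
    next
      case (mult x y)
      have "famS r \<iota> * (x \<iota> * y \<iota>) = (x \<iota> * y \<iota>) * famS r \<iota>"
        by (rule D.central_mult) (use mult in auto)
      moreover have "famS 1 \<iota> * (x \<iota> * y \<iota>) = x \<iota> * y \<iota>"
        using mult by (simp add: mult.assoc[symmetric])
      ultimately show ?case by simp
    next
      case (S s)
      show ?case by (simp add: M.S_mult[symmetric] mult.commute)
    qed (auto simp: M.S_X M.S_Y M.S_T M.S1_X M.S1_Y M.S1_T)
    show ?thesis
      by (rule D.Capelli_dunkl[OF m]) (use comm[OF snd_alg[OF z(1)]] in \<open>auto simp: fS\<close>)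
  qed
  then have "snd (cap m z) \<iota> = 0" for \<iota>
    using cap_hom[of "\<lambda>x. snd x \<iota>" m z] by simp
  then have snd0: "snd (cap m z) = 0" by (simp add: fun_eq_iff)
  obtain F C where F: "finite F" "F \<subseteq> P.Idx" "cap m z = (\<Sum>t\<in>F. ?S (C t) * P.mon t)"
    using P.NF_finite_sum[OF NF] by blast
  have "snd (P.mon t) = fam.mon t" for t
    by (cases t) (simp add: P.mon_def fam.mon_def P.xmon_def P.ymon_def fam.xmon_def fam.ymon_def snd_prod_list comp_def)
  then have zero_sum: "(\<Sum>t\<in>F. famS (C t) * fam.mon t) = 0"
    using snd0 unfolding F(3) snd_sum' by simp
  have "P.Idx = fam.Idx" by (simp add: P.Idx_def fam.Idx_def)
  then have "F \<subseteq> fam.Idx" using F(2) by simp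
  from family_independent[OF F(1) this zero_sum] have C0: "\<forall>t\<in>F. C t = 0" .
  have "cap m z = 0"
    unfolding F(3)
  proof (intro sum.neutral ballI)
    fix t assume "t \<in> F"
    then have "?S (C t) = 0" using C0 P.S_zero by simp
    then show "?S (C t) * P.mon t = 0" by (simp only: mult_zero_left)
  qed
  then show ?thesis using fst_cap by simp
qed

end

section \<open>Quotient algebras and free algebras\<close>

locale scalar_ring = ring A for A :: "('k::field, 'a) module" (structure) +
  assumes smult_closed [simp]: "a \<in> carrier A \<Longrightarrow> r \<odot> a \<in> carrier A"
    and smult_add: "a \<in> carrier A \<Longrightarrow> b \<in> carrier A \<Longrightarrow> r \<odot> (a \<oplus> b) = r \<odot> a \<oplus> r \<odot> b"
    and smult_mult: "a \<in> carrier A \<Longrightarrow> b \<in> carrier A \<Longrightarrow> (r \<odot> a) \<otimes> b = r \<odot> (a \<otimes> b)"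
begin

lemma smult_ideal:
  assumes "ideal I A" "a \<in> I" shows "r \<odot> a \<in> I"
proof -
  interpret I: ideal I A by fact
  have a: "a \<in> carrier A" using assms by simp
  have "(r \<odot> \<one>) \<otimes> a \<in> I" using assms(2) a by (intro I.I_l_closed) auto
  then show ?thesis using a by (simp add: smult_mult)
qed

lemma smult_zero: "r \<odot> \<zero> = \<zero>"
proof -
  have "r \<odot> \<zero> = r \<odot> \<zero> \<oplus> r \<odot> \<zero>" using smult_add[of \<zero> \<zero> r] by simp
  then show ?thesis by (metis add.l_cancel_one' smult_closed zero_closed)
qed

lemma smult_finsum:
  "finite J \<Longrightarrow> f \<in> J \<rightarrow> carrier A \<Longrightarrow> r \<odot> (\<Oplus>j\<in>J. f j) = (\<Oplus>j\<in>J. r \<odot> f j)"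
proof (induction J rule: finite_induct)
  case (insert j J)
  then have "f \<in> J \<rightarrow> carrier A" "f j \<in> carrier A" by auto
  then show ?case using insert by (simp add: finsum_closed smult_add Pi_def)
qed (simp add: smult_zero)

end

text \<open>The laws of a ring pass to images under a map that preserves the operations; here cosets.\<close>

lemma scalar_ring_image:
  assumes A: "scalar_ring A" and carr: "carrier Q = \<pi> ` carrier A"
    and add: "\<And>a b. a \<in> carrier A \<Longrightarrow> b \<in> carrier A \<Longrightarrow> \<pi> a \<oplus>\<^bsub>Q\<^esub> \<pi> b = \<pi> (a \<oplus>\<^bsub>A\<^esub> b)"
    and mult: "\<And>a b. a \<in> carrier A \<Longrightarrow> b \<in> carrier A \<Longrightarrow> \<pi> a \<otimes>\<^bsub>Q\<^esub> \<pi> b = \<pi> (a \<otimes>\<^bsub>A\<^esub> b)"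
    and one: "\<one>\<^bsub>Q\<^esub> = \<pi> \<one>\<^bsub>A\<^esub>" and zero: "\<zero>\<^bsub>Q\<^esub> = \<pi> \<zero>\<^bsub>A\<^esub>"
    and smult: "\<And>r a. a \<in> carrier A \<Longrightarrow> r \<odot>\<^bsub>Q\<^esub> \<pi> a = \<pi> (r \<odot>\<^bsub>A\<^esub> a)"
  shows "scalar_ring Q"
proof -
  interpret A: scalar_ring A by (rule A)
  have "abelian_group Q"
  proof (rule abelian_groupI)
    show "\<exists>y\<in>carrier Q. y \<oplus>\<^bsub>Q\<^esub> x = \<zero>\<^bsub>Q\<^esub>" if x: "x \<in> carrier Q" for x
    proof -
      obtain a where a: "a \<in> carrier A" "x = \<pi> a" using x carr by auto
      then have "\<pi> (\<ominus>\<^bsub>A\<^esub> a) \<oplus>\<^bsub>Q\<^esub> x = \<zero>\<^bsub>Q\<^esub>" by (simp add: add zero A.l_neg)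
      then show ?thesis using a carr by blast
    qed
  qed (auto simp: carr add zero A.a_assoc A.a_comm A.a_lcomm)
  moreover have "monoid Q"
    by (rule monoidI) (auto simp: carr mult one A.m_assoc)
  ultimately have "ring Q"
    by (rule ringI) (auto simp: carr mult add A.l_distr A.r_distr)
  then show ?thesis
    by (intro scalar_ring.intro scalar_ring_axioms.intro)
      (auto simp: carr smult mult add A.smult_add A.smult_mult)
qed

lemma
  assumes A: "scalar_ring A" and I: "ideal I A"
  shows carrier_quot_algebra: "carrier (quot_algebra A I) = (\<lambda>a. I +>\<^bsub>A\<^esub> a) ` carrier A"
    and add_quot_algebra: "a \<in> carrier A \<Longrightarrow> b \<in> carrier A \<Longrightarrow>
      (I +>\<^bsub>A\<^esub> a) \<oplus>\<^bsub>quot_algebra A I\<^esub> (I +>\<^bsub>A\<^esub> b) = I +>\<^bsub>A\<^esub> (a \<oplus>\<^bsub>A\<^esub> b)"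
    and mult_quot_algebra: "a \<in> carrier A \<Longrightarrow> b \<in> carrier A \<Longrightarrow>
      (I +>\<^bsub>A\<^esub> a) \<otimes>\<^bsub>quot_algebra A I\<^esub> (I +>\<^bsub>A\<^esub> b) = I +>\<^bsub>A\<^esub> (a \<otimes>\<^bsub>A\<^esub> b)"
    and one_quot_algebra: "\<one>\<^bsub>quot_algebra A I\<^esub> = I +>\<^bsub>A\<^esub> \<one>\<^bsub>A\<^esub>"
    and smult_quot_algebra: "a \<in> carrier A \<Longrightarrow>
      r \<odot>\<^bsub>quot_algebra A I\<^esub> (I +>\<^bsub>A\<^esub> a) = I +>\<^bsub>A\<^esub> (r \<odot>\<^bsub>A\<^esub> a)"
    and coset_zero: "a \<in> I \<Longrightarrow> I +>\<^bsub>A\<^esub> a = \<zero>\<^bsub>quot_algebra A I\<^esub>"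
    and scalar_ring_quot_algebra: "scalar_ring (quot_algebra A I)"
proof -
  interpret A: scalar_ring A by (rule A)
  interpret I: ideal I A by (rule I)
  note [simp] = I.a_Hcarr
  show c: "carrier (quot_algebra A I) = (\<lambda>a. I +>\<^bsub>A\<^esub> a) ` carrier A"
    by (auto simp: quot_algebra_def FactRing_def A_RCOSETS_def' a_r_coset_def')
  show ad: "(I +>\<^bsub>A\<^esub> a) \<oplus>\<^bsub>quot_algebra A I\<^esub> (I +>\<^bsub>A\<^esub> b) = I +>\<^bsub>A\<^esub> (a \<oplus>\<^bsub>A\<^esub> b)"
    if "a \<in> carrier A" "b \<in> carrier A" for a b
    using that by (simp add: quot_algebra_def FactRing_def I.a_rcos_sum)
  show mu: "(I +>\<^bsub>A\<^esub> a) \<otimes>\<^bsub>quot_algebra A I\<^esub> (I +>\<^bsub>A\<^esub> b) = I +>\<^bsub>A\<^esub> (a \<otimes>\<^bsub>A\<^esub> b)"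
    if "a \<in> carrier A" "b \<in> carrier A" for a b
    using that by (simp add: quot_algebra_def FactRing_def I.rcoset_mult_add)
  show on: "\<one>\<^bsub>quot_algebra A I\<^esub> = I +>\<^bsub>A\<^esub> \<one>\<^bsub>A\<^esub>" by (simp add: quot_algebra_def FactRing_def)
  have z: "\<zero>\<^bsub>quot_algebra A I\<^esub> = I" by (simp add: quot_algebra_def FactRing_def)
  have ze: "\<zero>\<^bsub>quot_algebra A I\<^esub> = I +>\<^bsub>A\<^esub> \<zero>\<^bsub>A\<^esub>" unfolding z using I.a_subset by simp
  show "I +>\<^bsub>A\<^esub> a = \<zero>\<^bsub>quot_algebra A I\<^esub>" if "a \<in> I" for a
    unfolding z using that I.a_rcos_const by simp
  show sm: "r \<odot>\<^bsub>quot_algebra A I\<^esub> (I +>\<^bsub>A\<^esub> a) = I +>\<^bsub>A\<^esub> (r \<odot>\<^bsub>A\<^esub> a)" if a: "a \<in> carrier A" for r a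
  proof -
    have "r \<odot>\<^bsub>quot_algebra A I\<^esub> (I +>\<^bsub>A\<^esub> a) = {i \<oplus>\<^bsub>A\<^esub> r \<odot>\<^bsub>A\<^esub> (j \<oplus>\<^bsub>A\<^esub> a) | i j. i \<in> I \<and> j \<in> I}"
      by (auto simp: quot_algebra_def set_add_def' a_r_coset_def')
    also have "\<dots> = {(i \<oplus>\<^bsub>A\<^esub> r \<odot>\<^bsub>A\<^esub> j) \<oplus>\<^bsub>A\<^esub> r \<odot>\<^bsub>A\<^esub> a | i j. i \<in> I \<and> j \<in> I}"
      using a by (metis (no_types, opaque_lifting) A.a_assoc A.smult_add A.smult_closed I.a_Hcarr)
    also have "\<dots> = {i \<oplus>\<^bsub>A\<^esub> r \<odot>\<^bsub>A\<^esub> a | i. i \<in> I}"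
    proof (intro equalityI subsetI)
      fix x assume "x \<in> {(i \<oplus>\<^bsub>A\<^esub> r \<odot>\<^bsub>A\<^esub> j) \<oplus>\<^bsub>A\<^esub> r \<odot>\<^bsub>A\<^esub> a | i j. i \<in> I \<and> j \<in> I}"
      then show "x \<in> {i \<oplus>\<^bsub>A\<^esub> r \<odot>\<^bsub>A\<^esub> a | i. i \<in> I}"
        using I.a_closed A.smult_ideal[OF I] by blast
    next
      fix x assume "x \<in> {i \<oplus>\<^bsub>A\<^esub> r \<odot>\<^bsub>A\<^esub> a | i. i \<in> I}"
      then obtain i where i: "i \<in> I" "x = i \<oplus>\<^bsub>A\<^esub> r \<odot>\<^bsub>A\<^esub> a" by auto
      then have "x = (i \<oplus>\<^bsub>A\<^esub> r \<odot>\<^bsub>A\<^esub> \<zero>\<^bsub>A\<^esub>) \<oplus>\<^bsub>A\<^esub> r \<odot>\<^bsub>A\<^esub> a" by (simp add: A.smult_zero)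
      then show "x \<in> {(i \<oplus>\<^bsub>A\<^esub> r \<odot>\<^bsub>A\<^esub> j) \<oplus>\<^bsub>A\<^esub> r \<odot>\<^bsub>A\<^esub> a | i j. i \<in> I \<and> j \<in> I}"
        using i(1) I.zero_closed by blast
    qed
    also have "\<dots> = I +>\<^bsub>A\<^esub> (r \<odot>\<^bsub>A\<^esub> a)" by (auto simp: a_r_coset_def')
    finally show ?thesis .
  qed
  show "scalar_ring (quot_algebra A I)"
    by (rule scalar_ring_image[OF A c ad mu on ze sm])
qed

lemma scalar_ring_free_algebra: "scalar_ring (free_algebra W :: ('k::field, 'w list \<Rightarrow> 'k) module)"
proof -
  let ?F = "free_algebra W :: ('k, 'w list \<Rightarrow> 'k) module"
  have carr: "f \<in> carrier ?F \<longleftrightarrow> finite {w. f w \<noteq> 0} \<and> {w. f w \<noteq> 0} \<subseteq> lists W" for f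
    by (simp add: free_algebra_def)
  have ops: "zero ?F = (\<lambda>w. 0)" "one ?F = (\<lambda>w. if w = [] then 1 else 0)"
    "f \<oplus>\<^bsub>?F\<^esub> g = (\<lambda>w. f w + g w)" "f \<otimes>\<^bsub>?F\<^esub> g = (\<lambda>w. \<Sum>i\<le>length w. f (take i w) * g (drop i w))"
    "r \<odot>\<^bsub>?F\<^esub> f = (\<lambda>w. r * f w)" for f g r
    by (simp_all add: free_algebra_def)
  have "abelian_group ?F"
  proof (rule abelian_groupI)
    fix f g assume f: "f \<in> carrier ?F" and g: "g \<in> carrier ?F"
    have "{w. f w + g w \<noteq> 0} \<subseteq> {w. f w \<noteq> 0} \<union> {w. g w \<noteq> 0}" by auto
    then show "f \<oplus>\<^bsub>?F\<^esub> g \<in> carrier ?F" using f g unfolding carr ops by (meson finite_UnI finite_subset le_sup_iff order_trans)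
    show "\<exists>g\<in>carrier ?F. g \<oplus>\<^bsub>?F\<^esub> f = \<zero>\<^bsub>?F\<^esub>"
      using f by (intro bexI[of _ "\<lambda>w. - f w"]) (auto simp: carr ops)
  qed (auto simp: carr ops algebra_simps)
  moreover have "monoid ?F"
  proof (rule monoidI)
    fix f g assume f: "f \<in> carrier ?F" and g: "g \<in> carrier ?F"
    let ?S = "{w. (\<Sum>i\<le>length w. f (take i w) * g (drop i w)) \<noteq> 0}"
    have sub: "?S \<subseteq> (\<lambda>(u, v). u @ v) ` ({w. f w \<noteq> 0} \<times> {w. g w \<noteq> 0})"
    proof
      fix w assume "w \<in> ?S"
      then obtain i where "f (take i w) * g (drop i w) \<noteq> 0" by (metis (mono_tags, lifting) mem_Collect_eq sum.neutral)
      then show "w \<in> (\<lambda>(u, v). u @ v) ` ({w. f w \<noteq> 0} \<times> {w. g w \<noteq> 0})"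
        by (intro image_eqI[of _ _ "(take i w, drop i w)"]) auto
    qed
    have "finite ?S" using f g by (intro finite_subset[OF sub]) (auto simp: carr)
    moreover have "?S \<subseteq> lists W" using sub f g unfolding carr by fastforce
    ultimately show "f \<otimes>\<^bsub>?F\<^esub> g \<in> carrier ?F" unfolding carr ops by blast
  next
    show "\<one>\<^bsub>?F\<^esub> \<in> carrier ?F" unfolding carr ops by (auto intro: finite_subset[of _ "{[]}"])
  next
    fix f assume "f \<in> carrier ?F"
    have "(\<Sum>i\<le>length w. (if take i w = [] then 1 else 0) * f (drop i w)) = (\<Sum>i\<le>length w. if i = 0 then f w else 0)" for w
      by (rule sum.cong) auto
    then show "\<one>\<^bsub>?F\<^esub> \<otimes>\<^bsub>?F\<^esub> f = f" by (simp add: ops)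
    have "(\<Sum>i\<le>length w. f (take i w) * (if drop i w = [] then 1 else 0)) = (\<Sum>i\<le>length w. if i = length w then f w else 0)" for w
      by (rule sum.cong) auto
    then show "f \<otimes>\<^bsub>?F\<^esub> \<one>\<^bsub>?F\<^esub> = f" by (simp add: ops)
  next
    fix f g h :: "'w list \<Rightarrow> 'k"
    show "f \<otimes>\<^bsub>?F\<^esub> g \<otimes>\<^bsub>?F\<^esub> h = f \<otimes>\<^bsub>?F\<^esub> (g \<otimes>\<^bsub>?F\<^esub> h)"
      unfolding ops
    proof
      fix w :: "'w list"
      let ?n = "length w"
      define G where "G i j = f (take i w) * (g (take j (drop i w)) * h (drop (i + j) w))" for i j
      have "(\<Sum>k\<le>?n. (\<Sum>i\<le>length (take k w). f (take i (take k w)) * g (drop i (take k w))) * h (drop k w))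
          = (\<Sum>k\<le>?n. \<Sum>i\<le>k. G i (k - i))"
        unfolding sum_distrib_right
      proof (rule sum.cong[OF refl])
        fix k assume "k \<in> {..?n}"
        then show "(\<Sum>i\<le>length (take k w). f (take i (take k w)) * g (drop i (take k w)) * h (drop k w)) = (\<Sum>i\<le>k. G i (k - i))"
          by (intro sum.cong) (auto simp: G_def min_def drop_take mult.assoc)
      qed
      also have "\<dots> = (\<Sum>(i, j)\<in>{(i, j). i + j \<le> ?n}. G i j)" by (rule sum.triangle_reindex_eq[symmetric])
      also have "{(i, j). i + j \<le> ?n} = Sigma {..?n} (\<lambda>i. {..?n - i})" by auto
      also have "(\<Sum>(i, j)\<in>Sigma {..?n} (\<lambda>i. {..?n - i}). G i j) = (\<Sum>i\<le>?n. \<Sum>j\<le>?n - i. G i j)"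
        by (subst sum.Sigma) auto
      also have "\<dots> = (\<Sum>i\<le>?n. f (take i w) * (\<Sum>j\<le>length (drop i w). g (take j (drop i w)) * h (drop j (drop i w))))"
        by (simp add: G_def sum_distrib_left add.commute)
      finally show "(\<Sum>k\<le>?n. (\<Sum>i\<le>length (take k w). f (take i (take k w)) * g (drop i (take k w))) * h (drop k w)) =
        (\<Sum>i\<le>?n. f (take i w) * (\<Sum>j\<le>length (drop i w). g (take j (drop i w)) * h (drop j (drop i w))))" .
    qed
  qed
  ultimately have "ring ?F"
    by (rule ringI) (auto simp: ops algebra_simps sum.distrib)
  then show ?thesis
  proof (intro scalar_ring.intro scalar_ring_axioms.intro)
    fix r f assume "f \<in> carrier ?F"
    moreover have "{w. r * f w \<noteq> 0} \<subseteq> {w. f w \<noteq> 0}" by auto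
    ultimately show "r \<odot>\<^bsub>?F\<^esub> f \<in> carrier ?F" unfolding carr ops by (meson finite_subset order_trans)
  qed (auto simp: ops algebra_simps sum_distrib_left)
qed

section \<open>Crossed products\<close>

locale crossed_data = T: scalar_ring T + group G for T :: "('k::field, 'a) module" and G :: "('g, 'b) monoid_scheme" (structure) +
  fixes act :: "'g \<Rightarrow> 'a \<Rightarrow> 'a"
  assumes finG: "finite (carrier G)"
    and act_closed: "g \<in> carrier G \<Longrightarrow> t \<in> carrier T \<Longrightarrow> act g t \<in> carrier T"
    and act_add: "g \<in> carrier G \<Longrightarrow> t \<in> carrier T \<Longrightarrow> u \<in> carrier T \<Longrightarrow> act g (t \<oplus>\<^bsub>T\<^esub> u) = act g t \<oplus>\<^bsub>T\<^esub> act g u"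
    and act_mult: "g \<in> carrier G \<Longrightarrow> t \<in> carrier T \<Longrightarrow> u \<in> carrier T \<Longrightarrow> act g (t \<otimes>\<^bsub>T\<^esub> u) = act g t \<otimes>\<^bsub>T\<^esub> act g u"
    and act_unit: "g \<in> carrier G \<Longrightarrow> act g \<one>\<^bsub>T\<^esub> = \<one>\<^bsub>T\<^esub>"
    and act_one: "t \<in> carrier T \<Longrightarrow> act \<one> t = t"
    and act_act: "g \<in> carrier G \<Longrightarrow> h \<in> carrier G \<Longrightarrow> t \<in> carrier T \<Longrightarrow> act g (act h t) = act (g \<otimes> h) t"
begin

abbreviation "C \<equiv> crossed_product G act T"
abbreviation "single \<equiv> crossed_single G T"

lemma act_zero: "g \<in> carrier G \<Longrightarrow> act g \<zero>\<^bsub>T\<^esub> = \<zero>\<^bsub>T\<^esub>"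
  using act_add[of g "\<zero>\<^bsub>T\<^esub>" "\<zero>\<^bsub>T\<^esub>"] act_closed[of g "\<zero>\<^bsub>T\<^esub>"]
  by (metis T.add.l_cancel_one' T.r_zero T.zero_closed)

lemma act_finsum:
  "g \<in> carrier G \<Longrightarrow> finite J \<Longrightarrow> f \<in> J \<rightarrow> carrier T \<Longrightarrow> act g (\<Oplus>\<^bsub>T\<^esub>j\<in>J. f j) = (\<Oplus>\<^bsub>T\<^esub>j\<in>J. act g (f j))"
proof (rotate_tac, induction J rule: finite_induct)
  case (insert j J)
  then have "f \<in> J \<rightarrow> carrier T" "f j \<in> carrier T" by auto
  then show ?case using insert by (simp add: T.finsum_closed act_add Pi_def act_closed)
qed (simp add: act_zero)

lemma finsum_swap:
  assumes "finite J" "finite L" "\<And>i j. i \<in> J \<Longrightarrow> j \<in> L \<Longrightarrow> f i j \<in> carrier T"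
  shows "(\<Oplus>\<^bsub>T\<^esub>i\<in>J. \<Oplus>\<^bsub>T\<^esub>j\<in>L. f i j) = (\<Oplus>\<^bsub>T\<^esub>j\<in>L. \<Oplus>\<^bsub>T\<^esub>i\<in>J. f i j)"
  using assms(1,3)
proof (induction J rule: finite_induct)
  case empty
  then show ?case by (simp add: T.finsum_zero)
next
  case (insert i J)
  have f: "f i \<in> L \<rightarrow> carrier T" "\<And>i'. i' \<in> J \<Longrightarrow> f i' \<in> L \<rightarrow> carrier T" "\<And>j. j \<in> L \<Longrightarrow> (\<lambda>i. f i j) \<in> J \<rightarrow> carrier T"
    using insert.prems by auto
  have "(\<Oplus>\<^bsub>T\<^esub>i\<in>insert i J. \<Oplus>\<^bsub>T\<^esub>j\<in>L. f i j) = (\<Oplus>\<^bsub>T\<^esub>j\<in>L. f i j) \<oplus>\<^bsub>T\<^esub> (\<Oplus>\<^bsub>T\<^esub>j\<in>L. \<Oplus>\<^bsub>T\<^esub>i\<in>J. f i j)"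
    using insert f by (subst T.finsum_insert) (auto intro!: T.finsum_closed)
  also have "\<dots> = (\<Oplus>\<^bsub>T\<^esub>j\<in>L. f i j \<oplus>\<^bsub>T\<^esub> (\<Oplus>\<^bsub>T\<^esub>i\<in>J. f i j))"
    using f by (subst T.finsum_addf) (auto intro!: T.finsum_closed)
  also have "\<dots> = (\<Oplus>\<^bsub>T\<^esub>j\<in>L. \<Oplus>\<^bsub>T\<^esub>i\<in>insert i J. f i j)"
  proof (rule T.finsum_cong', simp)
    fix j assume j: "j \<in> L"
    show "f i j \<oplus>\<^bsub>T\<^esub> (\<Oplus>\<^bsub>T\<^esub>i\<in>J. f i j) = (\<Oplus>\<^bsub>T\<^esub>i\<in>insert i J. f i j)"
      using insert j by (subst T.finsum_insert) auto
  qed (use insert.prems in \<open>auto intro!: T.finsum_closed\<close>)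
  finally show ?case .
qed

lemma finsum_translate:
  assumes h: "h \<in> carrier G" and f: "f \<in> carrier G \<rightarrow> carrier T"
  shows "(\<Oplus>\<^bsub>T\<^esub>g\<in>carrier G. f (h \<otimes> g)) = (\<Oplus>\<^bsub>T\<^esub>g\<in>carrier G. f g)"
proof -
  have bij: "(\<lambda>g. h \<otimes> g) ` carrier G = carrier G"
  proof (intro equalityI subsetI)
    fix g assume "g \<in> carrier G"
    then show "g \<in> (\<lambda>g. h \<otimes> g) ` carrier G"
      using h by (intro image_eqI[of _ _ "inv h \<otimes> g"]) (auto simp: m_assoc[symmetric])
  qed (use h in auto)
  have inj: "inj_on (\<lambda>g. h \<otimes> g) (carrier G)" using h by (auto intro: inj_onI)
  show ?thesis using T.finsum_reindex[of f "\<lambda>g. h \<otimes> g" "carrier G"] f inj by (simp add: bij)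
qed

lemma in_C: "F \<in> carrier C \<longleftrightarrow> F \<in> carrier G \<rightarrow>\<^sub>E carrier T" by (simp add: crossed_product_def)

lemma C_closed: "F \<in> carrier C \<Longrightarrow> g \<in> carrier G \<Longrightarrow> F g \<in> carrier T" by (auto simp: in_C)

lemma C_eqI: "F \<in> carrier C \<Longrightarrow> F' \<in> carrier C \<Longrightarrow> (\<And>k. k \<in> carrier G \<Longrightarrow> F k = F' k) \<Longrightarrow> F = F'"
  unfolding in_C by (rule PiE_ext)

lemma
  assumes k: "k \<in> carrier G"
  shows C_add: "(F \<oplus>\<^bsub>C\<^esub> F') k = F k \<oplus>\<^bsub>T\<^esub> F' k"
    and C_mult: "(F \<otimes>\<^bsub>C\<^esub> F') k = (\<Oplus>\<^bsub>T\<^esub>g\<in>carrier G. F g \<otimes>\<^bsub>T\<^esub> act g (F' (inv g \<otimes> k)))"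
    and C_one: "\<one>\<^bsub>C\<^esub> k = (if k = \<one> then \<one>\<^bsub>T\<^esub> else \<zero>\<^bsub>T\<^esub>)" and C_zero: "\<zero>\<^bsub>C\<^esub> k = \<zero>\<^bsub>T\<^esub>"
    and C_smult: "(r \<odot>\<^bsub>C\<^esub> F) k = r \<odot>\<^bsub>T\<^esub> F k"
    and single_apply: "single t g k = (if k = g then t else \<zero>\<^bsub>T\<^esub>)"
  using k by (simp_all add: crossed_product_def crossed_single_def)

lemma summand_closed:
  "F \<in> carrier C \<Longrightarrow> F' \<in> carrier C \<Longrightarrow> k \<in> carrier G \<Longrightarrow> (\<lambda>g. F g \<otimes>\<^bsub>T\<^esub> act g (F' (inv g \<otimes> k))) \<in> carrier G \<rightarrow> carrier T"
  by (intro funcsetI T.m_closed act_closed C_closed[of F] C_closed[of F']) auto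

lemma C_add_closed: "F \<in> carrier C \<Longrightarrow> F' \<in> carrier C \<Longrightarrow> F \<oplus>\<^bsub>C\<^esub> F' \<in> carrier C"
  and C_zero_closed: "\<zero>\<^bsub>C\<^esub> \<in> carrier C" and C_one_closed: "\<one>\<^bsub>C\<^esub> \<in> carrier C"
  and C_smult_closed: "F \<in> carrier C \<Longrightarrow> r \<odot>\<^bsub>C\<^esub> F \<in> carrier C"
  and single_closed: "t \<in> carrier T \<Longrightarrow> single t g \<in> carrier C"
  by (auto simp: crossed_product_def crossed_single_def intro!: T.smult_closed dest: PiE_mem)

lemma C_mult_closed: "F \<in> carrier C \<Longrightarrow> F' \<in> carrier C \<Longrightarrow> F \<otimes>\<^bsub>C\<^esub> F' \<in> carrier C"
proof -
  assume F: "F \<in> carrier C" "F' \<in> carrier C"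
  have "F \<otimes>\<^bsub>C\<^esub> F' = (\<lambda>k\<in>carrier G. \<Oplus>\<^bsub>T\<^esub>g\<in>carrier G. F g \<otimes>\<^bsub>T\<^esub> act g (F' (inv g \<otimes> k)))"
    by (simp add: crossed_product_def)
  then show ?thesis unfolding in_C using T.finsum_closed[OF summand_closed[OF F]] by auto
qed

lemma C_assoc:
  assumes F: "F \<in> carrier C" "F' \<in> carrier C" "F'' \<in> carrier C"
  shows "F \<otimes>\<^bsub>C\<^esub> F' \<otimes>\<^bsub>C\<^esub> F'' = F \<otimes>\<^bsub>C\<^esub> (F' \<otimes>\<^bsub>C\<^esub> F'')"
proof (rule C_eqI)
  fix k assume k: "k \<in> carrier G"
  note cl = C_closed[OF F(1)] C_closed[OF F(2)] C_closed[OF F(3)] act_closed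
  define t where "t h g = F h \<otimes>\<^bsub>T\<^esub> (act h (F' (inv h \<otimes> g)) \<otimes>\<^bsub>T\<^esub> act g (F'' (inv g \<otimes> k)))" for h g
  have tc: "t h g \<in> carrier T" if "h \<in> carrier G" "g \<in> carrier G" for h g
    unfolding t_def using that k by (intro T.m_closed cl) auto
  have "(F \<otimes>\<^bsub>C\<^esub> F' \<otimes>\<^bsub>C\<^esub> F'') k = (\<Oplus>\<^bsub>T\<^esub>g\<in>carrier G. \<Oplus>\<^bsub>T\<^esub>h\<in>carrier G. t h g)"
    unfolding C_mult[OF k]
  proof (rule T.finsum_cong', simp)
    fix g assume g: "g \<in> carrier G"
    have gk: "inv g \<otimes> k \<in> carrier G" using g k by simp
    have a: "act g (F'' (inv g \<otimes> k)) \<in> carrier T" using g gk by (intro cl) auto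
    have "(F \<otimes>\<^bsub>C\<^esub> F') g \<otimes>\<^bsub>T\<^esub> act g (F'' (inv g \<otimes> k)) =
        (\<Oplus>\<^bsub>T\<^esub>h\<in>carrier G. F h \<otimes>\<^bsub>T\<^esub> act h (F' (inv h \<otimes> g)) \<otimes>\<^bsub>T\<^esub> act g (F'' (inv g \<otimes> k)))"
      unfolding C_mult[OF g] by (rule T.finsum_ldistr[OF finG a summand_closed[OF F(1,2) g]])
    also have "\<dots> = (\<Oplus>\<^bsub>T\<^esub>h\<in>carrier G. t h g)"
    proof (rule T.finsum_cong', simp)
      fix h assume "h \<in> carrier G"
      then show "F h \<otimes>\<^bsub>T\<^esub> act h (F' (inv h \<otimes> g)) \<otimes>\<^bsub>T\<^esub> act g (F'' (inv g \<otimes> k)) = t h g"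
        unfolding t_def using g a k gk by (intro T.m_assoc cl) auto
    qed (use tc g in auto)
    finally show "(F \<otimes>\<^bsub>C\<^esub> F') g \<otimes>\<^bsub>T\<^esub> act g (F'' (inv g \<otimes> k)) = (\<Oplus>\<^bsub>T\<^esub>h\<in>carrier G. t h g)" .
  qed (use tc in \<open>auto intro!: T.finsum_closed\<close>)
  also have "\<dots> = (\<Oplus>\<^bsub>T\<^esub>h\<in>carrier G. \<Oplus>\<^bsub>T\<^esub>g\<in>carrier G. t h g)"
    by (rule finsum_swap[OF finG finG tc])
  also have "\<dots> = (F \<otimes>\<^bsub>C\<^esub> (F' \<otimes>\<^bsub>C\<^esub> F'')) k"
    unfolding C_mult[OF k]
  proof (rule T.finsum_cong', simp)
    fix h assume h: "h \<in> carrier G"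
    have hk: "inv h \<otimes> k \<in> carrier G" using h k by simp
    have "F h \<otimes>\<^bsub>T\<^esub> act h ((F' \<otimes>\<^bsub>C\<^esub> F'') (inv h \<otimes> k)) =
        F h \<otimes>\<^bsub>T\<^esub> (\<Oplus>\<^bsub>T\<^esub>g\<in>carrier G. act h (F' g \<otimes>\<^bsub>T\<^esub> act g (F'' (inv g \<otimes> (inv h \<otimes> k)))))"
      unfolding C_mult[OF hk] using act_finsum[OF h finG summand_closed[OF F(2,3) hk]] by simp
    also have "\<dots> = (\<Oplus>\<^bsub>T\<^esub>g\<in>carrier G. F h \<otimes>\<^bsub>T\<^esub> act h (F' g \<otimes>\<^bsub>T\<^esub> act g (F'' (inv g \<otimes> (inv h \<otimes> k)))))"
      by (rule T.finsum_rdistr[OF finG]) (use h hk in \<open>auto intro!: cl T.m_closed\<close>)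
    also have "\<dots> = (\<Oplus>\<^bsub>T\<^esub>g\<in>carrier G. t h (h \<otimes> g))"
    proof (rule T.finsum_cong', simp)
      fix g assume g: "g \<in> carrier G"
      have "act h (F' g \<otimes>\<^bsub>T\<^esub> act g (F'' (inv g \<otimes> (inv h \<otimes> k)))) =
          act h (F' g) \<otimes>\<^bsub>T\<^esub> act (h \<otimes> g) (F'' (inv g \<otimes> (inv h \<otimes> k)))"
        using h g hk by (simp add: act_mult act_act cl)
      then show "F h \<otimes>\<^bsub>T\<^esub> act h (F' g \<otimes>\<^bsub>T\<^esub> act g (F'' (inv g \<otimes> (inv h \<otimes> k)))) = t h (h \<otimes> g)"
        using h g k by (simp add: t_def inv_mult_group m_assoc[symmetric])
    qed (use tc h in auto)
    also have "\<dots> = (\<Oplus>\<^bsub>T\<^esub>g\<in>carrier G. t h g)"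
      by (rule finsum_translate[OF h]) (use tc h in auto)
    finally show "(\<Oplus>\<^bsub>T\<^esub>g\<in>carrier G. t h g) = F h \<otimes>\<^bsub>T\<^esub> act h ((F' \<otimes>\<^bsub>C\<^esub> F'') (inv h \<otimes> k))" ..
  qed (use summand_closed[OF F(1) C_mult_closed[OF F(2,3)] k] in auto)
  finally show "(F \<otimes>\<^bsub>C\<^esub> F' \<otimes>\<^bsub>C\<^esub> F'') k = (F \<otimes>\<^bsub>C\<^esub> (F' \<otimes>\<^bsub>C\<^esub> F'')) k" .
qed (intro C_mult_closed F)+

lemma finsum_delta:
  assumes g: "g0 \<in> carrier G" and t: "t \<in> carrier T"
  shows "(\<Oplus>\<^bsub>T\<^esub>g\<in>carrier G. if g = g0 then t else \<zero>\<^bsub>T\<^esub>) = t"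
proof -
  have "(\<Oplus>\<^bsub>T\<^esub>g\<in>carrier G. if g = g0 then t else \<zero>\<^bsub>T\<^esub>) = (\<Oplus>\<^bsub>T\<^esub>g\<in>carrier G. if g0 = g then t else \<zero>\<^bsub>T\<^esub>)"
    by (rule T.finsum_cong') (use t in auto)
  then show ?thesis using T.finsum_singleton[OF g finG, of "\<lambda>_. t"] t by simp
qed

lemma scalar_ring_crossed: "scalar_ring C"
proof -
  have "abelian_group C"
  proof (rule abelian_groupI)
    fix F assume F: "F \<in> carrier C"
    have "(\<lambda>k\<in>carrier G. \<ominus>\<^bsub>T\<^esub> F k) \<in> carrier C" using C_closed[OF F] by (auto simp: in_C)
    moreover from this have "(\<lambda>k\<in>carrier G. \<ominus>\<^bsub>T\<^esub> F k) \<oplus>\<^bsub>C\<^esub> F = \<zero>\<^bsub>C\<^esub>"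
      by (intro C_eqI C_add_closed C_zero_closed F) (auto simp: C_add C_zero C_closed[OF F] T.l_neg)
    ultimately show "\<exists>F'\<in>carrier C. F' \<oplus>\<^bsub>C\<^esub> F = \<zero>\<^bsub>C\<^esub>" by blast
  qed (auto intro!: C_eqI C_add_closed C_zero_closed simp: C_add C_zero C_closed T.a_assoc T.a_comm T.a_lcomm)
  moreover have "monoid C"
  proof (rule monoidI)
    fix F assume F: "F \<in> carrier C"
    show "\<one>\<^bsub>C\<^esub> \<otimes>\<^bsub>C\<^esub> F = F"
    proof (intro C_eqI C_mult_closed C_one_closed F)
      fix k assume k: "k \<in> carrier G"
      have "(\<Oplus>\<^bsub>T\<^esub>g\<in>carrier G. \<one>\<^bsub>C\<^esub> g \<otimes>\<^bsub>T\<^esub> act g (F (inv g \<otimes> k))) = (\<Oplus>\<^bsub>T\<^esub>g\<in>carrier G. if g = \<one> then F k else \<zero>\<^bsub>T\<^esub>)"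
        by (rule T.finsum_cong') (use k in \<open>auto simp: C_one C_closed[OF F] act_closed act_one\<close>)
      then show "(\<one>\<^bsub>C\<^esub> \<otimes>\<^bsub>C\<^esub> F) k = F k" using k F by (simp add: C_mult finsum_delta C_closed)
    qed
    show "F \<otimes>\<^bsub>C\<^esub> \<one>\<^bsub>C\<^esub> = F"
    proof (intro C_eqI C_mult_closed C_one_closed F)
      fix k assume k: "k \<in> carrier G"
      have "(\<Oplus>\<^bsub>T\<^esub>g\<in>carrier G. F g \<otimes>\<^bsub>T\<^esub> act g (\<one>\<^bsub>C\<^esub> (inv g \<otimes> k))) = (\<Oplus>\<^bsub>T\<^esub>g\<in>carrier G. if g = k then F k else \<zero>\<^bsub>T\<^esub>)"
      proof (rule T.finsum_cong', simp)
        fix g assume g: "g \<in> carrier G"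
        have "inv g \<otimes> k = \<one> \<longleftrightarrow> g = k" using g k by (metis inv_closed inv_equality inv_inv l_inv)
        then show "F g \<otimes>\<^bsub>T\<^esub> act g (\<one>\<^bsub>C\<^esub> (inv g \<otimes> k)) = (if g = k then F k else \<zero>\<^bsub>T\<^esub>)"
          using g k by (auto simp: C_one C_closed[OF F] act_unit act_zero)
      qed (use k in \<open>auto simp: C_closed[OF F]\<close>)
      then show "(F \<otimes>\<^bsub>C\<^esub> \<one>\<^bsub>C\<^esub>) k = F k" using k F by (simp add: C_mult finsum_delta C_closed)
    qed
  qed (auto intro: C_mult_closed C_one_closed C_assoc)
  moreover have "(F \<oplus>\<^bsub>C\<^esub> F') \<otimes>\<^bsub>C\<^esub> F'' = F \<otimes>\<^bsub>C\<^esub> F'' \<oplus>\<^bsub>C\<^esub> F' \<otimes>\<^bsub>C\<^esub> F''"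
    "F'' \<otimes>\<^bsub>C\<^esub> (F \<oplus>\<^bsub>C\<^esub> F') = F'' \<otimes>\<^bsub>C\<^esub> F \<oplus>\<^bsub>C\<^esub> F'' \<otimes>\<^bsub>C\<^esub> F'"
    if F: "F \<in> carrier C" "F' \<in> carrier C" "F'' \<in> carrier C" for F F' F''
  proof -
    show "(F \<oplus>\<^bsub>C\<^esub> F') \<otimes>\<^bsub>C\<^esub> F'' = F \<otimes>\<^bsub>C\<^esub> F'' \<oplus>\<^bsub>C\<^esub> F' \<otimes>\<^bsub>C\<^esub> F''"
    proof (intro C_eqI C_mult_closed C_add_closed F)
      fix k assume k: "k \<in> carrier G"
      show "((F \<oplus>\<^bsub>C\<^esub> F') \<otimes>\<^bsub>C\<^esub> F'') k = (F \<otimes>\<^bsub>C\<^esub> F'' \<oplus>\<^bsub>C\<^esub> F' \<otimes>\<^bsub>C\<^esub> F'') k"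
        unfolding C_add[OF k] C_mult[OF k] T.finsum_addf[OF summand_closed[OF F(1,3) k] summand_closed[OF F(2,3) k], symmetric]
        by (rule T.finsum_cong') (use k F in \<open>auto simp: C_add T.l_distr C_closed act_closed\<close>)
    qed
    show "F'' \<otimes>\<^bsub>C\<^esub> (F \<oplus>\<^bsub>C\<^esub> F') = F'' \<otimes>\<^bsub>C\<^esub> F \<oplus>\<^bsub>C\<^esub> F'' \<otimes>\<^bsub>C\<^esub> F'"
    proof (intro C_eqI C_mult_closed C_add_closed F)
      fix k assume k: "k \<in> carrier G"
      show "(F'' \<otimes>\<^bsub>C\<^esub> (F \<oplus>\<^bsub>C\<^esub> F')) k = (F'' \<otimes>\<^bsub>C\<^esub> F \<oplus>\<^bsub>C\<^esub> F'' \<otimes>\<^bsub>C\<^esub> F') k"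
        unfolding C_add[OF k] C_mult[OF k] T.finsum_addf[OF summand_closed[OF F(3,1) k] summand_closed[OF F(3,2) k], symmetric]
        by (rule T.finsum_cong') (use k F in \<open>auto simp: C_add T.r_distr C_closed act_closed act_add\<close>)
    qed
  qed
  ultimately have "ring C" by (intro ringI) auto
  then show ?thesis
  proof (intro scalar_ring.intro scalar_ring_axioms.intro)
    fix r F F' assume F: "F \<in> carrier C" "F' \<in> carrier C"
    show "r \<odot>\<^bsub>C\<^esub> (F \<oplus>\<^bsub>C\<^esub> F') = r \<odot>\<^bsub>C\<^esub> F \<oplus>\<^bsub>C\<^esub> r \<odot>\<^bsub>C\<^esub> F'"
      by (intro C_eqI C_smult_closed C_add_closed F) (auto simp: C_smult C_add C_closed F T.smult_add)
    show "(r \<odot>\<^bsub>C\<^esub> F) \<otimes>\<^bsub>C\<^esub> F' = r \<odot>\<^bsub>C\<^esub> (F \<otimes>\<^bsub>C\<^esub> F')"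
    proof (intro C_eqI C_smult_closed C_mult_closed F)
      fix k assume k: "k \<in> carrier G"
      show "((r \<odot>\<^bsub>C\<^esub> F) \<otimes>\<^bsub>C\<^esub> F') k = (r \<odot>\<^bsub>C\<^esub> (F \<otimes>\<^bsub>C\<^esub> F')) k"
        unfolding C_mult[OF k] C_smult[OF k] T.smult_finsum[OF finG summand_closed[OF F k]]
        by (rule T.finsum_cong') (use k F in \<open>auto simp: C_smult T.smult_mult C_closed act_closed\<close>)
    qed
  qed (auto intro: C_smult_closed)
qed

lemma single_mult:
  assumes t: "t \<in> carrier T" "u \<in> carrier T" and g: "g \<in> carrier G" "h \<in> carrier G"
  shows "single t g \<otimes>\<^bsub>C\<^esub> single u h = single (t \<otimes>\<^bsub>T\<^esub> act g u) (g \<otimes> h)"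
proof (rule C_eqI)
  fix k assume k: "k \<in> carrier G"
  have "(\<Oplus>\<^bsub>T\<^esub>j\<in>carrier G. single t g j \<otimes>\<^bsub>T\<^esub> act j (single u h (inv j \<otimes> k))) =
      (\<Oplus>\<^bsub>T\<^esub>j\<in>carrier G. if j = g then t \<otimes>\<^bsub>T\<^esub> act g (single u h (inv g \<otimes> k)) else \<zero>\<^bsub>T\<^esub>)"
    by (rule T.finsum_cong') (use t g k in \<open>auto simp: single_apply act_closed act_zero\<close>)
  also have "\<dots> = t \<otimes>\<^bsub>T\<^esub> act g (single u h (inv g \<otimes> k))"
    using t g k by (intro finsum_delta) (auto simp: single_apply act_closed act_zero)
  also have "\<dots> = single (t \<otimes>\<^bsub>T\<^esub> act g u) (g \<otimes> h) k"
  proof -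
    have "inv g \<otimes> k = h \<longleftrightarrow> k = g \<otimes> h" using g k by (metis inv_closed inv_solve_left l_one m_assoc m_closed r_inv)
    then show ?thesis using t g k by (auto simp: single_apply act_zero)
  qed
  finally show "(single t g \<otimes>\<^bsub>C\<^esub> single u h) k = single (t \<otimes>\<^bsub>T\<^esub> act g u) (g \<otimes> h) k"
    by (simp add: C_mult[OF k])
qed (use t g in \<open>auto intro!: C_mult_closed single_closed act_closed\<close>)

lemma single_add: "t \<in> carrier T \<Longrightarrow> u \<in> carrier T \<Longrightarrow> single (t \<oplus>\<^bsub>T\<^esub> u) g = single t g \<oplus>\<^bsub>C\<^esub> single u g"
  by (intro C_eqI single_closed C_add_closed) (auto simp: single_apply C_add)

lemma single_smult: "t \<in> carrier T \<Longrightarrow> single (r \<odot>\<^bsub>T\<^esub> t) g = r \<odot>\<^bsub>C\<^esub> single t g"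
  by (intro C_eqI single_closed C_smult_closed) (auto simp: single_apply C_smult T.smult_zero)

lemma single_one: "single \<one>\<^bsub>T\<^esub> \<one> = \<one>\<^bsub>C\<^esub>"
  by (intro C_eqI single_closed C_one_closed) (auto simp: single_apply C_one)

text \<open>Every element is the sum of its single terms.\<close>

lemma crossed_induct [consumes 1, case_names zero step]:
  assumes F: "F \<in> carrier C" and zero: "P \<zero>\<^bsub>C\<^esub>"
    and step: "\<And>t g F. t \<in> carrier T \<Longrightarrow> g \<in> carrier G \<Longrightarrow> F \<in> carrier C \<Longrightarrow> P F \<Longrightarrow> P (single t g \<oplus>\<^bsub>C\<^esub> F)"
  shows "P F"
proof -
  have "P F" if "finite J" "J \<subseteq> carrier G" "F \<in> carrier C" "\<And>k. k \<in> carrier G - J \<Longrightarrow> F k = \<zero>\<^bsub>T\<^esub>" for J F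
    using that
  proof (induction J arbitrary: F rule: finite_induct)
    case empty
    then have "F = \<zero>\<^bsub>C\<^esub>" by (intro C_eqI C_zero_closed) (auto simp: C_zero)
    then show ?case using zero by simp
  next
    case (insert j J)
    define F' where "F' = (\<lambda>k\<in>carrier G. if k = j then \<zero>\<^bsub>T\<^esub> else F k)"
    have F': "F' \<in> carrier C" using insert.prems C_closed by (auto simp: in_C F'_def)
    have "F' k = \<zero>\<^bsub>T\<^esub>" if "k \<in> carrier G - J" for k using insert.prems that by (auto simp: F'_def)
    then have "P F'" using insert.prems(1) by (intro insert.IH F') auto
    moreover have "F = single (F j) j \<oplus>\<^bsub>C\<^esub> F'"
      using insert.prems F'
      by (intro C_eqI C_add_closed single_closed C_closed) (auto simp: C_add single_apply F'_def C_closed)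
    ultimately show ?case using step[of "F j" j F'] insert.prems F' C_closed by auto
  qed
  from this[OF finG _ F] show ?thesis by auto
qed

end

section \<open>The action on the tensor algebra\<close>

definition word_elt :: "'w list \<Rightarrow> 'w list \<Rightarrow> 'k::field" where
  "word_elt w = (\<lambda>v. if v = w then 1 else 0)"

lemma free_algebra_simps:
  "f \<in> carrier (free_algebra W) \<longleftrightarrow> finite {w. f w \<noteq> 0} \<and> {w. f w \<noteq> 0} \<subseteq> lists W"
  "\<zero>\<^bsub>free_algebra W\<^esub> = (\<lambda>w. 0)" "\<one>\<^bsub>free_algebra W\<^esub> = word_elt []"
  "f \<oplus>\<^bsub>free_algebra W\<^esub> g = (\<lambda>w. f w + g w)"
  "f \<otimes>\<^bsub>free_algebra W\<^esub> g = (\<lambda>w. \<Sum>i\<le>length w. f (take i w) * g (drop i w))"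
  "r \<odot>\<^bsub>free_algebra W\<^esub> f = (\<lambda>w. r * f w)"
  by (simp_all add: free_algebra_def word_elt_def)

lemma word_elt_closed: "w \<in> lists W \<Longrightarrow> word_elt w \<in> carrier (free_algebra W)"
  by (auto simp: free_algebra_simps word_elt_def in_lists_conv_set intro: finite_subset[of _ "{w}"])

lemma letter_word: "letter u = word_elt [u]"
  by (simp add: letter_def word_elt_def)

lemma letter_closed: "u \<in> W \<Longrightarrow> letter u \<in> carrier (free_algebra W)"
  unfolding letter_word by (rule word_elt_closed) auto

lemma word_Cons: "(word_elt (u # w) :: 'w list \<Rightarrow> 'k::field) = letter u \<otimes>\<^bsub>free_algebra W\<^esub> word_elt w"
proof
  fix v :: "'w list"
  have "(\<Sum>i\<le>length v. letter u (take i v) * word_elt w (drop i v)) =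
    (\<Sum>i\<le>length v. if i = 1 \<and> v = u # w then 1 else (0 :: 'k))"
  proof (rule sum.cong[OF refl])
    fix i assume i: "i \<in> {..length v}"
    have "take i v = [u] \<and> drop i v = w \<longleftrightarrow> i = 1 \<and> v = u # w"
    proof
      assume t: "take i v = [u] \<and> drop i v = w"
      then have "length (take i v) = 1" by simp
      then have "i = 1" using i by simp
      moreover have "v = u # w" using t append_take_drop_id[of i v] by simp
      ultimately show "i = 1 \<and> v = u # w" by simp
    qed auto
    then show "letter u (take i v) * word_elt w (drop i v) = (if i = 1 \<and> v = u # w then 1 else (0 :: 'k))"
      by (auto simp: letter_def word_elt_def)
  qed
  also have "\<dots> = word_elt (u # w) v" by (cases v) (auto simp: word_elt_def Suc_le_eq)
  finally show "(word_elt (u # w) v :: 'k) = (letter u \<otimes>\<^bsub>free_algebra W\<^esub> word_elt w) v" by (simp add: free_algebra_simps)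
qed

lemma free_algebra_induct [consumes 1, case_names zero step]:
  assumes f: "f \<in> carrier (free_algebra W)" and zero: "P \<zero>\<^bsub>free_algebra W\<^esub>"
    and step: "\<And>r w f. w \<in> lists W \<Longrightarrow> f \<in> carrier (free_algebra W) \<Longrightarrow> P f \<Longrightarrow>
      P (r \<odot>\<^bsub>free_algebra W\<^esub> word_elt w \<oplus>\<^bsub>free_algebra W\<^esub> f)"
  shows "P f"
proof -
  have "P f" if "finite J" "J \<subseteq> lists W" "{w. f w \<noteq> 0} \<subseteq> J" for J f
    using that
  proof (induction J arbitrary: f rule: finite_induct)
    case empty
    then have "f = \<zero>\<^bsub>free_algebra W\<^esub>" by (auto simp: free_algebra_simps)
    then show ?case using zero by simp
  next
    case (insert j J)
    define f' where "f' = f(j := 0)"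
    have s: "{w. f' w \<noteq> 0} \<subseteq> J" using insert.prems by (auto simp: f'_def)
    then have "P f'" using insert by (intro insert.IH) auto
    moreover have "f' \<in> carrier (free_algebra W)"
      unfolding free_algebra_simps using s insert finite_subset[OF s] by auto
    moreover have "f = f j \<odot>\<^bsub>free_algebra W\<^esub> word_elt j \<oplus>\<^bsub>free_algebra W\<^esub> f'"
      by (auto simp: free_algebra_simps word_elt_def f'_def fun_eq_iff)
    ultimately show ?case using step[of j f' "f j"] insert.prems by auto
  qed
  then show ?thesis using f by (auto simp: free_algebra_simps)
qed

context reflection_data
begin

abbreviation "dbl \<equiv> double_act G \<rho> :: 'g \<Rightarrow> 'v \<times> ('v \<Rightarrow> 'k) \<Rightarrow> 'v \<times> ('v \<Rightarrow> 'k)"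
abbreviation "dsc \<equiv> double_scale scale"
abbreviation "W \<equiv> double_space scale"
abbreviation "FA \<equiv> free_algebra W :: ('k, ('v \<times> ('v \<Rightarrow> 'k)) list \<Rightarrow> 'k) module"
abbreviation "LI \<equiv> linearity_ideal dsc W"

lemma W_iff: "u \<in> W \<longleftrightarrow> snd u \<in> dual"
  by (cases u) (simp add: double_space_def)

lemma dbl_W: "g \<in> carrier G \<Longrightarrow> u \<in> W \<Longrightarrow> dbl g u \<in> W"
  by (cases u) (simp add: W_iff double_act_def dact_dual)

lemma dbl_one: "dbl \<one> u = u"
  by (cases u) (simp add: double_act_def dual_act_def \<rho>_one)

lemma dbl_mult: "g \<in> carrier G \<Longrightarrow> h \<in> carrier G \<Longrightarrow> dbl g (dbl h u) = dbl (g \<otimes> h) u"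
  by (cases u) (simp add: double_act_def dual_act_def \<rho>_mult G.inv_mult_group)

lemma dbl_inv: "g \<in> carrier G \<Longrightarrow> dbl g (dbl (inv g) u) = u" "g \<in> carrier G \<Longrightarrow> dbl (inv g) (dbl g u) = u"
  by (simp_all add: dbl_mult dbl_one)

lemma dsc_W: "u \<in> W \<Longrightarrow> dsc a u \<in> W" and add_W: "u \<in> W \<Longrightarrow> v \<in> W \<Longrightarrow> u + v \<in> W"
  by (cases u; simp add: W_iff double_scale_def dual_smult) (simp add: W_iff dual_plus)

lemma dbl_linear: "g \<in> carrier G \<Longrightarrow> dbl g (dsc a u + dsc b v) = dsc a (dbl g u) + dsc b (dbl g v)"
  by (cases u; cases v) (simp add: double_act_def double_scale_def \<rho>_add \<rho>_scale dual_act_def fun_eq_iff)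

sublocale FA: scalar_ring FA by (rule scalar_ring_free_algebra)

lemma relations_closed: "linearity_relations dsc W \<subseteq> carrier FA"
  by (auto simp: linearity_relations_def intro!: FA.minus_closed FA.a_closed FA.smult_closed letter_closed add_W dsc_W)

lemma ideal_LI: "ideal LI FA"
  unfolding linearity_ideal_def by (rule FA.genideal_ideal[OF relations_closed])

sublocale LI: ideal LI FA by (rule ideal_LI)

text \<open>The action on representatives of elements of the tensor algebra.\<close>

definition \<Phi> :: "'g \<Rightarrow> (('v \<times> ('v \<Rightarrow> 'k)) list \<Rightarrow> 'k) \<Rightarrow> ('v \<times> ('v \<Rightarrow> 'k)) list \<Rightarrow> 'k" where
  "\<Phi> g f = (\<lambda>w. f (map (dbl (inv g)) w))"

lemma \<Phi>_closed:
  assumes g: "g \<in> carrier G" and f: "f \<in> carrier FA" shows "\<Phi> g f \<in> carrier FA"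
proof -
  have eq: "{w. \<Phi> g f w \<noteq> 0} = map (dbl g) ` {w. f w \<noteq> 0}"
  proof (intro equalityI subsetI)
    fix w assume "w \<in> {w. \<Phi> g f w \<noteq> 0}"
    then show "w \<in> map (dbl g) ` {w. f w \<noteq> 0}"
      using g by (intro image_eqI[of _ _ "map (dbl (inv g)) w"]) (auto simp: \<Phi>_def comp_def dbl_inv)
  qed (use g in \<open>auto simp: \<Phi>_def comp_def dbl_inv\<close>)
  have "map (dbl g) w \<in> lists W" if "w \<in> lists W" for w
    using that dbl_W[OF g] by (auto simp: in_lists_conv_set)
  then show ?thesis using f unfolding free_algebra_simps eq by auto
qed

lemma \<Phi>_add: "\<Phi> g (f \<oplus>\<^bsub>FA\<^esub> f') = \<Phi> g f \<oplus>\<^bsub>FA\<^esub> \<Phi> g f'" and \<Phi>_smult: "\<Phi> g (r \<odot>\<^bsub>FA\<^esub> f) = r \<odot>\<^bsub>FA\<^esub> \<Phi> g f"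
  and \<Phi>_mult: "\<Phi> g (f \<otimes>\<^bsub>FA\<^esub> f') = \<Phi> g f \<otimes>\<^bsub>FA\<^esub> \<Phi> g f'" and \<Phi>_one: "\<Phi> g \<one>\<^bsub>FA\<^esub> = \<one>\<^bsub>FA\<^esub>"
  and \<Phi>_zero: "\<Phi> g \<zero>\<^bsub>FA\<^esub> = \<zero>\<^bsub>FA\<^esub>"
  by (simp_all add: \<Phi>_def free_algebra_simps word_elt_def take_map drop_map fun_eq_iff)

lemma \<Phi>_neg: "g \<in> carrier G \<Longrightarrow> f \<in> carrier FA \<Longrightarrow> \<Phi> g (\<ominus>\<^bsub>FA\<^esub> f) = \<ominus>\<^bsub>FA\<^esub> \<Phi> g f"
  by (metis FA.a_inv_closed FA.l_neg FA.minus_equality \<Phi>_add \<Phi>_closed \<Phi>_zero)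

lemma \<Phi>_\<Phi>: "g \<in> carrier G \<Longrightarrow> h \<in> carrier G \<Longrightarrow> \<Phi> g (\<Phi> h f) = \<Phi> (g \<otimes> h) f"
  by (simp add: \<Phi>_def comp_def dbl_mult G.inv_mult_group)

lemma \<Phi>_unit: "\<Phi> \<one> f = f"
proof -
  have "map (dbl \<one>) w = w" for w by (rule map_idI) (rule dbl_one)
  then show ?thesis by (simp add: \<Phi>_def)
qed

lemma \<Phi>_letter: "g \<in> carrier G \<Longrightarrow> \<Phi> g (letter u) = letter (dbl g u)"
proof
  fix w assume g: "g \<in> carrier G"
  have "map (dbl (inv g)) w = [u] \<longleftrightarrow> w = [dbl g u]" using g by (auto simp: dbl_inv)
  then show "\<Phi> g (letter u) w = letter (dbl g u) w" by (simp add: \<Phi>_def letter_def)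
qed

text \<open>The action permutes the linearity relations, and the elements that it sends into the ideal form an
  ideal themselves.\<close>

lemma \<Phi>_LI:
  assumes g: "g \<in> carrier G" and f: "f \<in> LI" shows "\<Phi> g f \<in> LI"
proof -
  let ?J = "{f \<in> carrier FA. \<Phi> g f \<in> LI}"
  have "ideal ?J FA"
  proof (rule idealI[OF FA.ring_axioms])
    show "subgroup ?J (add_monoid FA)"
    proof (rule FA.add.subgroupI)
      show "?J \<noteq> {}" using LI.zero_closed by (auto simp: \<Phi>_zero)
    qed (auto simp: \<Phi>_add \<Phi>_neg g intro: LI.a_closed)
  qed (auto simp: \<Phi>_mult \<Phi>_closed g intro: LI.I_l_closed LI.I_r_closed)
  moreover have "linearity_relations dsc W \<subseteq> ?J"
  proof
    fix r assume r: "r \<in> linearity_relations dsc W"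
    then obtain a b u v where uv: "u \<in> W" "v \<in> W"
      "r = letter (dsc a u + dsc b v) \<ominus>\<^bsub>FA\<^esub> (a \<odot>\<^bsub>FA\<^esub> letter u \<oplus>\<^bsub>FA\<^esub> b \<odot>\<^bsub>FA\<^esub> letter v)"
      by (auto simp: linearity_relations_def)
    have c: "letter (dsc a u + dsc b v) \<in> carrier FA" "a \<odot>\<^bsub>FA\<^esub> letter u \<oplus>\<^bsub>FA\<^esub> b \<odot>\<^bsub>FA\<^esub> letter v \<in> carrier FA"
      using uv by (auto intro!: letter_closed FA.a_closed FA.smult_closed add_W dsc_W)
    have "\<Phi> g r = letter (dsc a (dbl g u) + dsc b (dbl g v)) \<ominus>\<^bsub>FA\<^esub>
        (a \<odot>\<^bsub>FA\<^esub> letter (dbl g u) \<oplus>\<^bsub>FA\<^esub> b \<odot>\<^bsub>FA\<^esub> letter (dbl g v))"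
      using c g unfolding uv(3) a_minus_def
      by (simp only: \<Phi>_add \<Phi>_neg \<Phi>_smult \<Phi>_letter dbl_linear)
    then have "\<Phi> g r \<in> linearity_relations dsc W"
      unfolding linearity_relations_def using dbl_W[OF g uv(1)] dbl_W[OF g uv(2)] by blast
    then have "\<Phi> g r \<in> LI" unfolding linearity_ideal_def using FA.genideal_self[OF relations_closed] by auto
    then show "r \<in> ?J" using r relations_closed by auto
  qed
  ultimately have "LI \<subseteq> ?J" unfolding linearity_ideal_def by (rule FA.genideal_minimal)
  then show ?thesis using f by auto
qed

lemma tensor_act_coset:
  assumes g: "g \<in> carrier G" and f: "f \<in> carrier FA"
  shows "tensor_act G \<rho> g (LI +>\<^bsub>FA\<^esub> f) = LI +>\<^bsub>FA\<^esub> \<Phi> g f"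
proof -
  have "\<Phi> g ` LI = LI"
  proof (intro equalityI subsetI)
    fix i assume "i \<in> LI"
    then have "\<Phi> (inv g) i \<in> LI" using g by (intro \<Phi>_LI) auto
    moreover have "i = \<Phi> g (\<Phi> (inv g) i)" using g by (simp add: \<Phi>_\<Phi> \<Phi>_unit)
    ultimately show "i \<in> \<Phi> g ` LI" by blast
  qed (use g \<Phi>_LI in auto)
  moreover have "\<Phi> g ` (LI +>\<^bsub>FA\<^esub> f) = (\<lambda>i. i \<oplus>\<^bsub>FA\<^esub> \<Phi> g f) ` (\<Phi> g ` LI)"
    unfolding a_r_coset_def' UNION_singleton_eq_range image_image \<Phi>_add ..
  ultimately show ?thesis
    unfolding tensor_act_def \<Phi>_def[symmetric] by (simp only: a_r_coset_def' UNION_singleton_eq_range)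
qed

abbreviation "TA \<equiv> double_tensor scale :: ('k, (('v \<times> ('v \<Rightarrow> 'k)) list \<Rightarrow> 'k) set) module"

lemma TA: "TA = quot_algebra FA LI"
  by (simp add: double_tensor_def tensor_algebra_def)

lemmas FALI = FA.scalar_ring_axioms ideal_LI

lemma crossed_data_tensor: "crossed_data TA G (tensor_act G \<rho>)"
proof -
  interpret TA: scalar_ring TA unfolding TA by (rule scalar_ring_quot_algebra[OF FALI])
  show ?thesis
  proof
    show "finite (carrier G)" by (rule finG)
  next
    fix g t assume "g \<in> carrier G" "t \<in> carrier TA"
    then show "tensor_act G \<rho> g t \<in> carrier TA"
      unfolding TA carrier_quot_algebra[OF FALI] by (auto simp: tensor_act_coset \<Phi>_closed)
  next
    fix g t u assume "g \<in> carrier G" "t \<in> carrier TA" "u \<in> carrier TA"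
    then show "tensor_act G \<rho> g (t \<oplus>\<^bsub>TA\<^esub> u) = tensor_act G \<rho> g t \<oplus>\<^bsub>TA\<^esub> tensor_act G \<rho> g u"
      "tensor_act G \<rho> g (t \<otimes>\<^bsub>TA\<^esub> u) = tensor_act G \<rho> g t \<otimes>\<^bsub>TA\<^esub> tensor_act G \<rho> g u"
      unfolding TA carrier_quot_algebra[OF FALI]
      by (auto simp: tensor_act_coset \<Phi>_closed add_quot_algebra[OF FALI] mult_quot_algebra[OF FALI] \<Phi>_add \<Phi>_mult)
  next
    fix g assume "g \<in> carrier G"
    then show "tensor_act G \<rho> g \<one>\<^bsub>TA\<^esub> = \<one>\<^bsub>TA\<^esub>"
      unfolding TA one_quot_algebra[OF FALI] by (simp add: tensor_act_coset \<Phi>_one)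
  next
    fix t assume "t \<in> carrier TA"
    then show "tensor_act G \<rho> \<one> t = t"
      unfolding TA carrier_quot_algebra[OF FALI] by (auto simp: tensor_act_coset \<Phi>_unit)
  next
    fix g h t assume "g \<in> carrier G" "h \<in> carrier G" "t \<in> carrier TA"
    then show "tensor_act G \<rho> g (tensor_act G \<rho> h t) = tensor_act G \<rho> (g \<otimes> h) t"
      unfolding TA carrier_quot_algebra[OF FALI] by (auto simp: tensor_act_coset \<Phi>_closed \<Phi>_\<Phi>)
  qed
qed

sublocale CP: crossed_data TA G "tensor_act G \<rho>" by (rule crossed_data_tensor)

end

section \<open>Representations as ring homomorphisms\<close>

text \<open>A representation as a ring homomorphism \<open>E\<close> into operators, with scalars going to \<open>S\<close>.\<close>

locale endo_rep = scalar_ring A for A :: "('k::field, 'a) module" (structure) +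
  fixes S :: "'k \<Rightarrow> 'e::{ring,monoid_mult}" and E :: "'a \<Rightarrow> 'e"
  assumes E_add: "a \<in> carrier A \<Longrightarrow> b \<in> carrier A \<Longrightarrow> E (a \<oplus> b) = E a + E b"
    and E_mult: "a \<in> carrier A \<Longrightarrow> b \<in> carrier A \<Longrightarrow> E (a \<otimes> b) = E a * E b"
    and E_smult: "a \<in> carrier A \<Longrightarrow> E (r \<odot> a) = S r * E a"
    and E_one: "E \<one> = 1"
begin

lemma E_zero: "E \<zero> = 0" using E_add[of \<zero> \<zero>] by simp

lemma E_minus:
  assumes "a \<in> carrier A" "b \<in> carrier A" shows "E (a \<ominus> b) = E a - E b"
proof -
  have "E b + E (\<ominus> b) = 0" using E_add[of b "\<ominus> b"] assms by (simp add: r_neg E_zero)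
  then have "E (\<ominus> b) = - E b" by (rule group_add_class.minus_unique[symmetric])
  then show ?thesis using assms by (simp add: a_minus_def E_add)
qed

lemma E_finsum: "finite J \<Longrightarrow> f \<in> J \<rightarrow> carrier A \<Longrightarrow> E (\<Oplus>j\<in>J. f j) = (\<Sum>j\<in>J. E (f j))"
proof (induction J rule: finite_induct)
  case (insert j J)
  then have "f \<in> J \<rightarrow> carrier A" "f j \<in> carrier A" by auto
  then show ?case using insert by (simp add: finsum_closed E_add Pi_def)
qed (simp add: E_zero)

end

lemma endo_rep_quot:
  assumes A: "scalar_ring A" and I: "ideal I A" and E: "endo_rep (quot_algebra A I) S E"
  shows "endo_rep A S (\<lambda>a. E (I +>\<^bsub>A\<^esub> a))" and "a \<in> I \<Longrightarrow> E (I +>\<^bsub>A\<^esub> a) = 0"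
proof -
  interpret A: scalar_ring A by (rule A)
  interpret E: endo_rep "quot_algebra A I" S E by (rule E)
  have c: "I +>\<^bsub>A\<^esub> a \<in> carrier (quot_algebra A I)" if "a \<in> carrier A" for a
    using that by (auto simp: carrier_quot_algebra[OF A I])
  show "endo_rep A S (\<lambda>a. E (I +>\<^bsub>A\<^esub> a))"
    by unfold_locales
      (simp_all add: add_quot_algebra[OF A I, symmetric] mult_quot_algebra[OF A I, symmetric]
        smult_quot_algebra[OF A I, symmetric] one_quot_algebra[OF A I, symmetric] E.E_add E.E_mult E.E_smult E.E_one c)
  show "E (I +>\<^bsub>A\<^esub> a) = 0" if "a \<in> I" using coset_zero[OF A I that] E.E_zero by simp
qed

section \<open>Irreducible representations of the rational Cherednik algebra\<close>

context reflection_data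
begin

sublocale C: scalar_ring CP.C by (rule CP.scalar_ring_crossed)

abbreviation "rels \<equiv> cherednik_relations G scale \<rho> 1 c"
abbreviation "J \<equiv> genideal CP.C rels"

lemma ambient: "cherednik_ambient G scale \<rho> = CP.C"
  by (simp add: cherednik_ambient_def)

lemma coset_closed: "f \<in> carrier FA \<Longrightarrow> LI +>\<^bsub>FA\<^esub> f \<in> carrier TA"
  unfolding TA carrier_quot_algebra[OF FALI] by (rule imageI)

lemma vec_elt: "vec_elt G scale y = CP.single (LI +>\<^bsub>FA\<^esub> letter (y, 0)) \<one>"
  and covec_elt: "covec_elt G scale x = CP.single (LI +>\<^bsub>FA\<^esub> letter (0, x)) \<one>"
  and group_elt: "group_elt G scale g = CP.single \<one>\<^bsub>TA\<^esub> g"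
  by (simp_all add: vec_elt_def covec_elt_def group_elt_def tensor_incl_def)

lemma elt_closed [simp]:
  "vec_elt G scale y \<in> carrier CP.C" "x \<in> dual \<Longrightarrow> covec_elt G scale x \<in> carrier CP.C"
  "group_elt G scale g \<in> carrier CP.C"
  unfolding vec_elt covec_elt group_elt
  by (auto intro!: CP.single_closed coset_closed letter_closed simp: W_iff zero_dual)

lemma rels_closed: "rels \<subseteq> carrier CP.C"
  by (auto simp: cherednik_relations_def Let_def ambient commutator_def
      intro!: C.minus_closed C.smult_closed C.finsum_closed)

lemma ideal_J: "ideal J CP.C"
  by (rule C.genideal_ideal[OF rels_closed])

lemma rels_J: "F \<in> rels \<Longrightarrow> F \<in> J"
  using C.genideal_self[OF rels_closed] by blast

lemma rational: "rational_cherednik G scale \<rho> 1 c = quot_algebra CP.C J"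
  by (simp add: rational_cherednik_def ambient)

lemma scalar_ring_rational: "scalar_ring (rational_cherednik G scale \<rho> 1 c)"
  unfolding rational by (rule scalar_ring_quot_algebra[OF C.scalar_ring_axioms ideal_J])

end

text \<open>Composition with the quotient map and the inclusions turns a representation of \<open>H\<close> into
  representations \<open>\<theta>\<close> of the crossed product, \<open>\<tau>\<close> of the tensor algebra and \<open>\<omega>\<close> of the free algebra.\<close>

locale cherednik_rep = reflection_data G scale \<rho> c n e \<epsilon>
  for G :: "'g monoid" (structure)
    and scale :: "'k::field \<Rightarrow> 'v::ab_group_add \<Rightarrow> 'v" and \<rho> c n e \<epsilon> +
  fixes S :: "'k \<Rightarrow> 'e::{ring,monoid_mult}"
    and E :: "('g \<Rightarrow> (('v \<times> ('v \<Rightarrow> 'k)) list \<Rightarrow> 'k) set) set \<Rightarrow> 'e"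
  assumes rep: "endo_rep (rational_cherednik G scale \<rho> 1 c) S E"
    and S_add: "S (r + s) = S r + S s" and S_mult: "S (r * s) = S r * S s" and S_one: "S 1 = 1"
    and S_comm: "a \<in> carrier (rational_cherednik G scale \<rho> 1 c) \<Longrightarrow> E a * S r = S r * E a"
begin

definition \<theta> :: "('g \<Rightarrow> (('v \<times> ('v \<Rightarrow> 'k)) list \<Rightarrow> 'k) set) \<Rightarrow> 'e" where
  "\<theta> F = E (J +>\<^bsub>CP.C\<^esub> F)"

sublocale \<theta>: endo_rep CP.C S \<theta>
  unfolding \<theta>_def by (rule endo_rep_quot(1)[OF C.scalar_ring_axioms ideal_J rep[unfolded rational]])

lemma \<theta>_rel: "F \<in> rels \<Longrightarrow> \<theta> F = 0"
  unfolding \<theta>_def by (rule endo_rep_quot(2)[OF C.scalar_ring_axioms ideal_J rep[unfolded rational] rels_J])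

lemma S_\<theta>: "F \<in> carrier CP.C \<Longrightarrow> \<theta> F * S r = S r * \<theta> F"
  unfolding \<theta>_def by (rule S_comm) (simp add: rational carrier_quot_algebra[OF C.scalar_ring_axioms ideal_J])

definition \<tau> :: "(('v \<times> ('v \<Rightarrow> 'k)) list \<Rightarrow> 'k) set \<Rightarrow> 'e" where "\<tau> t = \<theta> (CP.single t \<one>)"
definition \<omega> :: "(('v \<times> ('v \<Rightarrow> 'k)) list \<Rightarrow> 'k) \<Rightarrow> 'e" where "\<omega> f = \<tau> (LI +>\<^bsub>FA\<^esub> f)"
definition X :: "('v \<Rightarrow> 'k) \<Rightarrow> 'e" where "X x = \<omega> (letter (0, x))"
definition Y :: "'v \<Rightarrow> 'e" where "Y y = \<omega> (letter (y, 0))"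
definition T :: "'g \<Rightarrow> 'e" where "T g = \<theta> (CP.single \<one>\<^bsub>TA\<^esub> g)"

lemma XYT: "\<theta> (covec_elt G scale x) = X x" "\<theta> (vec_elt G scale y) = Y y" "\<theta> (group_elt G scale g) = T g"
  by (simp_all add: X_def Y_def T_def \<omega>_def \<tau>_def vec_elt covec_elt group_elt)

lemma endo_rep_\<tau>: "endo_rep TA S \<tau>"
proof
  fix t u assume t: "t \<in> carrier TA" "u \<in> carrier TA"
  show "\<tau> (t \<oplus>\<^bsub>TA\<^esub> u) = \<tau> t + \<tau> u"
    using t by (simp add: \<tau>_def CP.single_add \<theta>.E_add CP.single_closed)
  have "\<tau> t * \<tau> u = \<theta> (CP.single t \<one> \<otimes>\<^bsub>CP.C\<^esub> CP.single u \<one>)"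
    using t by (simp add: \<tau>_def \<theta>.E_mult CP.single_closed)
  also have "\<dots> = \<tau> (t \<otimes>\<^bsub>TA\<^esub> u)"
    using t by (simp add: \<tau>_def CP.single_mult CP.act_one)
  finally show "\<tau> (t \<otimes>\<^bsub>TA\<^esub> u) = \<tau> t * \<tau> u" by simp
next
  fix t r assume "t \<in> carrier TA"
  then show "\<tau> (r \<odot>\<^bsub>TA\<^esub> t) = S r * \<tau> t" by (simp add: \<tau>_def CP.single_smult \<theta>.E_smult CP.single_closed)
next
  show "\<tau> \<one>\<^bsub>TA\<^esub> = 1" by (simp add: \<tau>_def CP.single_one \<theta>.E_one)
qed

sublocale \<omega>: endo_rep FA S \<omega>
  unfolding \<omega>_def by (rule endo_rep_quot(1)[OF FALI endo_rep_\<tau>[unfolded TA]])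

lemma \<omega>_linear:
  assumes uv: "u \<in> W" "v \<in> W"
  shows "\<omega> (letter (dsc a u + dsc b v)) = S a * \<omega> (letter u) + S b * \<omega> (letter v)"
proof -
  let ?r = "a \<odot>\<^bsub>FA\<^esub> letter u \<oplus>\<^bsub>FA\<^esub> b \<odot>\<^bsub>FA\<^esub> letter v"
  have cl: "letter u \<in> carrier FA" "letter v \<in> carrier FA" "letter (dsc a u + dsc b v) \<in> carrier FA"
    using uv by (auto intro!: letter_closed add_W dsc_W)
  have "letter (dsc a u + dsc b v) \<ominus>\<^bsub>FA\<^esub> ?r \<in> LI"
    unfolding linearity_ideal_def using FA.genideal_self[OF relations_closed] uv
    unfolding linearity_relations_def by blast
  then have "\<omega> (letter (dsc a u + dsc b v) \<ominus>\<^bsub>FA\<^esub> ?r) = 0"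
    unfolding \<omega>_def by (rule endo_rep_quot(2)[OF FALI endo_rep_\<tau>[unfolded TA]])
  then show ?thesis using cl by (simp add: \<omega>.E_minus \<omega>.E_add \<omega>.E_smult)
qed

lemma W_pair [simp]: "(y, 0) \<in> W" "x \<in> dual \<Longrightarrow> (0, x) \<in> W"
  by (simp_all add: W_iff zero_dual)

lemma dsc_pair: "dsc a (y, 0) = (scale a y, 0)" "dsc a (0, x) = (0, \<lambda>v. a * x v)"
  by (simp_all add: double_scale_def zero_fun_def)

lemma dbl_pair: "dbl g (y, 0) = (\<rho> g y, 0)" "g \<in> carrier G \<Longrightarrow> dbl g (0, x) = (0, dact g x)"
  by (simp_all add: double_act_def dual_act_def zero_fun_def \<rho>_zero)

lemma T_letter:
  assumes g: "g \<in> carrier G" and u: "u \<in> W"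
  shows "T g * \<omega> (letter u) = \<omega> (letter (dbl g u)) * T g"
proof -
  have cl: "letter u \<in> carrier FA" "letter (dbl g u) \<in> carrier FA"
    using g u by (auto intro!: letter_closed dbl_W)
  note cl' = coset_closed[OF cl(1)] coset_closed[OF cl(2)]
  have "T g * \<omega> (letter u) = \<theta> (CP.single \<one>\<^bsub>TA\<^esub> g \<otimes>\<^bsub>CP.C\<^esub> CP.single (LI +>\<^bsub>FA\<^esub> letter u) \<one>)"
    using cl' by (simp add: T_def \<omega>_def \<tau>_def \<theta>.E_mult CP.single_closed)
  also have "\<dots> = \<theta> (CP.single (LI +>\<^bsub>FA\<^esub> letter (dbl g u)) g)"
    using g cl cl' by (simp add: CP.single_mult tensor_act_coset \<Phi>_letter)
  also have "\<dots> = \<theta> (CP.single (LI +>\<^bsub>FA\<^esub> letter (dbl g u)) \<one> \<otimes>\<^bsub>CP.C\<^esub> CP.single \<one>\<^bsub>TA\<^esub> g)"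
    using g cl' by (simp add: CP.single_mult CP.act_one)
  also have "\<dots> = \<omega> (letter (dbl g u)) * T g"
    using cl' by (simp add: T_def \<omega>_def \<tau>_def \<theta>.E_mult CP.single_closed)
  finally show ?thesis .
qed

lemma \<theta>_commutator:
  "F \<in> carrier CP.C \<Longrightarrow> F' \<in> carrier CP.C \<Longrightarrow> \<theta> (commutator CP.C F F') = \<theta> F * \<theta> F' - \<theta> F' * \<theta> F"
  by (simp add: commutator_def \<theta>.E_minus \<theta>.E_mult)

lemma X_comm: "x \<in> dual \<Longrightarrow> x' \<in> dual \<Longrightarrow> X x * X x' = X x' * X x"
proof -
  assume x: "x \<in> dual" "x' \<in> dual"
  then have "commutator CP.C (covec_elt G scale x) (covec_elt G scale x') \<in> rels"
    by (auto simp: cherednik_relations_def Let_def ambient)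
  from \<theta>_rel[OF this] show ?thesis using x by (simp add: \<theta>_commutator XYT)
qed

lemma Y_comm: "Y y * Y y' = Y y' * Y y"
proof -
  have "commutator CP.C (vec_elt G scale y) (vec_elt G scale y') \<in> rels"
    by (auto simp: cherednik_relations_def Let_def ambient)
  from \<theta>_rel[OF this] show ?thesis by (simp add: \<theta>_commutator XYT)
qed

lemma Y_X:
  assumes x: "x \<in> dual"
  shows "Y y * X x = X x * Y y + S (x y) - (\<Sum>s\<in>refls. S (c s * (x - dact s x) y) * T s)"
proof -
  let ?f = "\<lambda>s. (c s * (x - dact s x) y) \<odot>\<^bsub>CP.C\<^esub> group_elt G scale s"
  let ?K = "commutator CP.C (vec_elt G scale y) (covec_elt G scale x)"
  let ?R = "(x y * 1) \<odot>\<^bsub>CP.C\<^esub> \<one>\<^bsub>CP.C\<^esub> \<ominus>\<^bsub>CP.C\<^esub> (\<Oplus>\<^bsub>CP.C\<^esub>s\<in>refls. ?f s)"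
  have f: "?f \<in> refls \<rightarrow> carrier CP.C" by auto
  have cl: "?K \<in> carrier CP.C" "(x y * 1) \<odot>\<^bsub>CP.C\<^esub> \<one>\<^bsub>CP.C\<^esub> \<in> carrier CP.C"
    "(\<Oplus>\<^bsub>CP.C\<^esub>s\<in>refls. ?f s) \<in> carrier CP.C" "?R \<in> carrier CP.C"
    using x C.finsum_closed[OF f] by (auto simp: commutator_def intro!: C.minus_closed)
  have "?K \<ominus>\<^bsub>CP.C\<^esub> ?R \<in> rels"
    unfolding cherednik_relations_def Let_def ambient using x by blast
  from \<theta>_rel[OF this] have "\<theta> ?K = \<theta> ?R" using cl by (simp only: \<theta>.E_minus) simp
  moreover have "\<theta> ?R = S (x y) - (\<Sum>s\<in>refls. S (c s * (x - dact s x) y) * T s)"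
    using cl by (simp only: \<theta>.E_minus \<theta>.E_finsum[OF finite_refl f])
      (simp only: \<theta>.E_smult C.one_closed elt_closed \<theta>.E_one XYT mult_1_right)
  moreover have "\<theta> ?K = Y y * X x - X x * Y y" using x by (simp add: \<theta>_commutator XYT)
  ultimately show ?thesis by (simp add: algebra_simps)
qed

lemma T_mult: "g \<in> carrier G \<Longrightarrow> h \<in> carrier G \<Longrightarrow> T g * T h = T (g \<otimes> h)"
  unfolding T_def by (simp add: \<theta>.E_mult[symmetric] CP.single_closed CP.single_mult CP.act_unit)

lemma S_zero: "S 0 = 0" using S_add[of 0 0] by simp

lemma cherednik_system_rep: "cherednik_system G scale \<rho> c n e \<epsilon> S X Y T"
proof
  show "S (r + s) = S r + S s" "S (r * s) = S r * S s" for r s by (rule S_add S_mult)+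
  show "S 1 * X x = X x" "S 1 * Y y = Y y" "S 1 * T g = T g" for x y g by (simp_all add: S_one)
  show "X x * S r = S r * X x" if "x \<in> dual" for x r unfolding XYT[symmetric] using that by (intro S_\<theta>) simp
  show "Y y * S r = S r * Y y" for y r unfolding XYT[symmetric] by (intro S_\<theta>) simp
  show "T g * S r = S r * T g" for g r unfolding XYT[symmetric] by (intro S_\<theta>) simp
  show "X (x + x') = X x + X x'" if "x \<in> dual" "x' \<in> dual" for x x'
    using \<omega>_linear[of "(0, x)" "(0, x')" 1 1] that
    by (simp add: X_def dsc_pair S_one)
  show "X (\<lambda>v. r * x v) = S r * X x" if "x \<in> dual" for r x
    using \<omega>_linear[of "(0, x)" "(0, x)" r 0] that
    by (simp add: X_def dsc_pair S_zero plus_fun_def)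
  show "Y (y + y') = Y y + Y y'" for y y'
    using \<omega>_linear[of "(y, 0)" "(y', 0)" 1 1] by (simp add: Y_def dsc_pair S_one)
  show "Y (scale r y) = S r * Y y" for r y
    using \<omega>_linear[of "(y, 0)" "(y, 0)" r 0] by (simp add: Y_def dsc_pair S_zero)
  show "T g * T h = T (g \<otimes> h)" if "g \<in> carrier G" "h \<in> carrier G" for g h using that by (rule T_mult)
  show "T \<one> = S 1" by (simp add: T_def CP.single_one \<theta>.E_one S_one)
  show "T g * X x = X (dact g x) * T g" if "g \<in> carrier G" "x \<in> dual" for g x
    using T_letter[of g "(0, x)"] that by (simp add: X_def dbl_pair)
  show "T g * Y y = Y (\<rho> g y) * T g" if "g \<in> carrier G" for g y
    using T_letter[of g "(y, 0)"] that by (simp add: Y_def dbl_pair)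
  show "X x * X x' = X x' * X x" if "x \<in> dual" "x' \<in> dual" for x x' using that by (rule X_comm)
  show "Y y * Y y' = Y y' * Y y" for y y' by (rule Y_comm)
  show "Y y * X x = X x * Y y + S (x y) - (\<Sum>s\<in>refls. S (c s * (x - dact s x) y) * T s)" if "x \<in> dual" for x y
    using that by (rule Y_X)
qed

sublocale sys: cherednik_system G scale \<rho> c n e \<epsilon> S X Y T by (rule cherednik_system_rep)

lemma \<omega>_generated:
  assumes f: "f \<in> carrier FA" shows "\<omega> f \<in> sys.alg"
  using f
proof (induction f rule: free_algebra_induct)
  case zero
  show ?case using generated_algebra.S[of S 0] by (simp add: \<omega>.E_zero S_zero)
next
  case (step r w f)
  have "\<omega> (word_elt w) \<in> sys.alg" using step(1)
  proof (induction w rule: list.induct)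
    case Nil
    show ?case using generated_algebra.S[of S 1] by (simp add: \<omega>.E_one[unfolded free_algebra_simps(3)] S_one)
  next
    case (Cons u w)
    then have u: "u \<in> W" "w \<in> lists W" by auto
    obtain y x where yx: "u = (y, x)" "x \<in> dual" using u(1) by (cases u) (auto simp: W_iff)
    have "\<omega> (letter u) = Y y + X x"
      using \<omega>_linear[of "(y, 0)" "(0, x)" 1 1] yx
      by (simp add: X_def Y_def dsc_pair S_one)
    then have "\<omega> (letter u) \<in> sys.alg" using yx by (auto intro: generated_algebra.intros)
    then show ?case
      unfolding word_Cons[of u w W] using Cons u
      by (simp add: \<omega>.E_mult letter_closed word_elt_closed generated_algebra.mult)
  qed
  then show ?case using step
    by (simp add: \<omega>.E_add \<omega>.E_smult word_elt_closed FA.smult_closed generated_algebra.intros)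
qed

lemma \<theta>_generated:
  assumes F: "F \<in> carrier CP.C" shows "\<theta> F \<in> sys.alg"
  using F
proof (induction F rule: CP.crossed_induct)
  case zero
  show ?case using generated_algebra.S[of S 0] by (simp add: \<theta>.E_zero S_zero)
next
  case (step t g F)
  obtain f where f: "f \<in> carrier FA" "t = LI +>\<^bsub>FA\<^esub> f"
    using step(1) unfolding TA carrier_quot_algebra[OF FALI] by auto
  have "\<theta> (CP.single t g) = \<theta> (CP.single t \<one> \<otimes>\<^bsub>CP.C\<^esub> CP.single \<one>\<^bsub>TA\<^esub> g)"
    using step by (simp add: CP.single_mult CP.act_one)
  also have "\<dots> = \<omega> f * T g"
    using step by (simp add: \<theta>.E_mult CP.single_closed \<omega>_def \<tau>_def T_def f(2))
  finally have "\<theta> (CP.single t g) \<in> sys.alg"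
    using \<omega>_generated[OF f(1)] step by (auto intro: generated_algebra.intros)
  then show ?case using step by (simp add: \<theta>.E_add CP.single_closed generated_algebra.add)
qed

lemma E_generated: "a \<in> carrier (rational_cherednik G scale \<rho> 1 c) \<Longrightarrow> E a \<in> sys.alg"
  using \<theta>_generated by (auto simp: rational carrier_quot_algebra[OF C.scalar_ring_axioms ideal_J] \<theta>_def)

lemma alg_comm: "a \<in> sys.alg \<Longrightarrow> S r * a = a * S r"
proof (induction rule: generated_algebra.induct)
  case (S r')
  show ?case by (metis S_mult mult.commute)
next
  case (mult a b)
  then show ?case by (metis mult.assoc)
qed (simp_all add: sys.S_X sys.S_Y sys.S_T algebra_simps)

end

text \<open>Invariance under the generated algebra of operators is invariance under \<open>H\<close>, and finitely many
  \<open>X (\<epsilon> i)\<close>, \<open>Y (e i)\<close> and \<open>T g\<close> generate it over the scalars.\<close>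

lemma (in cherednik_family) irreducible_rep_spanned:
  fixes mscale :: "'k \<Rightarrow> 'm::ab_group_add \<Rightarrow> 'm"
  assumes irr: "irreducible_rep (rational_cherednik G scale \<rho> 1 c) mscale \<phi>"
  shows "\<exists>d\<le>p ^ n * card (carrier G). \<exists>v. \<forall>w. \<exists>r. w = (\<Sum>j<d. mscale (r j) (v j))"
proof -
  let ?H = "rational_cherednik G scale \<rho> 1 c"
  interpret H: scalar_ring ?H by (rule scalar_ring_rational)
  have "algebra_rep ?H mscale \<phi>" using irr by (simp add: irreducible_rep_def)
  then have vsM: "vector_space mscale"
    and lin: "\<And>a. a \<in> carrier ?H \<Longrightarrow> Vector_Spaces.linear mscale mscale (\<phi> a)"
    and \<phi>_add: "\<And>a b. a \<in> carrier ?H \<Longrightarrow> b \<in> carrier ?H \<Longrightarrow> \<phi> (a \<oplus>\<^bsub>?H\<^esub> b) = (\<lambda>v. \<phi> a v + \<phi> b v)"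
    and \<phi>_mult: "\<And>a b. a \<in> carrier ?H \<Longrightarrow> b \<in> carrier ?H \<Longrightarrow> \<phi> (a \<otimes>\<^bsub>?H\<^esub> b) = \<phi> a \<circ> \<phi> b"
    and \<phi>_smult: "\<And>r a. a \<in> carrier ?H \<Longrightarrow> \<phi> (r \<odot>\<^bsub>?H\<^esub> a) = (\<lambda>v. mscale r (\<phi> a v))"
    and \<phi>_one: "\<phi> \<one>\<^bsub>?H\<^esub> = id"
    unfolding algebra_rep_def by blast+
  interpret M: vector_space mscale by (rule vsM)
  define S where "S r = Endo (mscale r)" for r
  define E where "E a = Endo (\<phi> a)" for a
  have app_S [simp]: "app (S r) v = mscale r v" for r v
    by (simp add: S_def M.scale_right_distrib)
  have app_E: "app (E a) v = \<phi> a v" if "a \<in> carrier ?H" for a v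
    using lin[OF that] by (simp add: E_def Vector_Spaces.linear_iff)
  interpret R: cherednik_rep G scale \<rho> c n e \<epsilon> S E
  proof (intro cherednik_rep.intro reflection_data_axioms cherednik_rep_axioms.intro)
    show "endo_rep ?H S E"
      by unfold_locales
        (auto intro!: endo_eqI simp: app_E \<phi>_add \<phi>_mult \<phi>_smult \<phi>_one H.smult_closed)
    show "S (r + s) = S r + S s" "S (r * s) = S r * S s" "S 1 = 1" for r s
      by (auto intro!: endo_eqI simp: M.scale_left_distrib)
    show "E a * S r = S r * E a" if "a \<in> carrier ?H" for a r
      using lin[OF that] that by (auto intro!: endo_eqI simp: app_E Vector_Spaces.linear_iff)
  qed
  interpret O: irreducible_operators S R.sys.alg
  proof
    show "S (r + s) = S r + S s" "S (r * s) = S r * S s" "S 1 = 1" for r s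
      by (rule R.S_add R.S_mult R.S_one)+
    show "S r * a = a * S r" if "a \<in> R.sys.alg" for a r using that by (rule R.alg_comm)
    show "U = {0} \<or> U = UNIV"
      if U: "0 \<in> U" "\<And>x y. x \<in> U \<Longrightarrow> y \<in> U \<Longrightarrow> x + y \<in> U"
        "\<And>a x. a \<in> R.sys.alg \<Longrightarrow> x \<in> U \<Longrightarrow> app a x \<in> U" for U
    proof -
      have "mscale r x \<in> U" if "x \<in> U" for r x
        using U(3)[OF generated_algebra.S that, of r] by simp
      then have "M.subspace U" using U(1,2) by (simp add: M.subspace_def)
      moreover have "\<phi> a ` U \<subseteq> U" if "a \<in> carrier ?H" for a
        using U(3)[OF R.E_generated[OF that]] app_E[OF that] by auto
      ultimately show ?thesis using irr unfolding irreducible_rep_def by blast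
    qed
    show "\<exists>v::'m. v \<noteq> 0" using irr unfolding irreducible_rep_def by blast
  qed (auto intro: generated_algebra.intros)
  let ?N = "p ^ n * card (carrier G)"
  let ?gens = "(\<lambda>i. R.X (\<epsilon> i)) ` {..<n} \<union> (\<lambda>i. R.Y (e i)) ` {..<n} \<union> R.T ` carrier G"
  have "\<exists>d\<le>?N. \<exists>v. \<forall>w. \<exists>r. w = (\<Sum>j<d. app (S (r j)) (v j))"
  proof (rule O.Capelli_dimension_bound)
    show "cap (Suc ?N * Suc ?N) a = 0" if "\<And>i. a i \<in> R.sys.alg" for a
      by (rule Capelli_cherednik[OF R.cherednik_system_rep that]) simp
    show "finite ?gens" using finG by simp
    show "?gens \<subseteq> R.sys.alg" using \<epsilon>_dual by (auto intro: generated_algebra.intros)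
    fix U a x
    assume U: "0 \<in> U" "\<And>x y. x \<in> U \<Longrightarrow> y \<in> U \<Longrightarrow> x + y \<in> U" "\<And>r x. x \<in> U \<Longrightarrow> app (S r) x \<in> U"
      "\<And>e x. e \<in> ?gens \<Longrightarrow> x \<in> U \<Longrightarrow> app e x \<in> U" and a: "a \<in> R.sys.alg" and x: "x \<in> U"
    have sum: "(\<Sum>i\<in>I. f i) \<in> U" if "\<And>i. i \<in> I \<Longrightarrow> f i \<in> U" for I :: "nat set" and f
      using that by (induction I rule: infinite_finite_induct) (auto intro: U)
    show "app a x \<in> U" using a x
    proof (induction arbitrary: x rule: generated_algebra.induct)
      case (X z)
      show ?case unfolding R.sys.X_expand[OF X(1)] app_sum app_simps
        using X(2) by (intro sum U(3) U(4)) auto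
    next
      case (Y y)
      show ?case unfolding R.sys.Y_expand[of y] app_sum app_simps
        using Y by (intro sum U(3) U(4)) auto
    next
      case (T g)
      then show ?case by (intro U(4)) auto
    qed (auto intro: U(2) U(3)[simplified])
  qed
  then show ?thesis by simp
qed

section \<open>The dimension bound\<close>

lemma finite_dimensional_dim_le:
  assumes vs: "vector_space scale" and span: "\<And>w. \<exists>r. w = (\<Sum>j<d. scale (r j) (v j))"
  shows "finite_dimensional scale" "vector_space.dim scale UNIV \<le> d"
proof -
  interpret V: vector_space scale by (rule vs)
  obtain B where B: "B \<subseteq> v ` {..<d}" "V.independent B" "v ` {..<d} \<subseteq> V.span B"
    using V.maximal_independent_subset[of "v ` {..<d}"] by blast
  have "w \<in> V.span B" for w
  proof -
    obtain r where "w = (\<Sum>j<d. scale (r j) (v j))" using span by blast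
    then show ?thesis using B(3) by (auto intro!: V.span_sum V.span_scale)
  qed
  then have spB: "V.span B = UNIV" by auto
  have finB: "finite B" by (rule finite_subset[OF B(1)]) simp
  interpret F: finite_dimensional_vector_space scale B
    by unfold_locales (rule finB B(2) spB)+
  show "finite_dimensional scale"
    unfolding finite_dimensional_def using F.finite_dimensional_vector_space_axioms by blast
  have "card B \<le> card (v ` {..<d})" by (rule card_mono) (use B in auto)
  also have "\<dots> \<le> d" using card_image_le[of "{..<d}" v] by simp
  finally show "V.dim UNIV \<le> d" by (simp add: F.dim_UNIV)
qed

lemma reflection_data_exists:
  fixes G :: "'g monoid" and scale :: "'k::field \<Rightarrow> 'v::ab_group_add \<Rightarrow> 'v"
  assumes G: "group G" "finite (carrier G)" and fd: "finite_dimensional scale"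
    and dim: "vector_space.dim scale UNIV = n"
    and hom: "\<rho> \<in> hom G (GL scale)" and inj: "inj_on \<rho> (carrier G)"
  shows "\<exists>e \<epsilon>. reflection_data G scale \<rho> n e \<epsilon>"
proof -
  interpret G: group G by (rule G)
  obtain B where "finite_dimensional_vector_space scale B" using fd by (auto simp: finite_dimensional_def)
  then interpret V: finite_dimensional_vector_space scale B .
  note indep = V.independent_Basis and B = V.finite_Basis V.span_Basis
  have "card B = n" using dim V.dim_UNIV by simp
  then obtain e where e: "bij_betw e {..<n} B"
    using ex_bij_betw_nat_finite[OF B(1)] by (auto simp: atLeast0LessThan)
  then have eB: "e i \<in> B" if "i < n" for i using that by (auto simp: bij_betw_def)
  define \<epsilon> where "\<epsilon> i v = V.representation B v (e i)" for i v
  have vsk: "vector_space ((*) :: 'k \<Rightarrow> 'k \<Rightarrow> 'k)" by unfold_locales (auto simp: algebra_simps)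
  have lin: "Vector_Spaces.linear scale scale (\<rho> g)" "bij (\<rho> g)" if "g \<in> carrier G" for g
    using hom_in_carrier[OF hom that] by (auto simp: GL_def)
  have mult: "\<rho> (g \<otimes>\<^bsub>G\<^esub> h) = \<rho> g \<circ> \<rho> h" if "g \<in> carrier G" "h \<in> carrier G" for g h
    using hom_mult[OF hom that] by (simp add: GL_def)
  have one: "\<rho> \<one>\<^bsub>G\<^esub> = id"
  proof
    fix v
    have "\<rho> \<one>\<^bsub>G\<^esub> (\<rho> \<one>\<^bsub>G\<^esub> v) = \<rho> \<one>\<^bsub>G\<^esub> v" using mult[of "\<one>\<^bsub>G\<^esub>" "\<one>\<^bsub>G\<^esub>"] by (simp add: fun_eq_iff)
    then show "\<rho> \<one>\<^bsub>G\<^esub> v = id v" using lin(2)[OF G.one_closed] by (simp add: bij_def inj_eq)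
  qed
  have "reflection_data G scale \<rho> n e \<epsilon>"
  proof (rule reflection_data.intro)
    show "vector_space scale" by (rule V.vector_space_axioms)
    show "group G" "finite (carrier G)" by (rule G)+
    show "\<epsilon> i \<in> dual_space scale" if "i < n" for i
      unfolding dual_space_def \<epsilon>_def
      by (auto simp: Vector_Spaces.linear_iff V.vector_space_axioms vsk B(2)
          V.representation_add[OF indep] V.representation_scale[OF indep])
    show "\<epsilon> i (e j) = (if i = j then 1 else 0)" if "i < n" "j < n" for i j
      using that e by (auto simp: \<epsilon>_def V.representation_basis[OF indep eB] bij_betw_def inj_on_def)
    show "y = (\<Sum>i<n. scale (\<epsilon> i y) (e i))" for y
    proof -
      have "(\<Sum>i<n. scale (\<epsilon> i y) (e i)) = (\<Sum>b\<in>B. scale (V.representation B y b) b)"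
        unfolding \<epsilon>_def by (rule sum.reindex_bij_betw[OF e])
      also have "\<dots> = y" by (rule V.sum_representation_eq[OF indep]) (auto simp: B)
      finally show ?thesis by simp
    qed
    show "\<rho> g (u + v) = \<rho> g u + \<rho> g v" "\<rho> g (scale r v) = scale r (\<rho> g v)" if "g \<in> carrier G" for g u v r
      using lin(1)[OF that] by (auto simp: Vector_Spaces.linear_iff)
    show "\<rho> \<one>\<^bsub>G\<^esub> v = v" for v by (simp add: one)
    show "\<rho> (g \<otimes>\<^bsub>G\<^esub> h) v = \<rho> g (\<rho> h v)" if "g \<in> carrier G" "h \<in> carrier G" for g h v
      by (simp add: mult[OF that])
    show "g = \<one>\<^bsub>G\<^esub>" if "g \<in> carrier G" "\<And>v. \<rho> g v = v" for g
      using inj_onD[OF inj, of g "\<one>\<^bsub>G\<^esub>"] that by (simp add: one fun_eq_iff)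
  qed
  then show ?thesis by blast
qed

theorem lemma3p5:
  fixes G :: "'g monoid"
    and scale :: "'k::alg_closed_field \<Rightarrow> 'v::ab_group_add \<Rightarrow> 'v"
    and \<rho> :: "'g \<Rightarrow> 'v \<Rightarrow> 'v"
    and c :: "'g \<Rightarrow> 'k"
    and p n :: nat
    and mscale :: "'k \<Rightarrow> 'm::ab_group_add \<Rightarrow> 'm"
    and \<phi> :: "('g \<Rightarrow> (('v \<times> ('v \<Rightarrow> 'k)) list \<Rightarrow> 'k) set) set \<Rightarrow> 'm \<Rightarrow> 'm"
  assumes "CHAR('k) = p" and "p > 0"
    and "group G" and "finite (carrier G)"
    and "vector_space scale" and "finite_dimensional scale" and "vector_space.dim scale UNIV = n"
    and "\<rho> \<in> hom G (GL scale)" and "inj_on \<rho> (carrier G)"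
    and "\<forall>g\<in>carrier G. \<forall>s\<in>reflections G scale \<rho>. c (g \<otimes>\<^bsub>G\<^esub> s \<otimes>\<^bsub>G\<^esub> inv\<^bsub>G\<^esub> g) = c s"
    and "irreducible_rep (rational_cherednik G scale \<rho> 1 c) mscale \<phi>"
  shows "finite_dimensional mscale \<and> vector_space.dim mscale UNIV \<le> p ^ n * order G"
proof -
  obtain e \<epsilon> where "reflection_data G scale \<rho> n e \<epsilon>"
    using reflection_data_exists[OF assms(3,4,6-9)] by blast
  then interpret reflection_data G scale \<rho> c n e \<epsilon> .
  interpret cherednik_family G scale \<rho> c n e \<epsilon> p
    by unfold_locales (use assms in auto)
  obtain d v where d: "d \<le> p ^ n * card (carrier G)" "\<And>w. \<exists>r. w = (\<Sum>j<d. mscale (r j) (v j))"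
    using irreducible_rep_spanned[OF assms(11)] by blast
  have "vector_space mscale" using assms(11) by (simp add: irreducible_rep_def algebra_rep_def)
  from finite_dimensional_dim_le[OF this d(2)] show ?thesis using d(1) by (simp add: order_def)
qed

end
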